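(* Let $s>1$, $T>0$, let $E$ be a Banach space, let $A:D(A)\subseteq E\to E$ be a closed operator which satisfies the Hille–Yosida condition and let $\mathbf{f}\in\mathcal{D}'^{(s)}_{L^1}(0,T;E)$. Then the equation $\mathbf{u}'=A\mathbf{u}+\mathbf{f}$ always has a solution $\mathbf{u}\in\mathcal{D}'^{(s)}_{L^1}(0,T;E)$. Moreover, $\mathbf{u}\in\mathcal{D}'^{(s)}_{L^p,h}(0,T;E)$, where $1<p<\infty$ and $h>0$ are such that $$\sum_{\alpha=0}^\infty\frac{\alpha!^{ps}}{h^{p\alpha}}\Big(\|\mathbf{F}_\alpha\|^p_{L^p(0,T;E)}+\|\mathbf{F}'_\alpha\|^p_{L^p(0,T;E)}\Big)<\infty,$$ with $\mathbf{f}=\sum_\alpha\mathbf{F}_\alpha^{(\alpha)}$, where $\mathbf{F}_\alpha\in W^{1,p}(0,T;E)$, $\mathbf{F}_\alpha(0)=0$, $\alpha\in\mathbb{N}$.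
   Context: Hille–Yosida condition: there are constants $\omega\in\mathbb{R}$ and $C>0$ such that every $\lambda>\omega$ belongs to the resolvent set $\rho(A)$ and $\|(\lambda-\omega)^kR(\lambda:A)^k\|\le C$ for all $\lambda>\omega$, $k\in\mathbb{Z}_+$, where $R(\lambda:A)=(\lambda-A)^{-1}$. The domain $D(A)$ need not be dense. Let $\mathcal{D}^{(s)}(0,T)$ be the space of all smooth $\varphi$ with compact support in $(0,T)$ with $\sup_{\alpha,t}|\varphi^{(\alpha)}(t)|/(k^\alpha\alpha!^s)<\infty$ for all $k>0$. For $1\le r\le\infty$, $h>0$, $\mathcal{D}^s_{L^r,h}(0,T)$ is the Banach space of $\varphi\in\mathcal{C}^\infty(0,T)$ with finite norm $\left(\sum_{\alpha\in\mathbb{N}}h^{r\alpha}\|\varphi^{(\alpha)}\|_{L^r}^r/\alpha!^{rs}\right)^{1/r}$ (sup for $r=\infty$), and $\mathcal{D}^{(s)}_{L^r,h}(0,T)$ is the closure of $\mathcal{D}^{(s)}(0,T)$ in it. $\dot{\mathcal{B}}^{(s)}(0,T)$ is the closure of $\mathcal{D}^{(s)}(0,T)$ in $\varprojlim_{h\to\infty}\mathcal{D}^s_{L^\infty,h}(0,T)$. $\mathcal{D}'^{(s)}_{L^1}(0,T;E)=\mathcal{L}_b(\dot{\mathcal{B}}^{(s)}(0,T),E)$ (continuous linear maps, topology of bounded convergence). For $1<p<\infty$, $1/p+1/q=1$, $\mathcal{D}'^{(s)}_{L^p,h}(0,T;E)=\mathcal{L}_b(\mathcal{D}^{(s)}_{L^q,h}(0,T)_c,E)$,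 where the subscript $c$ means that $\mathcal{D}^{(s)}_{L^q,h}(0,T)$ carries the topology of uniform convergence on compact convex circled subsets of its strong dual; restricting to $\dot{\mathcal{B}}^{(s)}(0,T)$ one regards it as a subspace of $\mathcal{D}'^{(s)}_{L^1}(0,T;E)$. A solution of $\mathbf{u}'=A\mathbf{u}+\mathbf{f}$ in $\mathcal{D}'^{(s)}_{L^1}(0,T;E)$ is an element $\mathbf{u}$ of this space such that for every $\varphi\in\dot{\mathcal{B}}^{(s)}(0,T)$, $\langle\mathbf{u},\varphi\rangle\in D(A)$ and $\langle\mathbf{u}',\varphi\rangle=A\langle\mathbf{u},\varphi\rangle+\langle\mathbf{f},\varphi\rangle$, where $\langle\mathbf{u}',\varphi\rangle=-\langle\mathbf{u},\varphi'\rangle$. $L^p(0,T;E)$ is the Bochner space. $W^{1,p}(0,T;E)$ is the space of all $\mathbf{F}:[0,T]\to E$ of the form $\mathbf{F}(t)=F_0+\int_0^t\mathbf{F}'(\tau)\,d\tau$ with $F_0\in E$, $\mathbf{F}'\in L^p(0,T;E)$. $\mathbf{F}_\alpha^{(\alpha)}$ is the ultradistributional derivative $\varphi\mapsto(-1)^\alpha\int_0^T\mathbf{F}_\alpha(t)\varphi^{(\alpha)}(t)\,dt$. For every $1<p<\infty$, every $\mathbf{f}\in\mathcal{D}'^{(s)}_{L^1}(0,T;E)$ admits a representation of the stated form for some $h>0$. *)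

theory Defs
  imports "HOL-Analysis.Analysis"
begin

section \<open>Complex Banach spaces and closed operators\<close>

text \<open>
  HOL-Analysis only provides normed spaces over the reals. A complex Banach space is a real one
  with a compatible multiplication by complex scalars.
\<close>

class complex_banach = banach +
  fixes scaleC :: "complex \<Rightarrow> 'a \<Rightarrow> 'a"  (infixr \<open>*\<^sub>C\<close> 75)
  assumes scaleC_add_right: "c *\<^sub>C (x + y) = c *\<^sub>C x + c *\<^sub>C y"
    and scaleC_add_left: "(c + d) *\<^sub>C x = c *\<^sub>C x + d *\<^sub>C x"
    and scaleC_scaleC: "c *\<^sub>C d *\<^sub>C x = (c * d) *\<^sub>C x"
    and scaleC_of_real: "complex_of_real r *\<^sub>C x = r *\<^sub>R x"
    and norm_scaleC: "norm (c *\<^sub>C x) = cmod c * norm x"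

instantiation complex :: complex_banach
begin

definition scaleC_complex :: "complex \<Rightarrow> complex \<Rightarrow> complex"
  where "scaleC_complex c x = c * x"

instance
  by standard (simp_all add: scaleC_complex_def algebra_simps norm_mult scaleR_conv_of_real)

end

text \<open>
  An operator is given by its domain \<open>DA\<close> and a function \<open>A\<close> of which only the values on \<open>DA\<close>
  matter.
\<close>

definition linear_operator :: "'e::complex_banach set \<Rightarrow> ('e \<Rightarrow> 'e) \<Rightarrow> bool"
  where "linear_operator DA A \<longleftrightarrow>
    0 \<in> DA \<and>
    (\<forall>x\<in>DA. \<forall>y\<in>DA. x + y \<in> DA \<and> A (x + y) = A x + A y) \<and>
    (\<forall>c. \<forall>x\<in>DA. c *\<^sub>C x \<in> DA \<and> A (c *\<^sub>C x) = c *\<^sub>C A x)"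

definition closed_operator :: "'e::complex_banach set \<Rightarrow> ('e \<Rightarrow> 'e) \<Rightarrow> bool"
  where "closed_operator DA A \<longleftrightarrow> linear_operator DA A \<and> closed {(x, A x) | x. x \<in> DA}"

definition resolvent :: "'e::complex_banach set \<Rightarrow> ('e \<Rightarrow> 'e) \<Rightarrow> complex \<Rightarrow> 'e \<Rightarrow> 'e"
  where "resolvent DA A \<mu> = inv_into DA (\<lambda>x. \<mu> *\<^sub>C x - A x)"

definition resolvent_set :: "'e::complex_banach set \<Rightarrow> ('e \<Rightarrow> 'e) \<Rightarrow> complex set"
  where "resolvent_set DA A =
    {\<mu>. bij_betw (\<lambda>x. \<mu> *\<^sub>C x - A x) DA UNIV \<and> bounded_linear (resolvent DA A \<mu>)}"

definition hille_yosida :: "'e::complex_banach set \<Rightarrow> ('e \<Rightarrow> 'e) \<Rightarrow> bool"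
  where "hille_yosida DA A \<longleftrightarrow>
    (\<exists>\<omega>::real. \<exists>C>0. \<forall>\<mu>>\<omega>. complex_of_real \<mu> \<in> resolvent_set DA A \<and>
      (\<forall>k\<ge>1. onorm (\<lambda>x. (\<mu> - \<omega>) ^ k *\<^sub>R (resolvent DA A (complex_of_real \<mu>) ^^ k) x) \<le> C))"


section \<open>Bochner integral, Bochner and Sobolev spaces\<close>

text \<open>
  The Bochner integral of HOL-Analysis requires a second countable codomain. The definition below
  is the same one with Borel measurability replaced by strong measurability, so that it applies to
  arbitrary (non-separable) Banach spaces.
\<close>

definition strongly_measurable :: "'a measure \<Rightarrow> ('a \<Rightarrow> 'e::banach) \<Rightarrow> bool"
  where "strongly_measurable M F \<longleftrightarrow>
    (\<exists>\<sigma>. (\<forall>n. simple_function M (\<sigma> n)) \<and> (AE t in M. (\<lambda>n. \<sigma> n t) \<longlonglongrightarrow> F t))"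

definition has_bochner :: "'a measure \<Rightarrow> ('a \<Rightarrow> 'e::banach) \<Rightarrow> 'e \<Rightarrow> bool"
  where "has_bochner M F x \<longleftrightarrow> strongly_measurable M F \<and>
    (\<exists>\<sigma>. (\<forall>n. Bochner_Integration.simple_bochner_integrable M (\<sigma> n)) \<and>
         (\<lambda>n. \<integral>\<^sup>+ t. ennreal (norm (F t - \<sigma> n t)) \<partial>M) \<longlonglongrightarrow> 0 \<and>
         (\<lambda>n. Bochner_Integration.simple_bochner_integral M (\<sigma> n)) \<longlonglongrightarrow> x)"

definition bochner_integral :: "'a measure \<Rightarrow> ('a \<Rightarrow> 'e::banach) \<Rightarrow> 'e"
  where "bochner_integral M F = (THE x. has_bochner M F x)"

text \<open>The \<open>p\<close>-th power of the \<open>L\<^sup>p\<close> norm on \<open>(0,T)\<close>, for finite \<open>p\<close>; possibly infinite.\<close>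

definition Lp_norm_pow :: "real \<Rightarrow> real \<Rightarrow> (real \<Rightarrow> 'e::real_normed_vector) \<Rightarrow> ennreal"
  where "Lp_norm_pow T p F = (\<integral>\<^sup>+ t. ennreal (norm (F t) powr p) \<partial>lebesgue_on {0<..<T})"

definition Lp_space :: "real \<Rightarrow> real \<Rightarrow> (real \<Rightarrow> 'e::banach) set"
  where "Lp_space T p =
    {F. strongly_measurable (lebesgue_on {0<..<T}) F \<and> Lp_norm_pow T p F < \<infinity>}"

text \<open>\<open>F\<close> belongs to \<open>W\<^sup>1\<^sup>,\<^sup>p(0,T;E)\<close>, and \<open>F'\<close> is (a representative of) its derivative.\<close>

definition sobolev_W1p ::
    "real \<Rightarrow> real \<Rightarrow> (real \<Rightarrow> 'e::banach) \<Rightarrow> (real \<Rightarrow> 'e) \<Rightarrow> bool"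
  where "sobolev_W1p T p F F' \<longleftrightarrow> F' \<in> Lp_space T p \<and>
    (\<exists>F0. \<forall>t\<in>{0..T}. F t = F0 + bochner_integral (lebesgue_on {0<..<t}) F')"


section \<open>Topologies defined by seminorms and continuous linear maps\<close>

text \<open>
  All vector spaces of test functions (and of functionals on them) consist of complex-valued
  functions. They are normalised to vanish off their natural domain, so that equality of their
  elements is equality of functions. \<open>X\<close> is meant to be a linear subspace and \<open>P\<close> a nonempty set
  of seminorms on \<open>X\<close>.
\<close>

definition seminorm_topology ::
    "('a \<Rightarrow> complex) set \<Rightarrow> (('a \<Rightarrow> complex) \<Rightarrow> real) set \<Rightarrow> ('a \<Rightarrow> complex) topology"
  where "seminorm_topology X P =
    topology_generated_by {{y \<in> X. \<rho> (\<lambda>a. y a - x a) < r} | x \<rho> r. x \<in> X \<and> \<rho> \<in> P \<and> 0 < r}"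

definition continuous_linear_maps ::
    "('a \<Rightarrow> complex) topology \<Rightarrow> (('a \<Rightarrow> complex) \<Rightarrow> 'e::complex_banach) set"
  where "continuous_linear_maps \<X> =
    {u. continuous_map \<X> euclidean u \<and>
        (\<forall>\<phi>\<in>topspace \<X>. \<forall>\<psi>\<in>topspace \<X>. u (\<lambda>a. \<phi> a + \<psi> a) = u \<phi> + u \<psi>) \<and>
        (\<forall>c. \<forall>\<phi>\<in>topspace \<X>. u (\<lambda>a. c * \<phi> a) = c *\<^sub>C u \<phi>) \<and>
        (\<forall>\<phi>. \<phi> \<notin> topspace \<X> \<longrightarrow> u \<phi> = 0)}"

text \<open>
  The strong dual of a normed space is its dual with the dual norm. For a subspace \<open>X\<close> with norm
  \<open>N\<close>, \<open>c_topology X N\<close> is the topology on \<open>X\<close> of uniform convergence on the compact convex circled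
  subsets of the strong dual.
\<close>

definition normed_dual ::
    "('a \<Rightarrow> complex) set \<Rightarrow> (('a \<Rightarrow> complex) \<Rightarrow> real) \<Rightarrow> (('a \<Rightarrow> complex) \<Rightarrow> complex) set"
  where "normed_dual X N = continuous_linear_maps (seminorm_topology X {N})"

definition dual_norm ::
    "('a \<Rightarrow> complex) set \<Rightarrow> (('a \<Rightarrow> complex) \<Rightarrow> real) \<Rightarrow> (('a \<Rightarrow> complex) \<Rightarrow> complex) \<Rightarrow> real"
  where "dual_norm X N \<xi> = (SUP \<phi>\<in>{\<phi> \<in> X. N \<phi> \<le> 1}. cmod (\<xi> \<phi>))"

definition strong_dual ::
    "('a \<Rightarrow> complex) set \<Rightarrow> (('a \<Rightarrow> complex) \<Rightarrow> real) \<Rightarrow> (('a \<Rightarrow> complex) \<Rightarrow> complex) topology"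
  where "strong_dual X N = seminorm_topology (normed_dual X N) {dual_norm X N}"

definition convex_circled :: "('a \<Rightarrow> complex) set \<Rightarrow> bool"
  where "convex_circled K \<longleftrightarrow>
    (\<forall>\<xi>\<in>K. \<forall>\<eta>\<in>K. \<forall>t\<in>{0..1}. (\<lambda>a. complex_of_real (1 - t) * \<xi> a + complex_of_real t * \<eta> a) \<in> K) \<and>
    (\<forall>\<xi>\<in>K. \<forall>c. cmod c \<le> 1 \<longrightarrow> (\<lambda>a. c * \<xi> a) \<in> K)"

definition c_topology ::
    "('a \<Rightarrow> complex) set \<Rightarrow> (('a \<Rightarrow> complex) \<Rightarrow> real) \<Rightarrow> ('a \<Rightarrow> complex) topology"
  where "c_topology X N = seminorm_topology X
    {(\<lambda>\<phi>. SUP \<xi>\<in>K. cmod (\<xi> \<phi>)) | K.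
       K \<noteq> {} \<and> compactin (strong_dual X N) K \<and> convex_circled K}"


section \<open>Test functions of Gevrey type on \<open>(0,T)\<close>\<close>

text \<open>A function on \<open>(0,T)\<close> is represented by its extension by zero, and so are its derivatives.\<close>

definition test_deriv :: "real \<Rightarrow> (real \<Rightarrow> complex) \<Rightarrow> real \<Rightarrow> complex"
  where "test_deriv T \<phi> = (\<lambda>t. if t \<in> {0<..<T} then vector_derivative \<phi> (at t) else 0)"

abbreviation test_derivs :: "real \<Rightarrow> nat \<Rightarrow> (real \<Rightarrow> complex) \<Rightarrow> real \<Rightarrow> complex"
  where "test_derivs T \<alpha> \<equiv> test_deriv T ^^ \<alpha>"

definition smooth_functions :: "real \<Rightarrow> (real \<Rightarrow> complex) set"
  where "smooth_functions T =
    {\<phi>. (\<forall>t. t \<notin> {0<..<T} \<longrightarrow> \<phi> t = 0) \<and>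
        (\<forall>\<alpha>. \<forall>t\<in>{0<..<T}. test_derivs T \<alpha> \<phi> differentiable (at t))}"

text \<open>\<open>\<D>\<^sup>(\<^sup>s\<^sup>)(0,T)\<close>\<close>

definition D_space :: "real \<Rightarrow> real \<Rightarrow> (real \<Rightarrow> complex) set"
  where "D_space s T =
    {\<phi> \<in> smooth_functions T.
       compact (closure {t. \<phi> t \<noteq> 0}) \<and> closure {t. \<phi> t \<noteq> 0} \<subseteq> {0<..<T} \<and>
       (\<forall>k>0. bdd_above
         {cmod (test_derivs T \<alpha> \<phi> t) / (k ^ \<alpha> * fact \<alpha> powr s) | \<alpha> t. t \<in> {0<..<T}})}"

text \<open>
  \<open>\<D>\<^sup>s\<close> with respect to \<open>L\<^sup>r\<close> and \<open>h\<close>, its norm, and the closure of \<open>\<D>\<^sup>(\<^sup>s\<^sup>)(0,T)\<close> in it, for finite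
  \<open>r\<close>. Norms are computed in \<open>[0,\<infinity>]\<close> first.
\<close>

definition DLr_norm_pow :: "real \<Rightarrow> real \<Rightarrow> real \<Rightarrow> real \<Rightarrow> (real \<Rightarrow> complex) \<Rightarrow> ennreal"
  where "DLr_norm_pow s T r h \<phi> =
    (\<Sum>\<alpha>. ennreal (h powr (r * real \<alpha>) / fact \<alpha> powr (r * s)) * Lp_norm_pow T r (test_derivs T \<alpha> \<phi>))"

definition DLr_norm :: "real \<Rightarrow> real \<Rightarrow> real \<Rightarrow> real \<Rightarrow> (real \<Rightarrow> complex) \<Rightarrow> real"
  where "DLr_norm s T r h \<phi> = enn2real (DLr_norm_pow s T r h \<phi>) powr (1 / r)"

definition DLr_space :: "real \<Rightarrow> real \<Rightarrow> real \<Rightarrow> real \<Rightarrow> (real \<Rightarrow> complex) set"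
  where "DLr_space s T r h = {\<phi> \<in> smooth_functions T. DLr_norm_pow s T r h \<phi> < \<infinity>}"

definition DLr_closure :: "real \<Rightarrow> real \<Rightarrow> real \<Rightarrow> real \<Rightarrow> (real \<Rightarrow> complex) set"
  where "DLr_closure s T r h =
    seminorm_topology (DLr_space s T r h) {DLr_norm s T r h} closure_of D_space s T"

text \<open>The case \<open>r = \<infinity>\<close>. All functions involved are continuous on \<open>(0,T)\<close>.\<close>

definition DLinf_enorm :: "real \<Rightarrow> real \<Rightarrow> real \<Rightarrow> (real \<Rightarrow> complex) \<Rightarrow> ennreal"
  where "DLinf_enorm s T h \<phi> =
    (SUP \<alpha>. SUP t\<in>{0<..<T}. ennreal (h ^ \<alpha> * cmod (test_derivs T \<alpha> \<phi> t) / fact \<alpha> powr s))"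

definition DLinf_norm :: "real \<Rightarrow> real \<Rightarrow> real \<Rightarrow> (real \<Rightarrow> complex) \<Rightarrow> real"
  where "DLinf_norm s T h \<phi> = enn2real (DLinf_enorm s T h \<phi>)"

definition DLinf_space :: "real \<Rightarrow> real \<Rightarrow> real \<Rightarrow> (real \<Rightarrow> complex) set"
  where "DLinf_space s T h = {\<phi> \<in> smooth_functions T. DLinf_enorm s T h \<phi> < \<infinity>}"

text \<open>
  The projective limit over \<open>h\<close> is the intersection of the spaces with the topology generated by
  all their norms; \<open>Bdot s T\<close> is the closure of \<open>\<D>\<^sup>(\<^sup>s\<^sup>)(0,T)\<close> in it.
\<close>

definition DLinf_projlim :: "real \<Rightarrow> real \<Rightarrow> (real \<Rightarrow> complex) topology"
  where "DLinf_projlim s T =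
    seminorm_topology (\<Inter>h\<in>{0<..}. DLinf_space s T h) {DLinf_norm s T h | h. 0 < h}"

definition Bdot :: "real \<Rightarrow> real \<Rightarrow> (real \<Rightarrow> complex) set"
  where "Bdot s T = DLinf_projlim s T closure_of D_space s T"

definition Bdot_topology :: "real \<Rightarrow> real \<Rightarrow> (real \<Rightarrow> complex) topology"
  where "Bdot_topology s T = subtopology (DLinf_projlim s T) (Bdot s T)"


section \<open>Vector-valued ultradistributions\<close>

definition ultradist_L1 ::
    "real \<Rightarrow> real \<Rightarrow> ((real \<Rightarrow> complex) \<Rightarrow> 'e::complex_banach) set"
  where "ultradist_L1 s T = continuous_linear_maps (Bdot_topology s T)"

definition ultradist_Lp_full ::
    "real \<Rightarrow> real \<Rightarrow> real \<Rightarrow> real \<Rightarrow> ((real \<Rightarrow> complex) \<Rightarrow> 'e::complex_banach) set"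
  where "ultradist_Lp_full s T p h =
    (let q = p / (p - 1)
     in continuous_linear_maps (c_topology (DLr_closure s T q h) (DLr_norm s T q h)))"

text \<open>The previous space, viewed inside \<open>ultradist_L1 s T\<close> by restriction to \<open>Bdot s T\<close>.\<close>

definition ultradist_Lp ::
    "real \<Rightarrow> real \<Rightarrow> real \<Rightarrow> real \<Rightarrow> ((real \<Rightarrow> complex) \<Rightarrow> 'e::complex_banach) set"
  where "ultradist_Lp s T p h =
    {u \<in> ultradist_L1 s T. \<exists>v \<in> ultradist_Lp_full s T p h. \<forall>\<phi>\<in>Bdot s T. u \<phi> = v \<phi>}"

definition ultradist_deriv ::
    "real \<Rightarrow> ((real \<Rightarrow> complex) \<Rightarrow> 'e::complex_banach) \<Rightarrow> (real \<Rightarrow> complex) \<Rightarrow> 'e"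
  where "ultradist_deriv T u = (\<lambda>\<phi>. - u (test_deriv T \<phi>))"

text \<open>The \<open>\<alpha>\<close>-th ultradistributional derivative of a function \<open>F\<close>.\<close>

definition function_deriv ::
    "real \<Rightarrow> nat \<Rightarrow> (real \<Rightarrow> 'e::complex_banach) \<Rightarrow> (real \<Rightarrow> complex) \<Rightarrow> 'e"
  where "function_deriv T \<alpha> F = (\<lambda>\<phi>. (- 1) ^ \<alpha> *\<^sub>R
    bochner_integral (lebesgue_on {0<..<T}) (\<lambda>t. test_derivs T \<alpha> \<phi> t *\<^sub>C F t))"

definition is_solution :: "real \<Rightarrow> real \<Rightarrow> 'e::complex_banach set \<Rightarrow> ('e \<Rightarrow> 'e) \<Rightarrow>
    ((real \<Rightarrow> complex) \<Rightarrow> 'e) \<Rightarrow> ((real \<Rightarrow> complex) \<Rightarrow> 'e) \<Rightarrow> bool"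
  where "is_solution s T DA A f u \<longleftrightarrow> u \<in> ultradist_L1 s T \<and>
    (\<forall>\<phi>\<in>Bdot s T. u \<phi> \<in> DA \<and> ultradist_deriv T u \<phi> = A (u \<phi>) + f \<phi>)"

text \<open>
  \<open>f\<close> is the sum of the \<open>F \<alpha>\<close> differentiated \<open>\<alpha>\<close> times, with \<open>F \<alpha>\<close> in \<open>W\<^sup>1\<^sup>,\<^sup>p(0,T;E)\<close> vanishing
  at zero and with the weighted norms of \<open>F \<alpha>\<close> and its derivative \<open>F' \<alpha>\<close> being \<open>p\<close>-summable. The
  series is summed pointwise on \<open>Bdot s T\<close>; by Hoelder's inequality the norm condition makes it
  converge absolutely and uniformly on bounded sets.
\<close>

definition represents :: "real \<Rightarrow> real \<Rightarrow> real \<Rightarrow> real \<Rightarrow> ((real \<Rightarrow> complex) \<Rightarrow> 'e::complex_banach) \<Rightarrow>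
    (nat \<Rightarrow> real \<Rightarrow> 'e) \<Rightarrow> (nat \<Rightarrow> real \<Rightarrow> 'e) \<Rightarrow> bool"
  where "represents s T p h f F F' \<longleftrightarrow>
    (\<forall>\<alpha>. sobolev_W1p T p (F \<alpha>) (F' \<alpha>) \<and> F \<alpha> 0 = 0) \<and>
    (\<Sum>\<alpha>. ennreal (fact \<alpha> powr (p * s) / h powr (p * real \<alpha>)) *
           (Lp_norm_pow T p (F \<alpha>) + Lp_norm_pow T p (F' \<alpha>))) < \<infinity> \<and>
    (\<forall>\<phi>\<in>Bdot s T. (\<lambda>\<alpha>. function_deriv T \<alpha> (F \<alpha>) \<phi>) sums f \<phi>)"

end

theory Submission
  imports Defs
begin

text \<open>
  For a continuous right-hand side vanishing at zero, backward Euler approximations converge to a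
  mild solution of \<open>u' = A u + F\<close>, and the bound depends on \<open>F\<close> through its sup norm only;
  by translation invariance, Hoelder constants are inherited as well. Solving for every \<open>F \<alpha>\<close> and
  summing the derivatives, \<open>u = \<Sum>\<alpha>. U \<alpha>\<close> differentiated \<open>\<alpha>\<close> times solves the equation because \<open>A\<close> is
  closed.

  A representation of \<open>f\<close> by continuous \<open>F \<alpha>\<close> exists because \<open>f\<close> is bounded for a
  Hilbert norm \<open>\<Sum>\<alpha>. w \<alpha> \<parallel>\<phi>\<^sup>(\<^sup>\<alpha>\<^sup>)\<parallel>\<^sup>2\<close> on test functions: by an approximate form of the Riesz
  theorem, \<open>f\<close> extends conjugate-linearly to functionals, and \<open>F \<alpha> t\<close> is, up to
  a weight, its value at the evaluation \<open>\<phi> \<mapsto> \<phi>\<^sup>(\<^sup>\<alpha>\<^sup>) t\<close>.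

  Functions in \<open>W\<^sup>1\<^sup>,\<^sup>p\<close> are Hoelder continuous with exponent \<open>1 - 1 / p\<close>. Expanding the pairing of
  \<open>\<phi>\<^sup>(\<^sup>\<alpha>\<^sup>)\<close> and \<open>U \<alpha>\<close> over dyadic subintervals bounds \<open>u \<phi>\<close> by \<open>\<Sum>m. \<bar>\<xi> m \<phi>\<bar>\<close> for unconditionally
  summable functionals \<open>\<xi> m\<close>. Their combinations with coefficients in the unit disc form a compact
  convex circled subset of the strong dual, so \<open>u\<close> is continuous for \<open>c_topology\<close>.
\<close>

section \<open>Complex scalars and seminorm topologies\<close>

text \<open>\<open>DA\<close> need not be dense, so there is no semigroup to convolve with. The
  bounds on powers of the resolvent are the stability of the implicit scheme, and right-hand sides
  that vanish for nonpositive times start it from 0, which avoids compatibility conditions on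
  initial data. The limit \<open>u\<close> satisfies the integrated equation only, and
  \<open>u t\<close> may lie outside \<open>DA\<close>; this suffices, since the pairing with a test
  function moves the missing derivative onto the test function, which vanishes with all its
  derivatives at both ends.

  Membership in \<open>ultradist_Lp\<close> asks for more than a norm estimate.
  \<open>c_topology\<close> is coarser than the norm topology, and for infinite-dimensional range a
  norm bounded map need not be continuous for it: a dominating seminorm must come from one compact
  set of functionals. Hoelder continuity gives the \<open>k\<close>-th dyadic level the factor
  \<open>\<rho> ^ k\<close> with \<open>\<rho> < 1\<close>, and summability over levels and orders
  is what makes that set compact.

  The extension of \<open>f\<close> is conjugate-linear because it follows the representing vectors,
  which sit in the second slot of the form.\<close>

lemma bounded_bilinear_scaleC:
  "bounded_bilinear (scaleC :: complex \<Rightarrow> 'e::complex_banach \<Rightarrow> 'e)"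
proof
  fix a a' :: complex and b b' :: 'e and r :: real
  show "(a + a') *\<^sub>C b = a *\<^sub>C b + a' *\<^sub>C b" by (rule scaleC_add_left)
  show "a *\<^sub>C (b + b') = a *\<^sub>C b + a *\<^sub>C b'" by (rule scaleC_add_right)
  show "(r *\<^sub>R a) *\<^sub>C b = r *\<^sub>R a *\<^sub>C b"
    using scaleC_scaleC[of "of_real r" a b] by (simp add: scaleC_of_real scaleR_conv_of_real)
  show "a *\<^sub>C r *\<^sub>R b = r *\<^sub>R a *\<^sub>C b"
    using scaleC_scaleC[of "of_real r" a b] scaleC_scaleC[of a "of_real r" b]
    by (simp add: scaleC_of_real mult.commute)
  show "\<exists>K. \<forall>a b. norm (a *\<^sub>C (b :: 'e)) \<le> norm a * norm b * K"
    by (rule exI[of _ 1]) (simp add: norm_scaleC)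
qed

interpretation scaleC: bounded_bilinear "scaleC :: complex \<Rightarrow> 'e::complex_banach \<Rightarrow> 'e"
  by (rule bounded_bilinear_scaleC)

lemma scaleC_one [simp]: "1 *\<^sub>C (x :: 'e::complex_banach) = x"
  using scaleC_of_real[of 1 x] by simp

lemma scaleC_scaleR_commute: "c *\<^sub>C r *\<^sub>R (x :: 'e::complex_banach) = r *\<^sub>R c *\<^sub>C x"
  by (rule scaleC.scaleR_right)

section \<open>Subspaces, seminorms and continuity estimates\<close>

definition fun_subspace :: "('a \<Rightarrow> complex) set \<Rightarrow> bool"
  where "fun_subspace X \<longleftrightarrow> (\<lambda>_. 0) \<in> X \<and> (\<forall>x\<in>X. \<forall>y\<in>X. (\<lambda>a. x a + y a) \<in> X) \<and>
    (\<forall>c. \<forall>x\<in>X. (\<lambda>a. c * x a) \<in> X)"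

definition fun_seminorm :: "('a \<Rightarrow> complex) set \<Rightarrow> (('a \<Rightarrow> complex) \<Rightarrow> real) \<Rightarrow> bool"
  where "fun_seminorm X \<rho> \<longleftrightarrow> (\<forall>x\<in>X. \<forall>y\<in>X. \<rho> (\<lambda>a. x a + y a) \<le> \<rho> x + \<rho> y) \<and>
    (\<forall>c. \<forall>x\<in>X. \<rho> (\<lambda>a. c * x a) = cmod c * \<rho> x)"

definition directed_seminorms :: "('a \<Rightarrow> complex) set \<Rightarrow> (('a \<Rightarrow> complex) \<Rightarrow> real) set \<Rightarrow> bool"
  where "directed_seminorms X P \<longleftrightarrow> P \<noteq> {} \<and> (\<forall>\<rho>\<in>P. fun_seminorm X \<rho>) \<and>
    (\<forall>\<rho>\<in>P. \<forall>\<sigma>\<in>P. \<exists>\<tau>\<in>P. \<forall>x\<in>X. \<rho> x \<le> \<tau> x \<and> \<sigma> x \<le> \<tau> x)"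

lemma fun_subspaceD:
  assumes "fun_subspace X"
  shows "(\<lambda>_. 0) \<in> X" "x \<in> X \<Longrightarrow> y \<in> X \<Longrightarrow> (\<lambda>a. x a + y a) \<in> X"
    "x \<in> X \<Longrightarrow> (\<lambda>a. c * x a) \<in> X"
  using assms unfolding fun_subspace_def by auto

lemma fun_subspace_diff:
  assumes "fun_subspace X" "x \<in> X" "y \<in> X"
  shows "(\<lambda>a. x a - y a) \<in> X"
  using fun_subspaceD(2)[OF assms(1,2) fun_subspaceD(3)[OF assms(1,3), of "-1"]] by simp

lemma fun_seminormD:
  assumes "fun_seminorm X \<rho>"
  shows "x \<in> X \<Longrightarrow> y \<in> X \<Longrightarrow> \<rho> (\<lambda>a. x a + y a) \<le> \<rho> x + \<rho> y"
    "x \<in> X \<Longrightarrow> \<rho> (\<lambda>a. c * x a) = cmod c * \<rho> x"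
  using assms unfolding fun_seminorm_def by auto

lemma fun_seminorm_zero:
  assumes "fun_seminorm X \<rho>" "fun_subspace X"
  shows "\<rho> (\<lambda>_. 0) = 0"
  using fun_seminormD(2)[OF assms(1) fun_subspaceD(1)[OF assms(2)], of 0] by simp

lemma fun_seminorm_nonneg:
  assumes "fun_seminorm X \<rho>" "fun_subspace X" "x \<in> X"
  shows "0 \<le> \<rho> x"
proof -
  have "\<rho> (\<lambda>a. x a + (-1) * x a) \<le> \<rho> x + \<rho> (\<lambda>a. (-1) * x a)"
    by (intro fun_seminormD(1)[OF assms(1,3)] fun_subspaceD(3)[OF assms(2,3)])
  then show ?thesis
    using fun_seminormD(2)[OF assms(1,3), of "-1"] fun_seminorm_zero[OF assms(1,2)] by simp
qed

lemma fun_seminorm_triangle: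
  assumes "fun_seminorm X \<rho>" "fun_subspace X" "x \<in> X" "y \<in> X" "z \<in> X"
  shows "\<rho> (\<lambda>a. x a - z a) \<le> \<rho> (\<lambda>a. x a - y a) + \<rho> (\<lambda>a. y a - z a)"
  using fun_seminormD(1)[OF assms(1) fun_subspace_diff[OF assms(2,3,4)]
      fun_subspace_diff[OF assms(2,4,5)]] by simp

lemma fun_subspaceI:
  assumes "(\<lambda>_. 0) \<in> X" "\<And>x y c. x \<in> X \<Longrightarrow> y \<in> X \<Longrightarrow> (\<lambda>a. c * x a + y a) \<in> X"
  shows "fun_subspace X"
  unfolding fun_subspace_def
proof (intro conjI ballI allI assms(1))
  fix x y c assume xy: "x \<in> X"
  show "(\<lambda>a. c * x a) \<in> X" using assms(2)[OF xy assms(1), of c] by simp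
  assume "y \<in> X"
  then show "(\<lambda>a. x a + y a) \<in> X" using assms(2)[OF xy, of y 1] by simp
qed

lemma openin_seminorm_ball:
  assumes "x \<in> X" "\<rho> \<in> P" "0 < r"
  shows "openin (seminorm_topology X P) {y \<in> X. \<rho> (\<lambda>a. y a - x a) < r}"
  unfolding seminorm_topology_def openin_topology_generated_by_iff
  by (rule generate_topology_on.Basis) (use assms in blast)

lemma topspace_seminorm_topology:
  assumes "\<rho> \<in> P" "\<rho> (\<lambda>_. 0) = 0"
  shows "topspace (seminorm_topology X P) = X"
proof -
  have "x \<in> topspace (seminorm_topology X P)" if "x \<in> X" for x
  proof -
    have "x \<in> {y \<in> X. \<rho> (\<lambda>a. y a - x a) < 1}" using that assms(2) by simp
    then show ?thesis
      using openin_subset[OF openin_seminorm_ball[OF that assms(1), of 1]] by auto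
  qed
  then show ?thesis
    unfolding seminorm_topology_def topology_generated_by_topspace by auto
qed

text \<open>The generating balls are a priori only a subbase. Directedness merges the seminorms of
  two intersecting balls into one, and the triangle inequality recentres a ball at any of its
  points, so a single seminorm ball around \<open>x\<close> fits into \<open>U\<close>.\<close>

lemma seminorm_topology_nhd:
  assumes P: "directed_seminorms X P" and X: "fun_subspace X"
    and U: "openin (seminorm_topology X P) U" and x: "x \<in> U"
  shows "\<exists>\<rho>\<in>P. \<exists>r>0. \<forall>y\<in>X. \<rho> (\<lambda>a. y a - x a) < r \<longrightarrow> y \<in> U"
proof -
  define B where "B = {{y \<in> X. \<rho> (\<lambda>a. y a - x a) < r} | x \<rho> r. x \<in> X \<and> \<rho> \<in> P \<and> 0 < r}"
  have BX: "b \<subseteq> X" if "b \<in> B" for b using that by (auto simp: B_def)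
  \<comment> \<open>Directedness compares seminorms on \<open>X\<close> only, so the intersection
    case has to know that its points lie in \<open>X\<close>.\<close>
  have GX: "A \<subseteq> X" if "generate_topology_on B A" for A
    using that by (induction rule: generate_topology_on.induct) (use BX in auto)
  have "generate_topology_on B U"
    using U unfolding seminorm_topology_def openin_topology_generated_by_iff B_def .
  then have "\<forall>x\<in>U. \<exists>\<rho>\<in>P. \<exists>r>0. \<forall>y\<in>X. \<rho> (\<lambda>a. y a - x a) < r \<longrightarrow> y \<in> U"
  proof (induction rule: generate_topology_on.induct)
    case (Int A C)
    show ?case
    proof
      fix x assume x: "x \<in> A \<inter> C"
      then obtain \<rho> r where *: "\<rho> \<in> P" "0 < r" "\<forall>y\<in>X. \<rho> (\<lambda>a. y a - x a) < r \<longrightarrow> y \<in> A"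
        using bspec[OF Int.IH(1), of x] by auto
      obtain \<sigma> s where **: "\<sigma> \<in> P" "0 < s" "\<forall>y\<in>X. \<sigma> (\<lambda>a. y a - x a) < s \<longrightarrow> y \<in> C"
        using bspec[OF Int.IH(2), of x] x by auto
      have "A \<subseteq> X" by (rule GX[OF Int.hyps(1)])
      then have xX: "x \<in> X" using x by auto
      obtain \<tau> where "\<tau> \<in> P" and t: "\<forall>x\<in>X. \<rho> x \<le> \<tau> x \<and> \<sigma> x \<le> \<tau> x"
        using P *(1) **(1) unfolding directed_seminorms_def by blast
      moreover have "y \<in> A \<inter> C" if "y \<in> X" "\<tau> (\<lambda>a. y a - x a) < min r s" for y
      proof -
        have "(\<lambda>a. y a - x a) \<in> X" by (rule fun_subspace_diff[OF X that(1) xX])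
        then have "\<rho> (\<lambda>a. y a - x a) < r" "\<sigma> (\<lambda>a. y a - x a) < s"
          using that(2) t by fastforce+
        then show ?thesis using *(3) **(3) that(1) by blast
      qed
      ultimately show "\<exists>\<rho>\<in>P. \<exists>r>0. \<forall>y\<in>X. \<rho> (\<lambda>a. y a - x a) < r \<longrightarrow> y \<in> A \<inter> C"
        using *(2) **(2) by (intro bexI[of _ \<tau>] exI[of _ "min r s"]) auto
    qed
  next
    case (UN K)
    show ?case
    proof
      fix x assume "x \<in> \<Union> K"
      then obtain k where k: "k \<in> K" "x \<in> k" by blast
      then obtain \<rho> r where "\<rho> \<in> P" "r > 0" "\<forall>y\<in>X. \<rho> (\<lambda>a. y a - x a) < r \<longrightarrow> y \<in> k"
        using bspec[OF UN.IH[OF k(1)] k(2)] by auto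
      then show "\<exists>\<rho>\<in>P. \<exists>r>0. \<forall>y\<in>X. \<rho> (\<lambda>a. y a - x a) < r \<longrightarrow> y \<in> \<Union> K"
        using k(1) by blast
    qed
  next
    case (Basis s)
    then obtain z \<rho> r where s: "s = {y \<in> X. \<rho> (\<lambda>a. y a - z a) < r}" "z \<in> X" "\<rho> \<in> P" "0 < r"
      unfolding B_def by blast
    have \<rho>: "fun_seminorm X \<rho>" using P s(3) unfolding directed_seminorms_def by blast
    show ?case
    proof
      fix x assume "x \<in> s"
      then have x: "x \<in> X" "\<rho> (\<lambda>a. x a - z a) < r" using s by auto
      have "y \<in> s" if "y \<in> X" "\<rho> (\<lambda>a. y a - x a) < r - \<rho> (\<lambda>a. x a - z a)" for y
        using fun_seminorm_triangle[OF \<rho> X that(1) x(1) s(2)] that s(1) by auto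
      then show "\<exists>\<rho>\<in>P. \<exists>r>0. \<forall>y\<in>X. \<rho> (\<lambda>a. y a - x a) < r \<longrightarrow> y \<in> s"
        using x(2) s(3) by (intro bexI[of _ \<rho>] exI[of _ "r - \<rho> (\<lambda>a. x a - z a)"]) auto
    qed
  qed auto
  then show ?thesis using x by blast
qed

lemma closure_of_seminorm_topology:
  assumes P: "directed_seminorms X P" and X: "fun_subspace X" and D: "D \<subseteq> X"
  shows "seminorm_topology X P closure_of D =
    {x \<in> X. \<forall>\<rho>\<in>P. \<forall>e>0. \<exists>y\<in>D. \<rho> (\<lambda>a. y a - x a) < e}"
proof -
  have sn: "fun_seminorm X \<rho>" if "\<rho> \<in> P" for \<rho>
    using P that unfolding directed_seminorms_def by blast
  obtain \<rho>0 where \<rho>0: "\<rho>0 \<in> P" using P unfolding directed_seminorms_def by blast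
  have top: "topspace (seminorm_topology X P) = X"
    by (rule topspace_seminorm_topology[OF \<rho>0 fun_seminorm_zero[OF sn[OF \<rho>0] X]])
  show ?thesis
  proof (intro equalityI subsetI)
    fix x assume "x \<in> seminorm_topology X P closure_of D"
    then have x: "x \<in> X" and *: "\<And>U. x \<in> U \<Longrightarrow> openin (seminorm_topology X P) U \<Longrightarrow> \<exists>y\<in>D. y \<in> U"
      unfolding in_closure_of top by blast+
    have "\<exists>y\<in>D. \<rho> (\<lambda>a. y a - x a) < e" if "\<rho> \<in> P" "e > 0" for \<rho> e
      using *[OF _ openin_seminorm_ball[OF x that]] x fun_seminorm_zero[OF sn[OF that(1)] X] that(2)
      by auto
    then show "x \<in> {x \<in> X. \<forall>\<rho>\<in>P. \<forall>e>0. \<exists>y\<in>D. \<rho> (\<lambda>a. y a - x a) < e}" using x by blast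
  next
    fix x assume x: "x \<in> {x \<in> X. \<forall>\<rho>\<in>P. \<forall>e>0. \<exists>y\<in>D. \<rho> (\<lambda>a. y a - x a) < e}"
    have "\<exists>y. y \<in> D \<and> y \<in> U" if U: "x \<in> U" "openin (seminorm_topology X P) U" for U
    proof -
      obtain \<rho> r where "\<rho> \<in> P" "r > 0" "\<forall>y\<in>X. \<rho> (\<lambda>a. y a - x a) < r \<longrightarrow> y \<in> U"
        using seminorm_topology_nhd[OF P X U(2,1)] by blast
      then show ?thesis using x D by blast
    qed
    then show "x \<in> seminorm_topology X P closure_of D"
      using x unfolding in_closure_of top by blast
  qed
qed

text \<open>A Lipschitz estimate for one member of the family suffices, since a ball of that
  seminorm is already a basic neighbourhood of its centre.\<close>

lemma continuous_map_seminorm_topology: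
  fixes v :: "('a \<Rightarrow> complex) \<Rightarrow> 'e::real_normed_vector"
  assumes "\<rho> \<in> P" "\<rho> (\<lambda>_. 0) = 0" and Y: "Y \<subseteq> X" and C: "0 \<le> C"
    and v: "\<And>x y. x \<in> Y \<Longrightarrow> y \<in> Y \<Longrightarrow> norm (v y - v x) \<le> C * \<rho> (\<lambda>a. y a - x a)"
  shows "continuous_map (subtopology (seminorm_topology X P) Y) euclidean v"
proof -
  have top: "topspace (subtopology (seminorm_topology X P) Y) = Y"
    using topspace_seminorm_topology[OF assms(1,2)] Y by auto
  show ?thesis
    unfolding continuous_map_def top
  proof (intro conjI allI impI)
    fix V :: "'e set" assume V: "openin euclidean V"
    show "openin (subtopology (seminorm_topology X P) Y) {x \<in> Y. v x \<in> V}"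
    proof (subst openin_subopen, intro ballI)
      fix x assume x: "x \<in> {x \<in> Y. v x \<in> V}"
      then obtain e where e: "e > 0" "ball (v x) e \<subseteq> V"
        using V by (auto simp: open_contains_ball)
      \<comment> \<open>Adding 1 keeps the radius positive and the final inequality strict when
        \<open>C = 0\<close>.\<close>
      define r where "r = e / (\<bar>C\<bar> + 1)"
      have r: "r > 0" using e by (simp add: r_def)
      define B where "B = {y \<in> X. \<rho> (\<lambda>a. y a - x a) < r} \<inter> Y"
      have "x \<in> X" using x Y by auto
      then have "openin (subtopology (seminorm_topology X P) Y) B"
        unfolding B_def using openin_seminorm_ball[OF _ assms(1) r] by (auto simp: openin_subtopology)
      moreover have "x \<in> B" using x Y r assms(2) by (auto simp: B_def)
      moreover have "B \<subseteq> {x \<in> Y. v x \<in> V}"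
      proof
        fix y assume y: "y \<in> B"
        then have yy: "norm (v y - v x) \<le> C * \<rho> (\<lambda>a. y a - x a)" using v x by (auto simp: B_def)
        have "C * \<rho> (\<lambda>a. y a - x a) < e"
        proof -
          have "C * \<rho> (\<lambda>a. y a - x a) \<le> C * r"
            using y C by (intro mult_left_mono) (auto simp: B_def)
          also have "\<dots> < e" using e(1) C unfolding r_def by (simp add: field_simps)
          finally show ?thesis .
        qed
        then have "v y \<in> ball (v x) e" using yy by (simp add: dist_norm norm_minus_commute)
        then show "y \<in> {x \<in> Y. v x \<in> V}" using e(2) y by (auto simp: B_def)
      qed
      ultimately show "\<exists>T. openin (subtopology (seminorm_topology X P) Y) T \<and> x \<in> T \<and> T \<subseteq> {x \<in> Y. v x \<in> V}"
        by blast
    qed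
  qed auto
qed

text \<open>By continuity at 0 some seminorm ball is sent into the unit ball, and homogeneity turns
  this into a bound. Directedness reduces the neighbourhood of 0 to a single seminorm.\<close>

lemma continuous_linear_maps_bound:
  fixes f :: "('a \<Rightarrow> complex) \<Rightarrow> 'e::complex_banach"
  assumes P: "directed_seminorms X P" and X: "fun_subspace X" and Y: "fun_subspace Y" "Y \<subseteq> X"
    and f: "f \<in> continuous_linear_maps (subtopology (seminorm_topology X P) Y)"
  shows "\<exists>\<rho>\<in>P. \<exists>C\<ge>0. \<forall>y\<in>Y. norm (f y) \<le> C * \<rho> y"
proof -
  obtain \<rho>0 where \<rho>0: "\<rho>0 \<in> P" using P unfolding directed_seminorms_def by blast
  have sn: "fun_seminorm X \<rho>" if "\<rho> \<in> P" for \<rho>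
    using P that unfolding directed_seminorms_def by blast
  have top: "topspace (subtopology (seminorm_topology X P) Y) = Y"
    using topspace_seminorm_topology[OF \<rho>0 fun_seminorm_zero[OF sn[OF \<rho>0] X]] Y by auto
  have fc: "continuous_map (subtopology (seminorm_topology X P) Y) euclidean f"
    and fl: "\<And>c x. x \<in> Y \<Longrightarrow> f (\<lambda>a. c * x a) = c *\<^sub>C f x"
    using f top unfolding continuous_linear_maps_def by auto
  have "openin (subtopology (seminorm_topology X P) Y) {x \<in> Y. f x \<in> ball 0 1}"
    using openin_continuous_map_preimage[OF fc, of "ball 0 1"] unfolding top by (simp only: open_openin[symmetric] open_ball simp_thms)
  then obtain U where U: "openin (seminorm_topology X P) U" "{x \<in> Y. f x \<in> ball 0 1} = U \<inter> Y"
    unfolding openin_subtopology by (elim exE conjE) (rule that)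
  have "f (\<lambda>_. 0) = 0" using fl[OF fun_subspaceD(1)[OF Y(1)], of 0] by (simp add: scaleC.zero_left)
  then have "(\<lambda>_. 0) \<in> {x \<in> Y. f x \<in> ball 0 1}" using fun_subspaceD(1)[OF Y(1)] by simp
  then have "(\<lambda>_. 0) \<in> U" unfolding U(2) by (rule IntD1)
  from seminorm_topology_nhd[OF P X U(1) this]
  obtain \<rho> r where \<rho>: "\<rho> \<in> P" and r: "0 < r"
    and nhd: "\<forall>y\<in>X. \<rho> (\<lambda>a. y a - 0) < r \<longrightarrow> y \<in> U"
    by (elim bexE exE conjE) (rule that)
  have U': "y \<in> U" if "y \<in> X" "\<rho> y < r" for y using nhd that by simp
  have "norm (f y) \<le> 2 / r * \<rho> y" if y: "y \<in> Y" for y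
  proof -
    have \<rho>y: "\<rho> y \<ge> 0" using fun_seminorm_nonneg[OF sn[OF \<rho>] X] y Y by blast
    have key: "c * norm (f y) < 1" if c: "c \<ge> 0" "c * \<rho> y < r" for c
    proof -
      have cy: "(\<lambda>a. of_real c * y a) \<in> Y" by (rule fun_subspaceD(3)[OF Y(1) y])
      have "\<rho> (\<lambda>a. of_real c * y a) = c * \<rho> y"
        using fun_seminormD(2)[OF sn[OF \<rho>], of y "of_real c"] y Y c(1) by auto
      then have "(\<lambda>a. of_real c * y a) \<in> U" using U' c(2) cy Y by auto
      then have "(\<lambda>a. of_real c * y a) \<in> U \<inter> Y" using cy by (rule IntI)
      then have "norm (f (\<lambda>a. of_real c * y a)) < 1" unfolding U(2)[symmetric] by simp
      then show ?thesis using fl[OF y] c(1) by (simp add: norm_scaleC)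
    qed
    show ?thesis
    proof (cases "\<rho> y = 0")
      case True
      \<comment> \<open>Where the seminorm vanishes every scaling factor is admissible; the factor
        \<open>1 / norm (f y)\<close> would give \<open>1 < 1\<close> unless
        \<open>f y = 0\<close>.\<close>
      then have "(1 / norm (f y)) * norm (f y) < 1" by (intro key) (auto simp: r)
      then have "norm (f y) = 0" by (auto simp: divide_simps split: if_splits)
      then show ?thesis using \<rho>y r by simp
    next
      case False
      then have "r / (2 * \<rho> y) * norm (f y) < 1" using \<rho>y r by (intro key) (auto simp: field_simps)
      then show ?thesis using False \<rho>y r by (simp add: field_simps)
    qed
  qed
  then show ?thesis using \<rho> r by (intro bexI[of _ \<rho>] exI[of _ "2 / r"]) auto
qed

section \<open>Mild solutions by backward Euler approximation\<close>

lemma linear_operatorD: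
  assumes "linear_operator DA A"
  shows "0 \<in> DA" "x \<in> DA \<Longrightarrow> y \<in> DA \<Longrightarrow> x + y \<in> DA"
    "x \<in> DA \<Longrightarrow> y \<in> DA \<Longrightarrow> A (x + y) = A x + A y"
    "x \<in> DA \<Longrightarrow> c *\<^sub>C x \<in> DA" "x \<in> DA \<Longrightarrow> A (c *\<^sub>C x) = c *\<^sub>C A x"
    "x \<in> DA \<Longrightarrow> r *\<^sub>R x \<in> DA" "x \<in> DA \<Longrightarrow> A (r *\<^sub>R x) = r *\<^sub>R A x"
  using assms unfolding linear_operator_def scaleC_of_real[symmetric] by auto

lemma linear_operator_zero:
  assumes "linear_operator DA A"
  shows "A 0 = 0"
  using linear_operatorD(7)[OF assms linear_operatorD(1)[OF assms], of 0] by simp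

lemma linear_operator_sum:
  assumes "linear_operator DA A" "\<And>j. j \<in> S \<Longrightarrow> x j \<in> DA"
  shows "sum x S \<in> DA \<and> A (sum x S) = (\<Sum>j\<in>S. A (x j))"
  using assms(2)
  by (induction S rule: infinite_finite_induct)
    (auto simp: linear_operatorD[OF assms(1)] linear_operator_zero[OF assms(1)])

lemma closed_operatorD:
  assumes "closed_operator DA A" "\<And>n. x n \<in> DA" "x \<longlonglongrightarrow> a" "(\<lambda>n. A (x n)) \<longlonglongrightarrow> b"
  shows "a \<in> DA \<and> A a = b"
proof -
  have "closed {(x, A x) | x. x \<in> DA}" using assms(1) by (simp add: closed_operator_def)
  moreover have "\<And>n. (x n, A (x n)) \<in> {(x, A x) | x. x \<in> DA}" using assms(2) by blast
  moreover have "(\<lambda>n. (x n, A (x n))) \<longlonglongrightarrow> (a, b)" by (intro tendsto_Pair assms)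
  ultimately have "(a, b) \<in> {(x, A x) | x. x \<in> DA}" by (rule closed_sequentially)
  then show ?thesis by auto
qed

section \<open>Backward differences of an antiderivative\<close>

definition bdiff :: "real \<Rightarrow> (real \<Rightarrow> 'e::real_normed_vector) \<Rightarrow> real \<Rightarrow> 'e"
  where "bdiff d g t = (g t - g (t - d)) /\<^sub>R d"

lemma bdiff_antiderivative_close:
  fixes g :: "real \<Rightarrow> 'e::real_normed_vector"
  assumes g: "continuous_on UNIV g" "\<And>t. t \<le> 0 \<Longrightarrow> g t = 0"
    and I: "\<And>t. (I has_vector_derivative g t) (at t)" and e: "0 < e"
  shows "\<exists>d0>0. \<forall>d t. 0 < d \<longrightarrow> d \<le> d0 \<longrightarrow> t \<le> T \<longrightarrow> norm (bdiff d I t - g t) \<le> e"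
proof -
  have "uniformly_continuous_on {-1..T} g"
    by (intro compact_uniformly_continuous continuous_on_subset[OF g(1)]) auto
  then obtain d1 where d1: "d1 > 0"
    "\<And>s t. s \<in> {-1..T} \<Longrightarrow> t \<in> {-1..T} \<Longrightarrow> dist s t < d1 \<Longrightarrow> dist (g s) (g t) < e"
    unfolding uniformly_continuous_on_def using e by meson
  \<comment> \<open>The bound 1 keeps \<open>t - d\<close> inside \<open>{-1..T}\<close> for
    positive \<open>t\<close>; the half makes the distance strictly less than
    \<open>d1\<close>.\<close>
  define d0 where "d0 = min 1 (d1 / 2)"
  have osc: "norm (g s - g t) \<le> e" if "t \<le> T" "t - d0 \<le> s" "s \<le> t" for s t
  proof (cases "t \<le> 0")
    case True
    then show ?thesis using that g(2) e by simp
  next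
    case False
    have "d0 \<le> 1" "d0 < d1" using d1(1) by (auto simp: d0_def)
    then have "dist (g s) (g t) < e" using that False by (intro d1(2)) (auto simp: dist_real_def)
    then show ?thesis by (simp add: dist_norm)
  qed
  have "norm (bdiff d I t - g t) \<le> e" if "0 < d" "d \<le> d0" "t \<le> T" for d t
  proof -
    have "norm (I (t - d) - I t - (t - d - t) *\<^sub>R g t) \<le> norm (t - d - t) * e"
    proof (rule vector_differentiable_bound_linearization[where S = "{t - d..t}"])
      show "(I has_vector_derivative g x) (at x within {t - d..t})" for x
        by (rule has_vector_derivative_at_within[OF I])
      show "closed_segment t (t - d) \<subseteq> {t - d..t}"
        using that by (auto simp: closed_segment_eq_real_ivl split: if_splits)
      show "norm (g x - g t) \<le> e" if "x \<in> {t - d..t}" for x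
        using that \<open>d \<le> d0\<close> \<open>t \<le> T\<close> by (intro osc) auto
    qed (use that in auto)
    then have *: "norm (I t - I (t - d) - d *\<^sub>R g t) \<le> d * e"
      using that by (simp add: norm_minus_commute algebra_simps)
    have "bdiff d I t - g t = (I t - I (t - d) - d *\<^sub>R g t) /\<^sub>R d"
      using that by (simp add: bdiff_def algebra_simps)
    then have "norm (bdiff d I t - g t) = norm (I t - I (t - d) - d *\<^sub>R g t) / d"
      using that by (simp add: divide_inverse mult.commute)
    also have "\<dots> \<le> e" using * that by (simp add: pos_divide_le_eq mult.commute)
    finally show ?thesis .
  qed
  then show ?thesis using d1(1) by (intro exI[of _ d0]) (auto simp: d0_def)
qed

lemma antiderivative_vanishing:
  fixes g :: "real \<Rightarrow> 'e::banach"
  assumes gc: "continuous_on UNIV g" and g0: "\<forall>t\<le>0. g t = 0"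
  shows "\<exists>I. (\<forall>t. (I has_vector_derivative g t) (at t)) \<and> (\<forall>t\<le>0. I t = 0) \<and>
    (\<forall>t\<ge>0. I t = integral {0..t} g)"
proof -
  note g = gc g0[rule_format]
  \<comment> \<open>Starting at \<open>-1\<close> instead of 0 makes 0 an interior point, so that
    the derivative there is two-sided.\<close>
  define I where "I = (\<lambda>t. integral {-1..t} g)"
  have int: "g integrable_on {a..b}" for a b
    by (intro integrable_continuous_real continuous_on_subset[OF g(1)]) auto
  have I0: "I t = 0" if "t \<le> 0" for t
  proof -
    have "integral {-1..t} g = integral {-1..t} (\<lambda>_. 0)" using g(2) that by (intro integral_cong) auto
    then show ?thesis by (simp add: I_def)
  qed
  have 1: "I t = integral {0..t} g" if "0 \<le> t" for t
  proof -
    have "I t = I 0 + integral {0..t} g"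
      unfolding I_def using that by (intro Henstock_Kurzweil_Integration.integral_combine[symmetric] int) auto
    then show ?thesis using I0[of 0] by simp
  qed
  have 2: "(I has_vector_derivative g t) (at t)" for t
  proof (cases "t > -1")
    case True
    have "(I has_vector_derivative g t) (at t within {-1..t+1})"
      unfolding I_def using True
      by (intro integral_has_vector_derivative continuous_on_subset[OF g(1)]) auto
    then have "(I has_vector_derivative g t) (at t within {-1<..<t+1})"
      by (rule has_vector_derivative_within_subset) auto
    then show ?thesis using True by (subst (asm) at_within_open) auto
  next
    case False
    have "((\<lambda>_. 0) has_vector_derivative 0) (at t)" by simp
    then have "(I has_vector_derivative 0) (at t)"
      by (rule has_vector_derivative_transform_within_open[of _ _ _ "{..<0}"]) (use False I0 in auto)
    then show ?thesis using False g(2) by simp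
  qed
  show ?thesis using I0 1 2 by blast
qed

text \<open>
  \<open>J N\<close> stands for \<open>(1 - \<delta> A)\<^sup>-\<^sup>1\<close> with step size \<open>\<delta> = T / N\<close>; \<open>euler N g\<close> solves
  \<open>(u(t) - u(t - \<delta>)) / \<delta> = A u(t) + g(t)\<close> when \<open>g\<close> vanishes for nonpositive times.
\<close>

locale euler_scheme =
  fixes DA :: "'e::complex_banach set" and A :: "'e \<Rightarrow> 'e" and T M :: real
    and N0 :: nat and J :: "nat \<Rightarrow> 'e \<Rightarrow> 'e"
  assumes T_pos: "0 < T" and M_nonneg: "0 \<le> M" and N0_pos: "0 < N0"
    and closed_A: "closed_operator DA A"
    and J_linear: "N0 \<le> N \<Longrightarrow> bounded_linear (J N)"
    and J_DA: "N0 \<le> N \<Longrightarrow> J N x \<in> DA"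
    and A_J: "N0 \<le> N \<Longrightarrow> A (J N x) = (real N / T) *\<^sub>R (J N x - x)"
    and J_inverse: "N0 \<le> N \<Longrightarrow> x \<in> DA \<Longrightarrow> J N (x - (T / real N) *\<^sub>R A x) = x"
    and J_power: "N0 \<le> N \<Longrightarrow> 1 \<le> k \<Longrightarrow> k \<le> N \<Longrightarrow> norm ((J N ^^ k) x) \<le> M * norm x"
begin

lemma linear_A: "linear_operator DA A"
  using closed_A by (simp add: closed_operator_def)

text \<open>Iterating \<open>u(t) = J (u(t - \<delta>) + \<delta> g(t))\<close> produces this sum.
  It may stop after \<open>N\<close> terms because for \<open>t \<le> T\<close> the later ones
  evaluate \<open>g\<close> at nonpositive times. It is formed at every real \<open>t\<close> and
  not on a grid only, which makes it commute with translations.\<close>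

definition euler :: "nat \<Rightarrow> (real \<Rightarrow> 'e) \<Rightarrow> real \<Rightarrow> 'e"
  where "euler N g t = (T / N) *\<^sub>R (\<Sum>j<N. (J N ^^ Suc j) (g (t - j * (T / N))))"

lemma power_linear: "N0 \<le> N \<Longrightarrow> bounded_linear (J N ^^ k)"
  by (induction k) (auto intro: bounded_linear_compose[OF J_linear] simp: id_def comp_def)

lemma euler_cong:
  assumes "\<And>s. s \<le> t \<Longrightarrow> g s = h s"
  shows "euler N g t = euler N h t"
  unfolding euler_def using T_pos
  by (intro arg_cong[where f = "\<lambda>x. (T / N) *\<^sub>R x"] sum.cong refl arg_cong[where f = "J N ^^ _"] assms) auto

text \<open>Stability: the number of terms cancels the weight \<open>T / N\<close>, and no exponent
  exceeds \<open>N\<close>, the range in which the power bound is available.\<close>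

lemma euler_norm:
  assumes N: "N0 \<le> N" and g: "\<And>s. s \<le> t \<Longrightarrow> norm (g s) \<le> B"
  shows "norm (euler N g t) \<le> T * M * B"
proof -
  have "norm (\<Sum>j<N. (J N ^^ Suc j) (g (t - j * (T / N)))) \<le> (\<Sum>j<N. M * B)"
  proof (rule sum_norm_le)
    fix j assume j: "j \<in> {..<N}"
    have "norm ((J N ^^ Suc j) (g (t - j * (T / N)))) \<le> M * norm (g (t - j * (T / N)))"
      using j by (intro J_power N) auto
    also have "\<dots> \<le> M * B" using M_nonneg T_pos by (intro mult_left_mono g) auto
    finally show "norm ((J N ^^ Suc j) (g (t - j * (T / N)))) \<le> M * B" .
  qed
  then have "(T / N) * norm (\<Sum>j<N. (J N ^^ Suc j) (g (t - j * (T / N)))) \<le> (T / N) * (N * (M * B))"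
    using T_pos by (intro mult_left_mono) auto
  then show ?thesis using N N0_pos T_pos by (simp add: euler_def)
qed

lemma euler_diff:
  "N0 \<le> N \<Longrightarrow> euler N (\<lambda>s. g s - h s) t = euler N g t - euler N h t"
  by (simp add: euler_def bounded_linear.linear[OF power_linear] linear_diff sum_subtractf
      scaleR_diff_right del: funpow.simps)

lemma euler_add:
  "N0 \<le> N \<Longrightarrow> euler N (\<lambda>s. g s + h s) t = euler N g t + euler N h t"
  by (simp add: euler_def bounded_linear.linear[OF power_linear] linear_add sum.distrib
      scaleR_add_right del: funpow.simps)

lemma euler_scaleR:
  "N0 \<le> N \<Longrightarrow> euler N (\<lambda>s. c *\<^sub>R g s) t = c *\<^sub>R euler N g t"
  by (simp add: euler_def bounded_linear.linear[OF power_linear] linear_scale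
      scaleR_sum_right[symmetric] mult.commute del: funpow.simps)

lemma euler_shift: "euler N (\<lambda>s. g (s - d)) t = euler N g (t - d)"
  by (simp add: euler_def algebra_simps)

lemma euler_bdiff: "N0 \<le> N \<Longrightarrow> euler N (bdiff d g) t = bdiff d (euler N g) t"
  using euler_scaleR[of N "inverse d" "\<lambda>s. g s - g (s - d)" t] euler_diff[of N g "\<lambda>s. g (s - d)" t]
  by (simp add: bdiff_def[abs_def] euler_shift)

lemma euler_nonpos:
  assumes "N0 \<le> N" "\<And>s. s \<le> 0 \<Longrightarrow> g s = 0" "t \<le> 0"
  shows "euler N g t = 0"
  using euler_norm[OF assms(1), of t g 0] assms(2,3) by simp

text \<open>\<open>A\<close> replaces \<open>J^(j+1)\<close> by
  \<open>(J^(j+1) - J^j) / \<delta>\<close>, so it produces two sums that also occur in the backward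
  difference. Besides \<open>g t\<close> the only boundary term is the one with index
  \<open>N\<close>, which sees \<open>g\<close> at a nonpositive time and vanishes.\<close>

lemma euler_step:
  assumes N: "N0 \<le> N" and g: "\<And>s. s \<le> 0 \<Longrightarrow> g s = 0" and t: "t \<le> T"
  shows "euler N g t \<in> DA \<and> A (euler N g t) = bdiff (T / N) (euler N g) t - g t"
proof -
  define \<delta> where "\<delta> = T / N"
  have N': "0 < N" using N N0_pos by simp
  then have \<delta>: "0 < \<delta>" "N * \<delta> = T" using T_pos by (auto simp: \<delta>_def)
  define z where "z = (\<lambda>j. (J N ^^ j) (g (t - j * \<delta>)))"
  define y where "y = (\<lambda>j. (J N ^^ Suc j) (g (t - j * \<delta>)))"
  have yz: "y j = J N (z j)" for j by (simp add: y_def z_def)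
  have e: "euler N g t = \<delta> *\<^sub>R (\<Sum>j<N. y j)" by (simp add: euler_def y_def \<delta>_def)
  have ys: "sum y {..<N} \<in> DA \<and> A (sum y {..<N}) = (\<Sum>j<N. A (y j))"
    by (rule linear_operator_sum[OF linear_A]) (simp add: yz J_DA[OF N])
  have "A (euler N g t) = \<delta> *\<^sub>R (\<Sum>j<N. inverse \<delta> *\<^sub>R (y j - z j))"
    using ys unfolding e by (simp add: linear_operatorD[OF linear_A] yz A_J[OF N] \<delta>_def)
  also have "\<dots> = sum y {..<N} - sum z {..<N}"
    using \<delta> by (simp add: scaleR_sum_right[symmetric] sum_subtractf)
  finally have A: "A (euler N g t) = sum y {..<N} - sum z {..<N}" .
  have "euler N g (t - \<delta>) = \<delta> *\<^sub>R (\<Sum>j<N. z (Suc j))"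
    by (simp add: euler_def z_def \<delta>_def algebra_simps add_divide_distrib del: funpow.simps)
  then have b: "bdiff \<delta> (euler N g) t = sum y {..<N} - (\<Sum>j<N. z (Suc j))"
    using \<delta> by (simp add: bdiff_def e scaleR_diff_right[symmetric])
  have "z N = 0" using g[of "t - N * \<delta>"] t \<delta> linear_0[OF bounded_linear.linear[OF power_linear[OF N]]]
    by (simp add: z_def)
  then have "(\<Sum>j<N. z (Suc j)) = sum z {..<N} - g t"
    using sum_lessThan_telescope[of z N] by (simp add: sum_subtractf z_def algebra_simps)
  then show ?thesis
    using A b ys by (simp add: e linear_operatorD[OF linear_A] \<delta>_def)
qed

text \<open>\<open>J N\<close> undoes \<open>1 - \<delta> A\<close>, so the terms telescope. With
  \<open>euler_step\<close> this makes \<open>euler N\<close> a two-sided inverse of the backward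
  difference minus \<open>A\<close>, on functions vanishing for nonpositive times; the resolvent
  identity needs both sides.\<close>

lemma euler_inverse:
  assumes N: "N0 \<le> N" and w: "\<And>s. s \<le> 0 \<Longrightarrow> w s = 0" "\<And>s. s \<le> T \<Longrightarrow> w s \<in> DA" and t: "t \<le> T"
  shows "euler N (\<lambda>s. bdiff (T / N) w s - A (w s)) t = w t"
proof -
  define \<delta> where "\<delta> = T / N"
  have N': "0 < N" using N N0_pos by simp
  then have \<delta>: "0 < \<delta>" "N * \<delta> = T" using T_pos by (auto simp: \<delta>_def)
  define z where "z = (\<lambda>j. (J N ^^ j) (w (t - j * \<delta>)))"
  have lin: "linear (J N ^^ k)" for k by (rule bounded_linear.linear[OF power_linear[OF N]])
  have "\<delta> *\<^sub>R (J N ^^ Suc j) (bdiff \<delta> w (t - j * \<delta>) - A (w (t - j * \<delta>))) = z j - z (Suc j)" for j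
  proof -
    define s where "s = t - j * \<delta>"
    have s: "s \<le> T" using t \<delta> by (simp add: s_def) (smt (verit) mult_nonneg_nonneg of_nat_0_le_iff)
    have s1: "s - \<delta> = t - Suc j * \<delta>" by (simp add: s_def algebra_simps)
    have "\<delta> *\<^sub>R (J N ^^ Suc j) (bdiff \<delta> w s - A (w s)) = (J N ^^ Suc j) (\<delta> *\<^sub>R (bdiff \<delta> w s - A (w s)))"
      by (simp only: linear_scale[OF lin])
    also have "\<delta> *\<^sub>R (bdiff \<delta> w s - A (w s)) = (w s - \<delta> *\<^sub>R A (w s)) - w (s - \<delta>)"
      using \<delta>(1) by (simp add: bdiff_def scaleR_diff_right)
    also have "(J N ^^ Suc j) \<dots> = (J N ^^ Suc j) (w s - \<delta> *\<^sub>R A (w s)) - (J N ^^ Suc j) (w (s - \<delta>))"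
      by (rule linear_diff[OF lin])
    also have "(J N ^^ Suc j) (w s - \<delta> *\<^sub>R A (w s)) = (J N ^^ j) (w s)"
      using J_inverse[OF N w(2)[OF s]] by (simp add: funpow_Suc_right \<delta>_def del: funpow.simps)
    finally show ?thesis unfolding z_def s_def[symmetric] s1[symmetric] .
  qed
  then have "euler N (\<lambda>s. bdiff \<delta> w s - A (w s)) t = (\<Sum>j<N. z j - z (Suc j))"
    unfolding euler_def scaleR_sum_right \<delta>_def[symmetric] by simp
  also have "\<dots> = z 0 - z N" by (rule sum_lessThan_telescope')
  also have "z N = 0" using w(1)[of "t - N * \<delta>"] t \<delta> linear_0[OF lin] by (simp add: z_def)
  finally show ?thesis by (simp add: z_def \<delta>_def)
qed

text \<open>The resolvent identity for the operators \<open>(B\<^sub>\<delta> - A)\<^sup>-\<^sup>1\<close>, with \<open>B\<^sub>\<delta>\<close> the backward difference.\<close>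

lemma euler_resolvent:
  assumes N: "N0 \<le> N" and K: "N0 \<le> K" and g: "\<And>s. s \<le> 0 \<Longrightarrow> g s = 0" and t: "t \<le> T"
  shows "euler K g t - euler N g t = euler N (euler K (\<lambda>s. bdiff (T / N) g s - bdiff (T / K) g s)) t"
proof -
  let ?w = "euler K g"
  have "?w t = euler N (\<lambda>s. bdiff (T / N) ?w s - A (?w s)) t"
    using euler_inverse[OF N, of ?w t] euler_nonpos[OF K g] euler_step[OF K g] t by auto
  also have "\<dots> = euler N (\<lambda>s. (bdiff (T / N) ?w s - bdiff (T / K) ?w s) + g s) t"
    using t euler_step[OF K g] by (intro euler_cong) auto
  also have "\<dots> = euler N (\<lambda>s. bdiff (T / N) ?w s - bdiff (T / K) ?w s) t + euler N g t"
    by (rule euler_add[OF N])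
  also have "(\<lambda>s. bdiff (T / N) ?w s - bdiff (T / K) ?w s) = euler K (\<lambda>s. bdiff (T / N) g s - bdiff (T / K) g s)"
    by (simp add: euler_diff[OF K] euler_bdiff[OF K] fun_eq_iff)
  finally show ?thesis by simp
qed

text \<open>For differentiable data the resolvent identity expresses the difference of two schemes
  by two stable operators applied to \<open>bdiff (T / N) I - bdiff (T / K) I\<close>, and both
  quotients are close to \<open>g\<close>.\<close>

lemma euler_Cauchy_antiderivative:
  assumes g: "continuous_on UNIV g" "\<And>t. t \<le> 0 \<Longrightarrow> g t = 0"
    and I: "\<And>t. (I has_vector_derivative g t) (at t)" "\<And>t. t \<le> 0 \<Longrightarrow> I t = 0" and e: "0 < e"
  shows "\<exists>N1\<ge>N0. \<forall>K\<ge>N1. \<forall>N\<ge>N1. \<forall>t\<le>T. norm (euler K I t - euler N I t) \<le> e"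
proof -
  \<comment> \<open>Each of the two applications costs the factor \<open>T * M\<close>, and the two
    difference quotients contribute \<open>2 * e'\<close>.\<close>
  define e' where "e' = e / (2 * (T * M * (T * M)) + 1)"
  have "0 \<le> T * M * (T * M)" using M_nonneg T_pos by simp
  then have "0 < 2 * (T * M * (T * M)) + 1" by linarith
  then have e': "e' > 0" "T * M * (T * M * (2 * e')) \<le> e"
    using e by (auto simp: e'_def field_simps)
  obtain d0 where d0: "d0 > 0" "\<And>d t. 0 < d \<Longrightarrow> d \<le> d0 \<Longrightarrow> t \<le> T \<Longrightarrow> norm (bdiff d I t - g t) \<le> e'"
    using bdiff_antiderivative_close[OF g I(1) e'(1), of T] by auto
  obtain N2 :: nat where N2: "T / d0 < N2" using reals_Archimedean2 by blast
  define N1 where "N1 = max N0 N2"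
  have small: "0 < T / N \<and> T / N \<le> d0" if "N1 \<le> N" for N :: nat
  proof -
    have "T / d0 \<le> N" using N2 that by (simp add: N1_def)
    moreover have "0 < N" using that N0_pos by (simp add: N1_def)
    ultimately show ?thesis using T_pos d0(1) by (simp add: field_simps)
  qed
  have "norm (euler K I t - euler N I t) \<le> e" if KN: "N1 \<le> K" "N1 \<le> N" "t \<le> T" for K N t
  proof -
    have KN': "N0 \<le> K" "N0 \<le> N" using KN by (auto simp: N1_def)
    have "norm (bdiff (T / N) I s - bdiff (T / K) I s) \<le> 2 * e'" if "s \<le> T" for s
      using d0(2)[of "T / N" s] d0(2)[of "T / K" s] small KN that
        norm_triangle_ineq4[of "bdiff (T / N) I s - g s" "bdiff (T / K) I s - g s"] by fastforce
    then have "norm (euler N (euler K (\<lambda>s. bdiff (T / N) I s - bdiff (T / K) I s)) t)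
      \<le> T * M * (T * M * (2 * e'))"
      using KN(3) by (intro euler_norm KN') auto
    then show ?thesis using euler_resolvent[OF KN'(2,1) I(2) KN(3)] e'(2) by simp
  qed
  then show ?thesis by (intro exI[of _ N1]) (auto simp: N1_def)
qed

text \<open>A merely continuous \<open>g\<close> is replaced by \<open>bdiff d I\<close> with fixed
  \<open>d\<close>, at a cost uniform in \<open>n\<close> by stability. The scheme commutes with
  \<open>bdiff d\<close>, so the replaced data inherit the Cauchy property of the
  antiderivative.\<close>

lemma euler_uniformly_Cauchy:
  assumes g: "continuous_on UNIV g" "\<And>t. t \<le> 0 \<Longrightarrow> g t = 0"
  shows "uniformly_Cauchy_on {..T} (\<lambda>n. euler n g)"
proof -
  obtain I where I: "\<And>t. (I has_vector_derivative g t) (at t)" "\<And>t. t \<le> 0 \<Longrightarrow> I t = 0"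
    and "\<And>t. 0 \<le> t \<Longrightarrow> I t = integral {0..t} g"
    using antiderivative_vanishing[of g] g by auto
  show ?thesis
    unfolding uniformly_Cauchy_on_def
  proof (intro allI impI)
    fix e :: real assume e: "e > 0"
    define e' where "e' = e / (4 * (T * M + 1))"
    have TM: "0 \<le> T * M" using M_nonneg T_pos by simp
    then have e': "e' > 0" "T * M * e' \<le> e / 4" using e by (auto simp: e'_def field_simps)
    obtain d where d: "d > 0" "\<And>t. t \<le> T \<Longrightarrow> norm (bdiff d I t - g t) \<le> e'"
      using bdiff_antiderivative_close[OF g I(1) e'(1), of T] by auto
    \<comment> \<open>The division by \<open>d\<close> in the difference quotient turns two errors
      \<open>d * e / 16\<close> into \<open>e / 8\<close>; the total is then
      \<open>e / 4 + e / 8 + e / 4 < e\<close>.\<close>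
    obtain N1 where N1: "N0 \<le> N1"
      "\<And>K N t. N1 \<le> K \<Longrightarrow> N1 \<le> N \<Longrightarrow> t \<le> T \<Longrightarrow> norm (euler K I t - euler N I t) \<le> d * e / 16"
      using euler_Cauchy_antiderivative[OF g I, of "d * e / 16"] d(1) e by auto
    have "dist (euler m g t) (euler n g t) < e" if mn: "N1 \<le> m" "N1 \<le> n" "t \<in> {..T}" for m n t
    proof -
      have near: "norm (bdiff d (euler n I) t - euler n g t) \<le> e / 4" if "N1 \<le> n" for n
      proof -
        have n: "N0 \<le> n" using that N1(1) by simp
        have "norm (euler n (\<lambda>s. bdiff d I s - g s) t) \<le> T * M * e'"
          using mn(3) d(2) by (intro euler_norm[OF n]) auto
        then show ?thesis using e'(2) by (simp add: euler_diff[OF n] euler_bdiff[OF n])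
      qed
      have "bdiff d (euler m I) t - bdiff d (euler n I) t =
        ((euler m I t - euler n I t) - (euler m I (t - d) - euler n I (t - d))) /\<^sub>R d"
        by (simp add: bdiff_def algebra_simps)
      then have "norm (bdiff d (euler m I) t - bdiff d (euler n I) t) =
        norm ((euler m I t - euler n I t) - (euler m I (t - d) - euler n I (t - d))) / d"
        using d(1) by (simp add: divide_inverse mult.commute)
      also have "\<dots> \<le> (d * e / 16 + d * e / 16) / d"
        using d(1) mn by (intro divide_right_mono norm_triangle_le_diff add_mono N1) auto
      also have "\<dots> = e / 8" using d(1) by simp
      finally have "norm (bdiff d (euler m I) t - bdiff d (euler n I) t) \<le> e / 8" .
      then have "norm (euler m g t - euler n g t) \<le> e / 4 + e / 8 + e / 4"
        using near[OF mn(1)] near[OF mn(2)] by norm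
      then show ?thesis using e by (simp add: dist_norm)
    qed
    then show "\<exists>M. \<forall>x\<in>{..T}. \<forall>m\<ge>M. \<forall>n\<ge>M. dist (euler m g x) (euler n g x) < e" by blast
  qed
qed

lemma euler_has_vector_derivative:
  assumes N: "N0 \<le> N" and I: "\<And>t. (I has_vector_derivative g t) (at t)"
  shows "(euler N I has_vector_derivative euler N g t) (at t)"
proof -
  have "((\<lambda>t. (T / N) *\<^sub>R (\<Sum>j<N. (J N ^^ Suc j) (I (t - j * (T / N))))) has_vector_derivative
    (T / N) *\<^sub>R (\<Sum>j<N. (J N ^^ Suc j) (g (t - j * (T / N))))) (at t)"
  proof (intro bounded_linear.has_vector_derivative[OF bounded_linear_scaleR_right]
      has_vector_derivative_sum bounded_linear.has_vector_derivative[OF power_linear[OF N]])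
    fix j
    have "((\<lambda>t. t - j * (T / N)) has_vector_derivative 1) (at t)"
      by (auto intro!: derivative_eq_intros simp flip: has_real_derivative_iff_has_vector_derivative)
    from vector_diff_chain_at[OF this I]
    show "((\<lambda>t. I (t - j * (T / N))) has_vector_derivative g (t - j * (T / N))) (at t)"
      by (simp add: comp_def)
  qed
  then show ?thesis by (simp add: euler_def[abs_def])
qed

lemma euler_continuous:
  assumes N: "N0 \<le> N" and g: "continuous_on UNIV g"
  shows "continuous_on S (euler N g)"
proof -
  have "continuous_on UNIV (\<lambda>t. (T / N) *\<^sub>R (\<Sum>j<N. (J N ^^ Suc j) (g (t - j * (T / N)))))"
    by (intro continuous_intros bounded_linear.continuous_on[OF power_linear[OF N]]
        continuous_on_compose2[OF g]) auto
  then show ?thesis by (auto simp: euler_def[abs_def] intro: continuous_on_subset)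
qed

text \<open>The scheme is run on \<open>g\<close> and on its antiderivative \<open>I\<close>. The
  second limit is the primitive of the first, and \<open>A\<close> of the second run converges as
  well, so closedness gives the integrated equation. The two final estimates are stability bounds
  carried through the limit, the last one applied to \<open>g\<close> minus a translate.\<close>

lemma mild_solution_vanishing:
  assumes gc: "continuous_on UNIV g" and g0: "\<forall>t\<le>0. g t = 0"
  shows "\<exists>u. continuous_on {0..T} u \<and> u 0 = 0 \<and>
    (\<forall>t\<in>{0..T}. integral {0..t} u \<in> DA \<and> A (integral {0..t} u) = u t - integral {0..t} g) \<and>
    (\<forall>t\<le>T. \<forall>B. (\<forall>s\<le>T. norm (g s) \<le> B) \<longrightarrow> norm (u t) \<le> T * M * B) \<and>
    (\<forall>t\<le>T. \<forall>d\<ge>0. \<forall>B. (\<forall>s\<le>T. norm (g s - g (s - d)) \<le> B) \<longrightarrow>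
      norm (u t - u (t - d)) \<le> T * M * B)"
proof -
  note g = gc g0[rule_format]
  obtain I where I: "\<And>t. (I has_vector_derivative g t) (at t)" "\<And>t. t \<le> 0 \<Longrightarrow> I t = 0"
    "\<And>t. 0 \<le> t \<Longrightarrow> I t = integral {0..t} g"
    using antiderivative_vanishing[OF gc g0] by auto
  have Ic: "continuous_on UNIV I"
    using has_vector_derivative_continuous[OF I(1)] by (simp add: continuous_at_imp_continuous_on)
  define u where "u t = lim (\<lambda>n. euler n g t)" for t
  define v where "v t = lim (\<lambda>n. euler n I t)" for t
  have ulim: "uniform_limit {..T} (\<lambda>n. euler n g) u sequentially"
    using Cauchy_uniformly_convergent[OF euler_uniformly_Cauchy[OF g]]
    unfolding uniformly_convergent_uniform_limit_iff u_def[abs_def] .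
  have vlim: "uniform_limit {..T} (\<lambda>n. euler n I) v sequentially"
    using Cauchy_uniformly_convergent[OF euler_uniformly_Cauchy[OF Ic I(2)]]
    unfolding uniformly_convergent_uniform_limit_iff v_def[abs_def] .
  have ut: "(\<lambda>n. euler n g t) \<longlonglongrightarrow> u t" if "t \<le> T" for t
    using tendsto_uniform_limitI[OF ulim] that by simp
  have vt: "(\<lambda>n. euler n I t) \<longlonglongrightarrow> v t" if "t \<le> T" for t
    using tendsto_uniform_limitI[OF vlim] that by simp
  have ev: "eventually (\<lambda>n. N0 \<le> n) sequentially" by (rule eventually_ge_at_top)
  have uc: "continuous_on {..T} u"
    by (rule uniform_limit_theorem[OF _ ulim]) (auto intro!: eventually_mono[OF ev] euler_continuous g)
  have norm_u: "norm (u t) \<le> T * M * B" if "t \<le> T" "\<And>s. s \<le> T \<Longrightarrow> norm (g s) \<le> B" for t B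
    by (rule tendsto_upperbound[OF tendsto_norm[OF ut[OF that(1)]] eventually_mono[OF ev]])
      (use that in \<open>auto intro!: euler_norm\<close>)
  have diff_u: "norm (u t - u (t - d)) \<le> T * M * B"
    if "t \<le> T" "0 \<le> d" "\<And>s. s \<le> T \<Longrightarrow> norm (g s - g (s - d)) \<le> B" for t d B
  proof (rule tendsto_upperbound[OF tendsto_norm[OF tendsto_diff[OF ut[OF that(1)] ut]] eventually_mono[OF ev]])
    fix n assume n: "N0 \<le> n"
    show "norm (euler n g t - euler n g (t - d)) \<le> T * M * B"
      using euler_norm[OF n, of t "\<lambda>s. g s - g (s - d)" B] that
      by (simp add: euler_diff[OF n] euler_shift)
  qed (use that in auto)
  have vu: "v t = integral {0..t} u" if t: "t \<in> {0..T}" for t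
  proof -
    have lim: "uniform_limit {0..t} (\<lambda>n. euler n g) u sequentially"
      by (rule uniform_limit_on_subset[OF ulim]) (use t in auto)
    have int: "(euler n g has_integral euler n I t) {0..t}" if n: "N0 \<le> n" for n
    proof -
      have "(euler n g has_integral (euler n I t - euler n I 0)) {0..t}"
        using t by (intro fundamental_theorem_of_calculus
            has_vector_derivative_at_within[OF euler_has_vector_derivative[OF n I(1)]]) auto
      moreover have "euler n I 0 = 0" by (rule euler_nonpos[OF n I(2)]) auto
      ultimately show ?thesis by simp
    qed
    have "(\<lambda>n. integral {0..t} (euler n g)) \<longlonglongrightarrow> integral {0..t} u"
    \<comment> \<open>Below \<open>N0\<close> nothing is known about \<open>J\<close>, so the
      integrals are compared only from that index on.\<close>
    proof (rule LIMSEQ_offset[of _ N0])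
      have "uniform_limit {0..t} (\<lambda>n. euler (n + N0) g) u sequentially"
        by (rule filterlim_compose[OF lim filterlim_add_const_nat_at_top])
      then obtain Im J' where *: "\<And>n. (euler (n + N0) g has_integral Im n) {0..t}" "(u has_integral J') {0..t}"
        "Im \<longlonglongrightarrow> J'"
        by (rule uniform_limit_integral) (auto intro!: euler_continuous g)
      have "(\<lambda>n. integral {0..t} (euler (n + N0) g)) = Im" using integral_unique[OF *(1)] by auto
      then show "(\<lambda>n. integral {0..t} (euler (n + N0) g)) \<longlonglongrightarrow> integral {0..t} u"
        using *(2,3) by (simp add: integral_unique)
    qed
    moreover have "eventually (\<lambda>n. integral {0..t} (euler n g) = euler n I t) sequentially"
      by (rule eventually_mono[OF ev]) (rule integral_unique[OF int])
    ultimately have "(\<lambda>n. euler n I t) \<longlonglongrightarrow> integral {0..t} u" by (rule Lim_transform_eventually)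
    then show ?thesis using vt[of t] t LIMSEQ_unique by auto
  qed
  have Av: "v t \<in> DA \<and> A (v t) = u t - I t" if t: "t \<le> T" for t
  proof (rule closed_operatorD[OF closed_A])
    show "(\<lambda>n. euler (n + N0) I t) \<longlonglongrightarrow> v t" using vt[OF t] by (rule LIMSEQ_ignore_initial_segment)
    show "euler (n + N0) I t \<in> DA" for n using euler_step[OF _ I(2) t, of "n + N0"] by simp
    \<comment> \<open>Consistency: \<open>A (euler n I t)\<close> contains the backward difference
      of \<open>euler n I\<close>, which is \<open>euler n\<close> of a quotient tending to
      \<open>g\<close>. Stability makes the replacement harmless.\<close>
    have 0: "(\<lambda>n. euler n (bdiff (T / n) I) t - euler n g t) \<longlonglongrightarrow> 0"
    proof (rule LIMSEQ_I)
      fix e :: real assume e: "e > 0"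
      define e' where "e' = e / (2 * (T * M + 1))"
      have TM: "0 \<le> T * M" using M_nonneg T_pos by simp
      then have e'0: "e' > 0" using e by (simp add: e'_def)
      have "2 * (T * M + 1) * e' = e" using TM by (simp add: e'_def)
      then have "2 * (T * M * e') + 2 * e' = e" by (simp add: algebra_simps)
      moreover have "0 \<le> T * M * e'" using TM e'0 by simp
      ultimately have e': "e' > 0" "T * M * e' < e" using e'0 by linarith+
      obtain d0 where d0: "d0 > 0" "\<And>d t. 0 < d \<Longrightarrow> d \<le> d0 \<Longrightarrow> t \<le> T \<Longrightarrow> norm (bdiff d I t - g t) \<le> e'"
        using bdiff_antiderivative_close[OF g I(1) e'(1), of T] by auto
      obtain N2 :: nat where N2: "T / d0 < N2" using reals_Archimedean2 by blast
      have "norm (euler n (bdiff (T / n) I) t - euler n g t - 0) < e" if "max N0 N2 \<le> n" for n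
      proof -
        have n: "N0 \<le> n" "0 < n" "T / d0 < n" using that N2 N0_pos by auto
        then have "0 < T / n" "T / n \<le> d0" using T_pos d0(1) by (auto simp: field_simps)
        then have "norm (euler n (\<lambda>s. bdiff (T / n) I s - g s) t) \<le> T * M * e'"
          using t d0(2) by (intro euler_norm n(1)) auto
        then show ?thesis using e'(2) by (simp add: euler_diff[OF n(1)])
      qed
      then show "\<exists>no. \<forall>n\<ge>no. norm (euler n (bdiff (T / n) I) t - euler n g t - 0) < e" by blast
    qed
    have "(\<lambda>n. (euler n (bdiff (T / n) I) t - euler n g t) + euler n g t - I t) \<longlonglongrightarrow> 0 + u t - I t"
      by (intro tendsto_intros 0 ut[OF t])
    then have "(\<lambda>n. euler n (bdiff (T / n) I) t - I t) \<longlonglongrightarrow> u t - I t" by simp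
    from LIMSEQ_ignore_initial_segment[OF this, of N0]
    show "(\<lambda>n. A (euler (n + N0) I t)) \<longlonglongrightarrow> u t - I t"
      using euler_step[OF _ I(2) t] by (simp add: euler_bdiff)
  qed
  show ?thesis
  proof (rule exI[of _ u], intro conjI allI impI ballI)
    show "continuous_on {0..T} u" by (rule continuous_on_subset[OF uc]) auto
    have "eventually (\<lambda>n. euler n g 0 = 0) sequentially"
      by (rule eventually_mono[OF ev]) (auto intro: euler_nonpos g(2))
    then have "(\<lambda>n. euler n g 0) \<longlonglongrightarrow> 0" by (rule tendsto_eventually)
    then show "u 0 = 0" using ut[of 0] T_pos LIMSEQ_unique by auto
    show "integral {0..t} u \<in> DA" "A (integral {0..t} u) = u t - integral {0..t} g" if "t \<in> {0..T}" for t
      using Av[of t] vu[OF that] I(3)[of t] that by auto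
  qed (use norm_u diff_u in auto)
qed

lemma mild_solution:
  assumes F: "continuous_on {0..T} F" "F 0 = 0"
  shows "\<exists>u. continuous_on {0..T} u \<and> u 0 = 0 \<and>
    (\<forall>t\<in>{0..T}. integral {0..t} u \<in> DA \<and> A (integral {0..t} u) = u t - integral {0..t} F) \<and>
    (\<forall>B. (\<forall>t\<in>{0..T}. norm (F t) \<le> B) \<longrightarrow> (\<forall>t\<in>{0..T}. norm (u t) \<le> T * M * B)) \<and>
    (\<forall>c \<gamma>. 0 \<le> c \<longrightarrow> 0 < \<gamma> \<longrightarrow> (\<forall>s\<in>{0..T}. \<forall>t\<in>{0..T}. norm (F t - F s) \<le> c * \<bar>t - s\<bar> powr \<gamma>) \<longrightarrow>
      (\<forall>s\<in>{0..T}. \<forall>t\<in>{0..T}. norm (u t - u s) \<le> T * M * (c * \<bar>t - s\<bar> powr \<gamma>)))"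
proof -
  \<comment> \<open>Clamping the time to \<open>{0..T}\<close> gives a continuous extension, zero on
    the negative axis because \<open>F 0 = 0\<close>. Clamping does not increase distances, so
    Hoelder constants are unchanged.\<close>
  define g where "g t = F (max 0 (min T t))" for t
  have gF: "g t = F t" if "t \<in> {0..T}" for t using that by (simp add: g_def)
  have gc: "continuous_on UNIV g"
    unfolding g_def by (rule continuous_on_compose2[OF F(1)]) (use T_pos in \<open>auto intro!: continuous_intros\<close>)
  have g0: "g t = 0" if "t \<le> 0" for t using that T_pos F(2) by (simp add: g_def)
  have clamp: "max 0 (min T t) \<in> {0..T}" for t using T_pos by auto
  obtain u where u: "continuous_on {0..T} u" "u 0 = 0"
    "\<And>t. t \<in> {0..T} \<Longrightarrow> integral {0..t} u \<in> DA \<and> A (integral {0..t} u) = u t - integral {0..t} g"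
    "\<And>t B. t \<le> T \<Longrightarrow> (\<And>s. s \<le> T \<Longrightarrow> norm (g s) \<le> B) \<Longrightarrow> norm (u t) \<le> T * M * B"
    "\<And>t d B. t \<le> T \<Longrightarrow> 0 \<le> d \<Longrightarrow> (\<And>s. s \<le> T \<Longrightarrow> norm (g s - g (s - d)) \<le> B) \<Longrightarrow>
      norm (u t - u (t - d)) \<le> T * M * B"
    using mild_solution_vanishing[of g] gc g0 by auto
  have hoelder: "norm (u t - u s) \<le> T * M * (c * \<bar>t - s\<bar> powr \<gamma>)"
    if c: "0 \<le> c" "0 < \<gamma>" "\<forall>s\<in>{0..T}. \<forall>t\<in>{0..T}. norm (F t - F s) \<le> c * \<bar>t - s\<bar> powr \<gamma>"
      and st: "t \<in> {0..T}" "s \<le> t" for c \<gamma> s t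
  proof -
    have "norm (g r - g (r - (t - s))) \<le> c * \<bar>t - s\<bar> powr \<gamma>" for r
    proof -
      let ?a = "max 0 (min T r)" and ?b = "max 0 (min T (r - (t - s)))"
      have "norm (F ?a - F ?b) \<le> c * \<bar>?a - ?b\<bar> powr \<gamma>" using c(3) clamp by blast
      also have "\<dots> \<le> c * \<bar>t - s\<bar> powr \<gamma>"
        using c(1,2) by (intro mult_left_mono powr_mono2) auto
      finally show ?thesis by (simp add: g_def)
    qed
    then show ?thesis using u(5)[of t "t - s" "c * \<bar>t - s\<bar> powr \<gamma>"] st by simp
  qed
  show ?thesis
  proof (intro exI[of _ u] conjI u(1,2) ballI allI impI)
    fix t assume t: "t \<in> {0..T}"
    have "integral {0..t} g = integral {0..t} F" using t by (intro integral_cong gF) auto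
    then show "integral {0..t} u \<in> DA" "A (integral {0..t} u) = u t - integral {0..t} F"
      using u(3)[OF t] by auto
  next
    fix B t assume "\<forall>t\<in>{0..T}. norm (F t) \<le> B" "t \<in> {0..T}"
    then show "norm (u t) \<le> T * M * B" using clamp by (intro u(4)) (auto simp: g_def)
  next
    fix c \<gamma> s t assume "0 \<le> c" "0 < \<gamma>"
      "\<forall>s\<in>{0..T}. \<forall>t\<in>{0..T}. norm (F t - F s) \<le> c * \<bar>t - s\<bar> powr \<gamma>" "s \<in> {0..T}" "t \<in> {0..T}"
    then show "norm (u t - u s) \<le> T * M * (c * \<bar>t - s\<bar> powr \<gamma>)"
      using hoelder[of c \<gamma> t s] hoelder[of c \<gamma> s t]
      by (cases "s \<le> t") (auto simp: norm_minus_commute abs_minus_commute)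
  qed
qed

end

text \<open>With \<open>m = N / T\<close>, the operator \<open>J N\<close> is \<open>m\<close> times
  the resolvent at \<open>m\<close>. The condition bounds powers weighted with
  \<open>m - \<omega>\<close>; the change to powers of \<open>m\<close> costs
  \<open>(m / (m - \<omega>)) ^ k\<close>, which stays below
  \<open>exp (2 * \<bar>\<omega>\<bar> * T)\<close> because \<open>k \<le> N\<close> means
  \<open>k / m \<le> T\<close>.\<close>

lemma hille_yosida_euler_scheme:
  fixes DA :: "'e::complex_banach set"
  assumes closed: "closed_operator DA A" and HY: "hille_yosida DA A" and T: "0 < T"
  shows "\<exists>M N0 J. euler_scheme DA A T M N0 J"
proof -
  obtain \<omega> C :: real where C: "0 < C"
    and res: "\<And>\<mu>. \<omega> < \<mu> \<Longrightarrow> complex_of_real \<mu> \<in> resolvent_set DA A"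
    and bound: "\<And>\<mu> k. \<omega> < \<mu> \<Longrightarrow> 1 \<le> k \<Longrightarrow>
      onorm (\<lambda>x. (\<mu> - \<omega>) ^ k *\<^sub>R (resolvent DA A (complex_of_real \<mu>) ^^ k) x) \<le> C"
    using HY unfolding hille_yosida_def by blast
  have lin: "linear_operator DA A" using closed by (simp add: closed_operator_def)
  \<comment> \<open>From here on \<open>m \<ge> 2 * \<bar>\<omega>\<bar>\<close>, hence
    \<open>m - \<omega> \<ge> m / 2\<close>; the summand 1 makes \<open>N0\<close> positive.\<close>
  define N0 where "N0 = nat \<lceil>2 * \<bar>\<omega>\<bar> * T\<rceil> + 1"
  define R where "R = (\<lambda>N::nat. resolvent DA A (complex_of_real (N / T)))"
  define J where "J = (\<lambda>N x. (real N / T) *\<^sub>R R N x)"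
  have \<mu>: "0 < real N / T" "2 * \<bar>\<omega>\<bar> \<le> real N / T" "\<omega> < real N / T" if "N0 \<le> N" for N
  proof -
    have "2 * \<bar>\<omega>\<bar> * T \<le> real N0" unfolding N0_def using real_nat_ceiling_ge[of "2 * \<bar>\<omega>\<bar> * T"] by simp
    then have *: "2 * \<bar>\<omega>\<bar> * T \<le> real N" "0 < real N" using that by (auto simp: N0_def)
    then show "0 < real N / T" "2 * \<bar>\<omega>\<bar> \<le> real N / T" using T by (auto simp: field_simps)
    then show "\<omega> < real N / T" by linarith
  qed
  have R: "bounded_linear (R N)" "R N x \<in> DA" "A (R N x) = (real N / T) *\<^sub>R R N x - x"
    "x \<in> DA \<longrightarrow> R N ((real N / T) *\<^sub>R x - A x) = x" if N: "N0 \<le> N" for N x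
  proof -
    let ?f = "\<lambda>x. complex_of_real (N / T) *\<^sub>C x - A x"
    have bij: "bij_betw ?f DA UNIV" and bl: "bounded_linear (R N)"
      using res[OF \<mu>(3)[OF N]] unfolding resolvent_set_def R_def by auto
    show "bounded_linear (R N)" by (rule bl)
    have img: "x \<in> ?f ` DA" using bij by (simp add: bij_betw_def)
    show "R N x \<in> DA" unfolding R_def resolvent_def by (rule inv_into_into[OF img])
    have "?f (R N x) = x" unfolding R_def resolvent_def by (rule f_inv_into_f[OF img])
    then show "A (R N x) = (real N / T) *\<^sub>R R N x - x"
      unfolding scaleC_of_real by (simp add: algebra_simps)
    show "x \<in> DA \<longrightarrow> R N ((real N / T) *\<^sub>R x - A x) = x"
      using bij_betw_inv_into_left[OF bij, of x] unfolding R_def resolvent_def scaleC_of_real by blast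
  qed
  have Jpow: "(J N ^^ k) x = (real N / T) ^ k *\<^sub>R (R N ^^ k) x" if N: "N0 \<le> N" for N k x
    by (induction k) (simp_all add: J_def linear_scale[OF bounded_linear.linear[OF R(1)[OF N]]])
  have "euler_scheme DA A T (C * exp (2 * \<bar>\<omega>\<bar> * T)) N0 J"
  proof (rule euler_scheme.intro)
    fix N assume N: "N0 \<le> N"
    show "bounded_linear (J N)"
      unfolding J_def by (rule bounded_linear_compose[OF bounded_linear_scaleR_right R(1)[OF N]])
    fix x
    show "J N x \<in> DA" using R(2)[OF N] by (simp add: J_def linear_operatorD[OF lin])
    show "A (J N x) = (real N / T) *\<^sub>R (J N x - x)"
      using R(2,3)[OF N] by (simp add: J_def linear_operatorD[OF lin])
    show "J N (x - (T / real N) *\<^sub>R A x) = x" if x: "x \<in> DA"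
    proof -
      have "J N (x - (T / real N) *\<^sub>R A x) = R N ((real N / T) *\<^sub>R (x - (T / real N) *\<^sub>R A x))"
        by (simp add: J_def linear_scale[OF bounded_linear.linear[OF R(1)[OF N]]])
      also have "(real N / T) *\<^sub>R (x - (T / real N) *\<^sub>R A x) = (real N / T) *\<^sub>R x - A x"
        using T \<mu>(1)[OF N] by (cases "N = 0") (auto simp: scaleR_diff_right)
      finally show ?thesis using R(4)[OF N] x by simp
    qed
    fix k :: nat assume k: "1 \<le> k" "k \<le> N"
    define m where "m = real N / T"
    have m: "0 < m" "2 * \<bar>\<omega>\<bar> \<le> m" "\<omega> < m" using \<mu>[OF N] by (auto simp: m_def)
    have bl: "bounded_linear (\<lambda>x. (m - \<omega>) ^ k *\<^sub>R (R N ^^ k) x)"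
    proof -
      have "bounded_linear (R N ^^ k)"
        by (induction k) (auto intro: bounded_linear_compose[OF R(1)[OF N]] simp: id_def comp_def)
      then show ?thesis by (rule bounded_linear_compose[OF bounded_linear_scaleR_right])
    qed
    have "norm ((m - \<omega>) ^ k *\<^sub>R (R N ^^ k) x) \<le> C * norm x"
      using onorm[OF bl, of x] mult_right_mono[OF bound[OF m(3) k(1)], of "norm x"]
      unfolding R_def m_def by simp
    then have le: "(m - \<omega>) ^ k * norm ((R N ^^ k) x) \<le> C * norm x" using m by simp
    \<comment> \<open>Clearing denominators leaves
      \<open>\<omega> * m \<le> 2 * \<bar>\<omega>\<bar> * (m - \<omega>)\<close>. For nonnegative
      \<open>\<omega>\<close> this follows from \<open>2 * \<omega> \<le> m\<close>; for negative
      \<open>\<omega>\<close> the sides have opposite signs.\<close>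
    have "m / (m - \<omega>) \<le> 1 + 2 * \<bar>\<omega>\<bar> / m"
    proof -
      have "\<omega> * m \<le> 2 * \<bar>\<omega>\<bar> * (m - \<omega>)"
      proof (cases "0 \<le> \<omega>")
        case True
        then have "\<omega> * m \<le> \<omega> * (2 * (m - \<omega>))" using m by (intro mult_left_mono) auto
        then show ?thesis using True by (simp add: mult_ac)
      next
        case False
        then show ?thesis using m by (smt (verit) mult_nonneg_nonneg mult_nonpos_nonneg)
      qed
      then show ?thesis using m by (simp add: field_simps)
    qed
    also have "\<dots> \<le> exp (2 * \<bar>\<omega>\<bar> / m)" by (rule exp_ge_add_one_self)
    finally have "(m / (m - \<omega>)) ^ k \<le> exp (2 * \<bar>\<omega>\<bar> / m) ^ k"
      using m by (intro power_mono) auto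
    also have "\<dots> = exp (k * (2 * \<bar>\<omega>\<bar> / m))" by (rule exp_of_nat_mult[symmetric])
    also have "\<dots> \<le> exp (2 * \<bar>\<omega>\<bar> * T)"
    proof -
      have "k / m \<le> T" using k m T by (simp add: m_def field_simps)
      then have "2 * \<bar>\<omega>\<bar> * (k / m) \<le> 2 * \<bar>\<omega>\<bar> * T" by (intro mult_left_mono) auto
      then show ?thesis by (simp add: mult_ac)
    qed
    finally have pow: "(m / (m - \<omega>)) ^ k \<le> exp (2 * \<bar>\<omega>\<bar> * T)" .
    have "norm ((J N ^^ k) x) = m ^ k * norm ((R N ^^ k) x)"
      using Jpow[OF N] m by (simp add: m_def[symmetric])
    also have "\<dots> = (m / (m - \<omega>)) ^ k * ((m - \<omega>) ^ k * norm ((R N ^^ k) x))"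
      using m by (simp add: power_divide)
    also have "\<dots> \<le> exp (2 * \<bar>\<omega>\<bar> * T) * (C * norm x)"
      by (rule mult_mono[OF pow le]) (use m in auto)
    finally show "norm ((J N ^^ k) x) \<le> C * exp (2 * \<bar>\<omega>\<bar> * T) * norm x" by (simp add: mult_ac)
  qed (use T C closed in \<open>auto simp: N0_def\<close>)
  then show ?thesis by blast
qed

section \<open>The equation paired with functions of time\<close>

lemma integral_by_parts_primitive:
  fixes U :: "real \<Rightarrow> 'e::complex_banach" and \<psi> \<psi>' :: "real \<Rightarrow> complex"
  assumes T: "0 \<le> T" and U: "continuous_on {0..T} U"
    and \<psi>: "continuous_on {0..T} \<psi>" "\<psi> 0 = 0" "\<psi> T = 0"
    and d: "\<And>t. t \<in> {0<..<T} \<Longrightarrow> (\<psi> has_vector_derivative \<psi>' t) (at t)"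
  shows "((\<lambda>t. \<psi>' t *\<^sub>C integral {0..t} U) has_integral - integral {0..T} (\<lambda>t. \<psi> t *\<^sub>C U t)) {0..T}"
proof (rule integration_by_parts_interior[OF bounded_bilinear_scaleC T \<psi>(1)])
  show "continuous_on {0..T} (\<lambda>t. integral {0..t} U)"
    by (rule indefinite_integral_continuous_1[OF integrable_continuous_real[OF U]])
  show "((\<lambda>t. integral {0..t} U) has_vector_derivative U t) (at t)" if "t \<in> {0<..<T}" for t
  proof -
    have "((\<lambda>t. integral {0..t} U) has_vector_derivative U t) (at t within {0..T})"
      using that by (intro integral_has_vector_derivative U) auto
    then have "((\<lambda>t. integral {0..t} U) has_vector_derivative U t) (at t within {0<..<T})"
      by (rule has_vector_derivative_within_subset) auto
    then show ?thesis using that by (subst (asm) at_within_open) auto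
  qed
  have "(\<lambda>t. \<psi> t *\<^sub>C U t) integrable_on {0..T}"
    by (intro integrable_continuous_real scaleC.continuous_on \<psi> U)
  then show "((\<lambda>t. \<psi> t *\<^sub>C U t) has_integral \<psi> T *\<^sub>C integral {0..T} U - \<psi> 0 *\<^sub>C integral {0..0} U -
      - integral {0..T} (\<lambda>t. \<psi> t *\<^sub>C U t)) {0..T}"
    using \<psi>(2,3) by (simp add: has_integral_integral scaleC.zero_left)
qed (use d in auto)

context euler_scheme
begin

text \<open>\<open>bounded_linear\<close> is real linearity only. Complex homogeneity of the
  resolvent comes back from that of \<open>A\<close>, since \<open>J N\<close> inverts
  \<open>1 - (T / N) A\<close>.\<close>

lemma J_scaleC:
  assumes "N0 \<le> N"
  shows "J N (c *\<^sub>C x) = c *\<^sub>C J N x"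
proof -
  let ?y = "J N x"
  have y: "?y \<in> DA" by (rule J_DA[OF assms])
  have "0 < N" using assms N0_pos by simp
  then have "x = ?y - (T / N) *\<^sub>R A ?y" using A_J[OF assms] T_pos by simp
  then have "c *\<^sub>C x = c *\<^sub>C ?y - (T / N) *\<^sub>R A (c *\<^sub>C ?y)"
    by (metis scaleC.diff_right scaleC_scaleR_commute linear_operatorD(5)[OF linear_A y])
  then show ?thesis using J_inverse[OF assms linear_operatorD(4)[OF linear_A y]] by metis
qed

text \<open>The graph of the unbounded \<open>A\<close> becomes a fixed point equation for a bounded
  operator. Bounded operators commute with integrals, so no Riemann sums in \<open>DA\<close> have
  to be formed.\<close>

lemma A_graph_iff:
  assumes "N0 \<le> N"
  shows "x \<in> DA \<and> A x = y \<longleftrightarrow> x = J N (x - (T / N) *\<^sub>R y)"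
proof
  assume "x \<in> DA \<and> A x = y"
  then show "x = J N (x - (T / N) *\<^sub>R y)" using J_inverse[OF assms, of x] by auto
next
  assume *: "x = J N (x - (T / N) *\<^sub>R y)"
  have "0 < N" using assms N0_pos by simp
  then have "A x = y"
    using A_J[OF assms, of "x - (T / N) *\<^sub>R y"] T_pos unfolding *[symmetric] by simp
  moreover have "x \<in> DA" using J_DA[OF assms] * by metis
  ultimately show "x \<in> DA \<and> A x = y" by simp
qed

lemma A_integral:
  fixes a b :: real
  assumes v: "continuous_on {a..b} v" and w: "continuous_on {a..b} w" and \<psi>: "continuous_on {a..b} \<psi>"
    and vw: "\<And>t. t \<in> {a..b} \<Longrightarrow> v t \<in> DA \<and> A (v t) = w t"
  shows "integral {a..b} (\<lambda>t. \<psi> t *\<^sub>C v t) \<in> DA \<and>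
    A (integral {a..b} (\<lambda>t. \<psi> t *\<^sub>C v t)) = integral {a..b} (\<lambda>t. \<psi> t *\<^sub>C w t)"
proof -
  define \<delta> where "\<delta> = T / N0"
  have int: "(\<lambda>t. \<psi> t *\<^sub>C v t) integrable_on {a..b}" "(\<lambda>t. \<psi> t *\<^sub>C w t) integrable_on {a..b}"
    by (rule integrable_continuous_real[OF scaleC.continuous_on[OF \<psi> v]],
        rule integrable_continuous_real[OF scaleC.continuous_on[OF \<psi> w]])
  have int': "(\<lambda>t. \<psi> t *\<^sub>C v t - \<delta> *\<^sub>R \<psi> t *\<^sub>C w t) integrable_on {a..b}"
    by (intro integrable_diff integrable_cmul int)
  have "\<psi> t *\<^sub>C v t = J N0 (\<psi> t *\<^sub>C v t - \<delta> *\<^sub>R \<psi> t *\<^sub>C w t)" if "t \<in> {a..b}" for t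
  proof -
    have "v t = J N0 (v t - \<delta> *\<^sub>R w t)"
      using iffD1[OF A_graph_iff[OF order_refl] vw[OF that]] by (simp add: \<delta>_def)
    then have "\<psi> t *\<^sub>C v t = \<psi> t *\<^sub>C J N0 (v t - \<delta> *\<^sub>R w t)" by (rule arg_cong)
    also have "\<dots> = J N0 (\<psi> t *\<^sub>C (v t - \<delta> *\<^sub>R w t))" by (rule J_scaleC[OF order_refl, symmetric])
    finally show ?thesis by (simp add: scaleC.diff_right scaleC_scaleR_commute)
  qed
  then have "integral {a..b} (\<lambda>t. \<psi> t *\<^sub>C v t) =
    integral {a..b} (J N0 \<circ> (\<lambda>t. \<psi> t *\<^sub>C v t - \<delta> *\<^sub>R \<psi> t *\<^sub>C w t))"
    by (intro integral_cong) auto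
  also have "\<dots> = J N0 (integral {a..b} (\<lambda>t. \<psi> t *\<^sub>C v t - \<delta> *\<^sub>R \<psi> t *\<^sub>C w t))"
    by (rule integral_linear[OF int' J_linear[OF order_refl]])
  also have "integral {a..b} (\<lambda>t. \<psi> t *\<^sub>C v t - \<delta> *\<^sub>R \<psi> t *\<^sub>C w t) =
    integral {a..b} (\<lambda>t. \<psi> t *\<^sub>C v t) - \<delta> *\<^sub>R integral {a..b} (\<lambda>t. \<psi> t *\<^sub>C w t)"
    by (subst integral_diff) (auto intro!: int integrable_cmul)
  finally show ?thesis unfolding A_graph_iff[OF order_refl] \<delta>_def .
qed

text \<open>Integration by parts trades \<open>u\<close> for its primitive, to which
  \<open>A\<close> applies. The mild equation then evaluates \<open>A\<close>, and a second
  integration by parts, for the primitive of \<open>F\<close>, removes the remaining primitive. The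
  endpoint values of \<open>\<psi>\<close> must vanish for both.\<close>

lemma mild_pairing:
  assumes u: "continuous_on {0..T} u" and F: "continuous_on {0..T} F"
    and mild: "\<And>t. t \<in> {0..T} \<Longrightarrow>
      integral {0..t} u \<in> DA \<and> A (integral {0..t} u) = u t - integral {0..t} F"
    and \<psi>: "continuous_on {0..T} \<psi>" "\<psi> 0 = 0" "\<psi> T = 0" "continuous_on {0..T} \<psi>'"
    and d: "\<And>t. t \<in> {0<..<T} \<Longrightarrow> (\<psi> has_vector_derivative \<psi>' t) (at t)"
  shows "integral {0..T} (\<lambda>t. \<psi> t *\<^sub>C u t) \<in> DA \<and>
    A (integral {0..T} (\<lambda>t. \<psi> t *\<^sub>C u t)) =
      - integral {0..T} (\<lambda>t. \<psi>' t *\<^sub>C u t) - integral {0..T} (\<lambda>t. \<psi> t *\<^sub>C F t)"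
proof -
  have T: "0 \<le> T" using T_pos by simp
  have vc: "continuous_on {0..T} (\<lambda>t. integral {0..t} u)" and Gc: "continuous_on {0..T} (\<lambda>t. integral {0..t} F)"
    by (intro indefinite_integral_continuous_1 integrable_continuous_real u F)+
  have U: "((\<lambda>t. \<psi>' t *\<^sub>C integral {0..t} u) has_integral - integral {0..T} (\<lambda>t. \<psi> t *\<^sub>C u t)) {0..T}"
    by (rule integral_by_parts_primitive[OF T u \<psi>(1-3)]) (rule d)
  have G: "((\<lambda>t. \<psi>' t *\<^sub>C integral {0..t} F) has_integral - integral {0..T} (\<lambda>t. \<psi> t *\<^sub>C F t)) {0..T}"
    by (rule integral_by_parts_primitive[OF T F \<psi>(1-3)]) (rule d)
  have *: "integral {0..T} (\<lambda>t. \<psi>' t *\<^sub>C integral {0..t} u) \<in> DA \<and>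
    A (integral {0..T} (\<lambda>t. \<psi>' t *\<^sub>C integral {0..t} u)) =
      integral {0..T} (\<lambda>t. \<psi>' t *\<^sub>C (u t - integral {0..t} F))"
    by (rule A_integral[OF vc continuous_on_diff[OF u Gc] \<psi>(4) mild])
  have "(\<lambda>t. \<psi>' t *\<^sub>C u t) integrable_on {0..T}" "(\<lambda>t. \<psi>' t *\<^sub>C integral {0..t} F) integrable_on {0..T}"
    by (rule integrable_continuous_real[OF scaleC.continuous_on[OF \<psi>(4) u]],
        rule integrable_continuous_real[OF scaleC.continuous_on[OF \<psi>(4) Gc]])
  then have "integral {0..T} (\<lambda>t. \<psi>' t *\<^sub>C (u t - integral {0..t} F)) =
    integral {0..T} (\<lambda>t. \<psi>' t *\<^sub>C u t) + integral {0..T} (\<lambda>t. \<psi> t *\<^sub>C F t)"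
    using integral_unique[OF G] by (simp add: scaleC.diff_right integral_diff)
  then show ?thesis
    using * linear_operatorD(6,7)[OF linear_A, of "- integral {0..T} (\<lambda>t. \<psi> t *\<^sub>C u t)" "-1"]
    unfolding integral_unique[OF U] by simp
qed

end

section \<open>Gevrey test functions\<close>

lemma test_derivs_test_deriv: "test_derivs T \<alpha> (test_deriv T \<phi>) = test_derivs T (Suc \<alpha>) \<phi>"
  by (simp add: funpow_swap1)

lemma test_derivs_Suc_eq:
  assumes "t \<in> {0<..<T}" "(test_derivs T \<alpha> \<phi> has_vector_derivative D) (at t)"
  shows "test_derivs T (Suc \<alpha>) \<phi> t = D"
  using assms by (simp add: test_deriv_def[of T "test_derivs T \<alpha> \<phi>"] vector_derivative_at)

lemma test_derivs_Suc_outside: "t \<notin> {0<..<T} \<Longrightarrow> test_derivs T (Suc \<alpha>) \<phi> t = 0"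
  by (auto simp add: test_deriv_def[of T "test_derivs T \<alpha> \<phi>"])

lemma test_derivs_outside:
  assumes "\<phi> \<in> smooth_functions T" "t \<notin> {0<..<T}"
  shows "test_derivs T \<alpha> \<phi> t = 0"
  using assms by (cases \<alpha>) (auto simp: smooth_functions_def test_deriv_def)

lemma smooth_has_vector_derivative:
  assumes "\<phi> \<in> smooth_functions T" "t \<in> {0<..<T}"
  shows "(test_derivs T \<alpha> \<phi> has_vector_derivative test_derivs T (Suc \<alpha>) \<phi> t) (at t)"
proof -
  have "test_derivs T \<alpha> \<phi> differentiable (at t)" using assms by (auto simp: smooth_functions_def)
  then show ?thesis using assms(2) by (simp add: test_deriv_def vector_derivative_works)
qed

lemma test_derivs_linear:
  assumes "\<phi> \<in> smooth_functions T" "\<psi> \<in> smooth_functions T"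
  shows "test_derivs T \<alpha> (\<lambda>t. c * \<phi> t + \<psi> t) = (\<lambda>t. c * test_derivs T \<alpha> \<phi> t + test_derivs T \<alpha> \<psi> t)"
proof (induction \<alpha>)
  case (Suc \<alpha>)
  show ?case
  proof
    fix t
    show "test_derivs T (Suc \<alpha>) (\<lambda>t. c * \<phi> t + \<psi> t) t =
      c * test_derivs T (Suc \<alpha>) \<phi> t + test_derivs T (Suc \<alpha>) \<psi> t"
    proof (cases "t \<in> {0<..<T}")
      case True
      have "((\<lambda>t. c * test_derivs T \<alpha> \<phi> t + test_derivs T \<alpha> \<psi> t) has_vector_derivative
        (c * test_derivs T (Suc \<alpha>) \<phi> t + test_derivs T (Suc \<alpha>) \<psi> t)) (at t)"
        by (intro has_vector_derivative_add has_vector_derivative_mult_right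
            smooth_has_vector_derivative assms True)
      then show ?thesis using True by (intro test_derivs_Suc_eq) (simp_all add: Suc)
    next
      case False
      then show ?thesis by (simp add: test_derivs_Suc_outside del: funpow.simps)
    qed
  qed
qed simp

lemma smooth_linear:
  assumes "\<phi> \<in> smooth_functions T" "\<psi> \<in> smooth_functions T"
  shows "(\<lambda>t. c * \<phi> t + \<psi> t) \<in> smooth_functions T"
  unfolding smooth_functions_def mem_Collect_eq
proof (intro conjI allI ballI impI)
  show "c * \<phi> t + \<psi> t = 0" if "t \<notin> {0<..<T}" for t
    using assms that by (simp add: smooth_functions_def)
  fix \<alpha> t assume t: "t \<in> {0<..<T}"
  have "((\<lambda>t. c * test_derivs T \<alpha> \<phi> t + test_derivs T \<alpha> \<psi> t) has_vector_derivative
    (c * test_derivs T (Suc \<alpha>) \<phi> t + test_derivs T (Suc \<alpha>) \<psi> t)) (at t)"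
    by (intro has_vector_derivative_add has_vector_derivative_mult_right
        smooth_has_vector_derivative assms t)
  then show "test_derivs T \<alpha> (\<lambda>t. c * \<phi> t + \<psi> t) differentiable (at t)"
    unfolding test_derivs_linear[OF assms] by (rule differentiableI_vector)
qed

lemma test_derivs_zero [simp]: "test_derivs T \<alpha> (\<lambda>_. 0) = (\<lambda>_. 0)"
  by (induction \<alpha>) (auto simp: test_deriv_def)

lemma fun_subspace_smooth: "fun_subspace (smooth_functions T)"
  by (rule fun_subspaceI[OF _ smooth_linear]) (simp_all add: smooth_functions_def)

lemma test_derivs_diff:
  assumes "\<phi> \<in> smooth_functions T" "\<psi> \<in> smooth_functions T"
  shows "test_derivs T \<alpha> (\<lambda>t. \<phi> t - \<psi> t) = (\<lambda>t. test_derivs T \<alpha> \<phi> t - test_derivs T \<alpha> \<psi> t)"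
  using test_derivs_linear[OF assms(2,1), of \<alpha> "-1"] by simp

lemma test_derivs_add:
  assumes "\<phi> \<in> smooth_functions T" "\<psi> \<in> smooth_functions T"
  shows "test_derivs T \<alpha> (\<lambda>t. \<phi> t + \<psi> t) = (\<lambda>t. test_derivs T \<alpha> \<phi> t + test_derivs T \<alpha> \<psi> t)"
  using test_derivs_linear[OF assms, of \<alpha> 1] by simp

lemma test_derivs_cmult:
  assumes "\<phi> \<in> smooth_functions T"
  shows "test_derivs T \<alpha> (\<lambda>t. c * \<phi> t) = (\<lambda>t. c * test_derivs T \<alpha> \<phi> t)"
  using test_derivs_linear[OF assms fun_subspaceD(1)[OF fun_subspace_smooth], of \<alpha> c] by simp

lemma test_deriv_smooth:
  assumes "\<phi> \<in> smooth_functions T"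
  shows "test_deriv T \<phi> \<in> smooth_functions T"
proof -
  have "test_derivs T (Suc \<alpha>) \<phi> differentiable (at t)" if "t \<in> {0<..<T}" for \<alpha> t
    using assms that unfolding smooth_functions_def by blast
  then show ?thesis unfolding smooth_functions_def mem_Collect_eq test_derivs_test_deriv
    by (auto simp: test_deriv_def)
qed

text \<open>Derivatives are extended by zero, so continuity on the whole line says that every order
  tends to zero at both ends of the interval. This removes all boundary terms from integrations by
  parts.\<close>

definition flat_functions :: "real \<Rightarrow> (real \<Rightarrow> complex) set"
  where "flat_functions T = {\<phi> \<in> smooth_functions T. \<forall>\<alpha>. continuous_on UNIV (test_derivs T \<alpha> \<phi>)}"

lemma flat_functionsD:
  assumes "\<phi> \<in> flat_functions T"
  shows "\<phi> \<in> smooth_functions T" "continuous_on S (test_derivs T \<alpha> \<phi>)"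
    "test_derivs T \<alpha> \<phi> 0 = 0" "test_derivs T \<alpha> \<phi> T = 0"
  using assms by (auto simp: flat_functions_def test_derivs_outside intro: continuous_on_subset)

lemma flat_has_integral:
  assumes \<phi>: "\<phi> \<in> flat_functions T" and ab: "0 \<le> a" "a \<le> b" "b \<le> T"
  shows "(test_derivs T (Suc \<alpha>) \<phi> has_integral test_derivs T \<alpha> \<phi> b - test_derivs T \<alpha> \<phi> a) {a..b}"
  using ab
  by (intro fundamental_theorem_of_calculus_interior flat_functionsD(2)[OF \<phi>]
      smooth_has_vector_derivative flat_functionsD(1)[OF \<phi>]) auto

lemma test_derivs_support:
  assumes "closed K" "\<And>t. t \<notin> K \<Longrightarrow> \<phi> t = 0" "t \<notin> K"
  shows "test_derivs T \<alpha> \<phi> t = 0"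
  using assms(3)
proof (induction \<alpha> arbitrary: t)
  case (Suc \<alpha>)
  have "((\<lambda>_. 0) has_vector_derivative 0) (at t)" by simp
  then have "(test_derivs T \<alpha> \<phi> has_vector_derivative 0) (at t)"
    by (rule has_vector_derivative_transform_within_open[of _ _ _ "- K"])
      (use Suc assms(1) in \<open>auto simp: open_Compl\<close>)
  then show ?case by (metis test_derivs_Suc_eq test_derivs_Suc_outside)
qed (use assms in simp)

text \<open>Smoothness inside the interval is assumed and only continuity at the ends has to survive
  the limit, so each order can be treated by its own uniformly convergent sequence of
  approximants.\<close>

lemma flat_functions_limit:
  assumes \<phi>: "\<phi> \<in> smooth_functions T"
    and lim: "\<And>\<alpha> e. 0 < e \<Longrightarrow> \<exists>\<psi>\<in>flat_functions T. \<forall>t\<in>{0<..<T}. cmod (test_derivs T \<alpha> \<psi> t - test_derivs T \<alpha> \<phi> t) \<le> e"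
  shows "\<phi> \<in> flat_functions T"
proof -
  have "continuous_on UNIV (test_derivs T \<alpha> \<phi>)" for \<alpha>
  proof -
    have "\<forall>n. \<exists>\<psi>. \<psi> \<in> flat_functions T \<and>
      (\<forall>t\<in>{0<..<T}. cmod (test_derivs T \<alpha> \<psi> t - test_derivs T \<alpha> \<phi> t) \<le> inverse (real (Suc n)))"
      using lim[of "inverse (real (Suc _))" \<alpha>] by (simp add: Bex_def)
    then obtain \<psi> where \<psi>: "\<And>n. \<psi> n \<in> flat_functions T"
      "\<And>n t. t \<in> {0<..<T} \<Longrightarrow> cmod (test_derivs T \<alpha> (\<psi> n) t - test_derivs T \<alpha> \<phi> t) \<le> inverse (real (Suc n))"
      by metis
    have le: "cmod (test_derivs T \<alpha> (\<psi> n) t - test_derivs T \<alpha> \<phi> t) \<le> inverse (real (Suc n))" for n t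
      using \<psi>(2)[of t n] test_derivs_outside[OF \<phi>] test_derivs_outside[OF flat_functionsD(1)[OF \<psi>(1)]]
      by (cases "t \<in> {0<..<T}") auto
    have "uniform_limit UNIV (\<lambda>n. test_derivs T \<alpha> (\<psi> n)) (test_derivs T \<alpha> \<phi>) sequentially"
    proof (rule uniform_limitI)
      fix e :: real assume "0 < e"
      then obtain N where N: "inverse (real (Suc N)) < e" using reals_Archimedean by blast
      have "dist (test_derivs T \<alpha> (\<psi> n) t) (test_derivs T \<alpha> \<phi> t) < e" if "N \<le> n" for n t
      proof -
        have "inverse (real (Suc n)) \<le> inverse (real (Suc N))"
          using that by (intro le_imp_inverse_le) auto
        then show ?thesis using le[of n t] N unfolding dist_norm by linarith
      qed
      then show "\<forall>\<^sub>F n in sequentially. \<forall>x\<in>UNIV. dist (test_derivs T \<alpha> (\<psi> n) x) (test_derivs T \<alpha> \<phi> x) < e"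
        unfolding eventually_sequentially by blast
    qed
    then show ?thesis
      by (rule uniform_limit_theorem[rotated]) (simp_all add: flat_functionsD(2)[OF \<psi>(1)])
  qed
  then show ?thesis using \<phi> by (simp add: flat_functions_def)
qed

section \<open>Gevrey sup norms and the closure \<open>Bdot\<close>\<close>

lemma DLinf_enorm_le_iff:
  assumes "0 < h" "0 \<le> B"
  shows "DLinf_enorm s T h \<phi> \<le> ennreal B \<longleftrightarrow>
    (\<forall>\<alpha>. \<forall>t\<in>{0<..<T}. cmod (test_derivs T \<alpha> \<phi> t) \<le> B * (fact \<alpha> powr s / h ^ \<alpha>))"
proof -
  have "h ^ \<alpha> * c / fact \<alpha> powr s \<le> B \<longleftrightarrow> c \<le> B * (fact \<alpha> powr s / h ^ \<alpha>)" for \<alpha> c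
    using assms(1) by (simp add: field_simps)
  then show ?thesis by (simp add: DLinf_enorm_def SUP_le_iff ennreal_le_iff assms)
qed

lemma DLinf_spaceI:
  assumes "\<phi> \<in> smooth_functions T" "0 < h" "0 \<le> B"
    "\<And>\<alpha> t. t \<in> {0<..<T} \<Longrightarrow> cmod (test_derivs T \<alpha> \<phi> t) \<le> B * (fact \<alpha> powr s / h ^ \<alpha>)"
  shows "\<phi> \<in> DLinf_space s T h" "DLinf_norm s T h \<phi> \<le> B"
proof -
  have "DLinf_enorm s T h \<phi> \<le> ennreal B" using DLinf_enorm_le_iff[OF assms(2,3)] assms(4) by blast
  then show "\<phi> \<in> DLinf_space s T h" "DLinf_norm s T h \<phi> \<le> B"
    using assms(1,3) by (auto simp: DLinf_space_def DLinf_norm_def enn2real_leI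
        intro: le_less_trans[OF _ ennreal_less_top])
qed

lemma DLinf_norm_nonneg [simp]: "0 \<le> DLinf_norm s T h \<phi>"
  by (simp add: DLinf_norm_def)

lemma DLinf_norm_bound:
  assumes "\<phi> \<in> DLinf_space s T h" "0 < h"
  shows "cmod (test_derivs T \<alpha> \<phi> t) \<le> DLinf_norm s T h \<phi> * (fact \<alpha> powr s / h ^ \<alpha>)"
proof (cases "t \<in> {0<..<T}")
  case True
  have "DLinf_enorm s T h \<phi> \<le> ennreal (DLinf_norm s T h \<phi>)"
    using assms(1) by (simp add: DLinf_space_def DLinf_norm_def)
  then show ?thesis using True DLinf_enorm_le_iff[OF assms(2) DLinf_norm_nonneg] by blast
next
  case False
  then show ?thesis using assms by (auto simp: DLinf_space_def test_derivs_outside)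
qed

lemma DLinf_space_smooth: "\<phi> \<in> DLinf_space s T h \<Longrightarrow> \<phi> \<in> smooth_functions T"
  by (simp add: DLinf_space_def)

lemma DLinf_linear:
  assumes \<phi>: "\<phi> \<in> DLinf_space s T h" and \<psi>: "\<psi> \<in> DLinf_space s T h" and h: "0 < h"
  shows "(\<lambda>t. c * \<phi> t + \<psi> t) \<in> DLinf_space s T h"
    "DLinf_norm s T h (\<lambda>t. c * \<phi> t + \<psi> t) \<le> cmod c * DLinf_norm s T h \<phi> + DLinf_norm s T h \<psi>"
proof -
  have "cmod (test_derivs T \<alpha> (\<lambda>t. c * \<phi> t + \<psi> t) t) \<le>
    (cmod c * DLinf_norm s T h \<phi> + DLinf_norm s T h \<psi>) * (fact \<alpha> powr s / h ^ \<alpha>)" for \<alpha> t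
  proof -
    have "cmod (test_derivs T \<alpha> (\<lambda>t. c * \<phi> t + \<psi> t) t) \<le>
      cmod c * cmod (test_derivs T \<alpha> \<phi> t) + cmod (test_derivs T \<alpha> \<psi> t)"
      unfolding test_derivs_linear[OF assms(1,2)[THEN DLinf_space_smooth]]
      by (metis norm_mult norm_triangle_ineq)
    also have "\<dots> \<le> cmod c * (DLinf_norm s T h \<phi> * (fact \<alpha> powr s / h ^ \<alpha>)) +
      DLinf_norm s T h \<psi> * (fact \<alpha> powr s / h ^ \<alpha>)"
      by (intro add_mono mult_left_mono DLinf_norm_bound assms) auto
    finally show ?thesis by (simp add: algebra_simps)
  qed
  then have b: "\<And>\<alpha> t. t \<in> {0<..<T} \<Longrightarrow> cmod (test_derivs T \<alpha> (\<lambda>t. c * \<phi> t + \<psi> t) t) \<le>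
    (cmod c * DLinf_norm s T h \<phi> + DLinf_norm s T h \<psi>) * (fact \<alpha> powr s / h ^ \<alpha>)" .
  have nn: "0 \<le> cmod c * DLinf_norm s T h \<phi> + DLinf_norm s T h \<psi>" by simp
  have sm: "(\<lambda>t. c * \<phi> t + \<psi> t) \<in> smooth_functions T"
    by (rule smooth_linear[OF DLinf_space_smooth[OF \<phi>] DLinf_space_smooth[OF \<psi>]])
  show "(\<lambda>t. c * \<phi> t + \<psi> t) \<in> DLinf_space s T h"
    by (rule DLinf_spaceI(1)[OF sm h nn b])
  show "DLinf_norm s T h (\<lambda>t. c * \<phi> t + \<psi> t) \<le> cmod c * DLinf_norm s T h \<phi> + DLinf_norm s T h \<psi>"
    by (rule DLinf_spaceI(2)[OF sm h nn b])
qed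

lemma DLinf_zero:
  assumes "0 < h"
  shows "(\<lambda>_. 0) \<in> DLinf_space s T h" "DLinf_norm s T h (\<lambda>_. 0) = 0"
proof -
  have sm: "(\<lambda>_. 0) \<in> smooth_functions T" by (rule fun_subspaceD(1)[OF fun_subspace_smooth])
  show "(\<lambda>_. 0) \<in> DLinf_space s T h"
    by (rule DLinf_spaceI(1)[OF sm assms order_refl]) simp
  have "DLinf_norm s T h (\<lambda>_. 0) \<le> 0"
    by (rule DLinf_spaceI(2)[OF sm assms order_refl]) simp
  then show "DLinf_norm s T h (\<lambda>_. 0) = 0" using DLinf_norm_nonneg[of s T h "\<lambda>_. 0"] by linarith
qed

lemma fun_subspace_DLinf: "0 < h \<Longrightarrow> fun_subspace (DLinf_space s T h)"
  by (rule fun_subspaceI[OF DLinf_zero(1) DLinf_linear(1)])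

lemma fun_seminormI:
  assumes X: "fun_subspace X" and nonneg: "\<And>x. x \<in> X \<Longrightarrow> 0 \<le> \<rho> x"
    and lin: "\<And>x y c. x \<in> X \<Longrightarrow> y \<in> X \<Longrightarrow> \<rho> (\<lambda>a. c * x a + y a) \<le> cmod c * \<rho> x + \<rho> y"
    and zero: "\<rho> (\<lambda>_. 0) = 0"
  shows "fun_seminorm X \<rho>"
  unfolding fun_seminorm_def
proof (intro conjI ballI allI)
  fix x y assume "x \<in> X" "y \<in> X"
  then show "\<rho> (\<lambda>a. x a + y a) \<le> \<rho> x + \<rho> y" using lin[of x y 1] by simp
next
  fix c x assume x: "x \<in> X"
  have le: "\<rho> (\<lambda>a. c * x a) \<le> cmod c * \<rho> x" if "x \<in> X" for c x
    using lin[OF that fun_subspaceD(1)[OF X], of c] zero by simp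
  show "\<rho> (\<lambda>a. c * x a) = cmod c * \<rho> x"
  proof (cases "c = 0")
    case False
    have "\<rho> (\<lambda>a. inverse c * (c * x a)) \<le> cmod (inverse c) * \<rho> (\<lambda>a. c * x a)"
      by (rule le[OF fun_subspaceD(3)[OF X x]])
    then have "\<rho> x \<le> \<rho> (\<lambda>a. c * x a) / cmod c"
      using False by (simp add: norm_inverse divide_inverse mult.commute flip: mult.assoc)
    then show ?thesis using le[OF x, of c] False by (simp add: field_simps)
  qed (simp add: zero)
qed

lemma fun_seminorm_DLinf: "0 < h \<Longrightarrow> fun_seminorm (DLinf_space s T h) (DLinf_norm s T h)"
  by (rule fun_seminormI[OF fun_subspace_DLinf]) (auto intro: DLinf_linear simp: DLinf_zero)

definition DLinf_all :: "real \<Rightarrow> real \<Rightarrow> (real \<Rightarrow> complex) set"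
  where "DLinf_all s T = (\<Inter>h\<in>{0<..}. DLinf_space s T h)"

lemma DLinf_allD: "\<phi> \<in> DLinf_all s T \<Longrightarrow> 0 < h \<Longrightarrow> \<phi> \<in> DLinf_space s T h"
  by (simp add: DLinf_all_def)

lemma DLinf_all_smooth: "\<phi> \<in> DLinf_all s T \<Longrightarrow> \<phi> \<in> smooth_functions T"
  using DLinf_allD[of \<phi> s T 1] by (simp add: DLinf_space_def)

lemma fun_subspace_DLinf_all: "fun_subspace (DLinf_all s T)"
  by (rule fun_subspaceI) (auto simp: DLinf_all_def intro: DLinf_zero DLinf_linear)

lemma DLinf_norm_mono:
  assumes "0 < h" "h \<le> k" "\<phi> \<in> DLinf_space s T k"
  shows "DLinf_norm s T h \<phi> \<le> DLinf_norm s T k \<phi>"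
proof (rule DLinf_spaceI(2))
  fix \<alpha> t
  have "cmod (test_derivs T \<alpha> \<phi> t) \<le> DLinf_norm s T k \<phi> * (fact \<alpha> powr s / k ^ \<alpha>)"
    using assms by (intro DLinf_norm_bound) auto
  also have "\<dots> \<le> DLinf_norm s T k \<phi> * (fact \<alpha> powr s / h ^ \<alpha>)"
    using assms by (intro mult_left_mono divide_left_mono power_mono) auto
  finally show "cmod (test_derivs T \<alpha> \<phi> t) \<le> DLinf_norm s T k \<phi> * (fact \<alpha> powr s / h ^ \<alpha>)" .
qed (use assms in \<open>auto simp: DLinf_space_smooth\<close>)

lemma directed_DLinf: "directed_seminorms (DLinf_all s T) {DLinf_norm s T h | h. 0 < h}"
  unfolding directed_seminorms_def
proof (intro conjI ballI)
  show "{DLinf_norm s T h | h. 0 < h} \<noteq> {}" using zero_less_one by blast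
  show "fun_seminorm (DLinf_all s T) \<rho>" if "\<rho> \<in> {DLinf_norm s T h | h. 0 < h}" for \<rho>
    using that fun_seminorm_DLinf unfolding fun_seminorm_def by (auto simp: DLinf_all_def)
  fix \<rho> \<sigma> assume "\<rho> \<in> {DLinf_norm s T h | h. 0 < h}" "\<sigma> \<in> {DLinf_norm s T h | h. 0 < h}"
  then obtain h k where *: "\<rho> = DLinf_norm s T h" "0 < h" "\<sigma> = DLinf_norm s T k" "0 < k" by blast
  have "\<rho> x \<le> DLinf_norm s T (max h k) x \<and> \<sigma> x \<le> DLinf_norm s T (max h k) x" if "x \<in> DLinf_all s T" for x
    using * that by (auto intro!: DLinf_norm_mono simp: DLinf_all_def)
  then show "\<exists>\<tau>\<in>{DLinf_norm s T h | h. 0 < h}. \<forall>x\<in>DLinf_all s T. \<rho> x \<le> \<tau> x \<and> \<sigma> x \<le> \<tau> x"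
    using * by (intro bexI[of _ "DLinf_norm s T (max h k)"]) auto
qed

text \<open>The parameter \<open>k\<close> in the definition is the reciprocal of the radius
  \<open>h\<close> of the sup norms, so the growth condition is membership for every
  \<open>h\<close>. A compact support inside the open interval amounts to a support in some
  \<open>{a..b}\<close> with room on both sides.\<close>

lemma D_space_iff:
  assumes T: "0 < T"
  shows "\<phi> \<in> D_space s T \<longleftrightarrow> \<phi> \<in> DLinf_all s T \<and> (\<exists>a b. 0 < a \<and> b < T \<and> (\<forall>t. \<phi> t \<noteq> 0 \<longrightarrow> t \<in> {a..b}))"
proof -
  let ?K = "closure {t. \<phi> t \<noteq> 0}"
  have K: "compact ?K \<and> ?K \<subseteq> {0<..<T} \<longleftrightarrow> (\<exists>a b. 0 < a \<and> b < T \<and> (\<forall>t. \<phi> t \<noteq> 0 \<longrightarrow> t \<in> {a..b}))"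
  proof
    assume K: "compact ?K \<and> ?K \<subseteq> {0<..<T}"
    show "\<exists>a b. 0 < a \<and> b < T \<and> (\<forall>t. \<phi> t \<noteq> 0 \<longrightarrow> t \<in> {a..b})"
    proof (cases "?K = {}")
      case True
      then show ?thesis using T by (intro exI[of _ "T/2"]) auto
    next
      case False
      obtain a where a: "a \<in> ?K" "\<forall>t\<in>?K. a \<le> t" using compact_attains_inf[of ?K] K False by blast
      obtain b where b: "b \<in> ?K" "\<forall>t\<in>?K. t \<le> b" using compact_attains_sup[of ?K] K False by blast
      have "{t. \<phi> t \<noteq> 0} \<subseteq> ?K" by (rule closure_subset)
      then show ?thesis using a b K by (intro exI[of _ a] exI[of _ b]) auto
    qed
  next
    assume "\<exists>a b. 0 < a \<and> b < T \<and> (\<forall>t. \<phi> t \<noteq> 0 \<longrightarrow> t \<in> {a..b})"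
    then obtain a b where ab: "0 < a" "b < T" "{t. \<phi> t \<noteq> 0} \<subseteq> {a..b}" by blast
    then have "?K \<subseteq> {a..b}" by (intro closure_minimal) auto
    moreover have "compact ({a..b} \<inter> ?K)" by (intro compact_Int_closed) auto
    ultimately show "compact ?K \<and> ?K \<subseteq> {0<..<T}" using ab by (auto simp: Int_absorb1)
  qed
  have B: "(\<forall>k>0. bdd_above {cmod (test_derivs T \<alpha> \<phi> t) / (k ^ \<alpha> * fact \<alpha> powr s) | \<alpha> t. t \<in> {0<..<T}}) \<longleftrightarrow>
    \<phi> \<in> DLinf_all s T" if sm: "\<phi> \<in> smooth_functions T"
  proof
    assume *: "\<forall>k>0. bdd_above {cmod (test_derivs T \<alpha> \<phi> t) / (k ^ \<alpha> * fact \<alpha> powr s) | \<alpha> t. t \<in> {0<..<T}}"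
    show "\<phi> \<in> DLinf_all s T"
      unfolding DLinf_all_def
    proof
      fix h :: real assume "h \<in> {0<..}"
      then have h: "0 < h" by simp
      obtain B where B: "\<And>\<alpha> t. t \<in> {0<..<T} \<Longrightarrow>
          cmod (test_derivs T \<alpha> \<phi> t) / (inverse h ^ \<alpha> * fact \<alpha> powr s) \<le> B"
        using *[rule_format, of "inverse h"] h unfolding bdd_above_def by auto
      have "cmod (test_derivs T \<alpha> \<phi> t) \<le> max B 0 * (fact \<alpha> powr s / h ^ \<alpha>)" if "t \<in> {0<..<T}" for \<alpha> t
      proof -
        have "cmod (test_derivs T \<alpha> \<phi> t) / (inverse h ^ \<alpha> * fact \<alpha> powr s) \<le> max B 0"
          using B[OF that, of \<alpha>] by simp
        then show ?thesis using h by (simp add: field_simps)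
      qed
      then show "\<phi> \<in> DLinf_space s T h" by (intro DLinf_spaceI(1)[OF sm h, of "max B 0"]) auto
    qed
  next
    assume *: "\<phi> \<in> DLinf_all s T"
    show "\<forall>k>0. bdd_above {cmod (test_derivs T \<alpha> \<phi> t) / (k ^ \<alpha> * fact \<alpha> powr s) | \<alpha> t. t \<in> {0<..<T}}"
    proof (intro allI impI)
      fix k :: real assume k: "0 < k"
      have "cmod (test_derivs T \<alpha> \<phi> t) / (k ^ \<alpha> * fact \<alpha> powr s) \<le> DLinf_norm s T (inverse k) \<phi>" for \<alpha> t
        using DLinf_norm_bound[OF DLinf_allD[OF *], of "inverse k" \<alpha> t] k by (simp add: field_simps)
      then show "bdd_above {cmod (test_derivs T \<alpha> \<phi> t) / (k ^ \<alpha> * fact \<alpha> powr s) | \<alpha> t. t \<in> {0<..<T}}"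
        unfolding bdd_above_def by blast
    qed
  qed
  have "\<phi> \<in> D_space s T \<longleftrightarrow> \<phi> \<in> smooth_functions T \<and> (compact ?K \<and> ?K \<subseteq> {0<..<T}) \<and>
    (\<forall>k>0. bdd_above {cmod (test_derivs T \<alpha> \<phi> t) / (k ^ \<alpha> * fact \<alpha> powr s) | \<alpha> t. t \<in> {0<..<T}})"
    unfolding D_space_def by simp
  then show ?thesis unfolding K using B DLinf_all_smooth[of \<phi> s T] by argo
qed

lemma fun_subspace_D_space:
  assumes T: "0 < T"
  shows "fun_subspace (D_space s T)"
proof (rule fun_subspaceI)
  show "(\<lambda>_. 0) \<in> D_space s T"
    using T unfolding D_space_iff[OF T] by (auto simp: fun_subspaceD[OF fun_subspace_DLinf_all] intro!: exI[of _ "T/2"])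
  fix \<phi> \<psi> c assume *: "\<phi> \<in> D_space s T" "\<psi> \<in> D_space s T"
  from *(1) obtain a b where 1: "0 < a" "b < T" "\<And>t. \<phi> t \<noteq> 0 \<Longrightarrow> t \<in> {a..b}"
    unfolding D_space_iff[OF T] by blast
  from *(2) obtain a' b' where 2: "0 < a'" "b' < T" "\<And>t. \<psi> t \<noteq> 0 \<Longrightarrow> t \<in> {a'..b'}"
    unfolding D_space_iff[OF T] by blast
  have "(\<lambda>t. c * \<phi> t + \<psi> t) \<in> DLinf_all s T"
    using * unfolding D_space_iff[OF T] by (intro fun_subspaceD[OF fun_subspace_DLinf_all]) auto
  moreover have "t \<in> {min a a'..max b b'}" if "c * \<phi> t + \<psi> t \<noteq> 0" for t
    using that 1(3)[of t] 2(3)[of t] by (cases "\<phi> t = 0"; cases "\<psi> t = 0") auto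
  ultimately show "(\<lambda>t. c * \<phi> t + \<psi> t) \<in> D_space s T"
    unfolding D_space_iff[OF T] using 1(1,2) 2(1,2)
    by (intro conjI exI[of _ "min a a'"] exI[of _ "max b b'"]) auto
qed

lemma D_space_flat:
  assumes "0 < T" "\<phi> \<in> D_space s T"
  shows "\<phi> \<in> flat_functions T"
proof -
  from assms obtain a b where ab: "0 < a" "b < T" "\<And>t. \<phi> t \<noteq> 0 \<Longrightarrow> t \<in> {a..b}" and
    sm: "\<phi> \<in> smooth_functions T" unfolding D_space_iff[OF assms(1)] by (blast dest: DLinf_all_smooth)
  have "continuous (at t) (test_derivs T \<alpha> \<phi>)" for \<alpha> t
  proof (cases "t \<in> {0<..<T}")
    case True
    then show ?thesis using has_vector_derivative_continuous smooth_has_vector_derivative[OF sm] by blast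
  next
    case False
    have z: "test_derivs T \<alpha> \<phi> x = 0" if "x \<notin> {a..b}" for x
      by (rule test_derivs_support[of "{a..b}"]) (use that ab(3) in auto)
    have "((\<lambda>_. 0) has_vector_derivative 0) (at t)" by simp
    then have "(test_derivs T \<alpha> \<phi> has_vector_derivative 0) (at t)"
      by (rule has_vector_derivative_transform_within_open[of _ _ _ "- {a..b}"])
        (use False z ab in \<open>auto simp: open_Compl\<close>)
    then show ?thesis by (rule has_vector_derivative_continuous)
  qed
  then show ?thesis using sm by (simp add: flat_functions_def continuous_at_imp_continuous_on)
qed

lemma Bdot_iff:
  assumes T: "0 < T"
  shows "\<phi> \<in> Bdot s T \<longleftrightarrow> \<phi> \<in> DLinf_all s T \<and>
    (\<forall>h>0. \<forall>e>0. \<exists>\<psi>\<in>D_space s T. DLinf_norm s T h (\<lambda>t. \<psi> t - \<phi> t) < e)"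
proof -
  have "D_space s T \<subseteq> DLinf_all s T" using D_space_iff[OF T] by blast
  from closure_of_seminorm_topology[OF directed_DLinf fun_subspace_DLinf_all this]
  show ?thesis unfolding Bdot_def DLinf_projlim_def DLinf_all_def[symmetric] by auto
qed

lemma Bdot_DLinf: "0 < T \<Longrightarrow> \<phi> \<in> Bdot s T \<Longrightarrow> 0 < h \<Longrightarrow> \<phi> \<in> DLinf_space s T h"
  by (simp add: Bdot_iff DLinf_allD)

lemma D_space_Bdot:
  assumes T: "0 < T" and \<phi>: "\<phi> \<in> D_space s T"
  shows "\<phi> \<in> Bdot s T"
  unfolding Bdot_iff[OF T]
proof (intro conjI allI impI bexI[OF _ \<phi>])
  show "\<phi> \<in> DLinf_all s T" using \<phi> D_space_iff[OF T] by blast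
  show "DLinf_norm s T h (\<lambda>t. \<phi> t - \<phi> t) < e" if "0 < h" "0 < e" for h e
    using that by (simp add: DLinf_zero(2))
qed

lemma fun_subspace_Bdot:
  assumes T: "0 < T"
  shows "fun_subspace (Bdot s T)"
proof (rule fun_subspaceI)
  show "(\<lambda>_. 0) \<in> Bdot s T"
    unfolding Bdot_iff[OF T] using fun_subspaceD(1)[OF fun_subspace_D_space[OF T]] DLinf_zero(2)
    by (auto simp: fun_subspaceD[OF fun_subspace_DLinf_all] intro!: bexI[of _ "\<lambda>_. 0"])
  fix \<phi> \<psi> c assume *: "\<phi> \<in> Bdot s T" "\<psi> \<in> Bdot s T"
  have "\<exists>\<eta>\<in>D_space s T. DLinf_norm s T h (\<lambda>t. \<eta> t - (c * \<phi> t + \<psi> t)) < e" if he: "0 < h" "0 < e" for h e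
  proof -
    have "0 < cmod c + 1" by (simp add: add_nonneg_pos)
    then have e': "0 < e / (2 * (cmod c + 1))" using he by simp
    obtain \<phi>' where \<phi>': "\<phi>' \<in> D_space s T" "DLinf_norm s T h (\<lambda>t. \<phi>' t - \<phi> t) < e / (2 * (cmod c + 1))"
      using *(1) e' he(1) unfolding Bdot_iff[OF T] by blast
    obtain \<psi>' where \<psi>': "\<psi>' \<in> D_space s T" "DLinf_norm s T h (\<lambda>t. \<psi>' t - \<psi> t) < e / 2"
      using *(2) he unfolding Bdot_iff[OF T] by (metis half_gt_zero)
    have mem: "\<phi> \<in> DLinf_space s T h" "\<psi> \<in> DLinf_space s T h" "\<phi>' \<in> DLinf_space s T h" "\<psi>' \<in> DLinf_space s T h"
      by (intro Bdot_DLinf[OF T _ he(1)] * D_space_Bdot[OF T] \<phi>' \<psi>')+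
    note sub = fun_subspace_diff[OF fun_subspace_DLinf[OF he(1)]]
    have "DLinf_norm s T h (\<lambda>t. c * (\<phi>' t - \<phi> t) + (\<psi>' t - \<psi> t)) \<le>
      cmod c * DLinf_norm s T h (\<lambda>t. \<phi>' t - \<phi> t) + DLinf_norm s T h (\<lambda>t. \<psi>' t - \<psi> t)"
      by (intro DLinf_linear(2) sub mem he)
    also have "\<dots> < cmod c * (e / (2 * (cmod c + 1))) + e / 2"
      using \<phi>'(2) \<psi>'(2) by (intro add_le_less_mono mult_left_mono) auto
    also have "cmod c * (e / (2 * (cmod c + 1))) \<le> e / 2"
      using \<open>0 < cmod c + 1\<close> he(2) by (simp add: field_simps)
    finally have "DLinf_norm s T h (\<lambda>t. c * (\<phi>' t - \<phi> t) + (\<psi>' t - \<psi> t)) < e" by simp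
    moreover have "(\<lambda>t. c * (\<phi>' t - \<phi> t) + (\<psi>' t - \<psi> t)) = (\<lambda>t. (c * \<phi>' t + \<psi>' t) - (c * \<phi> t + \<psi> t))"
      by (simp add: algebra_simps)
    moreover have "(\<lambda>t. c * \<phi>' t + \<psi>' t) \<in> D_space s T"
      by (intro fun_subspaceD[OF fun_subspace_D_space[OF T]] \<phi>'(1) \<psi>'(1))
    ultimately show ?thesis by (intro bexI[of _ "\<lambda>t. c * \<phi>' t + \<psi>' t"]) simp_all
  qed
  moreover have "(\<lambda>t. c * \<phi> t + \<psi> t) \<in> DLinf_all s T"
    using * unfolding Bdot_iff[OF T] by (intro fun_subspaceD[OF fun_subspace_DLinf_all]) auto
  ultimately show "(\<lambda>t. c * \<phi> t + \<psi> t) \<in> Bdot s T" unfolding Bdot_iff[OF T] by blast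
qed

lemma Bdot_flat:
  assumes T: "0 < T" and \<phi>: "\<phi> \<in> Bdot s T"
  shows "\<phi> \<in> flat_functions T"
proof (rule flat_functions_limit)
  show sm: "\<phi> \<in> smooth_functions T" using \<phi> unfolding Bdot_iff[OF T] by (blast dest: DLinf_all_smooth)
  fix \<alpha> and e :: real assume e: "0 < e"
  then have "0 < e / fact \<alpha> powr s" by simp
  then obtain \<psi> where \<psi>: "\<psi> \<in> D_space s T" "DLinf_norm s T 1 (\<lambda>t. \<psi> t - \<phi> t) < e / fact \<alpha> powr s"
    using \<phi> zero_less_one unfolding Bdot_iff[OF T] by blast
  have mem: "\<psi> \<in> DLinf_space s T 1" "\<phi> \<in> DLinf_space s T 1"
    using Bdot_DLinf[OF T \<phi>] Bdot_DLinf[OF T D_space_Bdot[OF T \<psi>(1)]] by auto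
  have "cmod (test_derivs T \<alpha> \<psi> t - test_derivs T \<alpha> \<phi> t) \<le> e" for t
  proof -
    have "cmod (test_derivs T \<alpha> (\<lambda>t. \<psi> t - \<phi> t) t) \<le> DLinf_norm s T 1 (\<lambda>t. \<psi> t - \<phi> t) * (fact \<alpha> powr s / 1 ^ \<alpha>)"
      by (intro DLinf_norm_bound fun_subspace_diff[OF fun_subspace_DLinf] mem) auto
    also have "\<dots> \<le> e / fact \<alpha> powr s * (fact \<alpha> powr s / 1 ^ \<alpha>)"
      using \<psi>(2) by (intro mult_right_mono) auto
    finally show ?thesis by (simp add: test_derivs_diff[OF mem[THEN DLinf_space_smooth]])
  qed
  then show "\<exists>\<psi>\<in>flat_functions T. \<forall>t\<in>{0<..<T}. cmod (test_derivs T \<alpha> \<psi> t - test_derivs T \<alpha> \<phi> t) \<le> e"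
    using D_space_flat[OF T \<psi>(1)] by blast
qed

text \<open>A polynomial factor is absorbed by a geometric one. It pays for the factor
  \<open>(\<alpha> + 1) powr s\<close> that one more derivative costs in Gevrey norms.\<close>

lemma powr_le_geometric:
  fixes s c :: real
  assumes "0 < s" "1 < c"
  obtains K where "0 < K" "\<And>n::nat. real (Suc n) powr s \<le> K * c ^ n"
proof -
  \<comment> \<open>Chosen so that \<open>s * e = ln c\<close>; the inequality
    \<open>ln x \<le> x - 1\<close> is then used at \<open>x = e * (n + 1)\<close>.\<close>
  define e where "e = ln c / s"
  have e: "0 < e" using assms by (simp add: e_def)
  have "real (Suc n) powr s \<le> exp (- s * (1 + ln e)) * c * c ^ n" for n
  proof -
    have "ln (e * real (Suc n)) \<le> e * real (Suc n) - 1" using e by (intro ln_le_minus_one) auto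
    then have "ln (real (Suc n)) \<le> e * real (Suc n) - 1 - ln e" using e by (simp add: ln_mult)
    then have "s * ln (real (Suc n)) \<le> s * (e * real (Suc n) - 1 - ln e)"
      using assms by (intro mult_left_mono) auto
    also have "\<dots> = - s * (1 + ln e) + real (Suc n) * ln c"
      using assms by (simp add: e_def field_simps)
    finally have "exp (s * ln (real (Suc n))) \<le> exp (- s * (1 + ln e)) * exp (real (Suc n) * ln c)"
      by (simp flip: exp_add)
    also have "exp (real (Suc n) * ln c) = c ^ Suc n"
      using assms by (simp only: exp_of_nat_mult exp_ln)
    finally show ?thesis by (simp add: powr_def mult_ac)
  qed
  then show thesis using assms by (intro that[of "exp (- s * (1 + ln e)) * c"]) auto
qed

text \<open>Passing from order \<open>\<alpha>\<close> to \<open>\<alpha> + 1\<close> multiplies the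
  factorial weight by \<open>(\<alpha> + 1) powr s\<close>, and doubling the radius absorbs it.
  Differentiation thus halves the radius, which is harmless when all radii are available.\<close>

lemma DLinf_test_deriv:
  assumes s: "0 < s" and h: "0 < h"
  obtains K where "0 < K" "\<And>\<phi>. \<phi> \<in> DLinf_space s T (2 * h) \<Longrightarrow> test_deriv T \<phi> \<in> DLinf_space s T h \<and>
    DLinf_norm s T h (test_deriv T \<phi>) \<le> K * DLinf_norm s T (2 * h) \<phi>"
proof -
  obtain K where K: "0 < K" "\<And>n::nat. real (Suc n) powr s \<le> K * 2 ^ n"
    using powr_le_geometric[OF s, of 2] by auto
  have main: "test_deriv T \<phi> \<in> DLinf_space s T h \<and>
    DLinf_norm s T h (test_deriv T \<phi>) \<le> (K / (2 * h)) * DLinf_norm s T (2 * h) \<phi>"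
    if \<phi>: "\<phi> \<in> DLinf_space s T (2 * h)" for \<phi>
  proof -
    let ?N = "DLinf_norm s T (2 * h) \<phi>"
    have b: "cmod (test_derivs T \<alpha> (test_deriv T \<phi>) t) \<le> (K / (2 * h)) * ?N * (fact \<alpha> powr s / h ^ \<alpha>)" for \<alpha> t
    proof -
      have "cmod (test_derivs T (Suc \<alpha>) \<phi> t) \<le> ?N * (fact (Suc \<alpha>) powr s / (2 * h) ^ Suc \<alpha>)"
        using h by (intro DLinf_norm_bound \<phi>) auto
      also have "fact (Suc \<alpha>) powr s = real (Suc \<alpha>) powr s * fact \<alpha> powr s"
        unfolding fact_Suc of_nat_mult by (simp add: powr_mult)
      also have "?N * (real (Suc \<alpha>) powr s * fact \<alpha> powr s / (2 * h) ^ Suc \<alpha>) \<le>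
        ?N * (K * 2 ^ \<alpha> * fact \<alpha> powr s / (2 * h) ^ Suc \<alpha>)"
        using h by (intro mult_left_mono divide_right_mono mult_right_mono K) auto
      also have "\<dots> = (K / (2 * h)) * ?N * (fact \<alpha> powr s / h ^ \<alpha>)"
        using h by (simp add: power_mult_distrib field_simps)
      finally show ?thesis by (simp add: test_derivs_test_deriv del: funpow.simps)
    qed
    have "0 \<le> (K / (2 * h)) * ?N" using K(1) h by simp
    then show ?thesis
      using DLinf_spaceI[OF test_deriv_smooth[OF DLinf_space_smooth[OF \<phi>]] h _ b] by blast
  qed
  show thesis by (rule that[of "K / (2 * h)"]) (use K(1) h main in auto)
qed

lemma test_deriv_diff:
  assumes "\<phi> \<in> smooth_functions T" "\<psi> \<in> smooth_functions T"
  shows "test_deriv T (\<lambda>t. \<phi> t - \<psi> t) = (\<lambda>t. test_deriv T \<phi> t - test_deriv T \<psi> t)"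
  using test_derivs_diff[OF assms, of 1] by simp

lemma test_deriv_Bdot:
  assumes T: "0 < T" and s: "0 < s" and \<phi>: "\<phi> \<in> Bdot s T"
  shows "test_deriv T \<phi> \<in> Bdot s T"
proof -
  have all: "test_deriv T \<phi> \<in> DLinf_all s T" if "\<phi> \<in> DLinf_all s T" for \<phi>
    unfolding DLinf_all_def
  proof
    fix h :: real assume "h \<in> {0<..}"
    then have h: "0 < h" by simp
    then have "\<phi> \<in> DLinf_space s T (2 * h)" using that by (simp add: DLinf_allD)
    then show "test_deriv T \<phi> \<in> DLinf_space s T h" using DLinf_test_deriv[OF s h] by metis
  qed
  have D: "test_deriv T \<psi> \<in> D_space s T" if \<psi>: "\<psi> \<in> D_space s T" for \<psi>
  proof -
    from \<psi> obtain a b where ab: "0 < a" "b < T" "\<And>t. \<psi> t \<noteq> 0 \<Longrightarrow> t \<in> {a..b}"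
      unfolding D_space_iff[OF T] by blast
    have "test_deriv T \<psi> t = 0" if "t \<notin> {a..b}" for t
      using test_derivs_support[of "{a..b}" \<psi> t 1 T] that ab(3) by auto
    then show ?thesis using \<psi> all ab(1,2) unfolding D_space_iff[OF T] by blast
  qed
  have \<phi>all: "\<phi> \<in> DLinf_all s T" using \<phi> unfolding Bdot_iff[OF T] by blast
  have "\<exists>\<psi>\<in>D_space s T. DLinf_norm s T h (\<lambda>t. \<psi> t - test_deriv T \<phi> t) < e" if he: "0 < h" "0 < e" for h e
  proof -
    obtain K where K: "0 < K" "\<And>\<phi>. \<phi> \<in> DLinf_space s T (2 * h) \<Longrightarrow> test_deriv T \<phi> \<in> DLinf_space s T h \<and>
      DLinf_norm s T h (test_deriv T \<phi>) \<le> K * DLinf_norm s T (2 * h) \<phi>"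
      using DLinf_test_deriv[OF s he(1), of T] by metis
    have "0 < 2 * h" "0 < e / K" using he K(1) by auto
    then obtain \<psi> where \<psi>: "\<psi> \<in> D_space s T" "DLinf_norm s T (2 * h) (\<lambda>t. \<psi> t - \<phi> t) < e / K"
      using \<phi> unfolding Bdot_iff[OF T] by blast
    have \<psi>all: "\<psi> \<in> DLinf_all s T" using \<psi>(1) unfolding D_space_iff[OF T] by blast
    have "(\<lambda>t. \<psi> t - \<phi> t) \<in> DLinf_space s T (2 * h)"
      using \<phi>all \<psi>all he by (intro fun_subspace_diff[OF fun_subspace_DLinf] DLinf_allD) auto
    then have "DLinf_norm s T h (test_deriv T (\<lambda>t. \<psi> t - \<phi> t)) \<le> K * DLinf_norm s T (2 * h) (\<lambda>t. \<psi> t - \<phi> t)"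
      using K(2) by blast
    also have "\<dots> < e" using \<psi>(2) K(1) by (simp add: field_simps)
    finally have "DLinf_norm s T h (\<lambda>t. test_deriv T \<psi> t - test_deriv T \<phi> t) < e"
      by (simp add: test_deriv_diff[OF \<psi>all[THEN DLinf_all_smooth] \<phi>all[THEN DLinf_all_smooth]])
    then show ?thesis using D[OF \<psi>(1)] by blast
  qed
  then show ?thesis unfolding Bdot_iff[OF T] using all[OF \<phi>all] by blast
qed

section \<open>Summing the mild solutions\<close>

definition pairing :: "real \<Rightarrow> (nat \<Rightarrow> real \<Rightarrow> 'e::complex_banach) \<Rightarrow> (real \<Rightarrow> complex) \<Rightarrow> nat \<Rightarrow> 'e"
  where "pairing T F \<phi> \<alpha> = (-1) ^ \<alpha> *\<^sub>R integral {0..T} (\<lambda>t. test_derivs T \<alpha> \<phi> t *\<^sub>C F \<alpha> t)"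

lemma pairing_integrable:
  assumes "continuous_on {0..T} (F \<alpha>)" "\<phi> \<in> flat_functions T"
  shows "(\<lambda>t. test_derivs T \<alpha> \<phi> t *\<^sub>C F \<alpha> t) integrable_on {0..T}"
  by (rule integrable_continuous_real[OF scaleC.continuous_on[OF flat_functionsD(2)[OF assms(2)] assms(1)]])

lemma pairing_linear:
  assumes F: "continuous_on {0..T} (F \<alpha>)" and \<phi>: "\<phi> \<in> flat_functions T" and \<psi>: "\<psi> \<in> flat_functions T"
  shows "pairing T F (\<lambda>t. c * \<phi> t + \<psi> t) \<alpha> = c *\<^sub>C pairing T F \<phi> \<alpha> + pairing T F \<psi> \<alpha>"
proof -
  note int = pairing_integrable[where F = F, OF F]
  have "integral {0..T} (\<lambda>t. test_derivs T \<alpha> (\<lambda>t. c * \<phi> t + \<psi> t) t *\<^sub>C F \<alpha> t) =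
    integral {0..T} (\<lambda>t. c *\<^sub>C test_derivs T \<alpha> \<phi> t *\<^sub>C F \<alpha> t + test_derivs T \<alpha> \<psi> t *\<^sub>C F \<alpha> t)"
    by (simp add: test_derivs_linear[OF flat_functionsD(1)[OF \<phi>] flat_functionsD(1)[OF \<psi>]]
        scaleC.add_left scaleC_scaleC)
  also have "\<dots> = integral {0..T} (\<lambda>t. c *\<^sub>C test_derivs T \<alpha> \<phi> t *\<^sub>C F \<alpha> t) +
    integral {0..T} (\<lambda>t. test_derivs T \<alpha> \<psi> t *\<^sub>C F \<alpha> t)"
    by (intro integral_add int \<psi> integrable_linear[OF int[OF \<phi>] scaleC.bounded_linear_right, unfolded comp_def])
  also have "integral {0..T} (\<lambda>t. c *\<^sub>C test_derivs T \<alpha> \<phi> t *\<^sub>C F \<alpha> t) =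
    c *\<^sub>C integral {0..T} (\<lambda>t. test_derivs T \<alpha> \<phi> t *\<^sub>C F \<alpha> t)"
    using integral_linear[OF int[OF \<phi>] scaleC.bounded_linear_right[of c]] by (simp add: comp_def)
  finally show ?thesis by (simp add: pairing_def scaleR_add_right scaleC_scaleR_commute)
qed

text \<open>Coefficients of radius \<open>h\<close> are measured against \<open>\<phi>\<close> at
  radius \<open>2 * h\<close>; the ratio leaves the factor \<open>(1 / 2) ^ \<alpha>\<close> that
  makes the series converge.\<close>

lemma pairing_bound:
  fixes F :: "nat \<Rightarrow> real \<Rightarrow> 'e::complex_banach"
  assumes T: "0 < T" and h: "0 < h" and F: "continuous_on {0..T} (F \<alpha>)"
    and C: "\<And>t. t \<in> {0..T} \<Longrightarrow> norm (F \<alpha> t) \<le> C * h ^ \<alpha> / fact \<alpha> powr s"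
    and \<phi>: "\<phi> \<in> Bdot s T"
  shows "norm (pairing T F \<phi> \<alpha>) \<le> T * C * DLinf_norm s T (2 * h) \<phi> * (1 / 2) ^ \<alpha>"
proof -
  let ?N = "DLinf_norm s T (2 * h) \<phi>"
  have "norm (integral {0..T} (\<lambda>t. test_derivs T \<alpha> \<phi> t *\<^sub>C F \<alpha> t)) \<le> (C * ?N * (1 / 2) ^ \<alpha>) * (T - 0)"
  proof (rule integral_bound)
    show "continuous_on {0..T} (\<lambda>t. test_derivs T \<alpha> \<phi> t *\<^sub>C F \<alpha> t)"
      by (rule scaleC.continuous_on[OF flat_functionsD(2)[OF Bdot_flat[OF T \<phi>]] F])
    fix t assume t: "t \<in> {0..T}"
    have "norm (test_derivs T \<alpha> \<phi> t *\<^sub>C F \<alpha> t) \<le>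
      (?N * (fact \<alpha> powr s / (2 * h) ^ \<alpha>)) * (C * h ^ \<alpha> / fact \<alpha> powr s)"
      unfolding norm_scaleC using h
      by (intro mult_mono C t DLinf_norm_bound Bdot_DLinf[OF T \<phi>]) auto
    also have "\<dots> = C * ?N * (1 / 2) ^ \<alpha>" using h by (simp add: power_mult_distrib power_divide)
    finally show "norm (test_derivs T \<alpha> \<phi> t *\<^sub>C F \<alpha> t) \<le> C * ?N * (1 / 2) ^ \<alpha>" .
  qed (use T in auto)
  then show ?thesis by (simp add: pairing_def mult_ac)
qed

lemma Bdot_topology_space:
  assumes T: "0 < T"
  shows "topspace (Bdot_topology s T) = Bdot s T"
proof -
  have "topspace (DLinf_projlim s T) = DLinf_all s T"
    unfolding DLinf_projlim_def DLinf_all_def[symmetric]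
    by (rule topspace_seminorm_topology[of "DLinf_norm s T 1"]) (auto intro: DLinf_zero(2) zero_less_one)
  moreover have "Bdot s T \<subseteq> DLinf_all s T" by (auto simp: Bdot_iff[OF T])
  ultimately show ?thesis unfolding Bdot_topology_def topspace_subtopology by blast
qed

lemma series_ultradist:
  fixes U :: "nat \<Rightarrow> real \<Rightarrow> 'e::complex_banach"
  assumes T: "0 < T" and h: "0 < h" and C: "0 \<le> C" and Uc: "\<And>\<alpha>. continuous_on {0..T} (U \<alpha>)"
    and U: "\<And>\<alpha> t. t \<in> {0..T} \<Longrightarrow> norm (U \<alpha> t) \<le> C * h ^ \<alpha> / fact \<alpha> powr s"
    and u: "u = (\<lambda>\<phi>. if \<phi> \<in> Bdot s T then suminf (pairing T U \<phi>) else 0)"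
  shows "u \<in> ultradist_L1 s T" "\<phi> \<in> Bdot s T \<Longrightarrow> pairing T U \<phi> sums u \<phi>"
proof -
  note flat = Bdot_flat[OF T]
  note pb = pairing_bound[where F = U, OF T h Uc U]
  have sm: "summable (\<lambda>\<alpha>. T * C * DLinf_norm s T (2 * h) \<phi> * (1 / 2) ^ \<alpha>)" for \<phi>
    by (intro summable_mult summable_geometric) auto
  have summ: "summable (pairing T U \<phi>)" if "\<phi> \<in> Bdot s T" for \<phi>
    by (rule summable_comparison_test'[OF sm]) (rule pb[OF _ that])
  then show sums: "pairing T U \<phi> sums u \<phi>" if "\<phi> \<in> Bdot s T" for \<phi>
    using that by (simp add: u summable_sums)
  have lin: "u (\<lambda>t. c * \<phi> t + \<psi> t) = c *\<^sub>C u \<phi> + u \<psi>" if "\<phi> \<in> Bdot s T" "\<psi> \<in> Bdot s T" for c \<phi> \<psi>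
  proof -
    have "(\<lambda>\<alpha>. c *\<^sub>C pairing T U \<phi> \<alpha> + pairing T U \<psi> \<alpha>) sums (c *\<^sub>C u \<phi> + u \<psi>)"
      by (intro sums_add sums bounded_linear.sums[OF scaleC.bounded_linear_right] that)
    moreover have "pairing T U (\<lambda>t. c * \<phi> t + \<psi> t) = (\<lambda>\<alpha>. c *\<^sub>C pairing T U \<phi> \<alpha> + pairing T U \<psi> \<alpha>)"
      by (rule ext) (rule pairing_linear[OF Uc flat[OF that(1)] flat[OF that(2)]])
    moreover have "(\<lambda>t. c * \<phi> t + \<psi> t) \<in> Bdot s T"
      by (intro fun_subspaceD[OF fun_subspace_Bdot[OF T]] that)
    ultimately show ?thesis using sums[of "\<lambda>t. c * \<phi> t + \<psi> t"] sums_unique2 by simp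
  qed
  have zero: "u (\<lambda>_. 0) = 0"
    using lin[OF fun_subspaceD(1)[OF fun_subspace_Bdot[OF T]] fun_subspaceD(1)[OF fun_subspace_Bdot[OF T]], of 1]
    by simp
  have bound: "norm (u \<phi>) \<le> 2 * T * C * DLinf_norm s T (2 * h) \<phi>" if "\<phi> \<in> Bdot s T" for \<phi>
  proof -
    have "norm (u \<phi>) \<le> (\<Sum>\<alpha>. T * C * DLinf_norm s T (2 * h) \<phi> * (1 / 2) ^ \<alpha>)"
      unfolding sums_unique[OF sums[OF that]] by (rule norm_suminf_le[OF pb[OF _ that] sm]) 
    also have "\<dots> = T * C * DLinf_norm s T (2 * h) \<phi> * 2"
      by (subst suminf_mult) (auto simp: suminf_geometric)
    finally show ?thesis by (simp add: mult_ac)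
  qed
  have diff: "u (\<lambda>t. \<psi> t - \<phi> t) = u \<psi> - u \<phi>" if "\<phi> \<in> Bdot s T" "\<psi> \<in> Bdot s T" for \<phi> \<psi>
    using lin[OF that, of "-1"] scaleC.minus_left[of 1 "u \<phi>"] by simp
  show "u \<in> ultradist_L1 s T"
    unfolding ultradist_L1_def continuous_linear_maps_def mem_Collect_eq Bdot_topology_space[OF T]
  proof (intro conjI ballI allI impI)
    show "continuous_map (Bdot_topology s T) euclidean u"
      unfolding Bdot_topology_def DLinf_projlim_def DLinf_all_def[symmetric]
    proof (rule continuous_map_seminorm_topology)
      show "DLinf_norm s T (2 * h) \<in> {DLinf_norm s T h | h. 0 < h}" using h by force
      show "DLinf_norm s T (2 * h) (\<lambda>_. 0) = 0" using h by (simp add: DLinf_zero)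
      show "Bdot s T \<subseteq> DLinf_all s T" by (auto simp: Bdot_iff[OF T])
      show "norm (u \<psi> - u \<phi>) \<le> 2 * T * C * DLinf_norm s T (2 * h) (\<lambda>t. \<psi> t - \<phi> t)"
        if "\<phi> \<in> Bdot s T" "\<psi> \<in> Bdot s T" for \<phi> \<psi>
        using bound[OF fun_subspace_diff[OF fun_subspace_Bdot[OF T] that(2,1)]] diff[OF that] by simp
    qed (use T C in auto)
    show "u (\<lambda>a. \<phi> a + \<psi> a) = u \<phi> + u \<psi>" if "\<phi> \<in> Bdot s T" "\<psi> \<in> Bdot s T" for \<phi> \<psi>
      using lin[OF that, of 1] by simp
    show "u (\<lambda>a. c * \<phi> a) = c *\<^sub>C u \<phi>" if "\<phi> \<in> Bdot s T" for c \<phi>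
      using lin[OF that fun_subspaceD(1)[OF fun_subspace_Bdot[OF T]], of c] zero by simp
  qed (simp add: u)
qed

text \<open>Each order satisfies the tested equation by \<open>mild_pairing\<close>. The images of
  the partial sums under \<open>A\<close> converge because the pairings of \<open>U\<close> with the
  derivative of \<open>\<phi>\<close> and of \<open>F\<close> with \<open>\<phi>\<close> are
  summable, and closedness identifies the limit.\<close>

lemma (in euler_scheme) series_solution:
  assumes h: "0 < h" and C: "0 \<le> C" and s: "0 < s"
    and F: "\<And>\<alpha>. continuous_on {0..T} (F \<alpha>)" and U: "\<And>\<alpha>. continuous_on {0..T} (U \<alpha>)"
    and U_bound: "\<And>\<alpha> t. t \<in> {0..T} \<Longrightarrow> norm (U \<alpha> t) \<le> C * h ^ \<alpha> / fact \<alpha> powr s"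
    and mild: "\<And>\<alpha> t. t \<in> {0..T} \<Longrightarrow>
      integral {0..t} (U \<alpha>) \<in> DA \<and> A (integral {0..t} (U \<alpha>)) = U \<alpha> t - integral {0..t} (F \<alpha>)"
    and f: "\<And>\<phi>. \<phi> \<in> Bdot s T \<Longrightarrow> pairing T F \<phi> sums f \<phi>"
    and u: "u = (\<lambda>\<phi>. if \<phi> \<in> Bdot s T then suminf (pairing T U \<phi>) else 0)"
  shows "is_solution s T DA A f u"
  unfolding is_solution_def
proof (intro conjI ballI)
  show uL1: "u \<in> ultradist_L1 s T"
    by (rule series_ultradist(1)[OF T_pos h C U U_bound u])
  fix \<phi> assume \<phi>: "\<phi> \<in> Bdot s T"
  have sums: "pairing T U \<phi> sums u \<phi>" if "\<phi> \<in> Bdot s T" for \<phi>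
    by (rule series_ultradist(2)[OF T_pos h C U U_bound u that])
  have \<phi>': "test_deriv T \<phi> \<in> Bdot s T" by (rule test_deriv_Bdot[OF T_pos s \<phi>])
  note flat = Bdot_flat[OF T_pos \<phi>]
  have pair: "pairing T U \<phi> \<alpha> \<in> DA \<and>
    A (pairing T U \<phi> \<alpha>) = - pairing T U (test_deriv T \<phi>) \<alpha> - pairing T F \<phi> \<alpha>" for \<alpha>
  proof -
    have "integral {0..T} (\<lambda>t. test_derivs T \<alpha> \<phi> t *\<^sub>C U \<alpha> t) \<in> DA \<and>
      A (integral {0..T} (\<lambda>t. test_derivs T \<alpha> \<phi> t *\<^sub>C U \<alpha> t)) =
      - integral {0..T} (\<lambda>t. test_derivs T (Suc \<alpha>) \<phi> t *\<^sub>C U \<alpha> t) -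
        integral {0..T} (\<lambda>t. test_derivs T \<alpha> \<phi> t *\<^sub>C F \<alpha> t)"
      by (rule mild_pairing[OF U F mild flat_functionsD(2-4)[OF flat] flat_functionsD(2)[OF flat]
            smooth_has_vector_derivative[OF flat_functionsD(1)[OF flat]]])
    then show ?thesis
      by (simp add: pairing_def linear_operatorD[OF linear_A] test_derivs_test_deriv scaleR_diff_right
          del: funpow.simps)
  qed
  have part: "sum (pairing T U \<phi>) {..<n} \<in> DA \<and>
    A (sum (pairing T U \<phi>) {..<n}) = (\<Sum>\<alpha><n. - pairing T U (test_deriv T \<phi>) \<alpha> - pairing T F \<phi> \<alpha>)" for n
    using linear_operator_sum[OF linear_A, of "{..<n}" "pairing T U \<phi>"] pair by simp
  have "(\<lambda>\<alpha>. - pairing T U (test_deriv T \<phi>) \<alpha> - pairing T F \<phi> \<alpha>) sums (- u (test_deriv T \<phi>) - f \<phi>)"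
    by (intro sums_diff sums_minus sums \<phi>' f \<phi>)
  then have "u \<phi> \<in> DA \<and> A (u \<phi>) = - u (test_deriv T \<phi>) - f \<phi>"
    using closed_operatorD[OF closed_A, of "\<lambda>n. sum (pairing T U \<phi>) {..<n}"] part sums[OF \<phi>]
    unfolding sums_def by auto
  then show "u \<phi> \<in> DA" "ultradist_deriv T u \<phi> = A (u \<phi>) + f \<phi>"
    by (simp_all add: ultradist_deriv_def)
qed

section \<open>Norms of \<open>L\<^sup>r\<close> type\<close>

text \<open>Convexity of the power \<open>r\<close> with weights \<open>1 - t\<close> and
  \<open>t\<close>. Being an inequality between \<open>r\<close>-th powers, it passes through
  integrals and series in the extended reals; Minkowski's inequality for the whole norm then follows
  by one choice of \<open>t\<close>.\<close>

lemma powr_add_le_weighted: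
  fixes a b r t :: real
  assumes "1 \<le> r" "0 \<le> a" "0 \<le> b" "0 < t" "t < 1"
  shows "(a + b) powr r \<le> (1 - t) powr (1 - r) * a powr r + t powr (1 - r) * b powr r"
proof -
  have pos: "(a + b) powr r \<le> (1 - t) powr (1 - r) * a powr r + t powr (1 - r) * b powr r"
    if "0 < a" "0 < b" for a b
  proof -
    have "((1 - t) *\<^sub>R (a / (1 - t)) + t *\<^sub>R (b / t)) powr r \<le>
      (1 - t) * (a / (1 - t)) powr r + t * (b / t) powr r"
      using that assms by (intro convex_onD[OF powr_convex]) auto
    also have "(1 - t) * (a / (1 - t)) powr r = (1 - t) powr (1 - r) * a powr r"
      using that assms by (simp add: powr_divide powr_diff)
    also have "t * (b / t) powr r = t powr (1 - r) * b powr r"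
      using that assms by (simp add: powr_divide powr_diff)
    finally show ?thesis using assms by simp
  qed
  have one: "1 \<le> x powr (1 - r)" if "0 < x" "x < 1" for x :: real
    using powr_mono'[of "1 - r" 0 x] that assms(1) by simp
  show ?thesis
  proof (cases "0 < a \<and> 0 < b")
    case True
    then show ?thesis using pos by blast
  next
    case False
    then consider "a = 0" | "b = 0" using assms by linarith
    then show ?thesis
    proof cases
      case 1
      then show ?thesis using mult_right_mono[OF one[of t], of "b powr r"] assms by simp
    next
      case 2
      then show ?thesis using mult_right_mono[OF one[of "1 - t"], of "a powr r"] assms by simp
    qed
  qed
qed

text \<open>An additive substitute for Hoelder's inequality against a constant: after integration
  the parameter \<open>c\<close> is chosen so as to balance the two terms.\<close>

lemma le_weighted_powr:
  fixes x c r :: real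
  assumes "0 \<le> x" "0 < c" "1 \<le> r"
  shows "x \<le> c + c powr (1 - r) * x powr r"
proof (cases "x \<le> c")
  case True
  then show ?thesis by (simp add: add_increasing2)
next
  case False
  have "1 = (x / c) powr 0" using False assms by simp
  also have "\<dots> \<le> (x / c) powr (r - 1)" using False assms by (intro powr_mono) auto
  finally have "x \<le> x * (x / c) powr (r - 1)" using assms(1) mult_left_mono[of 1 "(x / c) powr (r - 1)" x] by simp
  also have "\<dots> = c powr (1 - r) * x powr r"
    using False assms by (simp add: powr_divide powr_diff)
  finally show ?thesis using assms by simp
qed

lemma integral_le_powr_integral:
  fixes g :: "real \<Rightarrow> real"
  assumes ab: "a \<le> b" and g: "continuous_on {a..b} g" "\<And>t. t \<in> {a..b} \<Longrightarrow> 0 \<le> g t"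
    and r: "1 \<le> r" and n: "0 \<le> n" "integral {a..b} (\<lambda>t. g t powr r) \<le> n powr r"
  shows "integral {a..b} g \<le> (b - a + 1) * n"
proof (rule field_le_epsilon)
  fix e :: real assume e: "0 < e"
  \<comment> \<open>The natural choice \<open>n\<close> may be zero. The excess keeps
    \<open>c\<close> positive and is scaled to contribute exactly \<open>e\<close> to the final
    bound.\<close>
  define c where "c = n + e / (b - a + 1)"
  have c: "0 < c" "n \<le> c" using n(1) e ab by (auto simp: c_def add_nonneg_pos)
  have c1: "((\<lambda>_. c) has_integral (b - a) * c) {a..b}" using has_integral_const_real[of c a b] ab by simp
  have "(\<lambda>t. g t powr r) integrable_on {a..b}"
    using g r by (intro integrable_continuous_real continuous_on_powr') auto
  then have int: "((\<lambda>t. c + c powr (1 - r) * g t powr r) has_integral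
    ((b - a) * c + c powr (1 - r) * integral {a..b} (\<lambda>t. g t powr r))) {a..b}"
    by (intro has_integral_add[OF c1] has_integral_mult_right) (simp add: has_integral_integral)
  have "integral {a..b} g \<le> (b - a) * c + c powr (1 - r) * integral {a..b} (\<lambda>t. g t powr r)"
    by (rule has_integral_le[OF integrable_integral[OF integrable_continuous_real[OF g(1)]] int])
      (intro le_weighted_powr g(2) c r)
  also have "c powr (1 - r) * integral {a..b} (\<lambda>t. g t powr r) \<le> c powr (1 - r) * c powr r"
    using n c r by (intro mult_left_mono order_trans[OF n(2)] powr_mono2) auto
  also have "\<dots> = c" using c by (simp flip: powr_add)
  finally have "integral {a..b} g \<le> (b - a + 1) * c" by (simp add: algebra_simps)
  also have "\<dots> = (b - a + 1) * n + e" using ab by (simp add: c_def distrib_left)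
  finally show "integral {a..b} g \<le> (b - a + 1) * n + e" .
qed

lemma nn_integral_continuous_Icc:
  fixes g :: "real \<Rightarrow> real"
  assumes "continuous_on {a..b} g" "\<And>t. t \<in> {a..b} \<Longrightarrow> 0 \<le> g t"
  shows "(\<integral>\<^sup>+ t. ennreal (g t) \<partial>lebesgue_on {a..b}) = ennreal (integral {a..b} g)"
proof -
  have ae: "AE t in lebesgue_on {a..b}. 0 \<le> g t" using assms(2) by (intro AE_I2) simp
  have "integrable (lebesgue_on {a..b}) g" by (rule continuous_imp_integrable_real[OF assms(1)])
  then show ?thesis
    using nn_integral_eq_integral[of "lebesgue_on {a..b}" g] ae
    by (simp add: lebesgue_integral_eq_integral)
qed

lemma nn_integral_continuous_Ioo:
  fixes g :: "real \<Rightarrow> real"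
  assumes "continuous_on {a..b} g" "\<And>t. t \<in> {a..b} \<Longrightarrow> 0 \<le> g t"
  shows "(\<integral>\<^sup>+ t. ennreal (g t) \<partial>lebesgue_on {a<..<b}) = ennreal (integral {a..b} g)"
proof -
  have "(\<integral>\<^sup>+ t. ennreal (g t) \<partial>lebesgue_on {a<..<b}) = (\<integral>\<^sup>+ t. ennreal (g t) * indicator {a<..<b} t \<partial>lebesgue)"
    by (rule nn_integral_restrict_space) simp
  also have "\<dots> = (\<integral>\<^sup>+ t. ennreal (g t) * indicator {a..b} t \<partial>lebesgue)"
  proof (rule nn_integral_cong_AE)
    have "{a, b} \<in> null_sets lebesgue" by (auto intro!: null_sets_completionI finite_imp_null_set_lborel)
    then show "AE t in lebesgue. ennreal (g t) * indicator {a<..<b} t = ennreal (g t) * indicator {a..b} t"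
      by (rule AE_I') (auto simp: indicator_def)
  qed
  also have "\<dots> = (\<integral>\<^sup>+ t. ennreal (g t) \<partial>lebesgue_on {a..b})"
    by (rule nn_integral_restrict_space[symmetric]) simp
  finally show ?thesis using nn_integral_continuous_Icc[OF assms] by simp
qed

lemma smooth_continuous:
  assumes "\<phi> \<in> smooth_functions T"
  shows "continuous_on {0<..<T} (test_derivs T \<alpha> \<phi>)"
  using has_vector_derivative_continuous[OF smooth_has_vector_derivative[OF assms]]
  by (simp add: continuous_at_imp_continuous_on)

lemma test_derivs_measurable:
  assumes "\<phi> \<in> smooth_functions T"
  shows "test_derivs T \<alpha> \<phi> \<in> borel_measurable (lebesgue_on {0<..<T})"
  by (rule continuous_imp_measurable_on_sets_lebesgue[OF smooth_continuous[OF assms]]) simp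

lemma Lp_norm_pow_add_le:
  assumes r: "1 \<le> r" and t: "0 < t" "t < 1"
    and f: "f \<in> borel_measurable (lebesgue_on {0<..<T})" and g: "g \<in> borel_measurable (lebesgue_on {0<..<T})"
  shows "Lp_norm_pow T r (\<lambda>t. f t + g t) \<le>
    ennreal ((1 - t) powr (1 - r)) * Lp_norm_pow T r f + ennreal (t powr (1 - r)) * Lp_norm_pow T r (g :: real \<Rightarrow> complex)"
proof -
  have "Lp_norm_pow T r (\<lambda>t. f t + g t) \<le> (\<integral>\<^sup>+ x. (ennreal ((1 - t) powr (1 - r)) * ennreal (norm (f x) powr r)
      + ennreal (t powr (1 - r)) * ennreal (norm (g x) powr r)) \<partial>lebesgue_on {0<..<T})"
    unfolding Lp_norm_pow_def
  proof (rule nn_integral_mono)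
    fix x
    have "norm (f x + g x) powr r \<le> (norm (f x) + norm (g x)) powr r"
      using r by (intro powr_mono2 norm_triangle_ineq) auto
    also have "\<dots> \<le> (1 - t) powr (1 - r) * norm (f x) powr r + t powr (1 - r) * norm (g x) powr r"
      by (intro powr_add_le_weighted r t) auto
    finally show "ennreal (norm (f x + g x) powr r) \<le> ennreal ((1 - t) powr (1 - r)) * ennreal (norm (f x) powr r)
      + ennreal (t powr (1 - r)) * ennreal (norm (g x) powr r)"
      by (simp add: ennreal_mult[symmetric] ennreal_plus[symmetric] ennreal_leI del: ennreal_plus)
  qed
  also have "\<dots> = ennreal ((1 - t) powr (1 - r)) * Lp_norm_pow T r f + ennreal (t powr (1 - r)) * Lp_norm_pow T r g"
    unfolding Lp_norm_pow_def using f g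
    by (subst nn_integral_add) (auto simp: nn_integral_cmult)
  finally show ?thesis .
qed

lemma DLr_norm_pow_add_le:
  assumes r: "1 \<le> r" and t: "0 < t" "t < 1" and \<phi>: "\<phi> \<in> smooth_functions T" and \<psi>: "\<psi> \<in> smooth_functions T"
  shows "DLr_norm_pow s T r h (\<lambda>t. \<phi> t + \<psi> t) \<le>
    ennreal ((1 - t) powr (1 - r)) * DLr_norm_pow s T r h \<phi> + ennreal (t powr (1 - r)) * DLr_norm_pow s T r h \<psi>"
proof -
  define w where "w \<alpha> = ennreal (h powr (r * real \<alpha>) / fact \<alpha> powr (r * s))" for \<alpha>
  define a b where "a = ennreal ((1 - t) powr (1 - r))" and "b = ennreal (t powr (1 - r))"
  have "DLr_norm_pow s T r h (\<lambda>t. \<phi> t + \<psi> t) \<le> (\<Sum>\<alpha>. a * (w \<alpha> * Lp_norm_pow T r (test_derivs T \<alpha> \<phi>)) +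
    b * (w \<alpha> * Lp_norm_pow T r (test_derivs T \<alpha> \<psi>)))"
    unfolding DLr_norm_pow_def w_def[symmetric]
  proof (intro suminf_le)
    fix \<alpha>
    have "w \<alpha> * Lp_norm_pow T r (test_derivs T \<alpha> (\<lambda>t. \<phi> t + \<psi> t)) \<le>
      w \<alpha> * (a * Lp_norm_pow T r (test_derivs T \<alpha> \<phi>) + b * Lp_norm_pow T r (test_derivs T \<alpha> \<psi>))"
      unfolding a_def b_def test_derivs_add[OF \<phi> \<psi>]
      by (intro mult_left_mono Lp_norm_pow_add_le r t test_derivs_measurable \<phi> \<psi>) simp
    then show "w \<alpha> * Lp_norm_pow T r (test_derivs T \<alpha> (\<lambda>t. \<phi> t + \<psi> t)) \<le>
      a * (w \<alpha> * Lp_norm_pow T r (test_derivs T \<alpha> \<phi>)) + b * (w \<alpha> * Lp_norm_pow T r (test_derivs T \<alpha> \<psi>))"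
      by (simp add: distrib_left mult_ac)
  qed auto
  also have "\<dots> = a * DLr_norm_pow s T r h \<phi> + b * DLr_norm_pow s T r h \<psi>"
    unfolding DLr_norm_pow_def w_def[symmetric]
    by (simp add: suminf_add[symmetric] ennreal_suminf_cmult)
  finally show ?thesis unfolding a_def b_def .
qed

lemma DLr_norm_pow_cmult:
  assumes r: "1 \<le> r" and \<phi>: "\<phi> \<in> smooth_functions T"
  shows "DLr_norm_pow s T r h (\<lambda>t. c * \<phi> t) = ennreal (cmod c powr r) * DLr_norm_pow s T r h \<phi>"
proof -
  have "Lp_norm_pow T r (test_derivs T \<alpha> (\<lambda>t. c * \<phi> t)) = ennreal (cmod c powr r) * Lp_norm_pow T r (test_derivs T \<alpha> \<phi>)" for \<alpha>
    unfolding test_derivs_cmult[OF \<phi>] Lp_norm_pow_def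
    using test_derivs_measurable[OF \<phi>, of \<alpha>]
    by (simp add: norm_mult powr_mult ennreal_mult nn_integral_cmult)
  then show ?thesis
    unfolding DLr_norm_pow_def by (subst ennreal_suminf_cmult[symmetric]) (simp add: mult.left_commute)
qed

lemma DLr_norm_nonneg [simp]: "0 \<le> DLr_norm s T r h \<phi>"
  by (simp add: DLr_norm_def)

lemma DLr_norm_pow_eq:
  assumes "1 \<le> r" "\<phi> \<in> DLr_space s T r h"
  shows "DLr_norm_pow s T r h \<phi> = ennreal (DLr_norm s T r h \<phi> powr r)"
  using assms by (simp add: DLr_norm_def DLr_space_def powr_powr)

lemma DLr_normI:
  assumes r: "1 \<le> r" and B: "0 \<le> B" and \<phi>: "\<phi> \<in> smooth_functions T"
    and le: "DLr_norm_pow s T r h \<phi> \<le> ennreal (B powr r)"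
  shows "\<phi> \<in> DLr_space s T r h" "DLr_norm s T r h \<phi> \<le> B"
proof -
  show *: "\<phi> \<in> DLr_space s T r h"
    using \<phi> le by (auto simp: DLr_space_def intro: le_less_trans[OF _ ennreal_less_top])
  have "enn2real (DLr_norm_pow s T r h \<phi>) \<le> B powr r" by (rule enn2real_leI) (use le in auto)
  then have "enn2real (DLr_norm_pow s T r h \<phi>) powr (1 / r) \<le> (B powr r) powr (1 / r)"
    using r by (intro powr_mono2) auto
  then show "DLr_norm s T r h \<phi> \<le> B" using r B by (simp add: DLr_norm_def powr_powr)
qed

lemma DLr_add:
  assumes r: "1 \<le> r" and \<phi>: "\<phi> \<in> DLr_space s T r h" and \<psi>: "\<psi> \<in> DLr_space s T r h"
  shows "(\<lambda>t. \<phi> t + \<psi> t) \<in> DLr_space s T r h"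
    "DLr_norm s T r h (\<lambda>t. \<phi> t + \<psi> t) \<le> DLr_norm s T r h \<phi> + DLr_norm s T r h \<psi>"
proof -
  let ?X = "DLr_norm s T r h \<phi>" and ?Y = "DLr_norm s T r h \<psi>"
  have sm: "\<phi> \<in> smooth_functions T" "\<psi> \<in> smooth_functions T" using \<phi> \<psi> by (auto simp: DLr_space_def)
  have sm': "(\<lambda>t. \<phi> t + \<psi> t) \<in> smooth_functions T" by (rule fun_subspaceD(2)[OF fun_subspace_smooth sm])
  have key: "DLr_norm_pow s T r h (\<lambda>t. \<phi> t + \<psi> t) \<le> ennreal ((?X + ?Y + e) powr r)" if e: "0 < e" for e
  proof -
    \<comment> \<open>Adding \<open>e / 2\<close> to both norms keeps the weight
      \<open>t = b / (a + b)\<close> strictly between 0 and 1 even if a norm vanishes. For this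
      weight the two terms recombine to \<open>(a + b) powr r\<close>.\<close>
    define a b where "a = ?X + e / 2" and "b = ?Y + e / 2"
    have ab: "0 < a" "0 < b" "?X \<le> a" "?Y \<le> b" using e by (auto simp: a_def b_def add_nonneg_pos)
    define t where "t = b / (a + b)"
    have t: "0 < t" "t < 1" "1 - t = a / (a + b)" using ab by (auto simp: t_def field_simps)
    have "DLr_norm_pow s T r h (\<lambda>t. \<phi> t + \<psi> t) \<le>
      ennreal ((1 - t) powr (1 - r)) * ennreal (?X powr r) + ennreal (t powr (1 - r)) * ennreal (?Y powr r)"
      using DLr_norm_pow_add_le[OF r t(1,2) sm, of s h] by (simp only: DLr_norm_pow_eq[OF r] \<phi> \<psi>)
    also have "\<dots> = ennreal ((1 - t) powr (1 - r) * ?X powr r + t powr (1 - r) * ?Y powr r)"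
      by (simp add: ennreal_mult)
    also have "\<dots> \<le> ennreal ((1 - t) powr (1 - r) * a powr r + t powr (1 - r) * b powr r)"
      using ab r by (intro ennreal_leI add_mono mult_left_mono powr_mono2) auto
    also have "(1 - t) powr (1 - r) * a powr r = a / (a + b) * (a + b) powr r"
      using ab unfolding t(3) by (simp add: powr_divide powr_diff)
    also have "t powr (1 - r) * b powr r = b / (a + b) * (a + b) powr r"
      using ab unfolding t_def by (simp add: powr_divide powr_diff)
    also have "a / (a + b) * (a + b) powr r + b / (a + b) * (a + b) powr r = (a + b) powr r"
      using ab by (simp add: add_divide_distrib[symmetric] distrib_right[symmetric])
    also have "a + b = ?X + ?Y + e" by (simp add: a_def b_def)
    finally show ?thesis .
  qed
  show "(\<lambda>t. \<phi> t + \<psi> t) \<in> DLr_space s T r h"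
    by (rule DLr_normI(1)[OF r _ sm' key[of 1]]) (simp_all add: add_nonneg_nonneg)
  show "DLr_norm s T r h (\<lambda>t. \<phi> t + \<psi> t) \<le> ?X + ?Y"
  proof (rule field_le_epsilon)
    fix e :: real assume e: "0 < e"
    show "DLr_norm s T r h (\<lambda>t. \<phi> t + \<psi> t) \<le> ?X + ?Y + e"
      by (rule DLr_normI(2)[OF r _ sm' key[OF e]]) (use e in \<open>simp add: add_nonneg_nonneg\<close>)
  qed
qed

lemma DLr_cmult:
  assumes r: "1 \<le> r" and \<phi>: "\<phi> \<in> DLr_space s T r h"
  shows "(\<lambda>t. c * \<phi> t) \<in> DLr_space s T r h" "DLr_norm s T r h (\<lambda>t. c * \<phi> t) \<le> cmod c * DLr_norm s T r h \<phi>"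
proof -
  have sm: "\<phi> \<in> smooth_functions T" using \<phi> by (auto simp: DLr_space_def)
  have le: "DLr_norm_pow s T r h (\<lambda>t. c * \<phi> t) \<le> ennreal ((cmod c * DLr_norm s T r h \<phi>) powr r)"
    by (simp add: DLr_norm_pow_cmult[OF r sm] DLr_norm_pow_eq[OF r \<phi>] powr_mult ennreal_mult)
  note * = DLr_normI[OF r _ fun_subspaceD(3)[OF fun_subspace_smooth sm] le]
  show "(\<lambda>t. c * \<phi> t) \<in> DLr_space s T r h" by (rule *(1)) simp
  show "DLr_norm s T r h (\<lambda>t. c * \<phi> t) \<le> cmod c * DLr_norm s T r h \<phi>" by (rule *(2)) simp
qed

lemma DLr_zero:
  assumes "1 \<le> r"
  shows "(\<lambda>_. 0) \<in> DLr_space s T r h" "DLr_norm s T r h (\<lambda>_. 0) = 0"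
proof -
  have "DLr_norm_pow s T r h (\<lambda>_. 0) = 0" using assms by (simp add: DLr_norm_pow_def Lp_norm_pow_def)
  then show "(\<lambda>_. 0) \<in> DLr_space s T r h" "DLr_norm s T r h (\<lambda>_. 0) = 0"
    using fun_subspaceD(1)[OF fun_subspace_smooth] assms by (auto simp: DLr_space_def DLr_norm_def)
qed

lemma fun_subspace_DLr:
  assumes "1 \<le> r"
  shows "fun_subspace (DLr_space s T r h)"
  by (rule fun_subspaceI[OF DLr_zero(1)[OF assms] DLr_add(1)[OF assms DLr_cmult(1)[OF assms]]])

lemma fun_seminorm_DLr:
  assumes r: "1 \<le> r"
  shows "fun_seminorm (DLr_space s T r h) (DLr_norm s T r h)"
proof (rule fun_seminormI[OF fun_subspace_DLr[OF r]])
  fix x y c assume xy: "x \<in> DLr_space s T r h" "y \<in> DLr_space s T r h"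
  have "DLr_norm s T r h (\<lambda>a. c * x a + y a) \<le> DLr_norm s T r h (\<lambda>a. c * x a) + DLr_norm s T r h y"
    by (intro DLr_add r DLr_cmult xy)
  then show "DLr_norm s T r h (\<lambda>a. c * x a + y a) \<le> cmod c * DLr_norm s T r h x + DLr_norm s T r h y"
    using DLr_cmult(2)[OF r xy(1), of c] by linarith
qed (auto simp: DLr_zero r)

lemma fun_subspace_closure_of:
  assumes P: "directed_seminorms X P" and X: "fun_subspace X" and D: "fun_subspace D" "D \<subseteq> X"
  shows "fun_subspace (seminorm_topology X P closure_of D)"
  unfolding closure_of_seminorm_topology[OF P X D(2)]
proof (rule fun_subspaceI)
  have sn: "fun_seminorm X \<rho>" if "\<rho> \<in> P" for \<rho> using P that by (auto simp: directed_seminorms_def)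
  show "(\<lambda>_. 0) \<in> {x \<in> X. \<forall>\<rho>\<in>P. \<forall>e>0. \<exists>y\<in>D. \<rho> (\<lambda>a. y a - x a) < e}"
  proof (intro CollectI conjI ballI allI impI fun_subspaceD(1)[OF X])
    fix \<rho> and e :: real assume "\<rho> \<in> P" and e: "0 < e"
    then have "\<rho> (\<lambda>_. 0) = 0" by (intro fun_seminorm_zero[OF sn X])
    then show "\<exists>y\<in>D. \<rho> (\<lambda>a. y a - 0) < e"
      using e by (intro bexI[OF _ fun_subspaceD(1)[OF D(1)]]) simp
  qed
  fix x y c
  assume x: "x \<in> {x \<in> X. \<forall>\<rho>\<in>P. \<forall>e>0. \<exists>y\<in>D. \<rho> (\<lambda>a. y a - x a) < e}"
    and y: "y \<in> {x \<in> X. \<forall>\<rho>\<in>P. \<forall>e>0. \<exists>y\<in>D. \<rho> (\<lambda>a. y a - x a) < e}"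
  have "\<exists>z\<in>D. \<rho> (\<lambda>a. z a - (c * x a + y a)) < e" if \<rho>: "\<rho> \<in> P" and e: "0 < e" for \<rho> e
  proof -
    have c: "0 < cmod c + 1" by (simp add: add_nonneg_pos)
    then have e': "0 < e / (2 * (cmod c + 1))" "0 < e / 2" using e by auto
    obtain x' where x': "x' \<in> D" "\<rho> (\<lambda>a. x' a - x a) < e / (2 * (cmod c + 1))"
      using x \<rho> e'(1) by blast
    obtain y' where y': "y' \<in> D" "\<rho> (\<lambda>a. y' a - y a) < e / 2" using y \<rho> e'(2) by blast
    have dx: "(\<lambda>a. x' a - x a) \<in> X" and dy: "(\<lambda>a. y' a - y a) \<in> X"
      using x y x'(1) y'(1) D(2) by (auto intro!: fun_subspace_diff[OF X])
    have "\<rho> (\<lambda>a. c * (x' a - x a) + (y' a - y a)) \<le> \<rho> (\<lambda>a. c * (x' a - x a)) + \<rho> (\<lambda>a. y' a - y a)"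
      by (intro fun_seminormD(1)[OF sn[OF \<rho>]] fun_subspaceD(3)[OF X] dx dy)
    also have "\<rho> (\<lambda>a. c * (x' a - x a)) = cmod c * \<rho> (\<lambda>a. x' a - x a)"
      by (rule fun_seminormD(2)[OF sn[OF \<rho>] dx])
    also have "cmod c * \<rho> (\<lambda>a. x' a - x a) \<le> cmod c * (e / (2 * (cmod c + 1)))"
      using x'(2) by (intro mult_left_mono) auto
    also have "\<dots> \<le> e / 2" using c e by (simp add: field_simps)
    finally have "\<rho> (\<lambda>a. c * (x' a - x a) + (y' a - y a)) < e" using y'(2) by linarith
    moreover have "(\<lambda>a. c * (x' a - x a) + (y' a - y a)) = (\<lambda>a. (c * x' a + y' a) - (c * x a + y a))"
      by (simp add: algebra_simps)
    moreover have "(\<lambda>a. c * x' a + y' a) \<in> D" by (intro fun_subspaceD[OF D(1)] x'(1) y'(1))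
    ultimately show ?thesis by (intro bexI[of _ "\<lambda>a. c * x' a + y' a"]) simp_all
  qed
  moreover have "(\<lambda>a. c * x a + y a) \<in> X" using x y by (intro fun_subspaceD[OF X]) auto
  ultimately show "(\<lambda>a. c * x a + y a) \<in> {x \<in> X. \<forall>\<rho>\<in>P. \<forall>e>0. \<exists>y\<in>D. \<rho> (\<lambda>a. y a - x a) < e}"
    by blast
qed

section \<open>Comparison of the norms and flatness of the closures\<close>

lemma DLr_term_bound:
  assumes r: "1 \<le> r" and h: "0 < h" and \<phi>: "\<phi> \<in> DLr_space s T r h"
  shows "Lp_norm_pow T r (test_derivs T \<alpha> \<phi>) \<le> ennreal ((DLr_norm s T r h \<phi> * (fact \<alpha> powr s / h ^ \<alpha>)) powr r)"
proof -
  let ?N = "DLr_norm s T r h \<phi>"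
  define w where "w \<alpha> = h powr (r * real \<alpha>) / fact \<alpha> powr (r * s)" for \<alpha>
  have w: "0 < w \<alpha>" for \<alpha> using h by (simp add: w_def)
  have w': "(fact \<alpha> powr s / h ^ \<alpha>) powr r = inverse (w \<alpha>)"
    using h by (simp add: w_def powr_divide powr_powr powr_realpow[symmetric] mult.commute)
  have "ennreal (w \<alpha>) * Lp_norm_pow T r (test_derivs T \<alpha> \<phi>) \<le> DLr_norm_pow s T r h \<phi>"
    unfolding DLr_norm_pow_def w_def[symmetric]
    using sum_le_suminf[of "\<lambda>\<alpha>. ennreal (w \<alpha>) * Lp_norm_pow T r (test_derivs T \<alpha> \<phi>)" "{\<alpha>}"] by simp
  also have "\<dots> = ennreal (?N powr r)" by (rule DLr_norm_pow_eq[OF r \<phi>])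
  finally have "ennreal (inverse (w \<alpha>)) * (ennreal (w \<alpha>) * Lp_norm_pow T r (test_derivs T \<alpha> \<phi>)) \<le>
    ennreal (inverse (w \<alpha>)) * ennreal (?N powr r)" by (rule mult_left_mono) simp
  moreover have "ennreal (inverse (w \<alpha>)) * (ennreal (w \<alpha>) * Lp_norm_pow T r (test_derivs T \<alpha> \<phi>)) =
    Lp_norm_pow T r (test_derivs T \<alpha> \<phi>)"
    using w[of \<alpha>] by (simp add: ennreal_mult[symmetric] flip: mult.assoc)
  moreover have "(?N * (fact \<alpha> powr s / h ^ \<alpha>)) powr r = inverse (w \<alpha>) * ?N powr r"
    using h by (subst powr_mult) (simp_all add: w' mult.commute)
  ultimately show ?thesis using w[of \<alpha>] by (simp add: ennreal_mult)
qed

text \<open>A one-dimensional Sobolev embedding: the smallest modulus on an interval is at most the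
  mean, and the oscillation is at most the integral of the modulus of the next derivative. Both
  integrals are dominated by the \<open>L^r\<close> norms of orders \<open>\<alpha>\<close> and
  \<open>\<alpha> + 1\<close>.\<close>

lemma DLr_sup_bound:
  assumes T: "0 < T" and r: "1 \<le> r" and h: "0 < h"
  shows "\<exists>K\<ge>0. \<forall>\<phi>\<in>DLr_space s T r h. \<forall>t\<in>{0<..<T}. cmod (test_derivs T \<alpha> \<phi> t) \<le> K * DLr_norm s T r h \<phi>"
proof -
  define n where "n k = fact k powr s / h ^ k" for k
  have n: "0 < n k" for k using h by (simp add: n_def)
  define K where "K = (2 / T) * ((T + 1) * n \<alpha>) + (T + 1) * n (Suc \<alpha>)"
  have "cmod (test_derivs T \<alpha> \<phi> t) \<le> K * DLr_norm s T r h \<phi>" if \<phi>: "\<phi> \<in> DLr_space s T r h" and t: "t \<in> {0<..<T}" for \<phi> t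
  proof -
    let ?N = "DLr_norm s T r h \<phi>"
    have sm: "\<phi> \<in> smooth_functions T" using \<phi> by (simp add: DLr_space_def)
    \<comment> \<open>The interval contains \<open>t\<close>, has length at least
      \<open>T / 2\<close> so that the constant is independent of \<open>t\<close>, and stays
      strictly inside \<open>(0, T)\<close>, where continuity is known.\<close>
    define a b where "a = min t (T / 4)" and "b = max t (3 * T / 4)"
    have ab: "0 < a" "a \<le> b" "b < T" "T / 2 \<le> b - a" "t \<in> {a..b}"
      using t T by (auto simp: a_def b_def)
    have c: "continuous_on {a..b} (test_derivs T k \<phi>)" for k
      by (rule continuous_on_subset[OF smooth_continuous[OF sm]]) (use ab in auto)
    have arith: "c * ((T + 1) * (?N * x)) + (T + 1) * (?N * y) = (c * ((T + 1) * x) + (T + 1) * y) * ?N" for c x y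
      by (simp add: algebra_simps)
    have I: "integral {a..b} (\<lambda>t. cmod (test_derivs T k \<phi> t)) \<le> (T + 1) * (?N * n k)" for k
    proof -
      have "ennreal (integral {a..b} (\<lambda>t. cmod (test_derivs T k \<phi> t) powr r)) =
        (\<integral>\<^sup>+ t. ennreal (cmod (test_derivs T k \<phi> t) powr r) \<partial>lebesgue_on {a..b})"
        using r by (intro nn_integral_continuous_Icc[symmetric] continuous_on_powr' continuous_on_norm c continuous_on_const) auto
      also have "\<dots> = (\<integral>\<^sup>+ t. ennreal (cmod (test_derivs T k \<phi> t) powr r) * indicator {a..b} t \<partial>lebesgue)"
        by (rule nn_integral_restrict_space) simp
      also have "\<dots> \<le> (\<integral>\<^sup>+ t. ennreal (cmod (test_derivs T k \<phi> t) powr r) * indicator {0<..<T} t \<partial>lebesgue)"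
        using ab by (intro nn_integral_mono) (auto simp: indicator_def)
      also have "\<dots> = Lp_norm_pow T r (test_derivs T k \<phi>)"
        unfolding Lp_norm_pow_def by (rule nn_integral_restrict_space[symmetric]) simp
      also have "\<dots> \<le> ennreal ((?N * n k) powr r)" unfolding n_def by (rule DLr_term_bound[OF r h \<phi>])
      finally have le: "integral {a..b} (\<lambda>t. cmod (test_derivs T k \<phi> t) powr r) \<le> (?N * n k) powr r"
        by (simp add: ennreal_le_iff)
      have nn: "0 \<le> ?N * n k" using n[of k] by simp
      have "integral {a..b} (\<lambda>t. cmod (test_derivs T k \<phi> t)) \<le> (b - a + 1) * (?N * n k)"
        by (rule integral_le_powr_integral[OF ab(2) continuous_on_norm[OF c] _ r nn le]) simp
      also have "\<dots> \<le> (T + 1) * (?N * n k)" using ab nn by (intro mult_right_mono) auto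
      finally show ?thesis .
    qed
    \<comment> \<open>At a point where the modulus is minimal it is bounded by its mean over
      \<open>{a..b}\<close>.\<close>
    have "\<exists>x\<in>{a..b}. \<forall>y\<in>{a..b}. cmod (test_derivs T \<alpha> \<phi> x) \<le> cmod (test_derivs T \<alpha> \<phi> y)"
      by (rule continuous_attains_inf) (use ab in \<open>auto intro!: continuous_on_norm c\<close>)
    then obtain x where x: "x \<in> {a..b}" "\<And>y. y \<in> {a..b} \<Longrightarrow> cmod (test_derivs T \<alpha> \<phi> x) \<le> cmod (test_derivs T \<alpha> \<phi> y)"
      by blast
    have "cmod (test_derivs T \<alpha> \<phi> x) * (b - a) \<le> integral {a..b} (\<lambda>t. cmod (test_derivs T \<alpha> \<phi> t))"
      using has_integral_le[OF has_integral_const_real[of "cmod (test_derivs T \<alpha> \<phi> x)" a b]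
          integrable_integral[OF integrable_continuous_real[OF continuous_on_norm[OF c[of \<alpha>]]]]] x(2) ab
      by (simp add: mult.commute)
    moreover have "cmod (test_derivs T \<alpha> \<phi> x) * (T / 2) \<le> cmod (test_derivs T \<alpha> \<phi> x) * (b - a)"
      using ab by (intro mult_left_mono) auto
    ultimately have "cmod (test_derivs T \<alpha> \<phi> x) * (T / 2) \<le> (T + 1) * (?N * n \<alpha>)" using I[of \<alpha>] by linarith
    then have 1: "cmod (test_derivs T \<alpha> \<phi> x) \<le> (2 / T) * ((T + 1) * (?N * n \<alpha>))"
      using T by (simp add: field_simps)
    have osc: "cmod (test_derivs T \<alpha> \<phi> v - test_derivs T \<alpha> \<phi> u) \<le> (T + 1) * (?N * n (Suc \<alpha>))"
      if uv: "a \<le> u" "u \<le> v" "v \<le> b" for u v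
    proof -
      have "(test_derivs T (Suc \<alpha>) \<phi> has_integral (test_derivs T \<alpha> \<phi> v - test_derivs T \<alpha> \<phi> u)) {u..v}"
        using uv ab by (intro fundamental_theorem_of_calculus
            has_vector_derivative_at_within[OF smooth_has_vector_derivative[OF sm]]) auto
      then have "cmod (test_derivs T \<alpha> \<phi> v - test_derivs T \<alpha> \<phi> u) = cmod (integral {u..v} (test_derivs T (Suc \<alpha>) \<phi>))"
        by (simp only: integral_unique)
      also have "\<dots> \<le> integral {u..v} (\<lambda>t. cmod (test_derivs T (Suc \<alpha>) \<phi> t))"
        using uv by (intro integral_norm_bound_integral integrable_continuous_real continuous_on_norm
            continuous_on_subset[OF c]) auto
      also have "\<dots> \<le> integral {a..b} (\<lambda>t. cmod (test_derivs T (Suc \<alpha>) \<phi> t))"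
        using uv by (intro integral_subset_le integrable_continuous_real continuous_on_norm
            continuous_on_subset[OF c]) auto
      finally show ?thesis using I[of "Suc \<alpha>"] by linarith
    qed
    have "cmod (test_derivs T \<alpha> \<phi> t - test_derivs T \<alpha> \<phi> x) \<le> (T + 1) * (?N * n (Suc \<alpha>))"
      using osc[of x t] osc[of t x] x(1) ab(5) by (cases "x \<le> t") (auto simp: norm_minus_commute)
    from this have "cmod (test_derivs T \<alpha> \<phi> t) \<le> (2 / T) * ((T + 1) * (?N * n \<alpha>)) + (T + 1) * (?N * n (Suc \<alpha>))"
      using 1 norm_triangle_sub[of "test_derivs T \<alpha> \<phi> t" "test_derivs T \<alpha> \<phi> x"] by linarith
    also have "\<dots> = K * ?N" unfolding K_def by (rule arith)
    finally show ?thesis .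
  qed
  moreover have "0 \<le> K" using T n[of \<alpha>] n[of "Suc \<alpha>"] by (simp add: K_def)
  ultimately show ?thesis by blast
qed

text \<open>Halving the radius turns the sup bounds into a geometric series of ratio
  \<open>q = (1 / 2) powr r\<close>; \<open>K powr r\<close> is its sum times the length
  \<open>T\<close>.\<close>

lemma DLinf_DLr:
  assumes T: "0 < T" and r: "1 \<le> r" and h: "0 < h"
  shows "\<exists>K>0. \<forall>\<phi>\<in>DLinf_space s T (2 * h). \<phi> \<in> DLr_space s T r h \<and>
    DLr_norm s T r h \<phi> \<le> K * DLinf_norm s T (2 * h) \<phi>"
proof -
  define q where "q = (1 / 2 :: real) powr r"
  have q: "0 < q" "q < 1" using powr_mono'[OF r, of "1 / 2"] by (auto simp: q_def)
  define K where "K = (T / (1 - q)) powr (1 / r)"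
  have K: "0 < K" "K powr r = T / (1 - q)" using T q r by (auto simp: K_def powr_powr)
  have "\<phi> \<in> DLr_space s T r h \<and> DLr_norm s T r h \<phi> \<le> K * DLinf_norm s T (2 * h) \<phi>"
    if \<phi>: "\<phi> \<in> DLinf_space s T (2 * h)" for \<phi>
  proof -
    let ?N = "DLinf_norm s T (2 * h) \<phi>"
    have "ennreal (h powr (r * real \<alpha>) / fact \<alpha> powr (r * s)) * Lp_norm_pow T r (test_derivs T \<alpha> \<phi>) \<le>
      ennreal (T * ?N powr r * q ^ \<alpha>)" for \<alpha>
    proof -
      define B where "B = ?N * (fact \<alpha> powr s / (2 * h) ^ \<alpha>)"
      have "Lp_norm_pow T r (test_derivs T \<alpha> \<phi>) \<le> (\<integral>\<^sup>+ t. ennreal (B powr r) \<partial>lebesgue_on {0<..<T})"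
        unfolding Lp_norm_pow_def B_def using h r
        by (intro nn_integral_mono ennreal_leI powr_mono2 DLinf_norm_bound \<phi>) auto
      also have "\<dots> = ennreal (B powr r) * ennreal T"
        using T by (simp add: emeasure_restrict_space)
      finally have "ennreal (h powr (r * real \<alpha>) / fact \<alpha> powr (r * s)) * Lp_norm_pow T r (test_derivs T \<alpha> \<phi>) \<le>
        ennreal (h powr (r * real \<alpha>) / fact \<alpha> powr (r * s)) * (ennreal (B powr r) * ennreal T)"
        by (rule mult_left_mono) simp
      also have "\<dots> = ennreal (h powr (r * real \<alpha>) / fact \<alpha> powr (r * s) * (B powr r * T))"
        using T ennreal_mult[of "h powr (r * real \<alpha>) / fact \<alpha> powr (r * s)" "B powr r * T"]
          ennreal_mult[of "B powr r" T] by simp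
      also have "h powr (r * real \<alpha>) / fact \<alpha> powr (r * s) * (B powr r * T) = T * ?N powr r * q ^ \<alpha>"
      proof -
        have B: "B powr r = ?N powr r * (fact \<alpha> powr (r * s) / (2 powr (r * real \<alpha>) * h powr (r * real \<alpha>)))"
          using h by (simp add: B_def powr_mult powr_divide powr_powr powr_realpow[symmetric] mult_ac)
        have Q: "q ^ \<alpha> = 1 / 2 powr (r * real \<alpha>)"
          by (simp add: q_def powr_divide powr_power power_one_over mult_ac power_divide)
        show ?thesis unfolding B Q using h by (simp add: field_simps)
      qed
      finally show ?thesis .
    qed
    then have "DLr_norm_pow s T r h \<phi> \<le> (\<Sum>\<alpha>. ennreal (T * ?N powr r * q ^ \<alpha>))"
      unfolding DLr_norm_pow_def by (intro suminf_le) auto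
    also have "\<dots> = ennreal (\<Sum>\<alpha>. T * ?N powr r * q ^ \<alpha>)"
      using T q by (intro suminf_ennreal2 summable_mult summable_geometric) auto
    also have "(\<Sum>\<alpha>. T * ?N powr r * q ^ \<alpha>) = (K * ?N) powr r"
      using T q K by (simp add: suminf_mult summable_geometric suminf_geometric powr_mult)
    finally have "DLr_norm_pow s T r h \<phi> \<le> ennreal ((K * ?N) powr r)" .
    then show ?thesis using DLr_normI[where s = s and h = h and B = "K * ?N", OF r _ DLinf_space_smooth[OF \<phi>]] K(1) by simp
  qed
  then show ?thesis using K(1) by blast
qed

lemma D_space_DLr:
  assumes "0 < T" "1 \<le> r" "0 < h"
  shows "D_space s T \<subseteq> DLr_space s T r h"
  using DLinf_DLr[OF assms, of s] Bdot_DLinf[OF assms(1) D_space_Bdot[OF assms(1)]] assms(3) by fastforce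

lemma directed_DLr:
  assumes "1 \<le> r"
  shows "directed_seminorms (DLr_space s T r h) {DLr_norm s T r h}"
  using fun_seminorm_DLr[OF assms] by (auto simp: directed_seminorms_def)

lemma DLr_closure_iff:
  assumes "0 < T" "1 \<le> r" "0 < h"
  shows "\<phi> \<in> DLr_closure s T r h \<longleftrightarrow> \<phi> \<in> DLr_space s T r h \<and>
    (\<forall>e>0. \<exists>\<psi>\<in>D_space s T. DLr_norm s T r h (\<lambda>t. \<psi> t - \<phi> t) < e)"
  using closure_of_seminorm_topology[OF directed_DLr[OF assms(2)] fun_subspace_DLr[OF assms(2)] D_space_DLr[OF assms]]
  unfolding DLr_closure_def by auto

lemma fun_subspace_DLr_closure:
  assumes "0 < T" "1 \<le> r" "0 < h"
  shows "fun_subspace (DLr_closure s T r h)"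
  unfolding DLr_closure_def
  by (intro fun_subspace_closure_of directed_DLr fun_subspace_DLr fun_subspace_D_space D_space_DLr assms)

lemma Bdot_DLr_closure:
  assumes T: "0 < T" and r: "1 \<le> r" and h: "0 < h" and \<phi>: "\<phi> \<in> Bdot s T"
  shows "\<phi> \<in> DLr_closure s T r h"
proof -
  obtain K where K: "0 < K" "\<And>\<phi>. \<phi> \<in> DLinf_space s T (2 * h) \<Longrightarrow> \<phi> \<in> DLr_space s T r h \<and>
    DLr_norm s T r h \<phi> \<le> K * DLinf_norm s T (2 * h) \<phi>"
    using DLinf_DLr[OF T r h, of s] by blast
  have h2: "0 < 2 * h" using h by simp
  have "\<exists>\<psi>\<in>D_space s T. DLr_norm s T r h (\<lambda>t. \<psi> t - \<phi> t) < e" if e: "0 < e" for e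
  proof -
    have "0 < e / K" using e K(1) by simp
    then obtain \<psi> where \<psi>: "\<psi> \<in> D_space s T" "DLinf_norm s T (2 * h) (\<lambda>t. \<psi> t - \<phi> t) < e / K"
      using \<phi> h2 unfolding Bdot_iff[OF T] by blast
    have "(\<lambda>t. \<psi> t - \<phi> t) \<in> DLinf_space s T (2 * h)"
      by (intro Bdot_DLinf[OF T _ h2] fun_subspace_diff[OF fun_subspace_Bdot[OF T]] D_space_Bdot[OF T] \<psi> \<phi>)
    then have "DLr_norm s T r h (\<lambda>t. \<psi> t - \<phi> t) \<le> K * DLinf_norm s T (2 * h) (\<lambda>t. \<psi> t - \<phi> t)"
      using K(2) by blast
    also have "\<dots> < e" using \<psi>(2) K(1) by (simp add: field_simps)
    finally show ?thesis using \<psi>(1) by blast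
  qed
  then show ?thesis
    unfolding DLr_closure_iff[OF T r h] using K(2)[OF Bdot_DLinf[OF T \<phi> h2]] by blast
qed

text \<open>A general element of \<open>DLr_space\<close> may have nonzero boundary values. In the
  closure of the compactly supported functions they vanish, because the sup bound turns norm
  convergence into uniform convergence of every order.\<close>

lemma DLr_closure_flat:
  assumes T: "0 < T" and r: "1 \<le> r" and h: "0 < h" and \<phi>: "\<phi> \<in> DLr_closure s T r h"
  shows "\<phi> \<in> flat_functions T"
proof (rule flat_functions_limit)
  have \<phi>s: "\<phi> \<in> DLr_space s T r h" using \<phi> unfolding DLr_closure_iff[OF T r h] by blast
  then show sm: "\<phi> \<in> smooth_functions T" by (simp add: DLr_space_def)
  fix \<alpha> and e :: real assume e: "0 < e"
  obtain K where K: "0 \<le> K" "\<And>\<phi> t. \<phi> \<in> DLr_space s T r h \<Longrightarrow> t \<in> {0<..<T} \<Longrightarrow>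
    cmod (test_derivs T \<alpha> \<phi> t) \<le> K * DLr_norm s T r h \<phi>"
    using DLr_sup_bound[OF T r h, of s \<alpha>] by blast
  have "0 < e / (K + 1)" using e K(1) by simp
  then obtain \<psi> where \<psi>: "\<psi> \<in> D_space s T" "DLr_norm s T r h (\<lambda>t. \<psi> t - \<phi> t) < e / (K + 1)"
    using \<phi> unfolding DLr_closure_iff[OF T r h] by blast
  have \<psi>s: "\<psi> \<in> DLr_space s T r h" using D_space_DLr[OF T r h] \<psi>(1) by blast
  then have sm\<psi>: "\<psi> \<in> smooth_functions T" by (simp add: DLr_space_def)
  have "cmod (test_derivs T \<alpha> \<psi> t - test_derivs T \<alpha> \<phi> t) \<le> e" if "t \<in> {0<..<T}" for t
  proof -
    have "cmod (test_derivs T \<alpha> (\<lambda>t. \<psi> t - \<phi> t) t) \<le> K * DLr_norm s T r h (\<lambda>t. \<psi> t - \<phi> t)"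
      by (intro K(2) that fun_subspace_diff[OF fun_subspace_DLr[OF r]] \<psi>s \<phi>s)
    also have "\<dots> \<le> (K + 1) * (e / (K + 1))" using K(1) \<psi>(2) by (intro mult_mono) auto
    finally show ?thesis using K(1) by (simp add: test_derivs_diff[OF sm\<psi> sm])
  qed
  then show "\<exists>\<psi>\<in>flat_functions T. \<forall>t\<in>{0<..<T}. cmod (test_derivs T \<alpha> \<psi> t - test_derivs T \<alpha> \<phi> t) \<le> e"
    using D_space_flat[OF T \<psi>(1)] by blast
qed

section \<open>Bochner integrals on an interval\<close>

lemma simple_function_lebesgue_on_subset:
  assumes "simple_function (lebesgue_on S) \<sigma>" "R \<subseteq> S" "R \<in> sets lebesgue" "S \<in> sets lebesgue"
  shows "simple_function (lebesgue_on R) \<sigma>"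
  unfolding simple_function_def
proof (intro conjI ballI)
  have "finite (\<sigma> ` S)" using assms(1) by (simp add: simple_function_def)
  then show "finite (\<sigma> ` space (lebesgue_on R))"
    using assms(2) by (auto intro: finite_subset[OF image_mono])
  fix y assume "y \<in> \<sigma> ` space (lebesgue_on R)"
  then have "y \<in> \<sigma> ` space (lebesgue_on S)" using assms(2) by auto
  then have "\<sigma> -` {y} \<inter> S \<in> sets (lebesgue_on S)" using assms(1) by (auto simp: simple_function_def)
  then have "\<sigma> -` {y} \<inter> S \<in> sets lebesgue" using assms(4) by (simp add: sets_restrict_space_iff)
  then have "\<sigma> -` {y} \<inter> S \<inter> R \<in> sets lebesgue" using assms(3) by (rule sets.Int)
  moreover have "\<sigma> -` {y} \<inter> S \<inter> R = \<sigma> -` {y} \<inter> R" using assms(2) by blast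
  ultimately show "\<sigma> -` {y} \<inter> space (lebesgue_on R) \<in> sets (lebesgue_on R)"
    using assms(3) by (simp add: sets_restrict_space_iff)
qed

lemma simple_bochner_integrable_Ioo:
  fixes a b :: real
  assumes "simple_function (lebesgue_on {a<..<b}) \<sigma>"
  shows "Bochner_Integration.simple_bochner_integrable (lebesgue_on {a<..<b}) \<sigma>"
proof (rule simple_bochner_integrable.intros[OF assms])
  have "emeasure (lebesgue_on {a<..<b}) {y \<in> space (lebesgue_on {a<..<b}). \<sigma> y \<noteq> 0} \<le>
    emeasure (lebesgue_on {a<..<b}) {a<..<b}"
    by (rule emeasure_mono) (auto simp: sets_restrict_space_iff)
  also have "\<dots> = emeasure lebesgue {a<..<b}" by (subst emeasure_restrict_space) auto
  also have "\<dots> < \<infinity>" by (cases "a \<le> b") auto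
  finally show "emeasure (lebesgue_on {a<..<b}) {y \<in> space (lebesgue_on {a<..<b}). \<sigma> y \<noteq> 0} \<noteq> \<infinity>" by simp
qed

text \<open>The bridge between the two integrals: simple functions enter through the Bochner
  definition and are then handled by the limit theorems and bounds of the gauge integral.\<close>

lemma simple_has_integral_Ioo:
  fixes \<sigma> :: "real \<Rightarrow> 'e::banach"
  assumes \<sigma>: "simple_function (lebesgue_on {a<..<b}) \<sigma>"
  shows "(\<sigma> has_integral Bochner_Integration.simple_bochner_integral (lebesgue_on {a<..<b}) \<sigma>) {a..b}"
proof -
  let ?S = "{a<..<b}"
  let ?A = "\<lambda>y. {x \<in> ?S. \<sigma> x = y}"
  have fin: "finite (\<sigma> ` ?S)" using \<sigma> by (simp add: simple_function_def)
  have "((\<lambda>x. \<Sum>y\<in>\<sigma> ` ?S. indicat_real (?A y) x *\<^sub>R y) has_integral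
    (\<Sum>y\<in>\<sigma> ` ?S. measure lebesgue (?A y) *\<^sub>R y)) UNIV"
  proof (intro has_integral_sum fin has_integral_scaleR_left)
    fix y assume "y \<in> \<sigma> ` ?S"
    then have "\<sigma> -` {y} \<inter> ?S \<in> sets (lebesgue_on ?S)" using \<sigma> by (auto simp: simple_function_def)
    then have "\<sigma> -` {y} \<inter> ?S \<in> sets lebesgue" by (simp add: sets_restrict_space_iff)
    moreover have "\<sigma> -` {y} \<inter> ?S = ?A y" by auto
    moreover have "bounded (?A y)" by (rule bounded_subset[of ?S]) auto
    ultimately have "?A y \<in> lmeasurable" using bounded_set_imp_lmeasurable by metis
    then show "(indicat_real (?A y) has_integral measure lebesgue (?A y)) UNIV"
      by (simp add: lmeasurable_iff_has_integral)
  qed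
  also have "(\<lambda>x. \<Sum>y\<in>\<sigma> ` ?S. indicat_real (?A y) x *\<^sub>R y) = (\<lambda>x. if x \<in> ?S then \<sigma> x else 0)"
  proof
    fix x
    show "(\<Sum>y\<in>\<sigma> ` ?S. indicat_real (?A y) x *\<^sub>R y) = (if x \<in> ?S then \<sigma> x else 0)"
    proof (cases "x \<in> ?S")
      case True
      have "(\<Sum>y\<in>\<sigma> ` ?S. indicat_real (?A y) x *\<^sub>R y) = (\<Sum>y\<in>\<sigma> ` ?S. if \<sigma> x = y then y else 0)"
        using True by (intro sum.cong) (auto simp: indicator_def)
      also have "\<dots> = \<sigma> x" using True fin by (subst sum.delta') auto
      finally show ?thesis using True by simp
    next
      case False
      then show ?thesis by (intro trans[OF sum.neutral]) (auto simp: indicator_def)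
    qed
  qed
  finally have "(\<sigma> has_integral (\<Sum>y\<in>\<sigma> ` ?S. measure lebesgue (?A y) *\<^sub>R y)) ?S"
    by (simp only: has_integral_restrict_UNIV)
  moreover have "Bochner_Integration.simple_bochner_integral (lebesgue_on ?S) \<sigma> = (\<Sum>y\<in>\<sigma> ` ?S. measure lebesgue (?A y) *\<^sub>R y)"
  proof -
    have "measure (lebesgue_on ?S) (?A y) = measure lebesgue (?A y)" for y
      by (rule measure_restrict_space) auto
    then show ?thesis by (simp add: simple_bochner_integral_def)
  qed
  ultimately show ?thesis by (simp add: has_integral_Icc_iff_Ioo)
qed

lemma norm_simple_integral_le:
  fixes \<sigma> :: "real \<Rightarrow> 'e::banach"
  assumes \<sigma>: "simple_function (lebesgue_on {a<..<b}) \<sigma>"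
  shows "ennreal (norm (integral {a..b} \<sigma>)) \<le> (\<integral>\<^sup>+ t. ennreal (norm (\<sigma> t)) \<partial>lebesgue_on {a<..<b})"
proof -
  note si = simple_bochner_integrable_Ioo[OF \<sigma>]
  have "norm (integral {a..b} \<sigma>) \<le> Bochner_Integration.simple_bochner_integral (lebesgue_on {a<..<b}) (\<lambda>t. norm (\<sigma> t))"
    unfolding integral_unique[OF simple_has_integral_Ioo[OF \<sigma>]]
    by (rule simple_bochner_integral_norm_bound[OF si])
  moreover have "Bochner_Integration.simple_bochner_integrable (lebesgue_on {a<..<b}) (\<lambda>t. norm (\<sigma> t))"
    by (rule simple_bochner_integrable_compose2[where p = "\<lambda>x y. norm x", OF _ si si]) simp
  ultimately show ?thesis
    using simple_bochner_integral_eq_nn_integral[of "lebesgue_on {a<..<b}" "\<lambda>t. norm (\<sigma> t)"]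
    by (metis ennreal_leI norm_ge_zero)
qed

text \<open>Completeness of Lebesgue measure allows a change on a null set; extension by zero
  transfers this to the restricted measure.\<close>

lemma borel_measurable_lebesgue_on_AE:
  fixes f g :: "real \<Rightarrow> real"
  assumes "f \<in> borel_measurable (lebesgue_on S)" "AE t in lebesgue_on S. f t = g t" "S \<in> sets lebesgue"
  shows "g \<in> borel_measurable (lebesgue_on S)"
proof -
  have "(\<lambda>t. if t \<in> S then g t else 0) \<in> borel_measurable lebesgue"
  proof (rule borel_measurable_AE)
    show "(\<lambda>t. if t \<in> S then f t else 0) \<in> borel_measurable lebesgue"
      by (rule borel_measurable_if_I[OF assms(1,3)])
    show "AE t in lebesgue. (if t \<in> S then f t else 0) = (if t \<in> S then g t else 0)"
      using assms(2,3) by (subst (asm) AE_restrict_space_iff) (auto elim: eventually_mono)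
  qed
  then show ?thesis by (rule borel_measurable_if_D)
qed

text \<open>All estimates involve only these real functions, which are almost everywhere limits of
  real simple functions. Borel measurability of \<open>F\<close> itself is never asserted.\<close>

lemma strongly_measurable_norm_diff:
  fixes F :: "real \<Rightarrow> 'e::banach"
  assumes F: "strongly_measurable (lebesgue_on S) F" and S: "S \<in> sets lebesgue"
    and \<tau>: "simple_function (lebesgue_on S) \<tau>"
  shows "(\<lambda>t. norm (F t - \<tau> t)) \<in> borel_measurable (lebesgue_on S)"
proof -
  obtain \<sigma> where \<sigma>: "\<And>n. simple_function (lebesgue_on S) (\<sigma> n)"
    "AE t in lebesgue_on S. (\<lambda>n. \<sigma> n t) \<longlonglongrightarrow> F t"
    using F unfolding strongly_measurable_def by blast
  have "simple_function (lebesgue_on S) (\<lambda>t. norm (\<sigma> n t - \<tau> t))" for n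
    by (rule simple_function_compose2[OF \<sigma>(1) \<tau>])
  then have "(\<lambda>t. lim (\<lambda>n. norm (\<sigma> n t - \<tau> t))) \<in> borel_measurable (lebesgue_on S)"
    by (intro borel_measurable_lim_metric borel_measurable_simple_function)
  moreover have "AE t in lebesgue_on S. lim (\<lambda>n. norm (\<sigma> n t - \<tau> t)) = norm (F t - \<tau> t)"
    using \<sigma>(2) by (rule eventually_mono) (intro limI tendsto_intros)
  ultimately show ?thesis by (rule borel_measurable_lebesgue_on_AE[OF _ _ S])
qed

text \<open>Makes the definite description in \<open>bochner_integral\<close> meaningful. The
  integrals of two approximating sequences differ by at most the sum of their \<open>L^1\<close>
  errors, which tends to zero.\<close>

lemma has_bochner_unique:
  fixes F :: "real \<Rightarrow> 'e::banach"
  assumes x: "has_bochner (lebesgue_on {a<..<b}) F x" and y: "has_bochner (lebesgue_on {a<..<b}) F y"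
  shows "x = y"
proof -
  let ?M = "lebesgue_on {a<..<b}"
  have F: "strongly_measurable ?M F" using x by (simp add: has_bochner_def)
  obtain \<sigma> where \<sigma>: "\<And>n. Bochner_Integration.simple_bochner_integrable ?M (\<sigma> n)"
    "(\<lambda>n. \<integral>\<^sup>+ t. ennreal (norm (F t - \<sigma> n t)) \<partial>?M) \<longlonglongrightarrow> 0" "(\<lambda>n. Bochner_Integration.simple_bochner_integral ?M (\<sigma> n)) \<longlonglongrightarrow> x"
    using x unfolding has_bochner_def by blast
  obtain \<tau> where \<tau>: "\<And>n. Bochner_Integration.simple_bochner_integrable ?M (\<tau> n)"
    "(\<lambda>n. \<integral>\<^sup>+ t. ennreal (norm (F t - \<tau> n t)) \<partial>?M) \<longlonglongrightarrow> 0" "(\<lambda>n. Bochner_Integration.simple_bochner_integral ?M (\<tau> n)) \<longlonglongrightarrow> y"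
    using y unfolding has_bochner_def by blast
  have sf: "simple_function ?M (\<sigma> n)" "simple_function ?M (\<tau> n)" for n
    using \<sigma>(1) \<tau>(1) by (auto simp: simple_bochner_integrable.simps)
  have le: "ennreal (norm (Bochner_Integration.simple_bochner_integral ?M (\<sigma> n) - Bochner_Integration.simple_bochner_integral ?M (\<tau> n))) \<le>
    (\<integral>\<^sup>+ t. ennreal (norm (F t - \<sigma> n t)) \<partial>?M) + (\<integral>\<^sup>+ t. ennreal (norm (F t - \<tau> n t)) \<partial>?M)" for n
  proof -
    have sd: "simple_function ?M (\<lambda>t. \<sigma> n t - \<tau> n t)" by (rule simple_function_compose2[OF sf])
    have "Bochner_Integration.simple_bochner_integral ?M (\<sigma> n) - Bochner_Integration.simple_bochner_integral ?M (\<tau> n) =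
      Bochner_Integration.simple_bochner_integral ?M (\<lambda>t. \<sigma> n t - \<tau> n t)"
      by (rule simple_bochner_integral_diff[OF \<sigma>(1) \<tau>(1), symmetric])
    also have "\<dots> = integral {a..b} (\<lambda>t. \<sigma> n t - \<tau> n t)"
      by (rule integral_unique[OF simple_has_integral_Ioo[OF sd], symmetric])
    finally have "ennreal (norm (Bochner_Integration.simple_bochner_integral ?M (\<sigma> n) - Bochner_Integration.simple_bochner_integral ?M (\<tau> n))) \<le>
      (\<integral>\<^sup>+ t. ennreal (norm (\<sigma> n t - \<tau> n t)) \<partial>?M)"
      using norm_simple_integral_le[OF sd] by simp
    also have "\<dots> \<le> (\<integral>\<^sup>+ t. (ennreal (norm (F t - \<sigma> n t)) + ennreal (norm (F t - \<tau> n t))) \<partial>?M)"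
    proof (rule nn_integral_mono)
      fix t
      have "norm (\<sigma> n t - \<tau> n t) \<le> norm (F t - \<sigma> n t) + norm (F t - \<tau> n t)" by norm
      then show "ennreal (norm (\<sigma> n t - \<tau> n t)) \<le> ennreal (norm (F t - \<sigma> n t)) + ennreal (norm (F t - \<tau> n t))"
        by (simp add: ennreal_plus[symmetric] ennreal_leI del: ennreal_plus)
    qed
    also have "\<dots> = (\<integral>\<^sup>+ t. ennreal (norm (F t - \<sigma> n t)) \<partial>?M) + (\<integral>\<^sup>+ t. ennreal (norm (F t - \<tau> n t)) \<partial>?M)"
      by (intro nn_integral_add measurable_compose[OF _ measurable_ennreal] strongly_measurable_norm_diff F sf) auto
    finally show ?thesis .
  qed
  have up: "(\<lambda>n. (\<integral>\<^sup>+ t. ennreal (norm (F t - \<sigma> n t)) \<partial>?M) + (\<integral>\<^sup>+ t. ennreal (norm (F t - \<tau> n t)) \<partial>?M)) \<longlonglongrightarrow> 0"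
    using tendsto_add[OF \<sigma>(2) \<tau>(2)] by simp
  have "(\<lambda>n. ennreal (norm (Bochner_Integration.simple_bochner_integral ?M (\<sigma> n) -
      Bochner_Integration.simple_bochner_integral ?M (\<tau> n)))) \<longlonglongrightarrow> 0"
    by (rule tendsto_sandwich[OF always_eventually always_eventually tendsto_const up]) (auto intro: le)
  moreover have "(\<lambda>n. ennreal (norm (Bochner_Integration.simple_bochner_integral ?M (\<sigma> n) - Bochner_Integration.simple_bochner_integral ?M (\<tau> n)))) \<longlonglongrightarrow> ennreal (norm (x - y))"
    by (intro tendsto_ennrealI tendsto_norm tendsto_diff \<sigma> \<tau>)
  ultimately have "ennreal (norm (x - y)) = 0" using LIMSEQ_unique by blast
  then show ?thesis by simp
qed

lemma bochner_integral_eqI: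
  fixes F :: "real \<Rightarrow> 'e::banach"
  assumes "has_bochner (lebesgue_on {a<..<b}) F x"
  shows "bochner_integral (lebesgue_on {a<..<b}) F = x"
  unfolding bochner_integral_def
  by (rule the_equality[of "has_bochner (lebesgue_on {a<..<b}) F", OF assms])
    (rule has_bochner_unique[OF _ assms])

text \<open>Allows pairings of continuous functions to be computed with the gauge integral. Uniform
  continuity makes step functions sampled on a regular grid converge uniformly, hence in
  \<open>L^1\<close>.\<close>

lemma bochner_integral_continuous:
  fixes g :: "real \<Rightarrow> 'e::banach"
  assumes T: "0 < T" and g: "continuous_on {0..T} g"
  shows "bochner_integral (lebesgue_on {0<..<T}) g = integral {0..T} g"
proof (rule bochner_integral_eqI)
  let ?M = "lebesgue_on {0<..<T}"
  \<comment> \<open>The left end of the grid cell of length \<open>T / (n + 1)\<close> that contains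
    \<open>t\<close>.\<close>
  define pt where "pt n t = T * real (nat \<lfloor>real (Suc n) * t / T\<rfloor>) / real (Suc n)" for n t
  define \<sigma> where "\<sigma> n t = g (pt n t)" for n t
  have sf: "simple_function ?M (\<sigma> n)" for n
  proof -
    \<comment> \<open>The cell number takes finitely many values, and the sampled function is a
      function of it; measurability has to be checked for the integer part only.\<close>
    have "simple_function ?M (\<lambda>t. nat \<lfloor>real (Suc n) * t / T\<rfloor>)"
      unfolding simple_function_def
    proof (intro conjI ballI)
      show "finite ((\<lambda>t. nat \<lfloor>real (Suc n) * t / T\<rfloor>) ` space ?M)"
      proof (rule finite_subset[of _ "{..Suc n}"])
        show "(\<lambda>t. nat \<lfloor>real (Suc n) * t / T\<rfloor>) ` space ?M \<subseteq> {..Suc n}"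
        proof clarsimp
          fix t :: real assume "0 < t" "t < T"
          then have "(1 + real n) * t \<le> (1 + real n) * T" by (intro mult_left_mono) auto
          then have "(1 + real n) * t / T \<le> 1 + real n" using T by (simp add: pos_divide_le_eq)
          then have "\<lfloor>(1 + real n) * t / T\<rfloor> \<le> \<lfloor>1 + real n\<rfloor>" by (rule floor_mono)
          then show "nat \<lfloor>(1 + real n) * t / T\<rfloor> \<le> Suc n" by simp
        qed
      qed simp
      have m: "(\<lambda>t. nat \<lfloor>real (Suc n) * t / T\<rfloor>) \<in> measurable borel (count_space UNIV)" by measurable
      fix y assume "y \<in> (\<lambda>t. nat \<lfloor>real (Suc n) * t / T\<rfloor>) ` space ?M"
      have "(\<lambda>t. nat \<lfloor>real (Suc n) * t / T\<rfloor>) -` {y} \<in> sets borel"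
        using measurable_sets[OF m, of "{y}"] by simp
      then have "(\<lambda>t. nat \<lfloor>real (Suc n) * t / T\<rfloor>) -` {y} \<inter> {0<..<T} \<in> sets lebesgue"
        by (intro sets.Int) auto
      then show "(\<lambda>t. nat \<lfloor>real (Suc n) * t / T\<rfloor>) -` {y} \<inter> space ?M \<in> sets ?M"
        by (simp add: sets_restrict_space_iff)
    qed
    from simple_function_compose[OF this, of "\<lambda>k. g (T * real k / real (Suc n))"]
    show ?thesis by (simp add: \<sigma>_def[abs_def] pt_def comp_def)
  qed
  have pt: "pt n t \<in> {0..T} \<and> \<bar>pt n t - t\<bar> \<le> T / real (Suc n)" if "t \<in> {0<..<T}" for n t
  proof -
    define r where "r = real (Suc n) * t / T"
    have r: "0 \<le> r" "t = T * r / real (Suc n)" using that T by (auto simp: r_def)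
    have fl: "real (nat \<lfloor>r\<rfloor>) \<le> r" "r \<le> real (nat \<lfloor>r\<rfloor>) + 1" using r(1) by linarith+
    have p: "pt n t = T * real (nat \<lfloor>r\<rfloor>) / real (Suc n)" by (simp add: pt_def r_def)
    have le: "pt n t \<le> t" unfolding p using fl T by (subst r(2)) (intro divide_right_mono mult_left_mono; simp)
    have "t - pt n t = T * (r - real (nat \<lfloor>r\<rfloor>)) / real (Suc n)"
      unfolding p by (subst r(2)) (simp add: right_diff_distrib diff_divide_distrib)
    also have "\<dots> \<le> T * 1 / real (Suc n)"
    proof -
      have "r - real (nat \<lfloor>r\<rfloor>) \<le> 1" using fl(2) by linarith
      then show ?thesis by (intro divide_right_mono mult_left_mono) (use T in auto)
    qed
    finally have "t - pt n t \<le> T / real (Suc n)" by simp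
    moreover have "0 \<le> pt n t" unfolding p using T by simp
    ultimately show ?thesis using le that by auto
  qed
  have unif: "\<exists>N. \<forall>n\<ge>N. \<forall>t\<in>{0<..<T}. norm (g t - \<sigma> n t) \<le> e" if e: "0 < e" for e
  proof -
    have "uniformly_continuous_on {0..T} g" by (intro compact_uniformly_continuous g) auto
    then obtain d where d: "0 < d" "\<And>x y. x \<in> {0..T} \<Longrightarrow> y \<in> {0..T} \<Longrightarrow> dist y x < d \<Longrightarrow> dist (g y) (g x) < e"
      unfolding uniformly_continuous_on_def using e by meson
    obtain N :: nat where N: "T / d < N" using reals_Archimedean2 by blast
    have "norm (g t - \<sigma> n t) \<le> e" if "N \<le> n" "t \<in> {0<..<T}" for n t
    proof -
      have "T / d < real (Suc n)" using N that(1) by simp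
      then have "T / real (Suc n) < d" using d(1) by (simp add: field_simps)
      then have "dist (g t) (g (pt n t)) < e"
        using pt[OF that(2), of n] that(2) by (intro d(2)) (auto simp: dist_real_def)
      then show ?thesis by (simp add: \<sigma>_def dist_norm)
    qed
    then show ?thesis by blast
  qed
  show "has_bochner ?M g (integral {0..T} g)"
    unfolding has_bochner_def
  proof (intro conjI exI[of _ \<sigma>] allI)
    show "strongly_measurable ?M g"
      unfolding strongly_measurable_def
    proof (intro exI[of _ \<sigma>] conjI allI sf AE_I2)
      fix t assume t: "t \<in> space ?M"
      show "(\<lambda>n. \<sigma> n t) \<longlonglongrightarrow> g t"
      proof (rule LIMSEQ_I)
        fix e :: real assume e: "0 < e"
        then have "0 < e / 2" by simp
        then obtain N where N: "\<forall>n\<ge>N. \<forall>t\<in>{0<..<T}. norm (g t - \<sigma> n t) \<le> e / 2" using unif by blast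
        have "norm (\<sigma> n t - g t) < e" if "N \<le> n" for n
        proof -
          have "norm (g t - \<sigma> n t) \<le> e / 2" using N t that by simp
          then show ?thesis using e unfolding norm_minus_commute[of "\<sigma> n t"] by linarith
        qed
        then show "\<exists>N. \<forall>n\<ge>N. norm (\<sigma> n t - g t) < e" by blast
      qed
    qed
    show "Bochner_Integration.simple_bochner_integrable ?M (\<sigma> n)" for n by (rule simple_bochner_integrable_Ioo[OF sf])
    show "(\<lambda>n. \<integral>\<^sup>+ t. ennreal (norm (g t - \<sigma> n t)) \<partial>?M) \<longlonglongrightarrow> 0"
    proof (rule tendsto_zero_ennreal)
      fix e :: real assume e: "0 < e"
      then have "0 < e / (2 * T)" using T by simp
      then obtain N where N: "\<And>n t. N \<le> n \<Longrightarrow> t \<in> {0<..<T} \<Longrightarrow> norm (g t - \<sigma> n t) \<le> e / (2 * T)"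
        using unif by blast
      have "(\<integral>\<^sup>+ t. ennreal (norm (g t - \<sigma> n t)) \<partial>?M) < ennreal e" if "N \<le> n" for n
      proof -
        have "(\<integral>\<^sup>+ t. ennreal (norm (g t - \<sigma> n t)) \<partial>?M) \<le> (\<integral>\<^sup>+ t. ennreal (e / (2 * T)) \<partial>?M)"
          using N[OF that] by (intro nn_integral_mono ennreal_leI) auto
        also have "\<dots> = ennreal (e / (2 * T)) * ennreal T" using T by (simp add: emeasure_restrict_space)
        also have "\<dots> = ennreal (e / 2)" using T e by (simp add: ennreal_mult[symmetric])
        also have "\<dots> < ennreal e" using e by (simp add: ennreal_less_iff)
        finally show ?thesis .
      qed
      then show "\<forall>\<^sub>F n in sequentially. (\<integral>\<^sup>+ t. ennreal (norm (g t - \<sigma> n t)) \<partial>?M) < ennreal e"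
        unfolding eventually_sequentially by blast
    qed
    show "(\<lambda>n. Bochner_Integration.simple_bochner_integral ?M (\<sigma> n)) \<longlonglongrightarrow> integral {0..T} g"
    proof (rule LIMSEQ_I)
      fix e :: real assume e: "0 < e"
      then have "0 < e / (2 * T)" using T by simp
      then obtain N where N: "\<And>n t. N \<le> n \<Longrightarrow> t \<in> {0<..<T} \<Longrightarrow> norm (g t - \<sigma> n t) \<le> e / (2 * T)"
        using unif by blast
      have "norm (Bochner_Integration.simple_bochner_integral ?M (\<sigma> n) - integral {0..T} g) < e" if "N \<le> n" for n
      proof -
        have "((\<lambda>t. g t - \<sigma> n t) has_integral (integral {0..T} g - Bochner_Integration.simple_bochner_integral ?M (\<sigma> n))) {0..T}"
          by (intro has_integral_diff integrable_integral integrable_continuous_real g simple_has_integral_Ioo sf)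
        then have "norm (integral {0..T} g - Bochner_Integration.simple_bochner_integral ?M (\<sigma> n)) \<le>
          e / (2 * T) * measure lborel {0..T}"
          by (rule has_integral_bound_real[where S = "{0, T}", rotated 2]) (use N[OF that] T e in auto)
        then show ?thesis using T e by (simp add: norm_minus_commute)
      qed
      then show "\<exists>N. \<forall>n\<ge>N. norm (Bochner_Integration.simple_bochner_integral ?M (\<sigma> n) - integral {0..T} g) < e" by blast
    qed
  qed
qed

text \<open>Dropping the values larger than \<open>2 * norm (F t)\<close> gives a dominated
  sequence. The factor 2 is needed so that eventually nothing is dropped where \<open>F t\<close> is
  nonzero; where \<open>F t = 0\<close> the truncated values are zero.\<close>

lemma Lp_simple_approximation:
  fixes F :: "real \<Rightarrow> 'e::banach"
  assumes T: "0 < T" and p: "1 \<le> p" and F: "F \<in> Lp_space T p"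
  shows "\<exists>\<sigma>. (\<forall>n. simple_function (lebesgue_on {0<..<T}) (\<sigma> n)) \<and>
    (AE t in lebesgue_on {0<..<T}. (\<lambda>n. \<sigma> n t) \<longlonglongrightarrow> F t) \<and> (\<forall>n t. norm (\<sigma> n t) \<le> 2 * norm (F t)) \<and>
    (\<lambda>n. \<integral>\<^sup>+ t. ennreal (norm (F t - \<sigma> n t)) \<partial>lebesgue_on {0<..<T}) \<longlonglongrightarrow> 0"
proof -
  let ?M = "lebesgue_on {0<..<T}"
  have Fs: "strongly_measurable ?M F" and Fp: "Lp_norm_pow T p F < \<infinity>" using F by (auto simp: Lp_space_def)
  obtain \<rho> where \<rho>: "\<And>n. simple_function ?M (\<rho> n)" "AE t in ?M. (\<lambda>n. \<rho> n t) \<longlonglongrightarrow> F t"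
    using Fs unfolding strongly_measurable_def by blast
  have zero: "simple_function ?M (\<lambda>_. 0 :: 'e)" by simp
  have nF: "(\<lambda>t. norm (F t)) \<in> borel_measurable ?M"
    using strongly_measurable_norm_diff[OF Fs _ zero] by simp
  define \<sigma> where "\<sigma> n t = (if t \<in> {t. norm (\<rho> n t) \<le> 2 * norm (F t)} then \<rho> n t else 0)" for n t
  have sf: "simple_function ?M (\<sigma> n)" for n
    unfolding \<sigma>_def
  proof (rule simple_function_If_set[OF \<rho>(1) zero])
    have "(\<lambda>t. norm (\<rho> n t)) \<in> borel_measurable ?M"
      by (rule borel_measurable_simple_function[OF simple_function_compose[OF \<rho>(1), of norm n, unfolded comp_def]])
    then have "{t \<in> space ?M. norm (\<rho> n t) \<le> 2 * norm (F t)} \<in> sets ?M"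
      using nF by measurable
    then show "{t. norm (\<rho> n t) \<le> 2 * norm (F t)} \<inter> space ?M \<in> sets ?M" by (simp add: Int_def conj_commute)
  qed
  have lim: "AE t in ?M. (\<lambda>n. \<sigma> n t) \<longlonglongrightarrow> F t"
    using \<rho>(2)
  proof (rule eventually_mono)
    fix t assume t: "(\<lambda>n. \<rho> n t) \<longlonglongrightarrow> F t"
    show "(\<lambda>n. \<sigma> n t) \<longlonglongrightarrow> F t"
    proof (cases "F t = 0")
      case True
      then have "\<sigma> n t = 0" for n by (simp add: \<sigma>_def)
      then show ?thesis using True by simp
    next
      case False
      then have "norm (F t) < 2 * norm (F t)" by simp
      then have "eventually (\<lambda>n. norm (\<rho> n t) < 2 * norm (F t)) sequentially"
        by (rule order_tendstoD(2)[OF tendsto_norm[OF t]])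
      then have "eventually (\<lambda>n. \<rho> n t = \<sigma> n t) sequentially"
        by (rule eventually_mono) (simp add: \<sigma>_def)
      then show ?thesis by (rule Lim_transform_eventually[OF t])
    qed
  qed
  have dom: "norm (\<sigma> n t) \<le> 2 * norm (F t)" for n t by (simp add: \<sigma>_def)
  have "(\<lambda>n. \<integral>\<^sup>+ t. ennreal (norm (F t - \<sigma> n t)) \<partial>?M) \<longlonglongrightarrow> (\<integral>\<^sup>+ t. 0 \<partial>?M)"
  proof (rule nn_integral_dominated_convergence[where w = "\<lambda>t. ennreal (3 * norm (F t))"])
    show "(\<lambda>t. ennreal (norm (F t - \<sigma> n t))) \<in> borel_measurable ?M" for n
      by (intro measurable_compose[OF _ measurable_ennreal] strongly_measurable_norm_diff Fs sf) simp
    show "(\<lambda>t. ennreal (3 * norm (F t))) \<in> borel_measurable ?M" using nF by measurable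
    show "AE t in ?M. ennreal (norm (F t - \<sigma> n t)) \<le> ennreal (3 * norm (F t))" for n
    proof (rule AE_I2, rule ennreal_leI)
      fix t
      show "norm (F t - \<sigma> n t) \<le> 3 * norm (F t)" using norm_triangle_ineq4[of "F t" "\<sigma> n t"] dom[of n t] by linarith
    qed
    show "AE t in ?M. (\<lambda>n. ennreal (norm (F t - \<sigma> n t))) \<longlonglongrightarrow> 0"
      using lim
    proof (rule eventually_mono)
      fix t assume "(\<lambda>n. \<sigma> n t) \<longlonglongrightarrow> F t"
      then have "(\<lambda>n. ennreal (norm (F t - \<sigma> n t))) \<longlonglongrightarrow> ennreal (norm (F t - F t))"
        by (intro tendsto_ennrealI tendsto_intros)
      then show "(\<lambda>n. ennreal (norm (F t - \<sigma> n t))) \<longlonglongrightarrow> 0" by simp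
    qed
    have "(\<integral>\<^sup>+ t. ennreal (3 * norm (F t)) \<partial>?M) \<le> (\<integral>\<^sup>+ t. (3 + 3 * ennreal (norm (F t) powr p)) \<partial>?M)"
    proof (rule nn_integral_mono)
      fix t
      \<comment> \<open>On an interval of finite length this makes the majorant integrable.\<close>
      have "norm (F t) \<le> 1 + norm (F t) powr p" using le_weighted_powr[of "norm (F t)" 1 p] p by simp
      then have "ennreal (3 * norm (F t)) \<le> ennreal (3 + 3 * norm (F t) powr p)" by (intro ennreal_leI) simp
      then show "ennreal (3 * norm (F t)) \<le> 3 + 3 * ennreal (norm (F t) powr p)"
        by (simp add: ennreal_mult)
    qed
    also have "\<dots> = 3 * ennreal T + 3 * Lp_norm_pow T p F"
      unfolding Lp_norm_pow_def using nF T
      by (subst nn_integral_add) (auto simp: nn_integral_cmult emeasure_restrict_space)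
    also have "\<dots> < \<infinity>" using Fp by (simp add: ennreal_mult_less_top ennreal_add_less_top)
    finally show "(\<integral>\<^sup>+ t. ennreal (3 * norm (F t)) \<partial>?M) < \<infinity>" .
  qed simp
  then show ?thesis using sf lim dom by (intro exI[of _ \<sigma>] conjI allI) simp_all
qed

section \<open>Hoelder continuity of Sobolev functions\<close>

lemma nn_integral_lebesgue_on_mono:
  assumes "R \<subseteq> S" "R \<in> sets lebesgue" "S \<in> sets lebesgue"
  shows "(\<integral>\<^sup>+ t. f t \<partial>lebesgue_on R) \<le> (\<integral>\<^sup>+ t. f t \<partial>lebesgue_on S)"
proof -
  have "(\<integral>\<^sup>+ t. f t \<partial>lebesgue_on R) = (\<integral>\<^sup>+ t. f t * indicator R t \<partial>lebesgue)"
    by (rule nn_integral_restrict_space) (use assms in simp)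
  also have "\<dots> \<le> (\<integral>\<^sup>+ t. f t * indicator S t \<partial>lebesgue)"
    using assms(1) by (intro nn_integral_mono) (auto simp: indicator_def)
  also have "\<dots> = (\<integral>\<^sup>+ t. f t \<partial>lebesgue_on S)"
    by (rule nn_integral_restrict_space[symmetric]) (use assms in simp)
  finally show ?thesis .
qed

lemma AE_lebesgue_on_subset:
  assumes "AE t in lebesgue_on S. P t" "R \<subseteq> S" "R \<in> sets lebesgue" "S \<in> sets lebesgue"
  shows "AE t in lebesgue_on R. P t"
proof -
  have "AE t in lebesgue. t \<in> S \<longrightarrow> P t" using assms(1,4) by (subst (asm) AE_restrict_space_iff) auto
  then have "AE t in lebesgue. t \<in> R \<longrightarrow> P t" by (rule eventually_mono) (use assms(2) in auto)
  then show ?thesis using assms(3) by (subst AE_restrict_space_iff) auto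
qed

text \<open>The choice \<open>c = (P / d) powr (1 / p)\<close> makes the two terms equal and
  recovers the multiplicative form of Hoelder's inequality.\<close>

lemma le_powr_of_le_weighted:
  fixes x d P p :: real
  assumes p: "1 < p" and d: "0 < d" and P: "0 \<le> P"
    and le: "\<And>c. 0 < c \<Longrightarrow> x \<le> 2 * (c * d + c powr (1 - p) * P)"
  shows "x \<le> 4 * P powr (1 / p) * d powr (1 - 1 / p)"
proof (cases "P = 0")
  case True
  have "x \<le> 0"
  proof (rule field_le_epsilon)
    fix e :: real assume "0 < e"
    then show "x \<le> 0 + e" using le[of "e / (2 * d)"] d True by simp
  qed
  then show ?thesis using True by simp
next
  case False
  then have P: "0 < P" using P by simp
  define c where "c = (P / d) powr (1 / p)"
  have c: "0 < c" using P d by (simp add: c_def)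
  have "c * d = P powr (1 / p) * d powr (1 - 1 / p)"
    using P d by (simp add: c_def powr_divide powr_diff)
  moreover have "c powr (1 - p) * P = P powr (1 / p) * d powr (1 - 1 / p)"
  proof -
    have "c powr (1 - p) = (P / d) powr (1 / p - 1)"
      using p by (simp add: c_def powr_powr right_diff_distrib diff_divide_distrib)
    also have "\<dots> = P powr (1 / p) / P * (d powr (1 - 1 / p))"
      using P d by (simp add: powr_divide powr_diff)
    finally show ?thesis using P by simp
  qed
  ultimately show ?thesis using le[OF c] by simp
qed

text \<open>One sequence of simple functions serves all upper limits \<open>t\<close> by
  restriction. Its integrals over \<open>{a..b}\<close> are estimated with
  \<open>le_weighted_powr\<close> before the limit is taken. In the constant 4, one factor 2 comes
  from the truncation of the simple functions and one from the two balanced terms.\<close>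

lemma sobolev_hoelder:
  fixes F :: "real \<Rightarrow> 'e::banach"
  assumes T: "0 < T" and p: "1 < p" and W: "sobolev_W1p T p F F'"
    and P: "0 \<le> P" "Lp_norm_pow T p F' \<le> ennreal P" and ab: "0 \<le> a" "a \<le> b" "b \<le> T"
  shows "norm (F b - F a) \<le> 4 * P powr (1 / p) * (b - a) powr (1 - 1 / p)"
proof -
  let ?M = "\<lambda>t. lebesgue_on {0<..<t}"
  have F': "F' \<in> Lp_space T p" using W by (simp add: sobolev_W1p_def)
  obtain F0 where F0: "\<And>t. t \<in> {0..T} \<Longrightarrow> F t = F0 + bochner_integral (?M t) F'"
    using W unfolding sobolev_W1p_def by blast
  obtain \<sigma> where \<sigma>: "\<And>n. simple_function (?M T) (\<sigma> n)"
    "AE t in ?M T. (\<lambda>n. \<sigma> n t) \<longlonglongrightarrow> F' t" "\<And>n t. norm (\<sigma> n t) \<le> 2 * norm (F' t)"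
    "(\<lambda>n. \<integral>\<^sup>+ t. ennreal (norm (F' t - \<sigma> n t)) \<partial>?M T) \<longlonglongrightarrow> 0"
    using Lp_simple_approximation[OF T less_imp_le[OF p] F'] by (elim exE conjE) (rule that; simp)
  define I where "I n t = integral {0..t} (\<sigma> n)" for n t
  define E where "E n = (\<integral>\<^sup>+ t. ennreal (norm (F' t - \<sigma> n t)) \<partial>?M T)" for n
  have sub: "{c<..<d} \<subseteq> {0<..<T}" if "0 \<le> c" "d \<le> T" for c d using that by auto
  have sfab: "simple_function (lebesgue_on {c<..<d}) (\<sigma> n)" if "0 \<le> c" "d \<le> T" for c d n
    by (rule simple_function_lebesgue_on_subset[OF \<sigma>(1) sub[OF that]]) auto
  have smab: "strongly_measurable (lebesgue_on {c<..<d}) F'" if "0 \<le> c" "d \<le> T" for c d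
    unfolding strongly_measurable_def
    by (intro exI[of _ \<sigma>] conjI allI sfab that AE_lebesgue_on_subset[OF \<sigma>(2) sub[OF that]]) auto
  have int: "\<sigma> n integrable_on {c..d}" if "0 \<le> c" "d \<le> T" for c d n
    using simple_has_integral_Ioo[OF sfab[OF that]] by blast
  have meas: "(\<lambda>t. ennreal (norm (F' t - \<sigma> n t))) \<in> borel_measurable (?M T)" for n
    by (intro measurable_compose[OF _ measurable_ennreal] strongly_measurable_norm_diff smab \<sigma>(1)) auto
  have le: "ennreal (norm (I n t - I m t)) \<le> E n + E m" if t: "t \<in> {0..T}" for n m t
  proof -
    have t': "0 \<le> (0::real)" "t \<le> T" using t by auto
    have "I n t - I m t = integral {0..t} (\<lambda>x. \<sigma> n x - \<sigma> m x)"
      unfolding I_def by (intro integral_diff[symmetric] int t')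
    then have "ennreal (norm (I n t - I m t)) \<le> (\<integral>\<^sup>+ x. ennreal (norm (\<sigma> n x - \<sigma> m x)) \<partial>?M t)"
      using norm_simple_integral_le[OF simple_function_compose2[OF sfab[OF t'] sfab[OF t']], of "(-)" n m] by simp
    also have "\<dots> \<le> (\<integral>\<^sup>+ x. ennreal (norm (\<sigma> n x - \<sigma> m x)) \<partial>?M T)"
      by (rule nn_integral_lebesgue_on_mono) (use t in auto)
    also have "\<dots> \<le> (\<integral>\<^sup>+ x. (ennreal (norm (F' x - \<sigma> n x)) + ennreal (norm (F' x - \<sigma> m x))) \<partial>?M T)"
    proof (rule nn_integral_mono)
      fix x
      have "norm (\<sigma> n x - \<sigma> m x) \<le> norm (F' x - \<sigma> n x) + norm (F' x - \<sigma> m x)" by norm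
      then show "ennreal (norm (\<sigma> n x - \<sigma> m x)) \<le> ennreal (norm (F' x - \<sigma> n x)) + ennreal (norm (F' x - \<sigma> m x))"
        by (simp add: ennreal_plus[symmetric] ennreal_leI del: ennreal_plus)
    qed
    also have "\<dots> = E n + E m" unfolding E_def by (intro nn_integral_add meas)
    finally show ?thesis .
  qed
  have conv: "\<exists>x. (\<lambda>n. I n t) \<longlonglongrightarrow> x" if t: "t \<in> {0..T}" for t
  proof -
    have "Cauchy (\<lambda>n. I n t)"
    proof (rule CauchyI)
      fix e :: real assume e: "0 < e"
      then have "0 < ennreal (e / 2)" by simp
      from order_tendstoD(2)[OF \<sigma>(4) this] obtain N where N: "\<And>n. N \<le> n \<Longrightarrow> E n < ennreal (e / 2)"
        unfolding E_def eventually_sequentially by blast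
      have "norm (I m t - I n t) < e" if "N \<le> m" "N \<le> n" for m n
      proof -
        have "ennreal (norm (I m t - I n t)) < ennreal (e / 2) + ennreal (e / 2)"
          by (rule le_less_trans[OF le[OF t] add_strict_mono[OF N[OF that(1)] N[OF that(2)]]])
        also have "\<dots> = ennreal e" using e by (simp add: ennreal_plus[symmetric] del: ennreal_plus)
        finally show ?thesis by (simp add: ennreal_less_iff)
      qed
      then show "\<exists>M. \<forall>m\<ge>M. \<forall>n\<ge>M. norm (I m t - I n t) < e" by blast
    qed
    then show ?thesis by (simp add: Cauchy_convergent_iff convergent_def)
  qed
  \<comment> \<open>The Cauchy limit of the integrals is the Bochner integral over
    \<open>{0<..<t}\<close>, because the \<open>L^1\<close> error on the shorter interval is at most
    the one on \<open>{0<..<T}\<close>.\<close>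
  have lim: "(\<lambda>n. I n t) \<longlonglongrightarrow> bochner_integral (?M t) F'" if t: "t \<in> {0..T}" for t
  proof -
    obtain x where x: "(\<lambda>n. I n t) \<longlonglongrightarrow> x" using conv[OF t] by blast
    have t': "0 \<le> (0::real)" "t \<le> T" using t by auto
    have "has_bochner (?M t) F' x"
      unfolding has_bochner_def
    proof (intro conjI exI[of _ \<sigma>] allI)
      show "strongly_measurable (?M t) F'" by (rule smab[OF t'])
      show "Bochner_Integration.simple_bochner_integrable (?M t) (\<sigma> n)" for n by (rule simple_bochner_integrable_Ioo[OF sfab[OF t']])
      show "(\<lambda>n. \<integral>\<^sup>+ x. ennreal (norm (F' x - \<sigma> n x)) \<partial>?M t) \<longlonglongrightarrow> 0"
        by (rule tendsto_sandwich[OF always_eventually always_eventually tendsto_const \<sigma>(4)])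
          (use t in \<open>auto intro!: nn_integral_lebesgue_on_mono\<close>)
      have "Bochner_Integration.simple_bochner_integral (?M t) (\<sigma> n) = I n t" for n
        unfolding I_def by (rule integral_unique[OF simple_has_integral_Ioo[OF sfab[OF t']], symmetric])
      then show "(\<lambda>n. Bochner_Integration.simple_bochner_integral (?M t) (\<sigma> n)) \<longlonglongrightarrow> x" using x by simp
    qed
    then show ?thesis using x bochner_integral_eqI by metis
  qed
  have Fdiff: "(\<lambda>n. norm (integral {a..b} (\<sigma> n))) \<longlonglongrightarrow> norm (F b - F a)"
  proof -
    have "I n b - I n a = integral {a..b} (\<sigma> n)" for n
      using Henstock_Kurzweil_Integration.integral_combine[OF ab(1,2) int[OF _ ab(3), of 0 n]]
      by (simp add: I_def algebra_simps)
    moreover have "(\<lambda>n. norm (I n b - I n a)) \<longlonglongrightarrow> norm (bochner_integral (?M b) F' - bochner_integral (?M a) F')"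
      using ab by (intro tendsto_intros lim) auto
    ultimately show ?thesis using F0[of a] F0[of b] ab by simp
  qed
  show ?thesis
  proof (cases "a = b")
    case True
    then show ?thesis by simp
  next
    case False
    then have d: "0 < b - a" using ab by simp
    have nF: "(\<lambda>t. norm (F' t)) \<in> borel_measurable (lebesgue_on {a<..<b})"
      using strongly_measurable_norm_diff[OF smab[OF ab(1,3)], of "\<lambda>_. 0"] by simp
    have "norm (F b - F a) \<le> 2 * (c * (b - a) + c powr (1 - p) * P)" if c: "0 < c" for c
    proof (rule tendsto_upperbound[OF Fdiff always_eventually])
      have nn: "0 \<le> 2 * (c * (b - a) + c powr (1 - p) * P)"
        using c d P(1) by (intro mult_nonneg_nonneg add_nonneg_nonneg) auto
      show "\<forall>n. norm (integral {a..b} (\<sigma> n)) \<le> 2 * (c * (b - a) + c powr (1 - p) * P)"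
      proof
        fix n
        have "ennreal (norm (integral {a..b} (\<sigma> n))) \<le> (\<integral>\<^sup>+ t. ennreal (norm (\<sigma> n t)) \<partial>lebesgue_on {a<..<b})"
          by (rule norm_simple_integral_le[OF sfab[OF ab(1,3)]])
        also have "\<dots> \<le> (\<integral>\<^sup>+ t. (ennreal (2 * c) + ennreal (2 * c powr (1 - p)) * ennreal (norm (F' t) powr p)) \<partial>lebesgue_on {a<..<b})"
        proof (rule nn_integral_mono)
          fix t
          have "norm (\<sigma> n t) \<le> 2 * c + 2 * c powr (1 - p) * norm (F' t) powr p"
            using \<sigma>(3)[of n t] le_weighted_powr[of "norm (F' t)" c p] c p by simp
          then show "ennreal (norm (\<sigma> n t)) \<le> ennreal (2 * c) + ennreal (2 * c powr (1 - p)) * ennreal (norm (F' t) powr p)"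
            using c by (simp add: ennreal_mult[symmetric] ennreal_plus[symmetric] ennreal_leI del: ennreal_plus)
        qed
        also have "\<dots> = ennreal (2 * c) * ennreal (b - a) +
          ennreal (2 * c powr (1 - p)) * (\<integral>\<^sup>+ t. ennreal (norm (F' t) powr p) \<partial>lebesgue_on {a<..<b})"
          using nF ab by (subst nn_integral_add) (auto simp: nn_integral_cmult emeasure_restrict_space)
        also have "(\<integral>\<^sup>+ t. ennreal (norm (F' t) powr p) \<partial>lebesgue_on {a<..<b}) \<le> ennreal P"
          by (rule order_trans[OF nn_integral_lebesgue_on_mono P(2)[unfolded Lp_norm_pow_def]])
            (use sub[OF ab(1,3)] in auto)
        finally have "ennreal (norm (integral {a..b} (\<sigma> n))) \<le>
          ennreal (2 * c) * ennreal (b - a) + ennreal (2 * c powr (1 - p)) * ennreal P"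
          by (simp add: add_left_mono mult_left_mono)
        also have "\<dots> = ennreal (2 * (c * (b - a) + c powr (1 - p) * P))"
          using c d P(1) by (simp add: ennreal_mult[symmetric] ennreal_plus[symmetric] algebra_simps del: ennreal_plus)
        finally show "norm (integral {a..b} (\<sigma> n)) \<le> 2 * (c * (b - a) + c powr (1 - p) * P)"
          unfolding ennreal_le_iff[OF nn] .
      qed
    qed simp
    then show ?thesis by (rule le_powr_of_le_weighted[OF p d P(1)])
  qed
qed

lemma continuous_on_hoelder:
  fixes F :: "real \<Rightarrow> 'e::real_normed_vector"
  assumes "0 < \<gamma>" "\<And>s t. s \<in> S \<Longrightarrow> t \<in> S \<Longrightarrow> norm (F t - F s) \<le> c * \<bar>t - s\<bar> powr \<gamma>"
  shows "continuous_on S F"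
  unfolding continuous_on_def
proof
  fix s assume s: "s \<in> S"
  have "((\<lambda>t. c * \<bar>t - s\<bar> powr \<gamma>) \<longlongrightarrow> c * \<bar>s - s\<bar> powr \<gamma>) (at s within S)"
    using assms(1) by (intro tendsto_intros) auto
  then have "((\<lambda>t. c * \<bar>t - s\<bar> powr \<gamma>) \<longlongrightarrow> 0) (at s within S)" using assms(1) by simp
  moreover have "\<forall>\<^sub>F t in at s within S. norm (F t - F s) \<le> c * \<bar>t - s\<bar> powr \<gamma>"
    using assms(2)[OF s] by (auto simp: eventually_at_filter)
  ultimately have "((\<lambda>t. F t - F s) \<longlongrightarrow> 0) (at s within S)" by (rule Lim_null_comparison[rotated])
  then show "(F \<longlongrightarrow> F s) (at s within S)" by (rule LIM_zero_cancel)
qed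

section \<open>Continuity for the topology of compact convergence on the strong dual\<close>

lemma compact_polydisc: "compact {\<theta> :: 'i \<Rightarrow> complex. \<forall>m. cmod (\<theta> m) \<le> 1}"
proof -
  have "compactin (product_topology (\<lambda>_. euclidean) UNIV) (Pi\<^sub>E (UNIV :: 'i set) (\<lambda>_. cball (0 :: complex) 1))"
    by (simp add: compactin_PiE compactin_euclidean_iff)
  moreover have "Pi\<^sub>E (UNIV :: 'i set) (\<lambda>_. cball (0 :: complex) 1) = {\<theta>. \<forall>m. cmod (\<theta> m) \<le> 1}"
    by (auto simp: PiE_def Pi_def)
  ultimately show ?thesis by (simp add: euclidean_product_topology[symmetric] compactin_euclidean_iff[symmetric])
qed

lemma normed_dual_bound:
  assumes X: "fun_subspace X" and N: "fun_seminorm X N" and \<eta>: "\<eta> \<in> normed_dual X N"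
  shows "\<exists>C\<ge>0. \<forall>x\<in>X. cmod (\<eta> x) \<le> C * N x"
proof -
  have P: "directed_seminorms X {N}" using N by (auto simp: directed_seminorms_def)
  have "topspace (seminorm_topology X {N}) = X"
    by (rule topspace_seminorm_topology[where \<rho> = N]) (simp_all add: fun_seminorm_zero[OF N X])
  then have "subtopology (seminorm_topology X {N}) X = seminorm_topology X {N}"
    by (metis subtopology_topspace)
  then have "\<eta> \<in> continuous_linear_maps (subtopology (seminorm_topology X {N}) X)"
    using \<eta> by (simp add: normed_dual_def)
  from continuous_linear_maps_bound[OF P X X order_refl this] show ?thesis by simp
qed

lemma dual_norm_le:
  assumes X: "fun_subspace X" and N: "N (\<lambda>_. 0) = 0" and e: "0 \<le> e" and le: "\<And>x. x \<in> X \<Longrightarrow> cmod (\<eta> x) \<le> e * N x"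
  shows "dual_norm X N \<eta> \<le> e"
  unfolding dual_norm_def
proof (rule cSUP_least)
  show "{\<phi> \<in> X. N \<phi> \<le> 1} \<noteq> {}" using fun_subspaceD(1)[OF X] N by force
  fix x assume x: "x \<in> {\<phi> \<in> X. N \<phi> \<le> 1}"
  then have "cmod (\<eta> x) \<le> e * N x" using le by simp
  also have "\<dots> \<le> e * 1" using x e by (intro mult_left_mono) auto
  finally show "cmod (\<eta> x) \<le> e" by simp
qed

text \<open>\<open>dual_norm\<close> is a supremum of reals, so boundedness has to be shown before
  its values can be compared; it comes from the boundedness of continuous functionals.\<close>

lemma dual_norm_triangle:
  assumes X: "fun_subspace X" and N: "fun_seminorm X N"
    and \<eta>: "\<eta> \<in> normed_dual X N" and \<zeta>: "\<zeta> \<in> normed_dual X N" and \<xi>: "\<xi> \<in> normed_dual X N"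
  shows "dual_norm X N (\<lambda>a. \<eta> a - \<xi> a) \<le> dual_norm X N (\<lambda>a. \<eta> a - \<zeta> a) + dual_norm X N (\<lambda>a. \<zeta> a - \<xi> a)"
proof -
  have bdd: "bdd_above ((\<lambda>x. cmod (\<eta> x - \<zeta> x)) ` {\<phi> \<in> X. N \<phi> \<le> 1})"
    if mem: "\<eta> \<in> normed_dual X N" "\<zeta> \<in> normed_dual X N" for \<eta> \<zeta>
  proof -
    obtain C D where CD: "0 \<le> C" "\<And>x. x \<in> X \<Longrightarrow> cmod (\<eta> x) \<le> C * N x" "0 \<le> D" "\<And>x. x \<in> X \<Longrightarrow> cmod (\<zeta> x) \<le> D * N x"
      using normed_dual_bound[OF X N mem(1)] normed_dual_bound[OF X N mem(2)] by blast
    have "cmod (\<eta> x - \<zeta> x) \<le> C + D" if x: "x \<in> X" "N x \<le> 1" for x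
    proof -
      have "cmod (\<eta> x - \<zeta> x) \<le> C * N x + D * N x"
        using norm_triangle_ineq4[of "\<eta> x" "\<zeta> x"] CD(2,4)[OF x(1)] by linarith
      also have "\<dots> \<le> C * 1 + D * 1" using x CD by (intro add_mono mult_left_mono) auto
      finally show ?thesis by simp
    qed
    then show ?thesis unfolding bdd_above_def by blast
  qed
  show ?thesis
    unfolding dual_norm_def[of X N "\<lambda>a. \<eta> a - \<xi> a"]
  proof (rule cSUP_least)
    show "{\<phi> \<in> X. N \<phi> \<le> 1} \<noteq> {}" using fun_subspaceD(1)[OF X] fun_seminorm_zero[OF N X] by force
    fix x assume x: "x \<in> {\<phi> \<in> X. N \<phi> \<le> 1}"
    have "cmod (\<eta> x - \<xi> x) \<le> cmod (\<eta> x - \<zeta> x) + cmod (\<zeta> x - \<xi> x)"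
      using norm_triangle_ineq[of "\<eta> x - \<zeta> x" "\<zeta> x - \<xi> x"] by simp
    also have "\<dots> \<le> dual_norm X N (\<lambda>a. \<eta> a - \<zeta> a) + dual_norm X N (\<lambda>a. \<zeta> a - \<xi> a)"
      unfolding dual_norm_def by (intro add_mono cSUP_upper x bdd \<eta> \<zeta> \<xi>)
    finally show "cmod (\<eta> x - \<xi> x) \<le> dual_norm X N (\<lambda>a. \<eta> a - \<zeta> a) + dual_norm X N (\<lambda>a. \<zeta> a - \<xi> a)" .
  qed
qed

text \<open>
  Functionals \<open>\<xi> m\<close> whose series converges unconditionally, uniformly on the unit ball, span a
  compact convex circled set \<open>{\<Sum>\<^sub>m \<theta>\<^sub>m \<xi>\<^sub>m | \<bar>\<theta>\<^sub>m\<bar> \<le> 1}\<close> in the strong dual.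
\<close>

locale unconditional_functionals =
  fixes X :: "('a \<Rightarrow> complex) set" and N :: "('a \<Rightarrow> complex) \<Rightarrow> real"
    and \<xi> :: "'i \<Rightarrow> ('a \<Rightarrow> complex) \<Rightarrow> complex"
  assumes X: "fun_subspace X" and N: "fun_seminorm X N"
    and linear: "x \<in> X \<Longrightarrow> y \<in> X \<Longrightarrow> \<xi> m (\<lambda>a. c * x a + y a) = c * \<xi> m x + \<xi> m y"
    and bounded: "\<exists>B\<ge>0. \<forall>x\<in>X. cmod (\<xi> m x) \<le> B * N x"
    and tail: "0 < e \<Longrightarrow> \<exists>J. finite J \<and> (\<forall>x\<in>X. \<forall>J'. finite J' \<longrightarrow> J' \<inter> J = {} \<longrightarrow> (\<Sum>m\<in>J'. cmod (\<xi> m x)) \<le> e * N x)"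
begin

definition combination :: "('i \<Rightarrow> complex) \<Rightarrow> ('a \<Rightarrow> complex) \<Rightarrow> complex"
  where "combination \<theta> x = (if x \<in> X then infsum (\<lambda>m. \<theta> m * \<xi> m x) UNIV else 0)"

definition coefficients :: "('i \<Rightarrow> complex) set"
  where "coefficients = {\<theta>. \<forall>m. cmod (\<theta> m) \<le> 1}"

lemma N_nonneg: "x \<in> X \<Longrightarrow> 0 \<le> N x"
  by (rule fun_seminorm_nonneg[OF N X])

text \<open>Tolerance 1 in the tail condition leaves finitely many indices, and these are bounded
  one by one.\<close>

lemma sum_bound: "\<exists>S\<ge>0. \<forall>x\<in>X. \<forall>J. finite J \<longrightarrow> (\<Sum>m\<in>J. cmod (\<xi> m x)) \<le> S * N x"
proof -
  obtain J where J: "finite J" "\<And>x J'. x \<in> X \<Longrightarrow> finite J' \<Longrightarrow> J' \<inter> J = {} \<Longrightarrow> (\<Sum>m\<in>J'. cmod (\<xi> m x)) \<le> 1 * N x"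
    using tail[of 1] by auto
  obtain B where B: "\<And>m. 0 \<le> B m" "\<And>m x. x \<in> X \<Longrightarrow> cmod (\<xi> m x) \<le> B m * N x"
    using bounded by metis
  have "(\<Sum>m\<in>I. cmod (\<xi> m x)) \<le> (sum B J + 1) * N x" if "x \<in> X" "finite I" for x I
  proof -
    have "(\<Sum>m\<in>I. cmod (\<xi> m x)) = (\<Sum>m\<in>I \<inter> J. cmod (\<xi> m x)) + (\<Sum>m\<in>I - J. cmod (\<xi> m x))"
      using that(2) by (rule sum.Int_Diff)
    also have "(\<Sum>m\<in>I \<inter> J. cmod (\<xi> m x)) \<le> (\<Sum>m\<in>J. cmod (\<xi> m x))"
      using J(1) by (intro sum_mono2) auto
    also have "\<dots> \<le> (\<Sum>m\<in>J. B m * N x)" using B that by (intro sum_mono) auto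
    also have "(\<Sum>m\<in>I - J. cmod (\<xi> m x)) \<le> 1 * N x" by (rule J(2)) (use that in auto)
    finally show ?thesis by (simp add: sum_distrib_right distrib_right)
  qed
  moreover have "0 \<le> sum B J + 1" using B(1) by (simp add: sum_nonneg add_nonneg_nonneg)
  ultimately show ?thesis by blast
qed

lemma summable_norms:
  assumes "x \<in> X"
  shows "(\<lambda>m. cmod (\<xi> m x)) summable_on UNIV"
proof -
  obtain S where "\<And>J. finite J \<Longrightarrow> (\<Sum>m\<in>J. cmod (\<xi> m x)) \<le> S * N x" using sum_bound assms by blast
  then show ?thesis by (intro nonneg_bdd_above_summable_on bdd_aboveI[of _ "S * N x"]) auto
qed

lemma summable_combination:
  assumes "x \<in> X" "\<And>m. cmod (\<theta> m) \<le> C"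
  shows "(\<lambda>m. \<theta> m * \<xi> m x) summable_on UNIV" "(\<lambda>m. cmod (\<theta> m * \<xi> m x)) summable_on UNIV"
proof -
  have "(\<lambda>m. C * cmod (\<xi> m x)) summable_on UNIV" by (intro summable_on_cmult_right summable_norms assms)
  then show "(\<lambda>m. cmod (\<theta> m * \<xi> m x)) summable_on UNIV"
    by (rule summable_on_comparison_test) (auto simp: norm_mult intro: mult_right_mono assms)
  then show "(\<lambda>m. \<theta> m * \<xi> m x) summable_on UNIV" by (rule abs_summable_summable)
qed

lemma combination_bound:
  assumes "x \<in> X" "\<And>m. cmod (\<theta> m) \<le> C" "\<And>J. finite J \<Longrightarrow> (\<Sum>m\<in>J. cmod (\<theta> m * \<xi> m x)) \<le> B"
  shows "cmod (combination \<theta> x) \<le> B"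
proof -
  have "cmod (combination \<theta> x) \<le> infsum (\<lambda>m. cmod (\<theta> m * \<xi> m x)) UNIV"
    unfolding combination_def using assms(1) norm_infsum_bound[OF summable_combination(2)[OF assms(1,2)]] by simp
  also have "\<dots> \<le> B"
    by (rule infsum_le_finite_sums[OF summable_combination(2)[OF assms(1,2)]]) (use assms(3) in auto)
  finally show ?thesis .
qed

lemma combination_linear:
  assumes "x \<in> X" "y \<in> X" "\<And>m. cmod (\<theta> m) \<le> C"
  shows "combination \<theta> (\<lambda>a. c * x a + y a) = c * combination \<theta> x + combination \<theta> y"
proof -
  have "(\<lambda>a. c * x a + y a) \<in> X" by (intro fun_subspaceD[OF X] assms)
  then have "combination \<theta> (\<lambda>a. c * x a + y a) = infsum (\<lambda>m. c * (\<theta> m * \<xi> m x) + \<theta> m * \<xi> m y) UNIV"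
    by (simp add: combination_def linear[OF assms(1,2)] distrib_left mult.left_commute)
  also have "\<dots> = infsum (\<lambda>m. c * (\<theta> m * \<xi> m x)) UNIV + infsum (\<lambda>m. \<theta> m * \<xi> m y) UNIV"
    by (intro infsum_add summable_on_cmult_right summable_combination(1)[OF _ assms(3)] assms(1,2))
  also have "\<dots> = c * combination \<theta> x + combination \<theta> y"
    using assms(1,2) by (simp add: combination_def infsum_cmult_right')
  finally show ?thesis .
qed

lemma combination_param_linear:
  assumes "\<And>m. cmod (\<theta> m) \<le> C" "\<And>m. cmod (\<eta> m) \<le> D"
  shows "combination (\<lambda>m. c * \<theta> m + d * \<eta> m) x = c * combination \<theta> x + d * combination \<eta> x"
proof (cases "x \<in> X")
  case True
  have "combination (\<lambda>m. c * \<theta> m + d * \<eta> m) x = infsum (\<lambda>m. c * (\<theta> m * \<xi> m x) + d * (\<eta> m * \<xi> m x)) UNIV"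
    using True by (simp add: combination_def algebra_simps)
  also have "\<dots> = infsum (\<lambda>m. c * (\<theta> m * \<xi> m x)) UNIV + infsum (\<lambda>m. d * (\<eta> m * \<xi> m x)) UNIV"
    by (intro infsum_add summable_on_cmult_right summable_combination(1)[OF True assms(1)]
        summable_combination(1)[OF True assms(2)])
  also have "\<dots> = c * combination \<theta> x + d * combination \<eta> x"
    using True by (simp add: combination_def infsum_cmult_right')
  finally show ?thesis .
qed (simp add: combination_def)

lemma combination_dual:
  assumes \<theta>: "\<theta> \<in> coefficients"
  shows "combination \<theta> \<in> normed_dual X N"
proof -
  have \<theta>': "cmod (\<theta> m) \<le> 1" for m using \<theta> by (simp add: coefficients_def)
  have N0: "N (\<lambda>_. 0) = 0" by (rule fun_seminorm_zero[OF N X])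
  have top: "topspace (seminorm_topology X {N}) = X" by (rule topspace_seminorm_topology[where \<rho> = N]) (simp_all add: N0)
  obtain S where S: "0 \<le> S" "\<And>x J. x \<in> X \<Longrightarrow> finite J \<Longrightarrow> (\<Sum>m\<in>J. cmod (\<xi> m x)) \<le> S * N x"
    using sum_bound by blast
  have bound: "cmod (combination \<theta> x) \<le> S * N x" if "x \<in> X" for x
  proof (rule combination_bound[OF that \<theta>'])
    fix J :: "'i set" assume "finite J"
    have "(\<Sum>m\<in>J. cmod (\<theta> m * \<xi> m x)) \<le> (\<Sum>m\<in>J. cmod (\<xi> m x))"
      by (intro sum_mono) (simp add: norm_mult mult_left_le_one_le \<theta>')
    then show "(\<Sum>m\<in>J. cmod (\<theta> m * \<xi> m x)) \<le> S * N x" using S(2)[OF that \<open>finite J\<close>] by linarith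
  qed
  note lin = combination_linear[OF _ _ \<theta>']
  have diff: "combination \<theta> (\<lambda>a. y a - x a) = combination \<theta> y - combination \<theta> x" if "x \<in> X" "y \<in> X" for x y
    using lin[OF that, where c = "-1"] by simp
  have z: "combination \<theta> (\<lambda>_. 0) = 0" using bound[OF fun_subspaceD(1)[OF X]] N0 by simp
  have "continuous_map (subtopology (seminorm_topology X {N}) X) euclidean (combination \<theta>)"
    by (rule continuous_map_seminorm_topology[where \<rho> = N and C = S])
      (auto simp: N0 S diff[symmetric] intro!: bound fun_subspace_diff[OF X])
  then have "continuous_map (seminorm_topology X {N}) euclidean (combination \<theta>)"
    using subtopology_topspace[of "seminorm_topology X {N}"] top by simp
  then show ?thesis
    unfolding normed_dual_def continuous_linear_maps_def mem_Collect_eq top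
    using lin[where c = 1] lin[OF _ fun_subspaceD(1)[OF X]] z
    by (auto simp: scaleC_complex_def combination_def)
qed

text \<open>The coefficients carry the product topology, whose neighbourhoods restrict only finitely
  many coordinates. The tail condition makes the remaining coordinates irrelevant up to a small
  error, uniformly on the unit ball.\<close>

lemma combination_continuous:
  "continuous_map (top_of_set coefficients) (strong_dual X N) combination"
  unfolding strong_dual_def seminorm_topology_def
proof (rule continuous_on_generated_topo)
  have N0: "N (\<lambda>_. 0) = 0" by (rule fun_seminorm_zero[OF N X])
  have dual0: "dual_norm X N (\<lambda>_. 0) \<le> 0"
    by (rule dual_norm_le[where N = N, OF X N0]) auto
  show "combination ` topspace (top_of_set coefficients) \<subseteq>
    \<Union> {{y \<in> normed_dual X N. \<rho> (\<lambda>a. y a - x a) < r} | x \<rho> r. x \<in> normed_dual X N \<and> \<rho> \<in> {dual_norm X N} \<and> 0 < r}"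
  proof clarsimp
    fix \<theta> assume "\<theta> \<in> coefficients"
    then have "combination \<theta> \<in> normed_dual X N" by (rule combination_dual)
    then show "\<exists>x. (\<exists>xa r. x = {y \<in> normed_dual X N. dual_norm X N (\<lambda>a. y a - xa a) < r} \<and>
      xa \<in> normed_dual X N \<and> 0 < r) \<and> combination \<theta> \<in> x"
      using dual0 by (intro exI[of _ "{y \<in> normed_dual X N. dual_norm X N (\<lambda>a. y a - combination \<theta> a) < 1}"])
        (auto intro!: exI[of _ "combination \<theta>"] exI[of _ 1])
  qed
  fix U assume "U \<in> {{y \<in> normed_dual X N. \<rho> (\<lambda>a. y a - x a) < r} | x \<rho> r.
    x \<in> normed_dual X N \<and> \<rho> \<in> {dual_norm X N} \<and> 0 < r}"
  then obtain \<eta> r where U: "U = {y \<in> normed_dual X N. dual_norm X N (\<lambda>a. y a - \<eta> a) < r}"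
    and \<eta>: "\<eta> \<in> normed_dual X N" and r: "0 < r" by blast
  have "\<exists>W. openin (top_of_set coefficients) W \<and> \<theta>0 \<in> W \<and> W \<subseteq> combination -` U \<inter> coefficients"
    if \<theta>0: "\<theta>0 \<in> combination -` U \<inter> coefficients" for \<theta>0
  proof -
    have \<theta>0c: "\<theta>0 \<in> coefficients" using \<theta>0 by simp
    define \<delta> where "\<delta> = r - dual_norm X N (\<lambda>a. combination \<theta>0 a - \<eta> a)"
    have \<delta>: "0 < \<delta>" using \<theta>0 by (simp add: \<delta>_def U)
    \<comment> \<open>Two coefficients differ by at most 2, so a tail of size
      \<open>\<delta> / 6\<close> contributes \<open>\<delta> / 3\<close>. The coordinates in
      \<open>J\<close> contribute another \<open>\<delta> / 3\<close>, and the sum stays below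
      \<open>\<delta>\<close>.\<close>
    obtain J where J: "finite J" "\<And>x J'. x \<in> X \<Longrightarrow> finite J' \<Longrightarrow> J' \<inter> J = {} \<Longrightarrow> (\<Sum>m\<in>J'. cmod (\<xi> m x)) \<le> (\<delta> / 6) * N x"
      using tail[of "\<delta> / 6"] \<delta> by auto
    obtain S where S: "0 \<le> S" "\<And>x J. x \<in> X \<Longrightarrow> finite J \<Longrightarrow> (\<Sum>m\<in>J. cmod (\<xi> m x)) \<le> S * N x"
      using sum_bound by blast
    define \<epsilon> where "\<epsilon> = \<delta> / (3 * (S + 1))"
    have \<epsilon>: "0 < \<epsilon>" "\<epsilon> * S \<le> \<delta> / 3" using \<delta> S(1) by (auto simp: \<epsilon>_def field_simps)
    define W where "W = coefficients \<inter> (\<Inter>m\<in>J. {\<theta>. cmod (\<theta> m - \<theta>0 m) < \<epsilon>})"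
    have "open (\<Inter>m\<in>J. {\<theta>. cmod (\<theta> m - \<theta>0 m) < \<epsilon>})"
      by (intro open_INT J(1) ballI open_Collect_less continuous_intros continuous_on_product_coordinates)
    then have "openin (top_of_set coefficients) W" unfolding W_def by (rule openin_open_Int)
    moreover have "\<theta>0 \<in> W" using \<theta>0c \<epsilon>(1) by (auto simp: W_def)
    moreover have "W \<subseteq> combination -` U \<inter> coefficients"
    proof
      fix \<theta> assume \<theta>: "\<theta> \<in> W"
      then have \<theta>c: "\<theta> \<in> coefficients" and near: "\<And>m. m \<in> J \<Longrightarrow> cmod (\<theta> m - \<theta>0 m) \<le> \<epsilon>"
        by (auto simp: W_def)
      have c1: "cmod (\<theta> m) \<le> 1" "cmod (\<theta>0 m) \<le> 1" for m
        using \<theta>c \<theta>0c by (auto simp: coefficients_def)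
      have c2: "cmod (1 * \<theta> m + (-1) * \<theta>0 m) \<le> 2" for m
        using norm_triangle_ineq4[of "\<theta> m" "\<theta>0 m"] c1[of m] by simp
      have "cmod (combination \<theta> x - combination \<theta>0 x) \<le> (2 * \<delta> / 3) * N x" if x: "x \<in> X" for x
      proof -
        have "combination \<theta> x - combination \<theta>0 x = combination (\<lambda>m. 1 * \<theta> m + (-1) * \<theta>0 m) x"
          using combination_param_linear[OF c1(1) c1(2), where c = 1 and d = "-1" and x = x] by simp
        also have "cmod \<dots> \<le> (2 * \<delta> / 3) * N x"
        proof (rule combination_bound[OF x c2])
          fix I :: "'i set" assume I: "finite I"
          have "(\<Sum>m\<in>I. cmod ((1 * \<theta> m + (-1) * \<theta>0 m) * \<xi> m x)) =
            (\<Sum>m\<in>I \<inter> J. cmod ((1 * \<theta> m + (-1) * \<theta>0 m) * \<xi> m x)) + (\<Sum>m\<in>I - J. cmod ((1 * \<theta> m + (-1) * \<theta>0 m) * \<xi> m x))"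
            using I by (rule sum.Int_Diff)
          also have "(\<Sum>m\<in>I \<inter> J. cmod ((1 * \<theta> m + (-1) * \<theta>0 m) * \<xi> m x)) \<le> (\<Sum>m\<in>I \<inter> J. \<epsilon> * cmod (\<xi> m x))"
            by (intro sum_mono) (auto simp: norm_mult intro!: mult_right_mono near)
          also have "\<dots> \<le> \<epsilon> * (S * N x)"
            unfolding sum_distrib_left[symmetric] using \<epsilon>(1) I x by (intro mult_left_mono S(2)) auto
          also have "\<dots> \<le> \<delta> / 3 * N x"
            using mult_right_mono[OF \<epsilon>(2) N_nonneg[OF x]] by (simp add: mult.assoc)
          also have "(\<Sum>m\<in>I - J. cmod ((1 * \<theta> m + (-1) * \<theta>0 m) * \<xi> m x)) \<le> (\<Sum>m\<in>I - J. 2 * cmod (\<xi> m x))"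
            unfolding norm_mult[of "_ + _"] by (intro sum_mono mult_right_mono c2) auto
          also have "\<dots> \<le> 2 * (\<delta> / 6 * N x)"
            unfolding sum_distrib_left[symmetric] using I x by (intro mult_left_mono J(2)) auto
          finally show "(\<Sum>m\<in>I. cmod ((1 * \<theta> m + (-1) * \<theta>0 m) * \<xi> m x)) \<le> (2 * \<delta> / 3) * N x"
            by simp
        qed
        finally show ?thesis .
      qed
      then have "dual_norm X N (\<lambda>a. combination \<theta> a - combination \<theta>0 a) \<le> 2 * \<delta> / 3"
        using \<delta> by (intro dual_norm_le[where N = N, OF X N0]) auto
      then have "dual_norm X N (\<lambda>a. combination \<theta> a - \<eta> a) \<le> 2 * \<delta> / 3 + (r - \<delta>)"
        using dual_norm_triangle[OF X N combination_dual[OF \<theta>c] combination_dual[OF \<theta>0c] \<eta>]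
        unfolding \<delta>_def by linarith
      then show "\<theta> \<in> combination -` U \<inter> coefficients"
        using \<delta> \<theta>c combination_dual[OF \<theta>c] by (simp add: U)
    qed
    ultimately show ?thesis by blast
  qed
  then have "openin (top_of_set coefficients) (combination -` U \<inter> coefficients)"
    by (subst openin_subopen) blast
  then show "openin (top_of_set coefficients) (combination -` U \<inter> topspace (top_of_set coefficients))" by simp
qed

lemma combinations_compact:
  "compactin (strong_dual X N) (combination ` coefficients)" "convex_circled (combination ` coefficients)"
proof -
  have "compactin (top_of_set coefficients) coefficients"
    using compact_polydisc by (simp add: compactin_subtopology coefficients_def)
  then show "compactin (strong_dual X N) (combination ` coefficients)"
    by (rule image_compactin[OF _ combination_continuous])
  show "convex_circled (combination ` coefficients)"
    unfolding convex_circled_def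
  proof (intro conjI ballI allI impI)
    fix \<xi>' \<eta> and t :: real
    assume "\<xi>' \<in> combination ` coefficients" "\<eta> \<in> combination ` coefficients" and t: "t \<in> {0..1}"
    then obtain \<theta> \<theta>' where *: "\<xi>' = combination \<theta>" "\<eta> = combination \<theta>'"
      "\<And>m. cmod (\<theta> m) \<le> 1" "\<And>m. cmod (\<theta>' m) \<le> 1" by (auto simp: coefficients_def)
    have "cmod (complex_of_real (1 - t) * \<theta> m + complex_of_real t * \<theta>' m) \<le> 1" for m
    proof -
      have "cmod (complex_of_real (1 - t) * \<theta> m + complex_of_real t * \<theta>' m) \<le>
        (1 - t) * cmod (\<theta> m) + t * cmod (\<theta>' m)"
        using t by (intro order_trans[OF norm_triangle_ineq] add_mono) (simp_all add: norm_mult del: of_real_diff)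
      also have "\<dots> \<le> (1 - t) * 1 + t * 1" using t *(3,4) by (intro add_mono mult_left_mono) auto
      finally show ?thesis by simp
    qed
    then show "(\<lambda>a. complex_of_real (1 - t) * \<xi>' a + complex_of_real t * \<eta> a) \<in> combination ` coefficients"
      unfolding *(1,2) combination_param_linear[OF *(3,4), symmetric]
      by (intro image_eqI[OF refl]) (simp add: coefficients_def)
  next
    fix \<xi>' and c :: complex assume "\<xi>' \<in> combination ` coefficients" and c: "cmod c \<le> 1"
    then obtain \<theta> where *: "\<xi>' = combination \<theta>" "\<And>m. cmod (\<theta> m) \<le> 1" by (auto simp: coefficients_def)
    have "(\<lambda>a. c * \<xi>' a) = combination (\<lambda>m. c * \<theta> m + 0 * \<theta> m)"
    proof
      fix a
      show "c * \<xi>' a = combination (\<lambda>m. c * \<theta> m + 0 * \<theta> m) a"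
        unfolding combination_param_linear[OF *(2) *(2), where c = c and d = 0 and x = a] by (simp add: *(1))
    qed
    moreover have "(\<lambda>m. c * \<theta> m + 0 * \<theta> m) \<in> coefficients"
      using *(2) c by (simp add: coefficients_def norm_mult mult_le_one)
    ultimately show "(\<lambda>a. c * \<xi>' a) \<in> combination ` coefficients" by blast
  qed
qed

text \<open>The set of combinations is among those defining the topology, and its seminorm dominates
  the absolute sum of the functionals: for each \<open>x\<close> the phases can be chosen so that
  all terms become nonnegative.\<close>

lemma c_topology_continuous:
  fixes v :: "('a \<Rightarrow> complex) \<Rightarrow> 'e::complex_banach"
  assumes lin: "\<And>x y c. x \<in> X \<Longrightarrow> y \<in> X \<Longrightarrow> v (\<lambda>a. c * x a + y a) = c *\<^sub>C v x + v y"
    and outside: "\<And>x. x \<notin> X \<Longrightarrow> v x = 0"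
    and C: "0 \<le> C" "\<And>x. x \<in> X \<Longrightarrow> norm (v x) \<le> C * infsum (\<lambda>m. cmod (\<xi> m x)) UNIV"
  shows "v \<in> continuous_linear_maps (c_topology X N)"
proof -
  define P where "P = {(\<lambda>\<phi>. SUP \<xi>\<in>K. cmod (\<xi> \<phi>)) | K. K \<noteq> {} \<and> compactin (strong_dual X N) K \<and> convex_circled K}"
  define \<rho> where "\<rho> \<phi> = (SUP \<xi>\<in>combination ` coefficients. cmod (\<xi> \<phi>))" for \<phi>
  have ne: "coefficients \<noteq> {}" by (auto simp: coefficients_def intro!: exI[of _ "\<lambda>_. 0"])
  have \<rho>P: "\<rho> \<in> P" unfolding P_def \<rho>_def[abs_def] using combinations_compact ne by blast
  have N0: "N (\<lambda>_. 0) = 0" by (rule fun_seminorm_zero[OF N X])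
  obtain S where S: "0 \<le> S" "\<And>x J. x \<in> X \<Longrightarrow> finite J \<Longrightarrow> (\<Sum>m\<in>J. cmod (\<xi> m x)) \<le> S * N x"
    using sum_bound by blast
  have bound: "cmod (combination \<theta> x) \<le> S * N x" if x: "x \<in> X" and \<theta>: "\<theta> \<in> coefficients" for x \<theta>
  proof (rule combination_bound[OF x])
    show \<theta>': "cmod (\<theta> m) \<le> 1" for m using \<theta> by (simp add: coefficients_def)
    fix J :: "'i set" assume "finite J"
    have "(\<Sum>m\<in>J. cmod (\<theta> m * \<xi> m x)) \<le> (\<Sum>m\<in>J. cmod (\<xi> m x))"
      by (intro sum_mono) (simp add: norm_mult mult_left_le_one_le \<theta>')
    then show "(\<Sum>m\<in>J. cmod (\<theta> m * \<xi> m x)) \<le> S * N x" using S(2)[OF x \<open>finite J\<close>] by linarith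
  qed
  have \<rho>0: "\<rho> (\<lambda>_. 0) = 0"
  proof -
    have "cmod (combination \<theta> (\<lambda>_. 0)) = 0" if "\<theta> \<in> coefficients" for \<theta>
      using bound[OF fun_subspaceD(1)[OF X] that] unfolding N0 by simp
    then have "(SUP \<theta>\<in>coefficients. cmod (combination \<theta> (\<lambda>_. 0))) = (SUP \<theta>\<in>coefficients. 0)"
      by (intro SUP_cong) auto
    then show ?thesis unfolding \<rho>_def image_image using ne by simp
  qed
  have key: "infsum (\<lambda>m. cmod (\<xi> m x)) UNIV \<le> \<rho> x" if x: "x \<in> X" for x
  proof -
    \<comment> \<open>Conjugate phases rotate every value \<open>\<xi> m x\<close> to its modulus.
      They depend on \<open>x\<close>, which is allowed because the seminorm is a supremum over all
      coefficients.\<close>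
    define \<theta> where "\<theta> m = cnj (sgn (\<xi> m x))" for m
    have \<theta>: "\<theta> \<in> coefficients" by (simp add: coefficients_def \<theta>_def norm_sgn)
    have "\<theta> m * \<xi> m x = complex_of_real (cmod (\<xi> m x))" for m
    proof (cases "\<xi> m x = 0")
      case False
      have "cnj (sgn z) * z = of_real (cmod z)" if "z \<noteq> 0" for z :: complex
        using that complex_norm_square[of z]
        by (simp add: sgn_eq field_simps power2_eq_square mult.commute)
      then show ?thesis using False by (simp add: \<theta>_def)
    qed simp
    then have "combination \<theta> x = infsum (\<lambda>m. complex_of_real (cmod (\<xi> m x))) UNIV"
      using x by (simp add: combination_def)
    also have "\<dots> = complex_of_real (infsum (\<lambda>m. cmod (\<xi> m x)) UNIV)"
      by (intro infsumI) (simp add: has_sum_of_real_iff summable_norms[OF x])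
    finally have "infsum (\<lambda>m. cmod (\<xi> m x)) UNIV = cmod (combination \<theta> x)"
      by (simp add: infsum_nonneg)
    also have "\<dots> \<le> \<rho> x"
      unfolding \<rho>_def
      by (rule cSUP_upper[where f = "\<lambda>\<xi>. cmod (\<xi> x)"])
        (use \<theta> bound[OF x] in \<open>auto intro!: bdd_aboveI[of _ "S * N x"]\<close>)
    finally show ?thesis .
  qed
  have top: "topspace (c_topology X N) = X"
    unfolding c_topology_def P_def[symmetric] by (rule topspace_seminorm_topology[OF \<rho>P \<rho>0])
  have diff: "v (\<lambda>a. y a - x a) = v y - v x" if "x \<in> X" "y \<in> X" for x y
    using lin[OF that, of "-1"] scaleC.minus_left[of 1 "v x"] by simp
  have "continuous_map (subtopology (c_topology X N) X) euclidean v"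
    unfolding c_topology_def P_def[symmetric]
  proof (rule continuous_map_seminorm_topology[OF \<rho>P \<rho>0 order_refl C(1)])
    fix x y assume xy: "x \<in> X" "y \<in> X"
    have d: "(\<lambda>a. y a - x a) \<in> X" by (rule fun_subspace_diff[OF X xy(2,1)])
    have "norm (v y - v x) \<le> C * infsum (\<lambda>m. cmod (\<xi> m (\<lambda>a. y a - x a))) UNIV"
      using C(2)[OF d] diff[OF xy] by simp
    also have "\<dots> \<le> C * \<rho> (\<lambda>a. y a - x a)" by (intro mult_left_mono key d C)
    finally show "norm (v y - v x) \<le> C * \<rho> (\<lambda>a. y a - x a)" .
  qed
  then have cont: "continuous_map (c_topology X N) euclidean v"
    using subtopology_topspace[of "c_topology X N"] top by simp
  have z: "v (\<lambda>_. 0) = 0" using lin[OF fun_subspaceD(1)[OF X] fun_subspaceD(1)[OF X], of 1] by simp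
  show ?thesis
    unfolding continuous_linear_maps_def mem_Collect_eq top
    using cont lin[where c = 1] lin[OF _ fun_subspaceD(1)[OF X]] z outside by auto
qed

end

subsection \<open>Dyadic functionals\<close>

definition cell :: "real \<Rightarrow> nat \<Rightarrow> nat \<Rightarrow> real set"
  where "cell T k i = {T * real i / 2 ^ k..T * real (Suc i) / 2 ^ k}"

lemma sum_double: "(\<Sum>i<2 * n. a i) = (\<Sum>i<n. a (2 * i) + a (Suc (2 * i)) :: 'b::comm_monoid_add)"
  by (induction n) (simp_all add: add.assoc)

lemma cell_subset:
  assumes "0 \<le> T" "i < 2 ^ k"
  shows "cell T k i \<subseteq> {0..T}"
proof -
  have "real (Suc i) \<le> real (2 ^ k)" using assms(2) by (simp only: of_nat_le_iff Suc_le_eq)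
  then have "T * real (Suc i) / 2 ^ k \<le> T" using assms(1) mult_left_mono[of "real (Suc i)" "2 ^ k" T]
    by (simp add: pos_divide_le_eq)
  moreover have "0 \<le> T * real i / 2 ^ k" using assms(1) by simp
  ultimately show ?thesis by (auto simp: cell_def)
qed

lemma cell_left_endpoint:
  assumes "0 \<le> T" "i < 2 ^ k"
  shows "T * real i / 2 ^ k \<in> {0..T}"
proof (rule subsetD[OF cell_subset[OF assms]])
  show "T * real i / 2 ^ k \<in> cell T k i"
    unfolding cell_def using assms(1) by (auto intro!: divide_right_mono mult_left_mono)
qed

lemma continuous_on_cell:
  assumes "0 \<le> T" "continuous_on {0..T} f" "i < 2 ^ k"
  shows "continuous_on (cell T k i) f"
  by (rule continuous_on_subset[OF assms(2) cell_subset[OF assms(1,3)]])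

lemma integrable_cell:
  fixes f :: "real \<Rightarrow> 'e::banach"
  assumes "0 \<le> T" "continuous_on {0..T} f" "i < 2 ^ k"
  shows "f integrable_on cell T k i"
  using integrable_continuous_real continuous_on_cell[OF assms] unfolding cell_def by blast

lemma integral_cells:
  fixes f :: "real \<Rightarrow> 'e::banach"
  assumes T: "0 \<le> T" and f: "continuous_on {0..T} f"
  shows "integral {0..T} f = (\<Sum>i<2 ^ k. integral (cell T k i) f)"
proof -
  have "integral {0..T * real m / 2 ^ k} f = (\<Sum>i<m. integral (cell T k i) f)" if "m \<le> 2 ^ k" for m
    using that
  proof (induction m)
    case (Suc m)
    have le: "T * real (Suc m) / 2 ^ k \<le> T" using cell_subset[OF T, of m k] Suc.prems T
      by (auto simp: cell_def divide_right_mono mult_left_mono)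
    have "integral {0..T * real m / 2 ^ k} f + integral {T * real m / 2 ^ k..T * real (Suc m) / 2 ^ k} f =
      integral {0..T * real (Suc m) / 2 ^ k} f"
    proof (rule Henstock_Kurzweil_Integration.integral_combine)
      show "0 \<le> T * real m / 2 ^ k" "T * real m / 2 ^ k \<le> T * real (Suc m) / 2 ^ k"
        using T by (auto intro!: divide_right_mono mult_left_mono)
      show "f integrable_on {0..T * real (Suc m) / 2 ^ k}"
        by (intro integrable_continuous_real continuous_on_subset[OF f]) (use le in auto)
    qed
    then show ?case using Suc by (simp add: cell_def)
  qed simp
  from this[of "2 ^ k"] show ?thesis by simp
qed

lemma integral_cell_split:
  fixes f :: "real \<Rightarrow> 'e::banach"
  assumes T: "0 \<le> T" and f: "continuous_on {0..T} f" and i: "i < 2 ^ k"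
  shows "integral (cell T k i) f = integral (cell T (Suc k) (2 * i)) f + integral (cell T (Suc k) (Suc (2 * i))) f"
proof -
  have e: "T * real (2 * i) / 2 ^ Suc k = T * real i / 2 ^ k"
    "T * real (Suc (Suc (2 * i))) / 2 ^ Suc k = T * real (Suc i) / 2 ^ k" by (simp_all add: field_simps)
  have "integral {T * real i / 2 ^ k..T * real (Suc (2 * i)) / 2 ^ Suc k} f +
    integral {T * real (Suc (2 * i)) / 2 ^ Suc k..T * real (Suc i) / 2 ^ k} f =
    integral {T * real i / 2 ^ k..T * real (Suc i) / 2 ^ k} f"
  proof (rule Henstock_Kurzweil_Integration.integral_combine)
    show "T * real i / 2 ^ k \<le> T * real (Suc (2 * i)) / 2 ^ Suc k"
      unfolding e(1)[symmetric] using T by (intro divide_right_mono mult_left_mono) auto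
    show "T * real (Suc (2 * i)) / 2 ^ Suc k \<le> T * real (Suc i) / 2 ^ k"
      unfolding e(2)[symmetric] using T by (intro divide_right_mono mult_left_mono) auto
    show "f integrable_on {T * real i / 2 ^ k..T * real (Suc i) / 2 ^ k}"
      using integrable_cell[OF T f i] by (simp add: cell_def)
  qed
  then show ?thesis unfolding cell_def e by simp
qed

text \<open>The pairing of \<open>\<psi>\<close> with the step function that takes, on each dyadic
  cell, the value of \<open>U\<close> at the left end.\<close>

definition dyadic_sum :: "real \<Rightarrow> (real \<Rightarrow> 'e::complex_banach) \<Rightarrow> (real \<Rightarrow> complex) \<Rightarrow> nat \<Rightarrow> 'e"
  where "dyadic_sum T U \<psi> k = (\<Sum>i<2 ^ k. integral (cell T k i) \<psi> *\<^sub>C U (T * real i / 2 ^ k))"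

text \<open>The left child of a cell shares its left end and hence its sample of \<open>U\<close>,
  so refinement changes only the contributions of the right children. These have the odd
  indices.\<close>

lemma dyadic_sum_step:
  assumes T: "0 \<le> T" and \<psi>: "continuous_on {0..T} \<psi>"
  shows "dyadic_sum T U \<psi> (Suc k) - dyadic_sum T U \<psi> k =
    (\<Sum>i<2 ^ k. integral (cell T (Suc k) (Suc (2 * i))) \<psi> *\<^sub>C
      (U (T * real (Suc (2 * i)) / 2 ^ Suc k) - U (T * real i / 2 ^ k)))"
proof -
  have e: "T * real (2 * i) / 2 ^ Suc k = T * real i / 2 ^ k" for i by simp
  have "dyadic_sum T U \<psi> (Suc k) = (\<Sum>i<2 ^ k. integral (cell T (Suc k) (2 * i)) \<psi> *\<^sub>C U (T * real i / 2 ^ k) +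
    integral (cell T (Suc k) (Suc (2 * i))) \<psi> *\<^sub>C U (T * real (Suc (2 * i)) / 2 ^ Suc k))"
    unfolding dyadic_sum_def power_Suc sum_double unfolding power_Suc[symmetric] e ..
  moreover have "dyadic_sum T U \<psi> k = (\<Sum>i<2 ^ k. integral (cell T (Suc k) (2 * i)) \<psi> *\<^sub>C U (T * real i / 2 ^ k) +
    integral (cell T (Suc k) (Suc (2 * i))) \<psi> *\<^sub>C U (T * real i / 2 ^ k))"
    unfolding dyadic_sum_def
    by (intro sum.cong refl) (simp add: integral_cell_split[OF T \<psi>] scaleC.add_left del: power_Suc)
  ultimately show ?thesis by (simp add: sum_subtractf[symmetric] scaleC.diff_right del: power_Suc)
qed

lemma dyadic_sum_step_norm:
  assumes T: "0 \<le> T" and \<psi>: "continuous_on {0..T} \<psi>" and \<gamma>: "0 < \<gamma>" and B: "0 \<le> B"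
    and U: "\<And>s t. s \<in> {0..T} \<Longrightarrow> t \<in> {0..T} \<Longrightarrow> norm (U t - U s) \<le> B * \<bar>t - s\<bar> powr \<gamma>"
  shows "norm (dyadic_sum T U \<psi> (Suc k) - dyadic_sum T U \<psi> k) \<le>
    T powr \<gamma> * (\<Sum>i<2 ^ k. B * ((1 / 2) powr \<gamma>) ^ k * cmod (integral (cell T (Suc k) (Suc (2 * i))) \<psi>))"
proof -
  have "norm (dyadic_sum T U \<psi> (Suc k) - dyadic_sum T U \<psi> k) \<le>
    (\<Sum>i<2 ^ k. T powr \<gamma> * (B * ((1 / 2) powr \<gamma>) ^ k * cmod (integral (cell T (Suc k) (Suc (2 * i))) \<psi>)))"
    unfolding dyadic_sum_step[OF T \<psi>]
  proof (rule sum_norm_le)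
    fix i :: nat assume i: "i \<in> {..<2 ^ k}"
    let ?t = "T * real (Suc (2 * i)) / 2 ^ Suc k" and ?s = "T * real i / 2 ^ k"
    have "?s = T * real (2 * i) / 2 ^ Suc k" by simp
    then have d: "?t - ?s = T / 2 ^ Suc k" by (simp only: diff_divide_distrib[symmetric] right_diff_distrib[symmetric]) simp
    have i2: "Suc (2 * i) < 2 ^ Suc k" using i by auto
    have ts: "?t \<in> {0..T}" "?s \<in> {0..T}"
      using cell_left_endpoint[OF T i2] cell_left_endpoint[OF T, of i k] i by auto
    have "norm (U ?t - U ?s) \<le> B * \<bar>?t - ?s\<bar> powr \<gamma>" by (rule U[OF ts(2,1)])
    \<comment> \<open>The offset is \<open>T / 2 ^ Suc k\<close>; rounding it up leaves the plain
      power \<open>\<rho> ^ k\<close> with \<open>\<rho> = (1 / 2) powr \<gamma>\<close>.\<close>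
    also have "\<dots> \<le> B * (T / 2 ^ k) powr \<gamma>"
      unfolding d using T B \<gamma> by (intro mult_left_mono powr_mono2) (auto simp: divide_left_mono)
    also have "(T / 2 ^ k) powr \<gamma> = T powr \<gamma> * ((1 / 2) powr \<gamma>) ^ k"
      using T by (simp add: powr_divide powr_power powr_realpow[symmetric] powr_powr power_divide mult.commute)
    finally have U': "norm (U ?t - U ?s) \<le> B * (T powr \<gamma> * ((1 / 2) powr \<gamma>) ^ k)" .
    show "norm (integral (cell T (Suc k) (Suc (2 * i))) \<psi> *\<^sub>C (U ?t - U ?s)) \<le>
      T powr \<gamma> * (B * ((1 / 2) powr \<gamma>) ^ k * cmod (integral (cell T (Suc k) (Suc (2 * i))) \<psi>))"
      unfolding norm_scaleC using mult_left_mono[OF U' norm_ge_zero[of "integral (cell T (Suc k) (Suc (2 * i))) \<psi>"]]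
      by (simp add: mult_ac del: power_Suc of_nat_Suc)
  qed
  then show ?thesis by (simp add: sum_distrib_left)
qed

lemma norm_integral_le_integral_norm:
  fixes f :: "real \<Rightarrow> 'e::banach"
  assumes "continuous_on {a..b} f"
  shows "norm (integral {a..b} f) \<le> integral {a..b} (\<lambda>t. norm (f t))"
  by (intro integral_norm_bound_integral integrable_continuous_real continuous_on_norm assms) auto

text \<open>On a cell of length \<open>T / 2 ^ k\<close> the sample of \<open>U\<close> is off by at
  most the Hoelder bound for that length, and the weights add up to the integral of the modulus of
  \<open>\<psi>\<close>.\<close>

lemma dyadic_sum_tendsto:
  assumes T: "0 \<le> T" and \<psi>: "continuous_on {0..T} \<psi>" and \<gamma>: "0 < \<gamma>" and B: "0 \<le> B"
    and U: "\<And>s t. s \<in> {0..T} \<Longrightarrow> t \<in> {0..T} \<Longrightarrow> norm (U t - U s) \<le> B * \<bar>t - s\<bar> powr \<gamma>"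
  shows "dyadic_sum T U \<psi> \<longlonglongrightarrow> integral {0..T} (\<lambda>t. \<psi> t *\<^sub>C U t)"
proof -
  have Uc: "continuous_on {0..T} U" by (rule continuous_on_hoelder[OF \<gamma> U])
  have \<psi>U: "continuous_on {0..T} (\<lambda>t. \<psi> t *\<^sub>C U t)" by (rule scaleC.continuous_on[OF \<psi> Uc])
  have \<psi>n: "continuous_on {0..T} (\<lambda>t. cmod (\<psi> t))" by (intro continuous_on_norm \<psi>)
  have "norm (dyadic_sum T U \<psi> k - integral {0..T} (\<lambda>t. \<psi> t *\<^sub>C U t)) \<le>
    B * (T / 2 ^ k) powr \<gamma> * integral {0..T} (\<lambda>t. cmod (\<psi> t))" for k
  proof -
    have "dyadic_sum T U \<psi> k - integral {0..T} (\<lambda>t. \<psi> t *\<^sub>C U t) =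
      (\<Sum>i<2 ^ k. integral (cell T k i) \<psi> *\<^sub>C U (T * real i / 2 ^ k) - integral (cell T k i) (\<lambda>t. \<psi> t *\<^sub>C U t))"
      unfolding integral_cells[OF T \<psi>U, of k] dyadic_sum_def by (simp add: sum_subtractf)
    also have "norm \<dots> \<le> (\<Sum>i<2 ^ k. B * (T / 2 ^ k) powr \<gamma> * integral (cell T k i) (\<lambda>t. cmod (\<psi> t)))"
    proof (rule sum_norm_le)
      fix i :: nat assume "i \<in> {..<2 ^ k}"
      then have i: "i < 2 ^ k" by simp
      let ?s = "T * real i / 2 ^ k"
      have ce: "cell T k i = {?s..T * real (Suc i) / 2 ^ k}" by (simp add: cell_def)
      have sT: "?s \<in> {0..T}" by (rule cell_left_endpoint[OF T i])
      have int: "\<psi> integrable_on cell T k i" "(\<lambda>t. \<psi> t *\<^sub>C U t) integrable_on cell T k i"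
        using integrable_cell[OF T \<psi> i] integrable_cell[OF T \<psi>U i] by auto
      have "integral (cell T k i) \<psi> *\<^sub>C U ?s = integral (cell T k i) (\<lambda>t. \<psi> t *\<^sub>C U ?s)"
        using integral_linear[OF int(1) scaleC.bounded_linear_left[of "U ?s"]] by (simp add: comp_def)
      moreover have "(\<lambda>t. \<psi> t *\<^sub>C U ?s) integrable_on cell T k i"
        using integrable_linear[OF int(1) scaleC.bounded_linear_left[of "U ?s"]] by (simp add: comp_def)
      ultimately have "integral (cell T k i) \<psi> *\<^sub>C U ?s - integral (cell T k i) (\<lambda>t. \<psi> t *\<^sub>C U t) =
        integral (cell T k i) (\<lambda>t. \<psi> t *\<^sub>C U ?s - \<psi> t *\<^sub>C U t)"
        by (simp add: integral_diff int(2))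
      also have "norm \<dots> \<le> integral (cell T k i) (\<lambda>t. B * (T / 2 ^ k) powr \<gamma> * cmod (\<psi> t))"
      proof (rule integral_norm_bound_integral)
        show "(\<lambda>t. \<psi> t *\<^sub>C U ?s - \<psi> t *\<^sub>C U t) integrable_on cell T k i"
          by (intro integrable_diff int(2) \<open>(\<lambda>t. \<psi> t *\<^sub>C U ?s) integrable_on cell T k i\<close>)
        show "(\<lambda>t. B * (T / 2 ^ k) powr \<gamma> * cmod (\<psi> t)) integrable_on cell T k i"
          by (intro integrable_cell[OF T _ i] continuous_intros \<psi>)
        fix t assume t: "t \<in> cell T k i"
        have tT: "t \<in> {0..T}" using t cell_subset[OF T i] by blast
        have "\<bar>?s - t\<bar> \<le> T / 2 ^ k"
        proof -
          have "T * real (Suc i) / 2 ^ k = ?s + T / 2 ^ k"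
            by (simp add: distrib_left add_divide_distrib add.commute)
          then show ?thesis using t unfolding ce by auto
        qed
        then have "\<bar>?s - t\<bar> powr \<gamma> \<le> (T / 2 ^ k) powr \<gamma>" using \<gamma> by (intro powr_mono2) auto
        then have Ub: "norm (U ?s - U t) \<le> B * (T / 2 ^ k) powr \<gamma>"
          using U[OF tT sT] mult_left_mono[OF _ B] order_trans by blast
        then show "norm (\<psi> t *\<^sub>C U ?s - \<psi> t *\<^sub>C U t) \<le> B * (T / 2 ^ k) powr \<gamma> * cmod (\<psi> t)"
          using mult_left_mono[OF Ub norm_ge_zero[of "\<psi> t"]]
          by (simp add: scaleC.diff_right[symmetric] norm_scaleC mult.commute)
      qed
      finally show "norm (integral (cell T k i) \<psi> *\<^sub>C U ?s - integral (cell T k i) (\<lambda>t. \<psi> t *\<^sub>C U t)) \<le>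
        B * (T / 2 ^ k) powr \<gamma> * integral (cell T k i) (\<lambda>t. cmod (\<psi> t))" by simp
    qed
    also have "\<dots> = B * (T / 2 ^ k) powr \<gamma> * integral {0..T} (\<lambda>t. cmod (\<psi> t))"
      unfolding integral_cells[OF T \<psi>n, of k] by (simp add: sum_distrib_left)
    finally show ?thesis .
  qed
  moreover have "(\<lambda>k. B * (T / 2 ^ k) powr \<gamma> * integral {0..T} (\<lambda>t. cmod (\<psi> t))) \<longlonglongrightarrow> 0"
  proof -
    have "(\<lambda>k. T * (1 / 2) ^ k) \<longlonglongrightarrow> T * 0" by (intro tendsto_mult tendsto_const LIMSEQ_power_zero) simp
    moreover have "(\<lambda>k. T * (1 / 2) ^ k) = (\<lambda>k. T / 2 ^ k)" by (simp add: power_divide)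
    ultimately have "(\<lambda>k. T / 2 ^ k) \<longlonglongrightarrow> 0" by simp
    then have "(\<lambda>k. (T / 2 ^ k) powr \<gamma>) \<longlonglongrightarrow> 0"
      by (rule tendsto_zero_powrI) (use \<gamma> T in auto)
    from tendsto_mult_left[OF this, of B] have "(\<lambda>k. B * (T / 2 ^ k) powr \<gamma>) \<longlonglongrightarrow> 0" by simp
    from tendsto_mult_right[OF this, of "integral {0..T} (\<lambda>t. cmod (\<psi> t))"] show ?thesis by simp
  qed
  ultimately have "(\<lambda>k. dyadic_sum T U \<psi> k - integral {0..T} (\<lambda>t. \<psi> t *\<^sub>C U t)) \<longlonglongrightarrow> 0"
    by (rule Lim_null_comparison[OF always_eventually, OF allI])
  then show ?thesis by (rule LIM_zero_cancel)
qed

lemma sum_odd_cells_le: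
  assumes T: "0 \<le> T" and \<psi>: "continuous_on {0..T} \<psi>"
  shows "(\<Sum>i<2 ^ k. cmod (integral (cell T (Suc k) (Suc (2 * i))) \<psi>)) \<le> integral {0..T} (\<lambda>t. cmod (\<psi> t))"
proof -
  have \<psi>n: "continuous_on {0..T} (\<lambda>t. cmod (\<psi> t))" by (intro continuous_on_norm \<psi>)
  have "(\<Sum>i<2 ^ k. cmod (integral (cell T (Suc k) (Suc (2 * i))) \<psi>)) \<le>
    (\<Sum>i<2 ^ k. integral (cell T (Suc k) (2 * i)) (\<lambda>t. cmod (\<psi> t)) + integral (cell T (Suc k) (Suc (2 * i))) (\<lambda>t. cmod (\<psi> t)))"
  proof (rule sum_mono)
    fix i :: nat assume i: "i \<in> {..<2 ^ k}"
    have i2: "Suc (2 * i) < 2 ^ Suc k" "2 * i < 2 ^ Suc k" using i by auto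
    have "cmod (integral (cell T (Suc k) (Suc (2 * i))) \<psi>) \<le> integral (cell T (Suc k) (Suc (2 * i))) (\<lambda>t. cmod (\<psi> t))"
      using norm_integral_le_integral_norm continuous_on_cell[OF T \<psi> i2(1)] unfolding cell_def by blast
    moreover have "0 \<le> integral (cell T (Suc k) (2 * i)) (\<lambda>t. cmod (\<psi> t))"
      by (intro integral_nonneg integrable_cell[OF T \<psi>n i2(2)]) auto
    ultimately show "cmod (integral (cell T (Suc k) (Suc (2 * i))) \<psi>) \<le>
      integral (cell T (Suc k) (2 * i)) (\<lambda>t. cmod (\<psi> t)) + integral (cell T (Suc k) (Suc (2 * i))) (\<lambda>t. cmod (\<psi> t))" by simp
  qed
  also have "\<dots> = integral {0..T} (\<lambda>t. cmod (\<psi> t))"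
    unfolding integral_cells[OF T \<psi>n, of "Suc k"] power_Suc sum_double by simp
  finally show ?thesis .
qed

lemma Young_simple:
  fixes x y p q :: real
  assumes "1 < p" "q = p / (p - 1)" "0 \<le> x" "0 \<le> y"
  shows "x * y \<le> x powr p + y powr q"
proof -
  have q: "1 < q" "1 / p + 1 / q = 1" using assms(1) by (simp_all add: assms(2) field_simps)
  have "x * y \<le> x powr p / p + y powr q / q" by (rule Youngs_inequality[OF assms(1) q assms(3,4)])
  moreover have "x powr p / p \<le> x powr p / 1" "y powr q / q \<le> y powr q / 1"
    using assms(1) q by (intro divide_left_mono; simp)+
  ultimately show ?thesis by linarith
qed

text \<open>Hoelder's inequality in the order, written additively through Young's inequality. The
  free parameter \<open>\<kappa>\<close> serves the tails: a large \<open>\<kappa>\<close> makes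
  \<open>\<kappa> powr (- q)\<close> small, and then a late enough tail of the \<open>p\<close>-th
  powers makes the other term small.\<close>

lemma DLr_weighted_sum:
  assumes T: "0 < T" and h: "0 < h" and p: "1 < p" "q = p / (p - 1)" and \<phi>: "\<phi> \<in> DLr_closure s T q h"
    and B: "\<And>\<alpha>. 0 \<le> B \<alpha>" and \<kappa>: "0 < \<kappa>" and A: "finite A"
  shows "(\<Sum>\<alpha>\<in>A. B \<alpha> * integral {0..T} (\<lambda>t. cmod (test_derivs T \<alpha> \<phi> t))) \<le>
    (T + 1) * (\<kappa> powr p * (\<Sum>\<alpha>\<in>A. (B \<alpha> * (fact \<alpha> powr s / h ^ \<alpha>)) powr p) + \<kappa> powr (- q)) * DLr_norm s T q h \<phi>"
proof -
  have q: "1 < q" using p(1) by (simp add: p(2) pos_less_divide_eq)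
  let ?N = "DLr_norm s T q h \<phi>"
  have flat: "\<phi> \<in> flat_functions T" by (rule DLr_closure_flat[OF T _ h \<phi>]) (use q in simp)
  have \<phi>s: "\<phi> \<in> DLr_space s T q h" using \<phi> DLr_closure_iff[OF T _ h] q by simp
  define I where "I \<alpha> = integral {0..T} (\<lambda>t. cmod (test_derivs T \<alpha> \<phi> t) powr q)" for \<alpha>
  define x where "x \<alpha> = I \<alpha> powr (1 / q)" for \<alpha>
  define w where "w \<alpha> = h ^ \<alpha> / fact \<alpha> powr s" for \<alpha>
  define y where "y \<alpha> = w \<alpha> * x \<alpha>" for \<alpha>
  define a where "a \<alpha> = B \<alpha> * (fact \<alpha> powr s / h ^ \<alpha>)" for \<alpha>
  have w: "0 < w \<alpha>" for \<alpha> using h by (simp add: w_def)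
  have c: "continuous_on {0..T} (\<lambda>t. cmod (test_derivs T \<alpha> \<phi> t) powr q)" for \<alpha>
    using q by (intro continuous_on_powr' continuous_on_norm flat_functionsD(2)[OF flat] continuous_on_const) auto
  have I0: "0 \<le> I \<alpha>" for \<alpha> unfolding I_def by (intro integral_nonneg integrable_continuous_real c) simp
  have Lp: "Lp_norm_pow T q (test_derivs T \<alpha> \<phi>) = ennreal (I \<alpha>)" for \<alpha>
    unfolding Lp_norm_pow_def I_def by (intro nn_integral_continuous_Ioo c) simp
  have xq: "x \<alpha> powr q = I \<alpha>" for \<alpha> using q I0 by (simp add: x_def powr_powr)
  have x0: "0 \<le> x \<alpha>" "0 \<le> y \<alpha>" "0 \<le> a \<alpha>" for \<alpha> using w[of \<alpha>] B h by (auto simp: x_def y_def a_def)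
  have yq: "y \<alpha> powr q = h powr (q * real \<alpha>) / fact \<alpha> powr (q * s) * I \<alpha>" for \<alpha>
  proof -
    have "w \<alpha> powr q = h powr (q * real \<alpha>) / fact \<alpha> powr (q * s)"
      using h by (simp add: w_def powr_divide powr_powr powr_realpow[symmetric] mult.commute)
    then show ?thesis using w[of \<alpha>] x0 by (simp add: y_def powr_mult xq less_imp_le)
  qed
  have te: "ennreal (y \<alpha> powr q) = ennreal (h powr (q * real \<alpha>) / fact \<alpha> powr (q * s)) * Lp_norm_pow T q (test_derivs T \<alpha> \<phi>)" for \<alpha>
    unfolding Lp yq by (rule ennreal_mult) (auto simp: I0)
  have "ennreal (\<Sum>\<alpha>\<in>A. y \<alpha> powr q) = (\<Sum>\<alpha>\<in>A. ennreal (h powr (q * real \<alpha>) / fact \<alpha> powr (q * s)) * Lp_norm_pow T q (test_derivs T \<alpha> \<phi>))"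
    unfolding te[symmetric] by (rule sum_ennreal[symmetric]) simp
  also have "\<dots> \<le> DLr_norm_pow s T q h \<phi>" unfolding DLr_norm_pow_def by (intro sum_le_suminf A) auto
  also have "\<dots> = ennreal (?N powr q)" by (rule DLr_norm_pow_eq[OF _ \<phi>s]) (use q in simp)
  finally have sumy: "(\<Sum>\<alpha>\<in>A. y \<alpha> powr q) \<le> ?N powr q" by (simp add: ennreal_le_iff)
  have le_term: "B \<alpha> * integral {0..T} (\<lambda>t. cmod (test_derivs T \<alpha> \<phi> t)) \<le> (T + 1) * (a \<alpha> * y \<alpha>)" for \<alpha>
  proof -
    have "integral {0..T} (\<lambda>t. cmod (test_derivs T \<alpha> \<phi> t)) \<le> (T - 0 + 1) * x \<alpha>"
      by (rule integral_le_powr_integral[of 0 T _ q])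
        (use T q x0 in \<open>auto simp: xq I_def intro!: continuous_on_norm flat_functionsD(2)[OF flat]\<close>)
    then have "B \<alpha> * integral {0..T} (\<lambda>t. cmod (test_derivs T \<alpha> \<phi> t)) \<le> B \<alpha> * ((T + 1) * x \<alpha>)"
      using B by (intro mult_left_mono) auto
    also have "B \<alpha> * x \<alpha> = a \<alpha> * y \<alpha>" using h by (simp add: a_def y_def w_def)
    then have "B \<alpha> * ((T + 1) * x \<alpha>) = (T + 1) * (a \<alpha> * y \<alpha>)" by (simp add: mult.left_commute)
    finally show ?thesis .
  qed
  have "(\<Sum>\<alpha>\<in>A. a \<alpha> * y \<alpha>) \<le> (\<kappa> powr p * (\<Sum>\<alpha>\<in>A. a \<alpha> powr p) + \<kappa> powr (- q)) * ?N"
  \<comment> \<open>Young's inequality is applied after division by the norm. If the norm is zero,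
    all \<open>y \<alpha>\<close> in the sum vanish.\<close>
  proof (cases "?N = 0")
    case True
    then have "(\<Sum>\<alpha>\<in>A. y \<alpha> powr q) = 0" using sumy q sum_nonneg[of A "\<lambda>\<alpha>. y \<alpha> powr q"] by simp
    then have "y \<alpha> = 0" if "\<alpha> \<in> A" for \<alpha> using that A by (subst (asm) sum_nonneg_eq_0_iff) auto
    then show ?thesis using True by simp
  next
    case False
    then have N: "0 < ?N" using DLr_norm_nonneg[of s T q h \<phi>] by linarith
    have "a \<alpha> * y \<alpha> \<le> (\<kappa> powr p * a \<alpha> powr p + \<kappa> powr (- q) * (y \<alpha> powr q / ?N powr q)) * ?N" for \<alpha>
    proof -
      have "(\<kappa> * a \<alpha>) * (y \<alpha> / (\<kappa> * ?N)) \<le> (\<kappa> * a \<alpha>) powr p + (y \<alpha> / (\<kappa> * ?N)) powr q"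
        using x0 \<kappa> N by (intro Young_simple p) auto
      also have "(\<kappa> * a \<alpha>) powr p = \<kappa> powr p * a \<alpha> powr p" using \<kappa> x0 by (simp add: powr_mult)
      also have "(y \<alpha> / (\<kappa> * ?N)) powr q = \<kappa> powr (- q) * (y \<alpha> powr q / ?N powr q)"
        using \<kappa> N x0 by (simp add: powr_divide powr_mult powr_minus field_simps)
      finally have "(\<kappa> * a \<alpha>) * (y \<alpha> / (\<kappa> * ?N)) * ?N \<le> (\<kappa> powr p * a \<alpha> powr p + \<kappa> powr (- q) * (y \<alpha> powr q / ?N powr q)) * ?N"
        using N by (intro mult_right_mono) auto
      then show ?thesis using \<kappa> N by simp
    qed
    then have "(\<Sum>\<alpha>\<in>A. a \<alpha> * y \<alpha>) \<le> (\<Sum>\<alpha>\<in>A. (\<kappa> powr p * a \<alpha> powr p + \<kappa> powr (- q) * (y \<alpha> powr q / ?N powr q)) * ?N)"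
      by (rule sum_mono)
    also have "\<dots> = (\<kappa> powr p * (\<Sum>\<alpha>\<in>A. a \<alpha> powr p) + \<kappa> powr (- q) * ((\<Sum>\<alpha>\<in>A. y \<alpha> powr q) / ?N powr q)) * ?N"
      by (simp add: sum_distrib_left sum_distrib_right sum.distrib sum_divide_distrib distrib_right)
    also have "\<dots> \<le> (\<kappa> powr p * (\<Sum>\<alpha>\<in>A. a \<alpha> powr p) + \<kappa> powr (- q) * 1) * ?N"
      using sumy N by (intro mult_right_mono add_left_mono mult_left_mono) (auto simp: divide_le_eq)
    finally show ?thesis by simp
  qed
  then have "(T + 1) * (\<Sum>\<alpha>\<in>A. a \<alpha> * y \<alpha>) \<le> (T + 1) * ((\<kappa> powr p * (\<Sum>\<alpha>\<in>A. a \<alpha> powr p) + \<kappa> powr (- q)) * ?N)"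
    using T by (intro mult_left_mono) auto
  moreover have "(\<Sum>\<alpha>\<in>A. B \<alpha> * integral {0..T} (\<lambda>t. cmod (test_derivs T \<alpha> \<phi> t))) \<le> (T + 1) * (\<Sum>\<alpha>\<in>A. a \<alpha> * y \<alpha>)"
    unfolding sum_distrib_left by (intro sum_mono le_term)
  ultimately show ?thesis unfolding a_def by (simp add: mult.assoc)
qed

text \<open>Indices with \<open>i \<ge> 2 ^ k\<close> are padded with the zero functional, so that
  sums run over the whole type of triples. The weights are the Hoelder constant of order
  \<open>\<alpha>\<close> and the decay of level \<open>k\<close>.\<close>

definition dyadic_functional :: "real \<Rightarrow> real \<Rightarrow> (nat \<Rightarrow> real) \<Rightarrow> nat \<times> nat \<times> nat \<Rightarrow> (real \<Rightarrow> complex) \<Rightarrow> complex"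
  where "dyadic_functional T \<rho> B = (\<lambda>(\<alpha>, k, i) \<phi>. if i < 2 ^ k
    then complex_of_real (B \<alpha> * \<rho> ^ k) * integral (cell T (Suc k) (Suc (2 * i))) (test_derivs T \<alpha> \<phi>) else 0)"

lemma sum_dyadic_indices:
  fixes g :: "nat \<times> nat \<times> nat \<Rightarrow> 'b::comm_monoid_add"
  assumes "finite Q"
  shows "(\<Sum>(\<alpha>, k)\<in>Q. \<Sum>i<2 ^ k. g (\<alpha>, k, i)) = sum g {(\<alpha>, k, i). (\<alpha>, k) \<in> Q \<and> i < 2 ^ k}"
    and "finite {(\<alpha>, k, i :: nat). (\<alpha>, k) \<in> Q \<and> i < 2 ^ k}"
proof -
  let ?S = "SIGMA q:Q. {..<2 ^ snd q :: nat}" and ?f = "\<lambda>((\<alpha>, k), i). (\<alpha>, k, i) :: nat \<times> nat \<times> nat"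
  have img: "{(\<alpha>, k, i). (\<alpha>, k) \<in> Q \<and> i < 2 ^ k} = ?f ` ?S" by force
  have inj: "inj_on ?f ?S" by (auto simp: inj_on_def)
  show "finite {(\<alpha>, k, i :: nat). (\<alpha>, k) \<in> Q \<and> i < 2 ^ k}" unfolding img using assms by simp
  have "sum g {(\<alpha>, k, i). (\<alpha>, k) \<in> Q \<and> i < 2 ^ k} = (\<Sum>x\<in>?S. g (?f x))"
    unfolding img by (simp add: sum.reindex[OF inj])
  also have "\<dots> = (\<Sum>q\<in>Q. \<Sum>i<2 ^ snd q. g (fst q, snd q, i))"
    by (subst sum.Sigma) (auto simp: assms case_prod_beta)
  finally show "(\<Sum>(\<alpha>, k)\<in>Q. \<Sum>i<2 ^ k. g (\<alpha>, k, i)) = sum g {(\<alpha>, k, i). (\<alpha>, k) \<in> Q \<and> i < 2 ^ k}"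
    by (simp add: case_prod_beta)
qed

lemma geometric_sum_le:
  fixes \<rho> :: real
  assumes "0 < \<rho>" "\<rho> < 1"
  shows "(\<Sum>k\<in>{m..<n}. \<rho> ^ k) \<le> \<rho> ^ m / (1 - \<rho>)"
proof (cases "m \<le> n")
  case True
  have "(1 - \<rho>) * (\<Sum>k\<in>{m..<n}. \<rho> ^ k) = \<rho> ^ m - \<rho> ^ n"
    using True by (induction rule: dec_induct) (simp_all add: distrib_left left_diff_distrib)
  then have "(\<Sum>k\<in>{m..<n}. \<rho> ^ k) = (\<rho> ^ m - \<rho> ^ n) / (1 - \<rho>)"
    using assms(2) by (simp add: eq_divide_eq mult.commute)
  also have "\<dots> \<le> \<rho> ^ m / (1 - \<rho>)" using assms by (intro divide_right_mono) auto
  finally show ?thesis .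
qed (use assms in simp)

lemma dyadic_functional_sum_le:
  assumes T: "0 \<le> T" and \<rho>: "0 < \<rho>" "\<rho> < 1" and B: "\<And>\<alpha>. 0 \<le> B \<alpha>" and \<phi>: "\<phi> \<in> flat_functions T" and Q: "finite Q"
  shows "(\<Sum>m\<in>{(\<alpha>, k, i). (\<alpha>, k) \<in> Q \<and> i < 2 ^ k}. cmod (dyadic_functional T \<rho> B m \<phi>)) \<le>
    (\<Sum>(\<alpha>, k)\<in>Q. \<rho> ^ k * (B \<alpha> * integral {0..T} (\<lambda>t. cmod (test_derivs T \<alpha> \<phi> t))))"
  unfolding sum_dyadic_indices(1)[OF Q, symmetric]
proof (intro sum_mono, clarify)
  fix \<alpha> k
  have "(\<Sum>i<2 ^ k. cmod (dyadic_functional T \<rho> B (\<alpha>, k, i) \<phi>)) =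
    \<rho> ^ k * (B \<alpha> * (\<Sum>i<2 ^ k. cmod (integral (cell T (Suc k) (Suc (2 * i))) (test_derivs T \<alpha> \<phi>))))"
    using \<rho> B by (simp add: dyadic_functional_def norm_mult norm_power sum_distrib_left abs_mult mult_ac del: power_Suc)
  also have "\<dots> \<le> \<rho> ^ k * (B \<alpha> * integral {0..T} (\<lambda>t. cmod (test_derivs T \<alpha> \<phi> t)))"
    using \<rho> B by (intro mult_left_mono sum_odd_cells_le T flat_functionsD(2)[OF \<phi>]) auto
  finally show "(\<Sum>i<2 ^ k. cmod (dyadic_functional T \<rho> B (\<alpha>, k, i) \<phi>)) \<le>
    \<rho> ^ k * (B \<alpha> * integral {0..T} (\<lambda>t. cmod (test_derivs T \<alpha> \<phi> t)))" .
qed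

text \<open>Tails are small for two reasons: in the order by \<open>p\<close>-summability of the
  weighted Hoelder constants, in the dyadic level by the factor \<open>\<rho> ^ k\<close>. On each
  level the cells are disjoint, so their contributions add up to at most one \<open>L^1\<close>
  norm.\<close>

lemma dyadic_unconditional:
  assumes T: "0 < T" and h: "0 < h" and p: "1 < p" "q = p / (p - 1)" and \<rho>: "0 < \<rho>" "\<rho> < 1"
    and B: "\<And>\<alpha>. 0 \<le> B \<alpha>" and summ: "summable (\<lambda>\<alpha>. (B \<alpha> * (fact \<alpha> powr s / h ^ \<alpha>)) powr p)"
  shows "unconditional_functionals (DLr_closure s T q h) (DLr_norm s T q h) (dyadic_functional T \<rho> B)"
proof
  have q: "1 < q" using p(1) by (simp add: p(2) pos_less_divide_eq)
  let ?X = "DLr_closure s T q h" and ?N = "DLr_norm s T q h"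
  note iff = DLr_closure_iff[OF T less_imp_le[OF q] h]
  have flat: "\<phi> \<in> flat_functions T" if "\<phi> \<in> ?X" for \<phi>
    by (rule DLr_closure_flat[OF T _ h that]) (use q in simp)
  show X: "fun_subspace ?X" by (rule fun_subspace_DLr_closure[OF T _ h]) (use q in simp)
  show "fun_seminorm ?X ?N"
    using fun_seminorm_DLr[of q s T h] q iff by (auto simp: fun_seminorm_def)
  have N0: "0 \<le> ?N \<phi>" for \<phi> by simp
  define a where "a \<alpha> = (B \<alpha> * (fact \<alpha> powr s / h ^ \<alpha>)) powr p" for \<alpha>
  have a0: "0 \<le> a \<alpha>" for \<alpha> by (simp add: a_def)
  define b where "b \<phi> \<alpha> = B \<alpha> * integral {0..T} (\<lambda>t. cmod (test_derivs T \<alpha> \<phi> t))" for \<phi> \<alpha>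
  have b0: "0 \<le> b \<phi> \<alpha>" if "\<phi> \<in> ?X" for \<phi> \<alpha>
    unfolding b_def by (intro mult_nonneg_nonneg B integral_nonneg integrable_continuous_real
        continuous_on_norm flat_functionsD(2)[OF flat[OF that]]) simp
  have wsum: "(\<Sum>\<alpha>\<in>A. b \<phi> \<alpha>) \<le> (T + 1) * (\<kappa> powr p * (\<Sum>\<alpha>\<in>A. a \<alpha>) + \<kappa> powr (- q)) * ?N \<phi>"
    if "\<phi> \<in> ?X" "finite A" "0 < \<kappa>" for \<phi> A \<kappa>
    using DLr_weighted_sum[OF T h p that(1), of B \<kappa> A] B that unfolding a_def b_def by blast
  define S where "S = (T + 1) * (suminf a + 1)"
  have sa: "summable a" unfolding a_def[abs_def] by (rule summ)
  have suma: "sum a A \<le> suminf a" if "finite A" for A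
    by (intro sum_le_suminf that sa a0)
  have total: "(\<Sum>\<alpha>\<in>A. b \<phi> \<alpha>) \<le> S * ?N \<phi>" if "\<phi> \<in> ?X" "finite A" for \<phi> A
  proof -
    have "(\<Sum>\<alpha>\<in>A. b \<phi> \<alpha>) \<le> (T + 1) * (1 powr p * (\<Sum>\<alpha>\<in>A. a \<alpha>) + 1 powr (- q)) * ?N \<phi>"
      by (rule wsum[OF that zero_less_one])
    also have "\<dots> \<le> S * ?N \<phi>"
      unfolding S_def using T suma[OF that(2)] by (intro mult_right_mono mult_left_mono) auto
    finally show ?thesis .
  qed
  have S0: "0 \<le> S" using T suma[of "{}"] by (simp add: S_def)
  have tails: "\<exists>n0. \<forall>\<phi>\<in>?X. \<forall>n. (\<Sum>\<alpha>\<in>{n0..<n}. b \<phi> \<alpha>) \<le> e * ?N \<phi>" if e: "0 < e" for e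
  proof -
    \<comment> \<open>The term with \<open>\<kappa> powr (- q)\<close> and the tail of
      \<open>a\<close>, multiplied by \<open>\<kappa> powr p\<close>, are each made at most
      \<open>E\<close>; together with the factor \<open>T + 1\<close> this gives
      \<open>e\<close>.\<close>
    define E where "E = e / (2 * (T + 1))"
    have E: "0 < E" using e T by (simp add: E_def)
    define \<kappa> where "\<kappa> = E powr (- 1 / q)"
    have \<kappa>: "0 < \<kappa>" "\<kappa> powr (- q) = E" using E q by (auto simp: \<kappa>_def powr_powr)
    define d where "d = E / \<kappa> powr p"
    have d: "0 < d" "\<kappa> powr p * d = E" using E \<kappa> by (auto simp: d_def)
    have "\<exists>n0. \<forall>m\<ge>n0. \<forall>n. norm (sum a {m..<n}) < d"
      by (rule sa[unfolded summable_Cauchy, rule_format, OF d(1)])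
    then obtain n0 where n0: "\<And>n. norm (sum a {n0..<n}) < d" by blast
    have "(\<Sum>\<alpha>\<in>{n0..<n}. b \<phi> \<alpha>) \<le> e * ?N \<phi>" if \<phi>: "\<phi> \<in> ?X" for \<phi> n
    proof -
      have "sum a {n0..<n} \<le> d" using n0[of n] by (simp add: abs_less_iff)
      then have "\<kappa> powr p * sum a {n0..<n} \<le> E"
        unfolding d(2)[symmetric] by (intro mult_left_mono) auto
      then have "(T + 1) * (\<kappa> powr p * sum a {n0..<n} + \<kappa> powr (- q)) \<le> (T + 1) * (E + E)"
        unfolding \<kappa>(2) using T by (intro mult_left_mono add_right_mono) auto
      also have "E + E = e / (T + 1)" using T by (simp add: E_def divide_simps)
      also have "(T + 1) * (e / (T + 1)) = e" using T by simp
      finally have "(T + 1) * (\<kappa> powr p * sum a {n0..<n} + \<kappa> powr (- q)) * ?N \<phi> \<le> e * ?N \<phi>"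
        by (rule mult_right_mono) simp
      then show ?thesis using wsum[OF \<phi> _ \<kappa>(1), of "{n0..<n}"] by simp
    qed
    then show ?thesis by (intro exI[of _ n0] ballI allI)
  qed
  show "dyadic_functional T \<rho> B m (\<lambda>t. c * \<phi> t + \<psi> t) = c * dyadic_functional T \<rho> B m \<phi> + dyadic_functional T \<rho> B m \<psi>"
    if xy: "\<phi> \<in> ?X" "\<psi> \<in> ?X" for \<phi> \<psi> m c
  proof -
    obtain \<alpha> k i where m: "m = (\<alpha>, k, i)" by (cases m) auto
    note fl = flat[OF xy(1)] flat[OF xy(2)]
    have "integral (cell T (Suc k) (Suc (2 * i))) (test_derivs T \<alpha> (\<lambda>t. c * \<phi> t + \<psi> t)) =
      c * integral (cell T (Suc k) (Suc (2 * i))) (test_derivs T \<alpha> \<phi>) + integral (cell T (Suc k) (Suc (2 * i))) (test_derivs T \<alpha> \<psi>)"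
    proof -
      have int: "test_derivs T \<alpha> \<phi> integrable_on cell T (Suc k) (Suc (2 * i))" if "\<phi> \<in> flat_functions T" for \<phi>
        unfolding cell_def by (intro integrable_continuous_real flat_functionsD(2) that)
      show ?thesis
        unfolding test_derivs_linear[OF fl[THEN flat_functionsD(1)]]
        using integral_add[OF integrable_on_mult_right[OF int[OF fl(1)], of c] int[OF fl(2)]] by simp
    qed
    then show ?thesis by (simp add: m dyadic_functional_def algebra_simps del: power_Suc)
  qed
  have single: "cmod (dyadic_functional T \<rho> B m \<phi>) \<le> S * ?N \<phi>" if \<phi>: "\<phi> \<in> ?X" for m \<phi>
  proof -
    obtain \<alpha> k i where m: "m = (\<alpha>, k, i)" by (cases m) auto
    show ?thesis
    proof (cases "i < 2 ^ k")
      case True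
      have T': "0 \<le> T" using T by simp
      have "cmod (dyadic_functional T \<rho> B m \<phi>) \<le>
        (\<Sum>m\<in>{(\<alpha>', k', i). (\<alpha>', k') \<in> {(\<alpha>, k)} \<and> i < 2 ^ k'}. cmod (dyadic_functional T \<rho> B m \<phi>))"
        using True sum_dyadic_indices(2)[of "{(\<alpha>, k)}"] by (intro member_le_sum) (auto simp: m)
      also have "\<dots> \<le> \<rho> ^ k * b \<phi> \<alpha>"
        using dyadic_functional_sum_le[where B = B, OF T' \<rho> B flat[OF \<phi>], of "{(\<alpha>, k)}"] by (simp add: b_def)
      also have "\<dots> \<le> 1 * b \<phi> \<alpha>" using \<rho> b0[OF \<phi>] by (intro mult_right_mono power_le_one) auto
      also have "\<dots> \<le> S * ?N \<phi>" using total[OF \<phi>, of "{\<alpha>}"] by simp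
      finally show ?thesis .
    next
      case False
      then show ?thesis using S0 by (simp add: m dyadic_functional_def)
    qed
  qed
  then show "\<exists>C\<ge>0. \<forall>\<phi>\<in>?X. cmod (dyadic_functional T \<rho> B m \<phi>) \<le> C * ?N \<phi>" for m using S0 by blast
  fix e :: real assume e: "0 < e"
  have r: "0 < 1 - \<rho>" using \<rho> by simp
  \<comment> \<open>Half of \<open>e\<close> for large orders and half for high levels; the factor
    \<open>1 - \<rho>\<close> cancels the sum of the geometric series.\<close>
  have e': "0 < e * (1 - \<rho>) / 2" using e r by simp
  obtain n0 where "\<forall>\<phi>\<in>?X. \<forall>n. (\<Sum>\<alpha>\<in>{n0..<n}. b \<phi> \<alpha>) \<le> (e * (1 - \<rho>) / 2) * ?N \<phi>"
    using tails[OF e'] by (elim exE)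
  note n0 = this[rule_format]
  have "0 < e * (1 - \<rho>) / 2 / (S + 1)" using e' S0 by simp
  then obtain k0 where k0: "\<rho> ^ k0 < e * (1 - \<rho>) / 2 / (S + 1)" using real_arch_pow_inv \<rho>(2) by blast
  define J where "J = {..<n0} \<times> {..<k0} \<times> {..<2 ^ k0 :: nat}"
  have "(\<Sum>m\<in>J'. cmod (dyadic_functional T \<rho> B m \<phi>)) \<le> e * ?N \<phi>"
    if \<phi>: "\<phi> \<in> ?X" and J': "finite J'" "J' \<inter> J = {}" for \<phi> J'
  proof -
    have fin: "finite (fst ` J')" "finite ((fst \<circ> snd) ` J')" using J'(1) by auto
    obtain n1 where n1: "\<And>m. m \<in> J' \<Longrightarrow> fst m < n1" using finite_nat_set_iff_bounded[THEN iffD1, OF fin(1)] by auto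
    obtain k1 where k1: "\<And>m. m \<in> J' \<Longrightarrow> fst (snd m) < k1" using finite_nat_set_iff_bounded[THEN iffD1, OF fin(2)] by auto
    \<comment> \<open>Outside the box \<open>J\<close>, a functional that is not padding has
      \<open>\<alpha> \<ge> n0\<close> or \<open>k \<ge> k0\<close>. The two strips cover these
      indices, cut off at \<open>n1\<close> and \<open>k1\<close> because \<open>J'\<close> is
      finite.\<close>
    define Q where "Q = {n0..<n1} \<times> {..<k1} \<union> {..<n1} \<times> {k0..<k1}"
    have Q: "finite Q" by (simp add: Q_def)
    let ?R = "{(\<alpha>, k, i :: nat). (\<alpha>, k) \<in> Q \<and> i < 2 ^ k}"
    have R: "finite ?R" by (rule sum_dyadic_indices(2)[OF Q])
    have out: "cmod (dyadic_functional T \<rho> B m \<phi>) = 0" if "m \<in> J' - ?R" for m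
    proof -
      obtain \<alpha> k i where m: "m = (\<alpha>, k, i)" by (cases m) auto
      have "\<not> i < 2 ^ k"
      proof
        assume i: "i < 2 ^ k"
        have "\<alpha> < n1" "k < k1" using n1[of m] k1[of m] that by (auto simp: m)
        then have "\<alpha> < n0" "k < k0" using that i by (auto simp: m Q_def not_le)
        moreover have "i < 2 ^ k0"
          using i power_increasing[OF less_imp_le[OF \<open>k < k0\<close>], of "2 :: nat"] by linarith
        ultimately have "m \<in> J" using i by (auto simp: m J_def)
        then show False using that J'(2) by blast
      qed
      then show ?thesis by (simp add: m dyadic_functional_def)
    qed
    have T': "0 \<le> T" using T by simp
    have "(\<Sum>m\<in>J'. cmod (dyadic_functional T \<rho> B m \<phi>)) = (\<Sum>m\<in>J' \<inter> ?R. cmod (dyadic_functional T \<rho> B m \<phi>)) +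
      (\<Sum>m\<in>J' - ?R. cmod (dyadic_functional T \<rho> B m \<phi>))" by (rule sum.Int_Diff[OF J'(1)])
    also have "(\<Sum>m\<in>J' - ?R. cmod (dyadic_functional T \<rho> B m \<phi>)) = 0" by (rule sum.neutral) (use out in blast)
    also have "(\<Sum>m\<in>J' \<inter> ?R. cmod (dyadic_functional T \<rho> B m \<phi>)) \<le> (\<Sum>m\<in>?R. cmod (dyadic_functional T \<rho> B m \<phi>))"
      by (rule sum_mono2[OF R]) auto
    also have "\<dots> \<le> (\<Sum>(\<alpha>, k)\<in>Q. \<rho> ^ k * b \<phi> \<alpha>)"
      unfolding b_def by (rule dyadic_functional_sum_le[OF T' \<rho> B flat[OF \<phi>] Q])
    also have "\<dots> \<le> (\<Sum>(\<alpha>, k)\<in>{n0..<n1} \<times> {..<k1}. \<rho> ^ k * b \<phi> \<alpha>) + (\<Sum>(\<alpha>, k)\<in>{..<n1} \<times> {k0..<k1}. \<rho> ^ k * b \<phi> \<alpha>)"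
      unfolding Q_def using \<rho> b0[OF \<phi>]
      by (subst sum.union_inter[symmetric]) (auto intro!: sum_nonneg simp: add_increasing2)
    also have "(\<Sum>(\<alpha>, k)\<in>{n0..<n1} \<times> {..<k1}. \<rho> ^ k * b \<phi> \<alpha>) = (\<Sum>\<alpha>\<in>{n0..<n1}. b \<phi> \<alpha>) * (\<Sum>k\<in>{0..<k1}. \<rho> ^ k)"
      unfolding sum_product sum.cartesian_product[symmetric] atLeast0LessThan by (intro sum.cong refl mult.commute)
    also have "(\<Sum>(\<alpha>, k)\<in>{..<n1} \<times> {k0..<k1}. \<rho> ^ k * b \<phi> \<alpha>) = (\<Sum>\<alpha><n1. b \<phi> \<alpha>) * (\<Sum>k\<in>{k0..<k1}. \<rho> ^ k)"
      unfolding sum_product sum.cartesian_product[symmetric] by (intro sum.cong refl mult.commute)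
    also have "(\<Sum>\<alpha>\<in>{n0..<n1}. b \<phi> \<alpha>) * (\<Sum>k\<in>{0..<k1}. \<rho> ^ k) \<le> ((e * (1 - \<rho>) / 2) * ?N \<phi>) * (\<rho> ^ 0 / (1 - \<rho>))"
      using \<rho> e' b0[OF \<phi>] by (intro mult_mono n0[OF \<phi>] geometric_sum_le sum_nonneg mult_nonneg_nonneg) auto
    also have "(\<Sum>\<alpha><n1. b \<phi> \<alpha>) * (\<Sum>k\<in>{k0..<k1}. \<rho> ^ k) \<le> (S * ?N \<phi>) * (\<rho> ^ k0 / (1 - \<rho>))"
      using \<rho> S0 by (intro mult_mono total[OF \<phi>] geometric_sum_le sum_nonneg mult_nonneg_nonneg) auto
    also have "(S * ?N \<phi>) * (\<rho> ^ k0 / (1 - \<rho>)) \<le> (e / 2) * ?N \<phi>"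
    proof -
      have "S * \<rho> ^ k0 \<le> (S + 1) * (e * (1 - \<rho>) / 2 / (S + 1))" using k0 S0 \<rho> by (intro mult_mono) auto
      also have "\<dots> = e * (1 - \<rho>) / 2"
        using S0 by (intro nonzero_mult_div_cancel_left[of "S + 1", folded times_divide_eq_right]) simp
      finally have "S * \<rho> ^ k0 / (1 - \<rho>) \<le> e / 2" using r by (simp add: pos_divide_le_eq)
      then have "(S * \<rho> ^ k0 / (1 - \<rho>)) * ?N \<phi> \<le> (e / 2) * ?N \<phi>" by (rule mult_right_mono) simp
      then show ?thesis by (simp add: mult_ac)
    qed
    also have "((e * (1 - \<rho>) / 2) * ?N \<phi>) * (\<rho> ^ 0 / (1 - \<rho>)) = (e / 2) * ?N \<phi>"
    proof -
      have "((e * d / 2) * ?N \<phi>) * (\<rho> ^ 0 / d) = (e / 2) * ?N \<phi>" if "0 < d" for d using that by simp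
      from this[OF r] show ?thesis .
    qed
    finally show ?thesis by simp
  qed
  moreover have "finite J" by (simp add: J_def)
  ultimately show "\<exists>J. finite J \<and> (\<forall>\<phi>\<in>?X. \<forall>J'. finite J' \<longrightarrow> J' \<inter> J = {} \<longrightarrow>
    (\<Sum>m\<in>J'. cmod (dyadic_functional T \<rho> B m \<phi>)) \<le> e * ?N \<phi>)" by blast
qed

text \<open>Telescoping over the dyadic levels bounds finitely many pairings at finite depth by a
  finite sum of moduli of dyadic functionals. The depth tends to infinity before the number of
  orders does, so the infinite sum dominates the whole series. The factor
  \<open>T powr \<gamma>\<close> stays outside the functionals.\<close>

lemma series_ultradist_Lp:
  fixes U :: "nat \<Rightarrow> real \<Rightarrow> 'e::complex_banach"
  assumes T: "0 < T" and h: "0 < h" and p: "1 < p"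
    and B: "\<And>\<alpha>. 0 \<le> B \<alpha>" and summ: "summable (\<lambda>\<alpha>. (B \<alpha> * (fact \<alpha> powr s / h ^ \<alpha>)) powr p)"
    and U0: "\<And>\<alpha>. U \<alpha> 0 = 0"
    and U: "\<And>\<alpha> r t. r \<in> {0..T} \<Longrightarrow> t \<in> {0..T} \<Longrightarrow> norm (U \<alpha> t - U \<alpha> r) \<le> B \<alpha> * \<bar>t - r\<bar> powr (1 - 1 / p)"
    and u: "u = (\<lambda>\<phi>. if \<phi> \<in> Bdot s T then suminf (pairing T U \<phi>) else 0)" and uL1: "u \<in> ultradist_L1 s T"
  shows "u \<in> ultradist_Lp s T p h"
proof -
  define q where "q = p / (p - 1)"
  have q: "1 < q" using p by (simp add: q_def field_simps)
  let ?X = "DLr_closure s T q h"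
  define \<gamma> where "\<gamma> = 1 - 1 / p"
  have \<gamma>: "0 < \<gamma>" using p by (simp add: \<gamma>_def)
  define \<rho> where "\<rho> = (1 / 2 :: real) powr \<gamma>"
  have \<rho>: "0 < \<rho>" "\<rho> < 1" using \<gamma> powr_less_mono'[of "1 / 2" 0 \<gamma>] by (auto simp: \<rho>_def)
  have T': "0 \<le> T" using T by simp
  interpret unconditional_functionals ?X "DLr_norm s T q h" "dyadic_functional T \<rho> B"
    by (rule dyadic_unconditional[OF T h p q_def \<rho> B summ])
  have flat: "\<phi> \<in> flat_functions T" if "\<phi> \<in> ?X" for \<phi>
    by (rule DLr_closure_flat[OF T _ h that]) (use q in simp)
  note U\<gamma> = U[folded \<gamma>_def]
  have Uc: "continuous_on {0..T} (U \<alpha>)" for \<alpha> by (rule continuous_on_hoelder[OF \<gamma> U\<gamma>])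
  define I where "I \<phi> = infsum (\<lambda>m. cmod (dyadic_functional T \<rho> B m \<phi>)) UNIV" for \<phi>
  have lim: "(\<lambda>k. (-1) ^ \<alpha> *\<^sub>R dyadic_sum T (U \<alpha>) (test_derivs T \<alpha> \<phi>) k) \<longlonglongrightarrow> pairing T U \<phi> \<alpha>" if "\<phi> \<in> ?X" for \<phi> \<alpha>
    unfolding pairing_def
    by (intro tendsto_scaleR tendsto_const dyadic_sum_tendsto[OF T' _ \<gamma> B[of \<alpha>] U\<gamma>] flat_functionsD(2) flat that)
  have part: "(\<Sum>\<alpha>\<in>A. norm (pairing T U \<phi> \<alpha>)) \<le> T powr \<gamma> * I \<phi>" if \<phi>: "\<phi> \<in> ?X" and A: "finite A" for \<phi> A
  proof (rule tendsto_upperbound[OF tendsto_sum[OF tendsto_norm[OF lim[OF \<phi>]]] always_eventually])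
    show "\<forall>k. (\<Sum>\<alpha>\<in>A. norm ((-1) ^ \<alpha> *\<^sub>R dyadic_sum T (U \<alpha>) (test_derivs T \<alpha> \<phi>) k)) \<le> T powr \<gamma> * I \<phi>"
    proof
      fix K
      have le: "norm (dyadic_sum T (U \<alpha>) (test_derivs T \<alpha> \<phi>) K) \<le>
        (\<Sum>k<K. T powr \<gamma> * (\<Sum>i<2 ^ k. cmod (dyadic_functional T \<rho> B (\<alpha>, k, i) \<phi>)))" for \<alpha>
      proof -
        let ?D = "dyadic_sum T (U \<alpha>) (test_derivs T \<alpha> \<phi>)"
        \<comment> \<open>The level 0 sum samples \<open>U \<alpha>\<close> at time 0 only; its
          vanishing there lets the telescoping sum start from nothing.\<close>
        have "?D 0 = 0" by (simp add: dyadic_sum_def U0 scaleC.zero_right)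
        then have "?D K = (\<Sum>k<K. ?D (Suc k) - ?D k)" by (simp add: sum_lessThan_telescope)
        also have "norm \<dots> \<le> (\<Sum>k<K. T powr \<gamma> * (\<Sum>i<2 ^ k. cmod (dyadic_functional T \<rho> B (\<alpha>, k, i) \<phi>)))"
        proof (rule sum_norm_le)
          fix k
          have "norm (?D (Suc k) - ?D k) \<le> T powr \<gamma> * (\<Sum>i<2 ^ k. B \<alpha> * ((1 / 2) powr \<gamma>) ^ k *
            cmod (integral (cell T (Suc k) (Suc (2 * i))) (test_derivs T \<alpha> \<phi>)))"
            by (rule dyadic_sum_step_norm[OF T' flat_functionsD(2)[OF flat[OF \<phi>]] \<gamma> B U\<gamma>])
          then show "norm (?D (Suc k) - ?D k) \<le> T powr \<gamma> * (\<Sum>i<2 ^ k. cmod (dyadic_functional T \<rho> B (\<alpha>, k, i) \<phi>))"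
            using \<rho> B by (simp add: dyadic_functional_def norm_mult norm_power abs_mult \<rho>_def[symmetric] del: power_Suc)
        qed
        finally show ?thesis .
      qed
      have "(\<Sum>\<alpha>\<in>A. norm ((-1) ^ \<alpha> *\<^sub>R dyadic_sum T (U \<alpha>) (test_derivs T \<alpha> \<phi>) K)) \<le>
        (\<Sum>\<alpha>\<in>A. \<Sum>k<K. T powr \<gamma> * (\<Sum>i<2 ^ k. cmod (dyadic_functional T \<rho> B (\<alpha>, k, i) \<phi>)))"
        using le by (intro sum_mono) simp
      also have "\<dots> = T powr \<gamma> * (\<Sum>(\<alpha>, k)\<in>A \<times> {..<K}. \<Sum>i<2 ^ k. cmod (dyadic_functional T \<rho> B (\<alpha>, k, i) \<phi>))"
        by (simp add: sum.cartesian_product[symmetric] sum_distrib_left)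
      also have "\<dots> \<le> T powr \<gamma> * I \<phi>"
        unfolding I_def
        by (subst sum_dyadic_indices(1), simp add: A,
            intro mult_left_mono finite_sum_le_infsum summable_norms \<phi> sum_dyadic_indices(2)) (auto simp: A)
      finally show "(\<Sum>\<alpha>\<in>A. norm ((-1) ^ \<alpha> *\<^sub>R dyadic_sum T (U \<alpha>) (test_derivs T \<alpha> \<phi>) K)) \<le> T powr \<gamma> * I \<phi>" .
    qed
  qed simp
  have summp: "summable (\<lambda>\<alpha>. norm (pairing T U \<phi> \<alpha>))" if "\<phi> \<in> ?X" for \<phi>
    by (rule summableI_nonneg_bounded[of _ "T powr \<gamma> * I \<phi>"]) (auto intro: part that)
  \<comment> \<open>The same series, now on the larger space \<open>DLr_closure\<close>;
    \<open>u\<close> is its restriction to \<open>Bdot\<close>.\<close>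
  define v where "v \<phi> = (if \<phi> \<in> ?X then suminf (pairing T U \<phi>) else 0)" for \<phi>
  have sums: "pairing T U \<phi> sums v \<phi>" if "\<phi> \<in> ?X" for \<phi>
    using summable_sums[OF summable_norm_cancel[OF summp[OF that]]] that by (simp add: v_def)
  have "v \<in> continuous_linear_maps (c_topology ?X (DLr_norm s T q h))"
  proof (rule c_topology_continuous)
    show "v (\<lambda>a. c * x a + y a) = c *\<^sub>C v x + v y" if xy: "x \<in> ?X" "y \<in> ?X" for x y c
    proof -
      have "(\<lambda>\<alpha>. c *\<^sub>C pairing T U x \<alpha> + pairing T U y \<alpha>) sums (c *\<^sub>C v x + v y)"
        by (intro sums_add sums bounded_linear.sums[OF scaleC.bounded_linear_right] xy)
      moreover have "pairing T U (\<lambda>a. c * x a + y a) = (\<lambda>\<alpha>. c *\<^sub>C pairing T U x \<alpha> + pairing T U y \<alpha>)"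
        by (rule ext) (rule pairing_linear[OF Uc flat[OF xy(1)] flat[OF xy(2)]])
      moreover have "(\<lambda>a. c * x a + y a) \<in> ?X" by (intro fun_subspaceD[OF X] xy)
      ultimately show ?thesis using sums[of "\<lambda>a. c * x a + y a"] sums_unique2 by simp
    qed
    show "v x = 0" if "x \<notin> ?X" for x using that by (simp add: v_def)
    show "0 \<le> T powr \<gamma>" by simp
    show "norm (v x) \<le> T powr \<gamma> * infsum (\<lambda>m. cmod (dyadic_functional T \<rho> B m x)) UNIV" if x: "x \<in> ?X" for x
    proof -
      have "norm (v x) \<le> (\<Sum>\<alpha>. norm (pairing T U x \<alpha>))"
        using x summable_norm[OF summp[OF x]] by (simp add: v_def)
      also have "\<dots> \<le> T powr \<gamma> * I x" by (rule suminf_le_const[OF summp[OF x]]) (rule part[OF x], simp)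
      finally show ?thesis by (simp add: I_def)
    qed
  qed
  then have "v \<in> ultradist_Lp_full s T p h" by (simp add: ultradist_Lp_full_def Let_def q_def)
  moreover have "u \<phi> = v \<phi>" if "\<phi> \<in> Bdot s T" for \<phi>
    using Bdot_DLr_closure[OF T _ h that, of q] q that by (simp add: u v_def)
  ultimately show ?thesis using uL1 by (auto simp: ultradist_Lp_def)
qed

section \<open>Conjugate-linear extension to functionals\<close>

text \<open>
  For a form \<open>ip\<close> on a space that need not be complete, functionals are represented
  by vectors only approximately; \<open>extension\<close> carries \<open>f\<close> over from the representing vectors to
  the functionals.
\<close>

locale form_dominated_map =
  fixes V :: "('a \<Rightarrow> complex) set" and ip :: "('a \<Rightarrow> complex) \<Rightarrow> ('a \<Rightarrow> complex) \<Rightarrow> complex"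
    and f :: "('a \<Rightarrow> complex) \<Rightarrow> 'e::complex_banach" and C :: real
  assumes V: "fun_subspace V"
    and ip_left: "x \<in> V \<Longrightarrow> y \<in> V \<Longrightarrow> z \<in> V \<Longrightarrow> ip (\<lambda>a. c * x a + y a) z = c * ip x z + ip y z"
    and ip_commute: "x \<in> V \<Longrightarrow> y \<in> V \<Longrightarrow> ip y x = cnj (ip x y)"
    and ip_nonneg: "x \<in> V \<Longrightarrow> 0 \<le> Re (ip x x)"
    and f_linear: "x \<in> V \<Longrightarrow> y \<in> V \<Longrightarrow> f (\<lambda>a. c * x a + y a) = c *\<^sub>C f x + f y"
    and C: "0 \<le> C" and f_bound: "x \<in> V \<Longrightarrow> norm (f x) \<le> C * sqrt (Re (ip x x))"
begin

definition nrm :: "('a \<Rightarrow> complex) \<Rightarrow> real"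
  where "nrm x = sqrt (Re (ip x x))"

lemma V_linear: "x \<in> V \<Longrightarrow> y \<in> V \<Longrightarrow> (\<lambda>a. c * x a + y a) \<in> V"
  by (intro fun_subspaceD[OF V])

lemma nrm_nonneg: "x \<in> V \<Longrightarrow> 0 \<le> nrm x"
  by (simp add: nrm_def ip_nonneg)

lemma nrm_square: "x \<in> V \<Longrightarrow> (nrm x)\<^sup>2 = Re (ip x x)"
  by (simp add: nrm_def ip_nonneg)

lemma ip_right:
  assumes "x \<in> V" "y \<in> V" "z \<in> V"
  shows "ip z (\<lambda>a. c * x a + y a) = cnj c * ip z x + ip z y"
  using ip_left[OF assms, of c] ip_commute[OF V_linear[OF assms(1,2)] assms(3)]
    ip_commute[OF assms(1,3)] ip_commute[OF assms(2,3)] by simp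

lemma nrm_square_linear:
  assumes "x \<in> V" "y \<in> V"
  shows "(nrm (\<lambda>a. c * x a + y a))\<^sup>2 = (cmod c)\<^sup>2 * (nrm x)\<^sup>2 + 2 * Re (c * ip x y) + (nrm y)\<^sup>2"
proof -
  note xy = V_linear[OF assms]
  have "ip (\<lambda>a. c * x a + y a) (\<lambda>a. c * x a + y a) =
    c * (cnj c * ip x x + ip x y) + (cnj c * ip y x + ip y y)"
    unfolding ip_left[OF assms xy] ip_right[OF assms assms(1)] ip_right[OF assms assms(2)] ..
  then have "ip (\<lambda>a. c * x a + y a) (\<lambda>a. c * x a + y a) =
    (c * cnj c) * ip x x + (c * ip x y + cnj (c * ip x y)) + ip y y"
    unfolding ip_commute[OF assms] by (simp add: distrib_left del: complex_mult_cnj)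
  then show ?thesis
    by (simp add: nrm_square assms xy complex_add_cnj complex_norm_square[symmetric] del: complex_mult_cnj)
qed

text \<open>The vector stands in the second slot of the form: \<open>\<ll>\<close> is linear, while
  its representing vector depends on it conjugate-linearly. The error is relative to
  \<open>nrm\<close>, which may vanish on nonzero vectors.\<close>

definition approximates :: "('a \<Rightarrow> complex) \<Rightarrow> (('a \<Rightarrow> complex) \<Rightarrow> complex) \<Rightarrow> real \<Rightarrow> bool"
  where "approximates v \<ll> e \<longleftrightarrow> v \<in> V \<and> 0 \<le> e \<and> (\<forall>x\<in>V. cmod (ip x v - \<ll> x) \<le> e * nrm x)"

definition representable :: "(('a \<Rightarrow> complex) \<Rightarrow> complex) \<Rightarrow> bool"
  where "representable \<ll> \<longleftrightarrow> (\<forall>e>0. \<exists>v. approximates v \<ll> e)"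

text \<open>Characterised by all approximate representing vectors at once, hence free of any choice
  of a sequence; the completeness of the range supplies the value.\<close>

definition extension :: "(('a \<Rightarrow> complex) \<Rightarrow> complex) \<Rightarrow> 'e"
  where "extension \<ll> = (THE y. \<forall>v e. approximates v \<ll> e \<longrightarrow> norm (f v - y) \<le> C * e)"

lemma approximates_V: "approximates v \<ll> e \<Longrightarrow> v \<in> V"
  by (simp add: approximates_def)

text \<open>An almost minimiser of \<open>\<bar>v\<bar>\<^sup>2 - 2 Re (\<ll> v)\<close> almost represents \<open>\<ll>\<close>.\<close>

lemma bounded_representable:
  assumes lin: "\<And>x y c. x \<in> V \<Longrightarrow> y \<in> V \<Longrightarrow> \<ll> (\<lambda>a. c * x a + y a) = c * \<ll> x + \<ll> y"
    and bound: "\<And>x. x \<in> V \<Longrightarrow> cmod (\<ll> x) \<le> B * nrm x"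
  shows "representable \<ll>"
  unfolding representable_def
proof (intro allI impI)
  fix e :: real assume e: "0 < e"
  define Q where "Q v = (nrm v)\<^sup>2 - 2 * Re (\<ll> v)" for v
  have low: "- B\<^sup>2 \<le> Q v" if "v \<in> V" for v
  proof -
    have "Re (\<ll> v) \<le> B * nrm v" using bound[OF that] complex_Re_le_cmod[of "\<ll> v"] by linarith
    moreover have "0 \<le> (nrm v - B)\<^sup>2" by simp
    ultimately show ?thesis by (simp add: Q_def power2_diff mult.commute)
  qed
  have bdd: "bdd_below (Q ` V)" using low by (intro bdd_belowI[of _ "- B\<^sup>2"]) auto
  have ne: "Q ` V \<noteq> {}" using fun_subspaceD(1)[OF V] by blast
  have "Inf (Q ` V) < Inf (Q ` V) + e\<^sup>2" using e by simp
  then obtain v where v: "v \<in> V" "Q v < Inf (Q ` V) + e\<^sup>2"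
    unfolding cInf_less_iff[OF ne bdd] by blast
  have "cmod (ip x v - \<ll> x) \<le> e * nrm x" if x: "x \<in> V" for x
  proof -
    define D where "D = ip x v - \<ll> x"
    \<comment> \<open>The almost minimiser is moved in the direction \<open>x\<close>, with the
      phase that decreases the functional fastest. The real factor \<open>r\<close> is chosen
      afterwards: \<open>1 / (nrm x)\<^sup>2\<close> in general and
      \<open>e\<^sup>2 / (cmod D)\<^sup>2\<close> where \<open>nrm x\<close> vanishes.\<close>
    have ineq: "2 * r * (cmod D)\<^sup>2 \<le> r\<^sup>2 * (cmod D)\<^sup>2 * (nrm x)\<^sup>2 + e\<^sup>2" for r
    proof -
      define z where "z = - (complex_of_real r * cnj D)"
      have zD: "z * D = complex_of_real (- (r * (cmod D)\<^sup>2))"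
        unfolding of_real_minus of_real_mult complex_norm_square by (simp add: z_def mult_ac)
      have nz: "(cmod z)\<^sup>2 = r\<^sup>2 * (cmod D)\<^sup>2" by (simp add: z_def norm_mult power_mult_distrib)
      have "Q (\<lambda>a. z * x a + v a) = (cmod z)\<^sup>2 * (nrm x)\<^sup>2 + 2 * Re (z * D) + Q v"
        unfolding Q_def nrm_square_linear[OF x v(1)] lin[OF x v(1)] D_def by (simp add: algebra_simps)
      moreover have "Inf (Q ` V) \<le> Q (\<lambda>a. z * x a + v a)"
        by (intro cINF_lower bdd V_linear x v(1))
      ultimately show ?thesis using v(2) unfolding zD nz by simp
    qed
    have "cmod D \<le> e * nrm x"
    proof (cases "nrm x = 0")
      case True
      have "D = 0"
      proof (rule ccontr)
        assume "D \<noteq> 0"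
        then have "2 * e\<^sup>2 \<le> e\<^sup>2" using ineq[of "e\<^sup>2 / (cmod D)\<^sup>2"] by (simp add: True)
        then show False using e by simp
      qed
      then show ?thesis using True by simp
    next
      case False
      then have n: "0 < nrm x" using nrm_nonneg[OF x] by simp
      have "2 * (1 / (nrm x)\<^sup>2) * (cmod D)\<^sup>2 \<le> (1 / (nrm x)\<^sup>2) * (cmod D)\<^sup>2 + e\<^sup>2"
        using ineq[of "1 / (nrm x)\<^sup>2"] n by (simp add: power2_eq_square)
      then have "(cmod D)\<^sup>2 / (nrm x)\<^sup>2 \<le> e\<^sup>2" by simp
      then have "(cmod D)\<^sup>2 \<le> (e * nrm x)\<^sup>2" using n by (simp add: pos_divide_le_eq power_mult_distrib)
      then show ?thesis using e n by (simp add: power2_le_iff_abs_le)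
    qed
    then show ?thesis by (simp add: D_def)
  qed
  then show "\<exists>v. approximates v \<ll> e" using v(1) e by (auto simp: approximates_def)
qed

text \<open>Testing with the difference \<open>v - w\<close> itself bounds the square of its norm by
  \<open>d + e\<close> times its norm.\<close>

lemma approximates_dist:
  assumes v: "approximates v \<ll> d" and w: "approximates w \<ll> e"
  shows "norm (f v - f w) \<le> C * (d + e)"
proof -
  note vw = approximates_V[OF v] approximates_V[OF w]
  let ?x = "\<lambda>a. (- 1) * w a + v a"
  have x: "?x \<in> V" by (rule V_linear[OF vw(2,1)])
  have "ip ?x ?x = (ip ?x v - \<ll> ?x) - (ip ?x w - \<ll> ?x)"
    using ip_right[OF vw(2,1) x, of "- 1"] by simp
  then have "cmod (ip ?x ?x) \<le> cmod (ip ?x v - \<ll> ?x) + cmod (ip ?x w - \<ll> ?x)" by (simp only: norm_triangle_ineq4)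
  also have "\<dots> \<le> d * nrm ?x + e * nrm ?x" using v w x unfolding approximates_def by (intro add_mono) blast+
  finally have "(nrm ?x)\<^sup>2 \<le> (d + e) * nrm ?x"
    unfolding nrm_square[OF x] distrib_right using complex_Re_le_cmod[of "ip ?x ?x"] by linarith
  then have "nrm ?x \<le> d + e"
    using nrm_nonneg[OF x] v w by (cases "nrm ?x = 0") (auto simp: power2_eq_square approximates_def)
  have "norm (f v - f w) = norm (f ?x)" using f_linear[OF vw(2,1), of "- 1"] by (simp add: scaleC.minus_left)
  also have "\<dots> \<le> C * nrm ?x" using f_bound[OF x] by (simp add: nrm_def)
  also have "\<dots> \<le> C * (d + e)" by (rule mult_left_mono[OF \<open>nrm ?x \<le> d + e\<close> C])
  finally show ?thesis .
qed

text \<open>Only the images under \<open>f\<close> have to converge, and they do so in a complete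
  space. The representing vectors need not have a limit in \<open>V\<close>.\<close>

lemma approximates_extension:
  assumes \<ll>: "representable \<ll>" and w: "approximates w \<ll> e"
  shows "norm (f w - extension \<ll>) \<le> C * e"
proof -
  have "\<exists>v. \<forall>n. approximates (v n) \<ll> (1 / real (Suc n))"
    using \<ll> unfolding representable_def by (intro choice) simp
  then obtain v where v: "\<And>n. approximates (v n) \<ll> (1 / real (Suc n))" by blast
  have "Cauchy (\<lambda>n. f (v n))"
  proof (rule CauchyI)
    fix e :: real assume e: "0 < e"
    obtain N where N: "(2 * C + 1) / e < real N" using reals_Archimedean2 by blast
    have "norm (f (v m) - f (v n)) < e" if mn: "N \<le> m" "N \<le> n" for m n
    proof -
      have "0 < (2 * C + 1) / e" using C e by simp
      then have N0: "0 < real N" using N by linarith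
      have le: "1 / real (Suc n) \<le> 1 / real N" if "N \<le> n" for n
        using that N0 by (intro divide_left_mono) auto
      have "norm (f (v m) - f (v n)) \<le> C * (1 / real (Suc m) + 1 / real (Suc n))"
        by (rule approximates_dist[OF v v])
      also have "\<dots> \<le> C * (1 / real N + 1 / real N)" by (intro mult_left_mono add_mono le mn C)
      also have "\<dots> = 2 * C / real N" by simp
      also have "\<dots> < e"
      proof -
        have "2 * C + 1 < real N * e" using N e by (simp add: pos_divide_less_eq)
        then have "2 * C < e * real N" by (simp add: mult.commute)
        then show ?thesis using N0 by (simp add: pos_divide_less_eq)
      qed
      finally show ?thesis .
    qed
    then show "\<exists>N. \<forall>m\<ge>N. \<forall>n\<ge>N. norm (f (v m) - f (v n)) < e" by blast
  qed
  then obtain y where y: "(\<lambda>n. f (v n)) \<longlonglongrightarrow> y" using Cauchy_convergent convergent_def by blast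
  have inv0: "(\<lambda>n. 1 / real (Suc n)) \<longlonglongrightarrow> 0" using LIMSEQ_inverse_real_of_nat by (simp add: inverse_eq_divide)
  have near: "norm (f w - y) \<le> C * e" if w: "approximates w \<ll> e" for w e
  proof (rule LIMSEQ_le[OF tendsto_norm[OF tendsto_diff[OF tendsto_const y]]])
    have "(\<lambda>n. C * (e + 1 / real (Suc n))) \<longlonglongrightarrow> C * (e + 0)" by (intro tendsto_intros inv0)
    then show "(\<lambda>n. C * (e + 1 / real (Suc n))) \<longlonglongrightarrow> C * e" by simp
    show "\<exists>N. \<forall>n\<ge>N. norm (f w - f (v n)) \<le> C * (e + 1 / real (Suc n))"
      using approximates_dist[OF w v] by blast
  qed
  have "extension \<ll> = y"
    unfolding extension_def
  proof (rule the_equality)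
    show "\<forall>v e. approximates v \<ll> e \<longrightarrow> norm (f v - y) \<le> C * e" using near by blast
    fix z assume z: "\<forall>v e. approximates v \<ll> e \<longrightarrow> norm (f v - z) \<le> C * e"
    have "(\<lambda>n. f (v n) - z) \<longlonglongrightarrow> 0"
    proof (rule Lim_null_comparison[OF always_eventually])
      show "\<forall>n. norm (f (v n) - z) \<le> C * (1 / real (Suc n))" using z v by blast
      show "(\<lambda>n. C * (1 / real (Suc n))) \<longlonglongrightarrow> 0" using tendsto_mult_left[OF inv0, of C] by simp
    qed
    then have "(\<lambda>n. f (v n)) \<longlonglongrightarrow> z" by (rule LIM_zero_cancel)
    then show "z = y" using y by (rule LIMSEQ_unique)
  qed
  then show ?thesis using near[OF w] by simp
qed

text \<open>The factor \<open>B\<close> leaves room for the constants that accumulate when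
  approximants are combined.\<close>

lemma extension_eqI:
  assumes \<ll>: "representable \<ll>" and B: "0 \<le> B"
    and v: "\<And>e. 0 < e \<Longrightarrow> \<exists>v. approximates v \<ll> (B * e) \<and> norm (f v - y) \<le> B * e"
  shows "extension \<ll> = y"
proof -
  have "norm (extension \<ll> - y) \<le> e" if e: "0 < e" for e
  proof -
    define d where "d = e / (C * B + B + 1)"
    have CB: "0 < C * B + B + 1" using C B by (simp add: add_nonneg_pos)
    have d: "0 < d" using e CB by (simp add: d_def)
    obtain v where v: "approximates v \<ll> (B * d)" "norm (f v - y) \<le> B * d" using v[OF d] by blast
    have "norm (extension \<ll> - y) \<le> norm (f v - extension \<ll>) + norm (f v - y)"
      using norm_triangle_ineq4[of "f v - y" "f v - extension \<ll>"] by simp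
    also have "\<dots> \<le> C * (B * d) + B * d" by (intro add_mono approximates_extension \<ll> v)
    also have "\<dots> \<le> (C * B + B + 1) * d" using d by (simp add: algebra_simps)
    also have "\<dots> = e" using CB by (simp add: d_def)
    finally show ?thesis .
  qed
  then have "norm (extension \<ll> - y) \<le> 0" by (rule field_le_epsilon[of _ 0, unfolded add_0])
  then show ?thesis by simp
qed

lemma approximates_linear:
  assumes v: "approximates v \<ll> d" and w: "approximates w \<mm> e"
  shows "approximates (\<lambda>a. cnj c * v a + w a) (\<lambda>x. c * \<ll> x + \<mm> x) (cmod c * d + e)"
  unfolding approximates_def
proof (intro conjI ballI)
  note vw = approximates_V[OF v] approximates_V[OF w]
  show "(\<lambda>a. cnj c * v a + w a) \<in> V" by (intro V_linear vw)
  show "0 \<le> cmod c * d + e" using v w by (simp add: approximates_def)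
  fix x assume x: "x \<in> V"
  have "ip x (\<lambda>a. cnj c * v a + w a) - (c * \<ll> x + \<mm> x) = c * (ip x v - \<ll> x) + (ip x w - \<mm> x)"
    unfolding ip_right[OF vw x] by (simp add: algebra_simps)
  also have "cmod \<dots> \<le> cmod c * cmod (ip x v - \<ll> x) + cmod (ip x w - \<mm> x)"
    by (rule norm_triangle_ineq[THEN order_trans]) (simp add: norm_mult)
  also have "\<dots> \<le> cmod c * (d * nrm x) + e * nrm x"
    using v w x by (intro add_mono mult_left_mono) (auto simp: approximates_def)
  finally show "cmod (ip x (\<lambda>a. cnj c * v a + w a) - (c * \<ll> x + \<mm> x)) \<le> (cmod c * d + e) * nrm x"
    by (simp add: algebra_simps)
qed

lemma extension_linear:
  assumes \<ll>: "representable \<ll>" and \<mm>: "representable \<mm>"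
  shows "representable (\<lambda>x. c * \<ll> x + \<mm> x)" "extension (\<lambda>x. c * \<ll> x + \<mm> x) = cnj c *\<^sub>C extension \<ll> + extension \<mm>"
proof -
  have ex: "\<exists>v w. approximates v \<ll> e \<and> approximates w \<mm> e" if "0 < e" for e
    using \<ll> \<mm> that unfolding representable_def by blast
  show rep: "representable (\<lambda>x. c * \<ll> x + \<mm> x)"
    unfolding representable_def
  proof (intro allI impI)
    fix e :: real assume e: "0 < e"
    have c: "0 < cmod c + 1" using norm_ge_zero[of c] by linarith
    then have "0 < e / (cmod c + 1)" using e by simp
    from ex[OF this] obtain v w where "approximates v \<ll> (e / (cmod c + 1))" "approximates w \<mm> (e / (cmod c + 1))"
      by blast
    from approximates_linear[OF this, of c]
    have "approximates (\<lambda>a. cnj c * v a + w a) (\<lambda>x. c * \<ll> x + \<mm> x) ((cmod c + 1) * (e / (cmod c + 1)))"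
      unfolding distrib_right by simp
    then show "\<exists>v. approximates v (\<lambda>x. c * \<ll> x + \<mm> x) e" using c by auto
  qed
  show "extension (\<lambda>x. c * \<ll> x + \<mm> x) = cnj c *\<^sub>C extension \<ll> + extension \<mm>"
  proof (rule extension_eqI[OF rep])
    show "0 \<le> (C + 1) * (cmod c + 1)" using C by simp
    fix e :: real assume e: "0 < e"
    obtain v w where vw: "approximates v \<ll> e" "approximates w \<mm> e" using ex[OF e] by blast
    let ?u = "\<lambda>a. cnj c * v a + w a"
    have u: "approximates ?u (\<lambda>x. c * \<ll> x + \<mm> x) (cmod c * e + e)" by (rule approximates_linear[OF vw])
    have le: "cmod c * e + e \<le> (C + 1) * (cmod c + 1) * e" "C * (cmod c * e + e) \<le> (C + 1) * (cmod c + 1) * e"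
      using C e by (simp_all add: algebra_simps)
    have "approximates ?u (\<lambda>x. c * \<ll> x + \<mm> x) ((C + 1) * (cmod c + 1) * e)"
      unfolding approximates_def
    proof (intro conjI ballI)
      show "?u \<in> V" by (rule approximates_V[OF u])
      show "0 \<le> (C + 1) * (cmod c + 1) * e" using C e by simp
      fix x assume x: "x \<in> V"
      have "cmod (ip x ?u - (c * \<ll> x + \<mm> x)) \<le> (cmod c * e + e) * nrm x" using u x by (simp add: approximates_def)
      also have "\<dots> \<le> (C + 1) * (cmod c + 1) * e * nrm x" by (rule mult_right_mono[OF le(1) nrm_nonneg[OF x]])
      finally show "cmod (ip x ?u - (c * \<ll> x + \<mm> x)) \<le> (C + 1) * (cmod c + 1) * e * nrm x" .
    qed
    moreover have "norm (f ?u - (cnj c *\<^sub>C extension \<ll> + extension \<mm>)) \<le> (C + 1) * (cmod c + 1) * e"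
    proof -
      have n1: "norm (f v - extension \<ll>) \<le> C * e" by (rule approximates_extension[OF \<ll> vw(1)])
      have n2: "norm (f w - extension \<mm>) \<le> C * e" by (rule approximates_extension[OF \<mm> vw(2)])
      have eq: "f ?u - (cnj c *\<^sub>C extension \<ll> + extension \<mm>) = cnj c *\<^sub>C (f v - extension \<ll>) + (f w - extension \<mm>)"
        using f_linear[OF approximates_V[OF vw(1)] approximates_V[OF vw(2)], of "cnj c"]
        by (simp add: scaleC.diff_right)
      have "norm (cnj c *\<^sub>C (f v - extension \<ll>) + (f w - extension \<mm>)) \<le>
        cmod c * norm (f v - extension \<ll>) + norm (f w - extension \<mm>)"
        by (rule norm_triangle_ineq[THEN order_trans]) (simp add: norm_scaleC)
      moreover have "cmod c * norm (f v - extension \<ll>) \<le> cmod c * (C * e)"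
        by (rule mult_left_mono[OF n1 norm_ge_zero])
      moreover have "cmod c * (C * e) + C * e = C * (cmod c * e + e)" by (simp add: distrib_left)
      ultimately show ?thesis unfolding eq using n2 le(2) by linarith
    qed
    ultimately show "\<exists>v. approximates v (\<lambda>x. c * \<ll> x + \<mm> x) ((C + 1) * (cmod c + 1) * e) \<and>
      norm (f v - (cnj c *\<^sub>C extension \<ll> + extension \<mm>)) \<le> (C + 1) * (cmod c + 1) * e" by blast
  qed
qed

lemma extension_bound:
  assumes "representable \<ll>" "0 \<le> B" "\<And>x. x \<in> V \<Longrightarrow> cmod (\<ll> x) \<le> B * nrm x"
  shows "norm (extension \<ll>) \<le> C * B"
proof -
  have z: "(\<lambda>_. 0) \<in> V" by (rule fun_subspaceD(1)[OF V])
  have "ip x (\<lambda>_. 0) = 0" if "x \<in> V" for x using ip_right[OF z z that, of 0] ip_right[OF z z that, of 1] by simp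
  then have "approximates (\<lambda>_. 0) \<ll> B" unfolding approximates_def using assms(2,3) z by simp
  moreover have "f (\<lambda>_. 0) = 0" using f_linear[OF z z, of 1] by simp
  ultimately show ?thesis using approximates_extension[OF assms(1), of "\<lambda>_. 0" B] by simp
qed

lemma extension_diff_bound:
  assumes \<ll>: "representable \<ll>" and \<mm>: "representable \<mm>" and "0 \<le> B" "\<And>x. x \<in> V \<Longrightarrow> cmod (\<ll> x - \<mm> x) \<le> B * nrm x"
  shows "norm (extension \<ll> - extension \<mm>) \<le> C * B"
proof -
  note e = extension_linear[OF \<mm> \<ll>, of "- 1"]
  have "norm (extension (\<lambda>x. - 1 * \<mm> x + \<ll> x)) \<le> C * B"
    by (rule extension_bound[OF e(1)]) (use assms(3,4) in auto)
  then show ?thesis unfolding e(2) by (simp add: scaleC.minus_left)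
qed

lemma extension_ip:
  assumes "x \<in> V"
  shows "representable (\<lambda>y. ip y x)" "extension (\<lambda>y. ip y x) = f x"
proof -
  have a: "approximates x (\<lambda>y. ip y x) 0" using assms by (simp add: approximates_def)
  have "approximates x (\<lambda>y. ip y x) e" if "0 < e" for e
    using assms that nrm_nonneg by (simp add: approximates_def)
  then show r: "representable (\<lambda>y. ip y x)" unfolding representable_def by blast
  show "extension (\<lambda>y. ip y x) = f x" using approximates_extension[OF r a] by simp
qed

text \<open>The integral up to \<open>t\<close> is differentiated as a path of functionals.
  Continuity of \<open>m\<close> uniformly on the unit ball controls the difference quotients after
  extension, and the fundamental theorem of calculus returns the integral.\<close>

lemma extension_integral:
  fixes m :: "real \<Rightarrow> ('a \<Rightarrow> complex) \<Rightarrow> complex"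
  assumes ab: "a \<le> b"
    and lin: "\<And>t x y c. t \<in> {a..b} \<Longrightarrow> x \<in> V \<Longrightarrow> y \<in> V \<Longrightarrow> m t (\<lambda>a. c * x a + y a) = c * m t x + m t y"
    and bound: "\<And>t x. t \<in> {a..b} \<Longrightarrow> x \<in> V \<Longrightarrow> cmod (m t x) \<le> B * nrm x"
    and cont: "\<And>t e. t \<in> {a..b} \<Longrightarrow> 0 < e \<Longrightarrow>
      \<exists>d>0. \<forall>r\<in>{a..b}. \<bar>r - t\<bar> < d \<longrightarrow> (\<forall>x\<in>V. cmod (m r x - m t x) \<le> e * nrm x)"
  shows "representable (\<lambda>x. integral {a..b} (\<lambda>t. m t x))"
    "((\<lambda>t. extension (m t)) has_integral extension (\<lambda>x. integral {a..b} (\<lambda>t. m t x))) {a..b}"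
proof -
  have mc: "continuous_on {a..b} (\<lambda>t. m t x)" if x: "x \<in> V" for x
    unfolding continuous_on_iff
  proof (intro ballI allI impI)
    fix t e :: real assume t: "t \<in> {a..b}" and e: "0 < e"
    have n: "0 < nrm x + 1" using nrm_nonneg[OF x] by linarith
    then have "0 < e / (nrm x + 1)" using e by simp
    from cont[OF t this] obtain d where d: "0 < d"
      "\<And>r. r \<in> {a..b} \<Longrightarrow> \<bar>r - t\<bar> < d \<Longrightarrow> cmod (m r x - m t x) \<le> e / (nrm x + 1) * nrm x" using x by blast
    have "e / (nrm x + 1) * nrm x < e" using e n nrm_nonneg[OF x] by (simp add: pos_divide_less_eq)
    then have "dist (m r x) (m t x) < e" if "r \<in> {a..b}" "dist r t < d" for r
      using d(2)[of r] that unfolding dist_norm real_norm_def by (meson order.strict_trans1)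
    then show "\<exists>d>0. \<forall>r\<in>{a..b}. dist r t < d \<longrightarrow> dist (m r x) (m t x) < e"
      using d(1) by blast
  qed
  have int: "(\<lambda>t. m t x) integrable_on {r..t}" if "x \<in> V" "a \<le> r" "t \<le> b" for x r t
    by (intro integrable_continuous_real continuous_on_subset[OF mc]) (use that in auto)
  define L where "L t x = integral {a..t} (\<lambda>t. m t x)" for t x
  have mrep: "representable (m t)" if "t \<in> {a..b}" for t
    by (rule bounded_representable[OF lin[OF that] bound[OF that]])
  have Lrep: "representable (L t)" if t: "t \<in> {a..b}" for t
  proof (rule bounded_representable)
    fix x y c assume xy: "x \<in> V" "y \<in> V"
    have "integral {a..t} (\<lambda>r. m r (\<lambda>a. c * x a + y a)) = integral {a..t} (\<lambda>r. c * m r x + m r y)"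
      by (rule integral_cong) (use lin[OF _ xy] t in auto)
    also have "\<dots> = c * integral {a..t} (\<lambda>r. m r x) + integral {a..t} (\<lambda>r. m r y)"
      using t integral_add[OF integrable_on_mult_right[OF int[OF xy(1), of a t]] int[OF xy(2), of a t], of c] by simp
    finally show "L t (\<lambda>a. c * x a + y a) = c * L t x + L t y" by (simp add: L_def)
  next
    fix x assume x: "x \<in> V"
    have "cmod (integral {a..t} (\<lambda>r. m r x)) \<le> integral {a..t} (\<lambda>_. B * nrm x)"
      by (rule integral_norm_bound_integral) (use t int[OF x] bound[OF _ x] in auto)
    also have "\<dots> = B * (t - a) * nrm x" using t by simp
    finally show "cmod (L t x) \<le> B * (t - a) * nrm x" by (simp add: L_def)
  qed
  have "((\<lambda>t. extension (L t)) has_vector_derivative extension (m t)) (at t within {a..b})"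
    if t: "t \<in> {a..b}" for t
    unfolding has_vector_derivative_def has_derivative_within_alt2
  proof (intro conjI allI impI bounded_linear_scaleR_left)
    fix e :: real assume e: "0 < e"
    have C1: "0 < C + 1" using C by simp
    then have "0 < e / (C + 1)" using e by simp
    from cont[OF t this] obtain d where d: "0 < d"
      "\<And>r x. r \<in> {a..b} \<Longrightarrow> \<bar>r - t\<bar> < d \<Longrightarrow> x \<in> V \<Longrightarrow> cmod (m r x - m t x) \<le> e / (C + 1) * nrm x" by blast
    have step: "norm (extension (L r) - extension (L t) - (r - t) *\<^sub>R extension (m t)) \<le> e * norm (r - t)"
      if r: "r \<in> {a..b}" "\<bar>r - t\<bar> < d" for r
    proof -
      have diff: "cmod (L v x - L u x - (v - u) * m t x) \<le> e / (C + 1) * nrm x * (v - u)"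
        if uv: "u \<in> {a..b}" "v \<in> {a..b}" "u \<le> v" "{u..v} \<subseteq> {t - d<..<t + d}" and x: "x \<in> V" for u v x
      proof -
        have "L u x + integral {u..v} (\<lambda>r. m r x) = L v x"
          unfolding L_def by (rule Henstock_Kurzweil_Integration.integral_combine) (use uv int[OF x] in auto)
        moreover have "((\<lambda>r. m r x - m t x) has_integral integral {u..v} (\<lambda>r. m r x) - (v - u) *\<^sub>R m t x) {u..v}"
          using has_integral_diff[OF integrable_integral[OF int[OF x, of u v]] has_integral_const_real[of "m t x" u v]] uv
          by simp
        ultimately have "L v x - L u x - (v - u) * m t x = integral {u..v} (\<lambda>r. m r x - m t x)"
          by (simp add: integral_unique scaleR_conv_of_real eq_diff_eq diff_eq_eq add_ac)
        also have "cmod \<dots> \<le> integral {u..v} (\<lambda>_. e / (C + 1) * nrm x)"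
        proof (rule integral_norm_bound_integral)
          show "(\<lambda>r. m r x - m t x) integrable_on {u..v}" using int[OF x, of u v] uv by (intro integrable_diff) auto
          fix r assume r: "r \<in> {u..v}"
          then have "r \<in> {t - d<..<t + d}" using uv by blast
          then have "\<bar>r - t\<bar> < d" by auto
          then show "cmod (m r x - m t x) \<le> e / (C + 1) * nrm x" using d(2)[of r x] uv r x by auto
        qed auto
        finally show ?thesis using uv by (simp add: mult_ac)
      qed
      \<comment> \<open>The increment \<open>r - t\<close> is real, so conjugate-linearity of the
        extension leaves it unchanged; this is why it appears as a complex number here.\<close>
      have "norm (extension (L r) - extension (\<lambda>x. complex_of_real (r - t) * m t x + L t x)) \<le> C * (e / (C + 1) * \<bar>r - t\<bar>)"
      proof (rule extension_diff_bound[OF Lrep[OF r(1)] extension_linear(1)[OF mrep[OF t] Lrep[OF t]]])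
        show "0 \<le> e / (C + 1) * \<bar>r - t\<bar>" using e C1 by simp
        fix x assume x: "x \<in> V"
        show "cmod (L r x - (complex_of_real (r - t) * m t x + L t x)) \<le> e / (C + 1) * \<bar>r - t\<bar> * nrm x"
        proof (cases "t \<le> r")
          case True
          have "{t..r} \<subseteq> {t - d<..<t + d}" using r d(1) by auto
          from diff[OF t r(1) True this x] True show ?thesis by (simp add: diff_diff_eq add.commute mult_ac)
        next
          case False
          have "{r..t} \<subseteq> {t - d<..<t + d}" "r \<le> t" using False r d(1) by auto
          from diff[OF r(1) t this(2,1) x]
          have "cmod (L t x - L r x - (t - r) * m t x) \<le> e / (C + 1) * nrm x * (t - r)" by simp
          moreover have "L r x - (complex_of_real (r - t) * m t x + L t x) = - (L t x - L r x - (t - r) * m t x)"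
            by (simp add: algebra_simps)
          moreover have "\<bar>r - t\<bar> = t - r" using False by simp
          ultimately show ?thesis by (simp only: norm_minus_cancel mult_ac)
        qed
      qed
      also have "C * (e / (C + 1) * \<bar>r - t\<bar>) \<le> e * norm (r - t)"
      proof -
        have "C * (e / (C + 1)) \<le> e" using C1 e C by (simp add: pos_divide_le_eq mult.commute)
        then have "C * (e / (C + 1)) * \<bar>r - t\<bar> \<le> e * \<bar>r - t\<bar>" by (rule mult_right_mono) simp
        then show ?thesis by (simp add: mult.assoc)
      qed
      finally show ?thesis
        unfolding extension_linear(2)[OF mrep[OF t] Lrep[OF t]] complex_cnj_complex_of_real scaleC_of_real
        by (simp only: diff_diff_eq add.commute)
    qed
    show "\<forall>\<^sub>F r in at t within {a..b}. norm (extension (L r) - extension (L t) - (r - t) *\<^sub>R extension (m t)) \<le> e * norm (r - t)"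
      unfolding eventually_at using d(1) step by (intro exI[of _ d]) (auto simp: dist_real_def)
  qed
  from fundamental_theorem_of_calculus[OF ab this]
  have "((\<lambda>t. extension (m t)) has_integral extension (L b) - extension (L a)) {a..b}" by simp
  moreover have "extension (L a) = 0"
  proof -
    have "norm (extension (L a)) \<le> C * 0"
      by (rule extension_bound[OF Lrep]) (use ab in \<open>auto simp: L_def\<close>)
    then show ?thesis by simp
  qed
  ultimately show "((\<lambda>t. extension (m t)) has_integral extension (\<lambda>x. integral {a..b} (\<lambda>t. m t x))) {a..b}"
    by (simp add: L_def[abs_def])
  show "representable (\<lambda>x. integral {a..b} (\<lambda>t. m t x))" using Lrep[of b] ab by (simp add: L_def[abs_def])
qed

end

section \<open>Representation of ultradistributions\<close>

lemma norm_integral_le_const: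
  fixes g :: "real \<Rightarrow> 'e::banach"
  assumes "a \<le> b" "continuous_on {a..b} g" "\<And>t. t \<in> {a..b} \<Longrightarrow> norm (g t) \<le> B"
  shows "norm (integral {a..b} g) \<le> B * (b - a)"
proof -
  have "norm (integral {a..b} g) \<le> integral {a..b} (\<lambda>_. B)"
    by (rule integral_norm_bound_integral) (use assms in \<open>auto intro: integrable_continuous_real\<close>)
  then show ?thesis using assms(1) by (simp add: mult.commute)
qed

locale energy_form =
  fixes s T k :: real
  assumes s_pos: "0 < s" and T_pos: "0 < T" and k_pos: "0 < k"
begin

definition weight :: "nat \<Rightarrow> real"
  where "weight \<alpha> = k ^ \<alpha> / fact \<alpha> powr s"

definition product :: "nat \<Rightarrow> (real \<Rightarrow> complex) \<Rightarrow> (real \<Rightarrow> complex) \<Rightarrow> complex"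
  where "product \<alpha> \<phi> \<psi> = integral {0..T} (\<lambda>t. cnj (test_derivs T \<alpha> \<psi> t) * test_derivs T \<alpha> \<phi> t)"

definition energy :: "(real \<Rightarrow> complex) \<Rightarrow> (real \<Rightarrow> complex) \<Rightarrow> complex"
  where "energy \<phi> \<psi> = (\<Sum>\<alpha>. complex_of_real ((weight \<alpha>)\<^sup>2) * product \<alpha> \<phi> \<psi>)"

text \<open>The constant of the Sobolev embedding into sup norms: order \<open>\<alpha>\<close> is
  controlled by the \<open>L^2\<close> norm of order \<open>\<alpha> + 1\<close>, with
  \<open>T + 1\<close> from \<open>integral_le_powr_integral\<close>.\<close>

definition growth :: "nat \<Rightarrow> real"
  where "growth \<alpha> = (T + 1) / weight (Suc \<alpha>)"

lemma weight_pos: "0 < weight \<alpha>"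
  using k_pos by (simp add: weight_def)

lemma growth_pos: "0 < growth \<alpha>"
  using weight_pos T_pos by (simp add: growth_def)

lemma weight_cancel: "0 < c \<Longrightarrow> weight \<alpha> * (fact \<alpha> powr s / (c * k) ^ \<alpha>) = (1 / c) ^ \<alpha>"
  using k_pos by (simp add: weight_def power_mult_distrib power_one_over field_simps)

text \<open>The quotient of consecutive weights is a constant times
  \<open>(\<alpha> + 1) powr s\<close>, hence at most geometric; the embedding costs a factor 2 in
  the radius.\<close>

lemma growth_le: "\<exists>K>0. \<forall>\<alpha>. weight \<alpha> * growth \<alpha> \<le> K * 2 ^ \<alpha>"
proof -
  obtain K where K: "0 < K" "\<And>n. real (Suc n) powr s \<le> K * 2 ^ n" using powr_le_geometric[OF s_pos, of 2] by auto
  have "weight \<alpha> * growth \<alpha> \<le> ((T + 1) * K / k) * 2 ^ \<alpha>" for \<alpha>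
  proof -
    have "(fact (Suc \<alpha>) :: real) powr s = real (Suc \<alpha>) powr s * fact \<alpha> powr s"
      unfolding fact_Suc by (rule powr_mult)
    then have "weight \<alpha> * growth \<alpha> = (T + 1) / k * real (Suc \<alpha>) powr s"
      using k_pos by (simp add: weight_def growth_def field_simps del: of_nat_Suc fact_Suc)
    also have "\<dots> \<le> (T + 1) / k * (K * 2 ^ \<alpha>)" using T_pos k_pos by (intro mult_left_mono K(2)) auto
    finally show ?thesis by (simp add: mult.assoc)
  qed
  moreover have "0 < (T + 1) * K / k" using T_pos K(1) k_pos by simp
  ultimately show ?thesis by blast
qed

context
  fixes V assumes V_def: "V = Bdot s T"
begin

lemma smooth: "\<phi> \<in> V \<Longrightarrow> \<phi> \<in> smooth_functions T"
  using flat_functionsD(1)[OF Bdot_flat[OF T_pos]] by (simp add: V_def)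

lemma derivs_continuous: "\<phi> \<in> V \<Longrightarrow> continuous_on S (test_derivs T \<alpha> \<phi>)"
  using flat_functionsD(2)[OF Bdot_flat[OF T_pos]] by (simp add: V_def)

lemma derivs_decay: "\<phi> \<in> V \<Longrightarrow> 0 < h \<Longrightarrow> cmod (test_derivs T \<alpha> \<phi> t) \<le> DLinf_norm s T h \<phi> * (fact \<alpha> powr s / h ^ \<alpha>)"
  using DLinf_norm_bound[OF Bdot_DLinf[OF T_pos]] by (simp add: V_def)

lemma product_continuous:
  assumes "\<phi> \<in> V" "\<psi> \<in> V"
  shows "continuous_on {0..T} (\<lambda>t. cnj (test_derivs T \<alpha> \<psi> t) * test_derivs T \<alpha> \<phi> t)"
  by (intro continuous_intros derivs_continuous assms)

lemma product_linear:
  assumes "\<phi> \<in> V" "\<psi> \<in> V" "\<eta> \<in> V"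
  shows "product \<alpha> (\<lambda>t. c * \<phi> t + \<psi> t) \<eta> = c * product \<alpha> \<phi> \<eta> + product \<alpha> \<psi> \<eta>"
proof -
  note i = integrable_continuous_real[OF product_continuous[OF assms(1,3), of \<alpha>]]
    integrable_continuous_real[OF product_continuous[OF assms(2,3), of \<alpha>]]
  have "product \<alpha> (\<lambda>t. c * \<phi> t + \<psi> t) \<eta> = integral {0..T} (\<lambda>t. c * (cnj (test_derivs T \<alpha> \<eta> t) * test_derivs T \<alpha> \<phi> t)
    + cnj (test_derivs T \<alpha> \<eta> t) * test_derivs T \<alpha> \<psi> t)"
    unfolding product_def test_derivs_linear[OF smooth[OF assms(1)] smooth[OF assms(2)]]
    by (simp add: distrib_left mult.left_commute)
  also have "\<dots> = c * product \<alpha> \<phi> \<eta> + product \<alpha> \<psi> \<eta>"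
    using integral_add[OF integrable_on_mult_right[OF i(1)] i(2), of c] by (simp add: product_def)
  finally show ?thesis .
qed

lemma product_commute: "product \<alpha> \<psi> \<phi> = cnj (product \<alpha> \<phi> \<psi>)"
  by (simp add: product_def Henstock_Kurzweil_Integration.integral_cnj mult.commute)

lemma product_self:
  assumes "\<phi> \<in> V"
  shows "product \<alpha> \<phi> \<phi> = complex_of_real (integral {0..T} (\<lambda>t. (cmod (test_derivs T \<alpha> \<phi> t))\<^sup>2))"
proof -
  have "continuous_on {0..T} (\<lambda>t. (cmod (test_derivs T \<alpha> \<phi> t))\<^sup>2)"
    by (intro continuous_intros derivs_continuous assms)
  from integral_linear[OF integrable_continuous_real[OF this] bounded_linear_of_real[where 'a = complex],
      unfolded comp_def complex_norm_square]
  show ?thesis by (simp add: product_def mult.commute)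
qed

lemma energy_term_bound:
  assumes "\<phi> \<in> V" "\<psi> \<in> V"
  shows "cmod (complex_of_real ((weight \<alpha>)\<^sup>2) * product \<alpha> \<phi> \<psi>) \<le>
    T * DLinf_norm s T (2 * k) \<phi> * DLinf_norm s T (2 * k) \<psi> * (1 / 4) ^ \<alpha>"
proof -
  let ?g = "fact \<alpha> powr s / (2 * k) ^ \<alpha>"
  have k2: "0 < 2 * k" using k_pos by simp
  have "cmod (product \<alpha> \<phi> \<psi>) \<le> (DLinf_norm s T (2 * k) \<psi> * ?g) * (DLinf_norm s T (2 * k) \<phi> * ?g) * (T - 0)"
    unfolding product_def norm_mult[symmetric]
  proof (rule norm_integral_le_const[OF _ product_continuous[OF assms]])
    fix t
    show "cmod (cnj (test_derivs T \<alpha> \<psi> t) * test_derivs T \<alpha> \<phi> t) \<le> DLinf_norm s T (2 * k) \<psi> * ?g * (DLinf_norm s T (2 * k) \<phi> * ?g)"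
      unfolding norm_mult complex_mod_cnj
      using k2 by (intro mult_mono derivs_decay assms) auto
  qed (use T_pos in simp)
  then have "(weight \<alpha>)\<^sup>2 * cmod (product \<alpha> \<phi> \<psi>) \<le>
    (weight \<alpha>)\<^sup>2 * ((DLinf_norm s T (2 * k) \<psi> * ?g) * (DLinf_norm s T (2 * k) \<phi> * ?g) * (T - 0))"
    by (rule mult_left_mono) simp
  also have "\<dots> = T * DLinf_norm s T (2 * k) \<phi> * DLinf_norm s T (2 * k) \<psi> * (weight \<alpha> * ?g)\<^sup>2"
    by (simp add: power2_eq_square mult_ac)
  also have "(weight \<alpha> * ?g)\<^sup>2 = ((1 / 2) ^ \<alpha>)\<^sup>2" unfolding weight_cancel[OF zero_less_numeral] ..
  also have "((1 / 2 :: real) ^ \<alpha>)\<^sup>2 = (1 / 4) ^ \<alpha>"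
    by (simp add: power_divide power_mult[symmetric] mult.commute[of \<alpha>]) (simp add: power_mult)
  finally show ?thesis by (simp add: norm_mult norm_power)
qed

lemma energy_summable:
  assumes "\<phi> \<in> V" "\<psi> \<in> V"
  shows "summable (\<lambda>\<alpha>. complex_of_real ((weight \<alpha>)\<^sup>2) * product \<alpha> \<phi> \<psi>)"
  by (rule summable_comparison_test'[OF _ energy_term_bound[OF assms]])
    (intro summable_mult summable_geometric, simp)

lemma energy_linear:
  assumes "\<phi> \<in> V" "\<psi> \<in> V" "\<eta> \<in> V"
  shows "energy (\<lambda>t. c * \<phi> t + \<psi> t) \<eta> = c * energy \<phi> \<eta> + energy \<psi> \<eta>"
proof -
  have "(\<lambda>\<alpha>. c * (complex_of_real ((weight \<alpha>)\<^sup>2) * product \<alpha> \<phi> \<eta>) + complex_of_real ((weight \<alpha>)\<^sup>2) * product \<alpha> \<psi> \<eta>)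
    sums (c * energy \<phi> \<eta> + energy \<psi> \<eta>)"
    unfolding energy_def by (intro sums_add sums_mult summable_sums energy_summable assms)
  from sums_unique[OF this] show ?thesis
    unfolding energy_def product_linear[OF assms] by (simp add: distrib_left mult.left_commute)
qed

lemma energy_commute:
  assumes "\<phi> \<in> V" "\<psi> \<in> V"
  shows "energy \<psi> \<phi> = cnj (energy \<phi> \<psi>)"
proof -
  have "(\<lambda>\<alpha>. cnj (complex_of_real ((weight \<alpha>)\<^sup>2) * product \<alpha> \<phi> \<psi>)) sums cnj (energy \<phi> \<psi>)"
    unfolding sums_cnj energy_def by (intro summable_sums energy_summable assms)
  from sums_unique[OF this] show ?thesis
    unfolding energy_def[of \<psi> \<phi>] product_commute[of _ \<psi> \<phi>] by simp
qed

lemma energy_self: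
  assumes "\<phi> \<in> V"
  shows "0 \<le> Re (energy \<phi> \<phi>)"
    "(weight \<alpha>)\<^sup>2 * integral {0..T} (\<lambda>t. (cmod (test_derivs T \<alpha> \<phi> t))\<^sup>2) \<le> Re (energy \<phi> \<phi>)"
proof -
  let ?a = "\<lambda>\<alpha>. (weight \<alpha>)\<^sup>2 * integral {0..T} (\<lambda>t. (cmod (test_derivs T \<alpha> \<phi> t))\<^sup>2)"
  have "(\<lambda>\<alpha>. Re (complex_of_real ((weight \<alpha>)\<^sup>2) * product \<alpha> \<phi> \<phi>)) sums Re (energy \<phi> \<phi>)"
    unfolding energy_def by (intro sums_Re summable_sums energy_summable assms)
  then have sums: "?a sums Re (energy \<phi> \<phi>)"
    unfolding product_self[OF assms] of_real_mult[symmetric] Re_complex_of_real .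
  have nonneg: "0 \<le> ?a \<alpha>" for \<alpha>
    by (intro mult_nonneg_nonneg integral_nonneg integrable_continuous_real continuous_intros derivs_continuous assms) simp_all
  show "0 \<le> Re (energy \<phi> \<phi>)" by (rule sums_le[OF nonneg sums_zero sums])
  show "?a \<alpha> \<le> Re (energy \<phi> \<phi>)"
    using sum_le_suminf[OF sums_summable[OF sums], of "{\<alpha>}"] nonneg sums_unique[OF sums] by simp
qed

text \<open>Flatness at 0 allows integration of the next derivative from 0, whose \<open>L^1\<close>
  norm is bounded by its \<open>L^2\<close> norm and therefore by a single term of the energy. Point
  evaluations of every order thus become bounded functionals.\<close>

lemma derivs_le_energy:
  assumes \<phi>: "\<phi> \<in> V"
  shows "cmod (test_derivs T \<alpha> \<phi> t) \<le> growth \<alpha> * sqrt (Re (energy \<phi> \<phi>))"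
proof (cases "t \<in> {0<..<T}")
  case False
  have "0 \<le> growth \<alpha> * sqrt (Re (energy \<phi> \<phi>))"
    using growth_pos[of \<alpha>] energy_self(1)[OF \<phi>] by (intro mult_nonneg_nonneg real_sqrt_ge_zero) auto
  then show ?thesis using test_derivs_outside[OF smooth[OF \<phi>] False] by simp
next
  case True
  let ?f = "test_derivs T (Suc \<alpha>) \<phi>" and ?n = "sqrt (Re (energy \<phi> \<phi>)) / weight (Suc \<alpha>)"
  note flat = Bdot_flat[OF T_pos \<phi>[unfolded V_def]]
  have n0: "0 \<le> ?n" using energy_self(1)[OF \<phi>] weight_pos by (simp add: less_imp_le)
  have "(?f has_integral test_derivs T \<alpha> \<phi> t - test_derivs T \<alpha> \<phi> 0) {0..t}"
    by (rule flat_has_integral[OF flat]) (use True in auto)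
  then have "test_derivs T \<alpha> \<phi> t = integral {0..t} ?f"
    unfolding flat_functionsD(3)[OF flat] by (simp add: integral_unique)
  also have "cmod \<dots> \<le> integral {0..t} (\<lambda>t. cmod (?f t))"
    by (rule norm_integral_le_integral_norm[OF derivs_continuous[OF \<phi>]])
  also have "\<dots> \<le> integral {0..T} (\<lambda>t. cmod (?f t))"
    by (rule integral_subset_le) (use True in \<open>auto simp del: funpow.simps intro!: integrable_continuous_real continuous_intros derivs_continuous[OF \<phi>]\<close>)
  also have "\<dots> \<le> (T - 0 + 1) * ?n"
  proof (rule integral_le_powr_integral[of 0 T _ 2])
    show "continuous_on {0..T} (\<lambda>t. cmod (?f t))" by (intro continuous_intros derivs_continuous[OF \<phi>])
    have "(weight (Suc \<alpha>))\<^sup>2 * integral {0..T} (\<lambda>t. (cmod (?f t))\<^sup>2) \<le> Re (energy \<phi> \<phi>)"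
      by (rule energy_self(2)[OF \<phi>])
    then have "integral {0..T} (\<lambda>t. (cmod (?f t))\<^sup>2) \<le> ?n\<^sup>2"
      using weight_pos[of "Suc \<alpha>"] energy_self(1)[OF \<phi>]
      by (simp add: power_divide pos_le_divide_eq mult.commute del: funpow.simps)
    then show "integral {0..T} (\<lambda>t. cmod (?f t) powr 2) \<le> ?n powr 2"
      using n0 by (simp add: powr_numeral del: funpow.simps)
  qed (use T_pos n0 in auto)
  finally show ?thesis by (simp add: growth_def del: funpow.simps)
qed

lemma derivs_lipschitz:
  assumes \<phi>: "\<phi> \<in> V" and rt: "r \<in> {0..T}" "t \<in> {0..T}"
  shows "cmod (test_derivs T \<alpha> \<phi> t - test_derivs T \<alpha> \<phi> r) \<le> growth (Suc \<alpha>) * \<bar>t - r\<bar> * sqrt (Re (energy \<phi> \<phi>))"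
proof -
  have *: "cmod (test_derivs T \<alpha> \<phi> b - test_derivs T \<alpha> \<phi> a) \<le> growth (Suc \<alpha>) * sqrt (Re (energy \<phi> \<phi>)) * (b - a)"
    if "0 \<le> a" "a \<le> b" "b \<le> T" for a b
    unfolding integral_unique[OF flat_has_integral[OF Bdot_flat[OF T_pos \<phi>[unfolded V_def]] that], symmetric]
    by (rule norm_integral_le_const[OF that(2) derivs_continuous[OF \<phi>] derivs_le_energy[OF \<phi>]])
  show ?thesis
  proof (cases "r \<le> t")
    case True
    then show ?thesis using *[of r t] rt by (simp add: mult_ac)
  next
    case False
    then show ?thesis using *[of t r] rt by (simp add: norm_minus_commute mult_ac)
  qed
qed

end

end

lemma ultradist_L1_bound:
  fixes f :: "(real \<Rightarrow> complex) \<Rightarrow> 'e::complex_banach"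
  assumes T: "0 < T" and f: "f \<in> ultradist_L1 s T"
  shows "\<exists>h C. 0 < h \<and> 0 \<le> C \<and> (\<forall>\<phi>\<in>Bdot s T. norm (f \<phi>) \<le> C * DLinf_norm s T h \<phi>)"
proof -
  have "f \<in> continuous_linear_maps (subtopology (seminorm_topology (DLinf_all s T) {DLinf_norm s T h | h. 0 < h}) (Bdot s T))"
    using f unfolding ultradist_L1_def Bdot_topology_def DLinf_projlim_def DLinf_all_def .
  moreover have "Bdot s T \<subseteq> DLinf_all s T" by (auto simp: Bdot_iff[OF T])
  ultimately show ?thesis
    using continuous_linear_maps_bound[OF directed_DLinf fun_subspace_DLinf_all fun_subspace_Bdot[OF T]] by fast
qed

lemma ultradist_L1_linear:
  assumes T: "0 < T" and f: "f \<in> ultradist_L1 s T" and \<phi>: "\<phi> \<in> Bdot s T" and \<psi>: "\<psi> \<in> Bdot s T"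
  shows "f (\<lambda>t. c * \<phi> t + \<psi> t) = c *\<^sub>C f \<phi> + f \<psi>"
  using f fun_subspaceD(3)[OF fun_subspace_Bdot[OF T] \<phi>] \<phi> \<psi>
  unfolding ultradist_L1_def continuous_linear_maps_def Bdot_topology_space[OF T] by auto

text \<open>For fixed \<open>\<phi>\<close>, \<open>f \<phi>\<close> is the extension of
  \<open>\<psi> \<mapsto> energy \<psi> \<phi>\<close>. The energy is a series of integrals of point
  evaluations of \<open>\<psi>\<close> weighted with the conjugate of
  \<open>\<phi>\<^sup>(\<^sup>\<alpha>\<^sup>)\<close>, so extending termwise under the integral
  yields a series of pairings. Conjugate-linearity is what turns the weights into
  \<open>\<phi>\<^sup>(\<^sup>\<alpha>\<^sup>)\<close> itself.\<close>

theorem ultradist_L1_representation: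
  fixes f :: "(real \<Rightarrow> complex) \<Rightarrow> 'e::complex_banach"
  assumes T: "0 < T" and s: "0 < s" and f: "f \<in> ultradist_L1 s T"
  shows "\<exists>F k C. 0 < k \<and> 0 \<le> C \<and> (\<forall>\<alpha>. continuous_on {0..T} (F \<alpha>) \<and> F \<alpha> 0 = 0 \<and>
      (\<forall>t\<in>{0..T}. norm (F \<alpha> t) \<le> C * k ^ \<alpha> / fact \<alpha> powr s)) \<and>
    (\<forall>\<phi>\<in>Bdot s T. pairing T F \<phi> sums f \<phi>)"
proof -
  obtain h C0 where h: "0 < h" and C0: "0 \<le> C0" "\<And>\<phi>. \<phi> \<in> Bdot s T \<Longrightarrow> norm (f \<phi>) \<le> C0 * DLinf_norm s T h \<phi>"
    using ultradist_L1_bound[OF T f] by blast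
  \<comment> \<open>The embedding costs a factor \<open>2 ^ \<alpha>\<close>; starting from radius
    \<open>2 * h\<close> leaves exactly the radius \<open>h\<close> for which \<open>f\<close> is
    bounded.\<close>
  interpret energy_form s T "2 * h" by unfold_locales (use T s h in auto)
  obtain K where K: "0 < K" "\<And>\<alpha>. weight \<alpha> * growth \<alpha> \<le> K * 2 ^ \<alpha>" using growth_le by blast
  let ?V = "Bdot s T"
  have growth_bound: "growth \<alpha> \<le> K * (fact \<alpha> powr s / h ^ \<alpha>)" for \<alpha>
  proof -
    have "weight \<alpha> * (fact \<alpha> powr s / h ^ \<alpha>) = 2 ^ \<alpha>" using weight_cancel[of "1 / 2" \<alpha>] by simp
    then have "K * 2 ^ \<alpha> = weight \<alpha> * (K * (fact \<alpha> powr s / h ^ \<alpha>))" by (simp only: mult.left_commute)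
    then have "weight \<alpha> * growth \<alpha> \<le> weight \<alpha> * (K * (fact \<alpha> powr s / h ^ \<alpha>))"
      using K(2)[of \<alpha>] by linarith
    then show ?thesis by (rule mult_left_le_imp_le[OF _ weight_pos])
  qed
  define C where "C = C0 * K"
  have C: "0 \<le> C" using C0 K by (simp add: C_def)
  interpret form_dominated_map ?V energy f C
  proof
    show "fun_subspace ?V" by (rule fun_subspace_Bdot[OF T])
    fix x y z c assume "x \<in> ?V" "y \<in> ?V" "z \<in> ?V"
    then show "energy (\<lambda>a. c * x a + y a) z = c * energy x z + energy y z" by (rule energy_linear[OF refl])
  next
    fix x y c assume xy: "x \<in> ?V" "y \<in> ?V"
    show "energy y x = cnj (energy x y)" by (rule energy_commute[OF refl xy])
    show "f (\<lambda>a. c * x a + y a) = c *\<^sub>C f x + f y" by (rule ultradist_L1_linear[OF T f xy])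
  next
    fix x assume x: "x \<in> ?V"
    show n0: "0 \<le> Re (energy x x)" by (rule energy_self(1)[OF refl x])
    have "DLinf_norm s T h x \<le> K * sqrt (Re (energy x x))"
    proof (rule DLinf_spaceI(2)[OF smooth[OF refl x] h])
      show "0 \<le> K * sqrt (Re (energy x x))" using n0 K(1) by simp
      fix \<alpha> t
      have "cmod (test_derivs T \<alpha> x t) \<le> growth \<alpha> * sqrt (Re (energy x x))" by (rule derivs_le_energy[OF refl x])
      also have "\<dots> \<le> K * (fact \<alpha> powr s / h ^ \<alpha>) * sqrt (Re (energy x x))"
        by (rule mult_right_mono[OF growth_bound]) (use n0 in simp)
      finally show "cmod (test_derivs T \<alpha> x t) \<le> K * sqrt (Re (energy x x)) * (fact \<alpha> powr s / h ^ \<alpha>)"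
        by (simp only: mult_ac)
    qed
    from mult_left_mono[OF this C0(1)] C0(2)[OF x] show "norm (f x) \<le> C * sqrt (Re (energy x x))"
      by (simp add: C_def)
  qed (rule C)
  note derivs = derivs_le_energy[OF refl, folded nrm_def]
  note lip = derivs_lipschitz[OF refl, folded nrm_def]
  note linear = test_derivs_linear[OF smooth[OF refl] smooth[OF refl]]
  define ev where "ev \<alpha> t \<phi> = test_derivs T \<alpha> \<phi> t" for \<alpha> t and \<phi> :: "real \<Rightarrow> complex"
  have ev_rep: "representable (ev \<alpha> t)" for \<alpha> t
    by (rule bounded_representable[of _ "growth \<alpha>"]) (simp_all add: ev_def linear derivs)
  define G where "G \<alpha> t = extension (ev \<alpha> t)" for \<alpha> t
  have G_bound: "norm (G \<alpha> t) \<le> C * growth \<alpha>" for \<alpha> t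
    unfolding G_def by (rule extension_bound[OF ev_rep]) (simp_all add: ev_def derivs less_imp_le growth_pos)
  have G_lip: "norm (G \<alpha> t - G \<alpha> r) \<le> C * (growth (Suc \<alpha>) * \<bar>t - r\<bar>)" if "r \<in> {0..T}" "t \<in> {0..T}" for \<alpha> t r
    unfolding G_def using lip[OF _ that]
    by (intro extension_diff_bound ev_rep) (simp_all add: ev_def less_imp_le growth_pos)
  have G0: "G \<alpha> 0 = 0" for \<alpha>
  proof -
    have "norm (G \<alpha> 0) \<le> C * 0"
      unfolding G_def using flat_functionsD(3)[OF Bdot_flat[OF T]]
      by (intro extension_bound[OF ev_rep]) (simp_all add: ev_def)
    then show ?thesis by simp
  qed
  have G_cont: "continuous_on {0..T} (G \<alpha>)" for \<alpha>
  proof (rule continuous_on_hoelder[of 1])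
    fix r t assume "r \<in> {0..T}" "t \<in> {0..T}"
    from G_lip[OF this] show "norm (G \<alpha> t - G \<alpha> r) \<le> C * growth (Suc \<alpha>) * \<bar>t - r\<bar> powr 1" by (simp add: mult.assoc)
  qed simp
  \<comment> \<open>The sign cancels the one in \<open>pairing\<close>; the squared weight is that
    of the energy form.\<close>
  define F where "F \<alpha> t = (- 1) ^ \<alpha> *\<^sub>R (weight \<alpha>)\<^sup>2 *\<^sub>R G \<alpha> t" for \<alpha> t
  \<comment> \<open>One weight contributes radius \<open>2 * h\<close>; the other, multiplied by the
    embedding constant, contributes \<open>2 ^ \<alpha>\<close>. Together they give the radius
    \<open>4 * h\<close>.\<close>
  have F_bound: "norm (F \<alpha> t) \<le> C * K * (4 * h) ^ \<alpha> / fact \<alpha> powr s" for \<alpha> t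
  proof -
    have "norm (F \<alpha> t) = (weight \<alpha>)\<^sup>2 * norm (G \<alpha> t)" by (simp add: F_def abs_mult)
    also have "\<dots> \<le> (weight \<alpha>)\<^sup>2 * (C * growth \<alpha>)" by (intro mult_left_mono G_bound) simp
    also have "\<dots> = C * weight \<alpha> * (weight \<alpha> * growth \<alpha>)" by (simp add: power2_eq_square)
    also have "\<dots> \<le> C * weight \<alpha> * (K * 2 ^ \<alpha>)"
      using C weight_pos[of \<alpha>] by (intro mult_left_mono K(2)) simp
    also have "\<dots> = C * K * ((2 * h) ^ \<alpha> * 2 ^ \<alpha>) / fact \<alpha> powr s" by (simp only: weight_def) simp
    also have "(2 * h) ^ \<alpha> * 2 ^ \<alpha> = (4 * h) ^ \<alpha>" unfolding power_mult_distrib[symmetric] by simp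
    finally show ?thesis .
  qed
  have zero: "representable (\<lambda>_. 0)" "extension (\<lambda>_. 0) = 0"
  proof -
    show r: "representable (\<lambda>_. 0)" by (rule bounded_representable[of _ 0]) simp_all
    show "extension (\<lambda>_. 0) = 0" using extension_bound[OF r, of 0] by simp
  qed
  have product: "representable (\<lambda>\<psi>. product \<alpha> \<psi> \<phi>)"
    "extension (\<lambda>\<psi>. product \<alpha> \<psi> \<phi>) = integral {0..T} (\<lambda>t. test_derivs T \<alpha> \<phi> t *\<^sub>C G \<alpha> t)" if \<phi>: "\<phi> \<in> ?V" for \<alpha> \<phi>
  proof -
    define m where "m t \<psi> = cnj (test_derivs T \<alpha> \<phi> t) * test_derivs T \<alpha> \<psi> t" for t and \<psi> :: "real \<Rightarrow> complex"
    define c where "c = nrm \<phi> * growth \<alpha> * growth (Suc \<alpha>)"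
    have c0: "0 \<le> c" using nrm_nonneg[OF \<phi>] growth_pos by (simp add: c_def less_imp_le)
    have m_lip: "cmod (m r \<psi> - m t \<psi>) \<le> 2 * c * \<bar>r - t\<bar> * nrm \<psi>"
      if rt: "t \<in> {0..T}" "r \<in> {0..T}" and \<psi>: "\<psi> \<in> ?V" for r t \<psi>
    proof -
      let ?\<phi> = "test_derivs T \<alpha> \<phi>" and ?\<psi> = "test_derivs T \<alpha> \<psi>"
      have "m r \<psi> - m t \<psi> = cnj (?\<phi> r) * (?\<psi> r - ?\<psi> t) + cnj (?\<phi> r - ?\<phi> t) * ?\<psi> t"
        by (simp add: m_def algebra_simps)
      then have "cmod (m r \<psi> - m t \<psi>) \<le> cmod (?\<phi> r) * cmod (?\<psi> r - ?\<psi> t) + cmod (?\<phi> r - ?\<phi> t) * cmod (?\<psi> t)"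
        using norm_triangle_ineq[of "cnj (?\<phi> r) * (?\<psi> r - ?\<psi> t)" "cnj (?\<phi> r - ?\<phi> t) * ?\<psi> t"]
        by (simp add: norm_mult del: complex_cnj_diff)
      also have "\<dots> \<le> (growth \<alpha> * nrm \<phi>) * (growth (Suc \<alpha>) * \<bar>r - t\<bar> * nrm \<psi>) +
        (growth (Suc \<alpha>) * \<bar>r - t\<bar> * nrm \<phi>) * (growth \<alpha> * nrm \<psi>)"
        using nrm_nonneg[OF \<phi>] nrm_nonneg[OF \<psi>] growth_pos
        by (intro add_mono mult_mono derivs lip rt \<phi> \<psi>) (auto simp: less_imp_le)
      also have "\<dots> = 2 * c * \<bar>r - t\<bar> * nrm \<psi>" by (simp add: c_def algebra_simps)
      finally show ?thesis .
    qed
    \<comment> \<open>The functional \<open>m t\<close> is the evaluation times the conjugate of the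
      derivative of \<open>\<phi>\<close>, and the extension conjugates this scalar back.\<close>
    have m_ext: "extension (m t) = test_derivs T \<alpha> \<phi> t *\<^sub>C G \<alpha> t" for t
      using extension_linear(2)[OF ev_rep[of \<alpha> t] zero(1), of "cnj (test_derivs T \<alpha> \<phi> t)"]
      unfolding m_def ev_def G_def by (simp add: zero(2))
    have T0: "0 \<le> T" using T by simp
    have *: "representable (\<lambda>\<psi>. integral {0..T} (\<lambda>t. m t \<psi>))"
      "((\<lambda>t. extension (m t)) has_integral extension (\<lambda>\<psi>. integral {0..T} (\<lambda>t. m t \<psi>))) {0..T}"
    proof -
      have lin: "m t (\<lambda>a. c * x a + y a) = c * m t x + m t y" if "x \<in> ?V" "y \<in> ?V" for t x y c
        by (simp add: m_def linear[OF that] distrib_left mult.left_commute)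
      have bd: "cmod (m t \<psi>) \<le> growth \<alpha> * nrm \<phi> * growth \<alpha> * nrm \<psi>" if \<psi>: "\<psi> \<in> ?V" for t \<psi>
        using mult_mono[OF derivs[OF \<phi>, of \<alpha> t] derivs[OF \<psi>, of \<alpha> t]] nrm_nonneg[OF \<phi>] growth_pos[of \<alpha>]
        by (simp add: m_def norm_mult mult.assoc less_imp_le)
      have ct: "\<exists>d>0. \<forall>r\<in>{0..T}. \<bar>r - t\<bar> < d \<longrightarrow> (\<forall>x\<in>?V. cmod (m r x - m t x) \<le> e * nrm x)"
        if t: "t \<in> {0..T}" and e: "0 < e" for t e
      proof (intro exI[of _ "e / (2 * c + 1)"] conjI ballI impI)
        show "0 < e / (2 * c + 1)" using e c0 by simp
        fix r x assume r: "r \<in> {0..T}" "\<bar>r - t\<bar> < e / (2 * c + 1)" and x: "x \<in> ?V"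
        have "2 * c * \<bar>r - t\<bar> \<le> (2 * c + 1) * \<bar>r - t\<bar>" by (intro mult_right_mono) auto
        also have "\<dots> \<le> e" using r(2) c0 by (simp add: pos_less_divide_eq mult.commute)
        finally have "2 * c * \<bar>r - t\<bar> * nrm x \<le> e * nrm x" by (rule mult_right_mono[OF _ nrm_nonneg[OF x]])
        then show "cmod (m r x - m t x) \<le> e * nrm x" using m_lip[OF t r(1) x] by linarith
      qed
      show "representable (\<lambda>\<psi>. integral {0..T} (\<lambda>t. m t \<psi>))"
        by (rule extension_integral(1)[where m = m, OF T0 lin bd ct])
      show "((\<lambda>t. extension (m t)) has_integral extension (\<lambda>\<psi>. integral {0..T} (\<lambda>t. m t \<psi>))) {0..T}"
        by (rule extension_integral(2)[where m = m, OF T0 lin bd ct])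
    qed
    show "representable (\<lambda>\<psi>. product \<alpha> \<psi> \<phi>)" using *(1) by (simp add: product_def m_def)
    show "extension (\<lambda>\<psi>. product \<alpha> \<psi> \<phi>) = integral {0..T} (\<lambda>t. test_derivs T \<alpha> \<phi> t *\<^sub>C G \<alpha> t)"
      using integral_unique[OF *(2)] unfolding m_ext by (simp add: product_def m_def)
  qed
  have pair: "pairing T F \<phi> \<alpha> = (weight \<alpha>)\<^sup>2 *\<^sub>R integral {0..T} (\<lambda>t. test_derivs T \<alpha> \<phi> t *\<^sub>C G \<alpha> t)" for \<phi> \<alpha>
    unfolding pairing_def F_def by (simp add: scaleC_scaleR_commute)
  have partial: "representable (\<lambda>\<psi>. \<Sum>\<alpha><n. complex_of_real ((weight \<alpha>)\<^sup>2) * product \<alpha> \<psi> \<phi>) \<and>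
    extension (\<lambda>\<psi>. \<Sum>\<alpha><n. complex_of_real ((weight \<alpha>)\<^sup>2) * product \<alpha> \<psi> \<phi>) = sum (pairing T F \<phi>) {..<n}"
    if \<phi>: "\<phi> \<in> ?V" for \<phi> n
  proof (induction n)
    case 0
    then show ?case using zero by simp
  next
    case (Suc n)
    note e = extension_linear[OF product(1)[OF \<phi>, of n] conjunct1[OF Suc], of "complex_of_real ((weight n)\<^sup>2)"]
    then show ?case
      unfolding conjunct2[OF Suc] product(2)[OF \<phi>] complex_cnj_complex_of_real scaleC_of_real pair[symmetric]
      by (simp add: add.commute)
  qed
  have sums: "pairing T F \<phi> sums f \<phi>" if \<phi>: "\<phi> \<in> ?V" for \<phi>
  proof -
    \<comment> \<open>At radius \<open>8 * h\<close>, four times that of the weights,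
      \<open>\<phi>\<close> yields the decay \<open>(1 / 4) ^ \<alpha>\<close>. The evaluation of
      \<open>\<psi>\<close> costs \<open>2 ^ \<alpha>\<close>, which leaves
      \<open>(1 / 2) ^ \<alpha>\<close>.\<close>
    define D where "D = T * DLinf_norm s T (8 * h) \<phi> * K"
    have D0: "0 \<le> D" using T K by (simp add: D_def)
    have h8: "0 < 8 * h" using h by simp
    have bd: "cmod (complex_of_real ((weight \<alpha>)\<^sup>2) * product \<alpha> \<psi> \<phi>) \<le> D * nrm \<psi> * (1 / 2) ^ \<alpha>" if \<psi>: "\<psi> \<in> ?V" for \<psi> \<alpha>
    proof -
      let ?g = "fact \<alpha> powr s / (4 * (2 * h)) ^ \<alpha>"
      have "cmod (product \<alpha> \<psi> \<phi>) \<le> (DLinf_norm s T (8 * h) \<phi> * ?g) * (growth \<alpha> * nrm \<psi>) * (T - 0)"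
        unfolding product_def
      proof (rule norm_integral_le_const[OF _ product_continuous[OF refl \<psi> \<phi>]])
        fix t
        show "cmod (cnj (test_derivs T \<alpha> \<phi> t) * test_derivs T \<alpha> \<psi> t) \<le> DLinf_norm s T (8 * h) \<phi> * ?g * (growth \<alpha> * nrm \<psi>)"
          unfolding norm_mult complex_mod_cnj
          using derivs_decay[OF refl \<phi> h8, of \<alpha> t] h by (intro mult_mono derivs \<psi>) auto
      qed (use T in simp)
      then have "(weight \<alpha>)\<^sup>2 * cmod (product \<alpha> \<psi> \<phi>) \<le>
        (weight \<alpha>)\<^sup>2 * ((DLinf_norm s T (8 * h) \<phi> * ?g) * (growth \<alpha> * nrm \<psi>) * (T - 0))"
        by (rule mult_left_mono) simp
      also have "\<dots> = (T * DLinf_norm s T (8 * h) \<phi> * nrm \<psi> * (weight \<alpha> * ?g)) * (weight \<alpha> * growth \<alpha>)"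
        by (simp add: power2_eq_square mult_ac)
      also have "\<dots> \<le> (T * DLinf_norm s T (8 * h) \<phi> * nrm \<psi> * (weight \<alpha> * ?g)) * (K * 2 ^ \<alpha>)"
        using T h weight_pos[of \<alpha>] nrm_nonneg[OF \<psi>] by (intro mult_left_mono K(2) mult_nonneg_nonneg) auto
      also have "weight \<alpha> * ?g = (1 / 4) ^ \<alpha>" by (rule weight_cancel) simp
      also have "(T * DLinf_norm s T (8 * h) \<phi> * nrm \<psi> * (1 / 4) ^ \<alpha>) * (K * 2 ^ \<alpha>) = D * nrm \<psi> * ((1 / 4) ^ \<alpha> * 2 ^ \<alpha>)"
        by (simp add: D_def mult_ac)
      also have "(1 / 4 :: real) ^ \<alpha> * 2 ^ \<alpha> = (1 / 2) ^ \<alpha>" by (simp add: power_mult_distrib[symmetric])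
      finally show ?thesis by (simp add: norm_mult norm_power)
    qed
    \<comment> \<open>Both terms are extensions, so their distance is controlled by the tail of the
      energy series as a functional of \<open>\<psi>\<close>, uniformly relative to
      \<open>nrm \<psi>\<close>.\<close>
    have "norm (sum (pairing T F \<phi>) {..<n} - f \<phi>) \<le> C * (2 * D * (1 / 2) ^ n)" for n
      unfolding conjunct2[OF partial[OF \<phi>], symmetric] extension_ip(2)[OF \<phi>, symmetric]
    proof (rule extension_diff_bound[OF conjunct1[OF partial[OF \<phi>]] extension_ip(1)[OF \<phi>]])
      show "0 \<le> 2 * D * (1 / 2) ^ n" using D0 by simp
      fix \<psi> assume \<psi>: "\<psi> \<in> ?V"
      let ?t = "\<lambda>\<alpha>. complex_of_real ((weight \<alpha>)\<^sup>2) * product \<alpha> \<psi> \<phi>"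
      have g: "(\<lambda>\<alpha>. D * nrm \<psi> * (1 / 2) ^ n * (1 / 2) ^ \<alpha>) sums (D * nrm \<psi> * (1 / 2) ^ n * (1 / (1 - 1 / 2)))"
        by (intro sums_mult geometric_sums) simp
      have "cmod ((\<Sum>\<alpha><n. ?t \<alpha>) - energy \<psi> \<phi>) = cmod (energy \<psi> \<phi> - (\<Sum>\<alpha><n. ?t \<alpha>))"
        by (rule norm_minus_commute)
      also have "energy \<psi> \<phi> - (\<Sum>\<alpha><n. ?t \<alpha>) = (\<Sum>\<alpha>. ?t (\<alpha> + n))"
        unfolding energy_def by (rule suminf_minus_initial_segment[OF energy_summable[OF refl \<psi> \<phi>], symmetric])
      also have "cmod \<dots> \<le> (\<Sum>\<alpha>. D * nrm \<psi> * (1 / 2) ^ n * (1 / 2) ^ \<alpha>)"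
      proof (rule norm_suminf_le[OF _ sums_summable[OF g]])
        show "cmod (?t (\<alpha> + n)) \<le> D * nrm \<psi> * (1 / 2) ^ n * (1 / 2) ^ \<alpha>" for \<alpha>
          using bd[OF \<psi>, of "\<alpha> + n"] by (simp only: power_add mult_ac)
      qed
      also have "\<dots> = 2 * D * (1 / 2) ^ n * nrm \<psi>" unfolding sums_unique[OF g, symmetric] by simp
      finally show "cmod ((\<Sum>\<alpha><n. ?t \<alpha>) - energy \<psi> \<phi>) \<le> 2 * D * (1 / 2) ^ n * nrm \<psi>" .
    qed
    moreover have "(\<lambda>n. C * (2 * D * (1 / 2) ^ n)) \<longlonglongrightarrow> 0"
    proof -
      have "(\<lambda>n. (1 / 2 :: real) ^ n) \<longlonglongrightarrow> 0" by (rule LIMSEQ_power_zero) simp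
      from tendsto_mult_left[OF this, of "C * (2 * D)"] show ?thesis by (simp add: mult.assoc)
    qed
    ultimately have "(\<lambda>n. sum (pairing T F \<phi>) {..<n} - f \<phi>) \<longlonglongrightarrow> 0"
      by (rule Lim_null_comparison[OF always_eventually, OF allI])
    then show ?thesis unfolding sums_def by (rule LIM_zero_cancel)
  qed
  have "continuous_on {0..T} (F \<alpha>) \<and> F \<alpha> 0 = 0" for \<alpha>
    unfolding F_def by (simp add: G0 continuous_on_scaleR continuous_on_const G_cont)
  then show ?thesis
    using F_bound sums h C K by (intro exI[of _ F] exI[of _ "4 * h"] exI[of _ "C * K"]) simp
qed

section \<open>Existence and regularity of solutions\<close>

text \<open>The solutions are chosen once and keep the Hoelder transfer for every constant and
  exponent, so that one choice serves both existence and the regularity statement.\<close>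

lemma (in euler_scheme) series_solution_exists:
  assumes k: "0 < k" and C: "0 \<le> C" and s: "0 < s"
    and F: "\<forall>\<alpha>. continuous_on {0..T} (F \<alpha>) \<and> F \<alpha> 0 = 0 \<and> (\<forall>t\<in>{0..T}. norm (F \<alpha> t) \<le> C * k ^ \<alpha> / fact \<alpha> powr s)"
    and f: "\<forall>\<phi>\<in>Bdot s T. pairing T F \<phi> sums f \<phi>"
  shows "\<exists>U. (\<forall>\<alpha>. U \<alpha> 0 = 0 \<and>
      (\<forall>c \<gamma>. 0 \<le> c \<longrightarrow> 0 < \<gamma> \<longrightarrow> (\<forall>r\<in>{0..T}. \<forall>t\<in>{0..T}. norm (F \<alpha> t - F \<alpha> r) \<le> c * \<bar>t - r\<bar> powr \<gamma>) \<longrightarrow>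
        (\<forall>r\<in>{0..T}. \<forall>t\<in>{0..T}. norm (U \<alpha> t - U \<alpha> r) \<le> T * M * (c * \<bar>t - r\<bar> powr \<gamma>)))) \<and>
    is_solution s T DA A f (\<lambda>\<phi>. if \<phi> \<in> Bdot s T then suminf (pairing T U \<phi>) else 0)"
proof -
  let ?mild = "\<lambda>\<alpha> U. continuous_on {0..T} U \<and> U 0 = 0 \<and>
    (\<forall>t\<in>{0..T}. integral {0..t} U \<in> DA \<and> A (integral {0..t} U) = U t - integral {0..t} (F \<alpha>)) \<and>
    (\<forall>B. (\<forall>t\<in>{0..T}. norm (F \<alpha> t) \<le> B) \<longrightarrow> (\<forall>t\<in>{0..T}. norm (U t) \<le> T * M * B)) \<and>
    (\<forall>c \<gamma>. 0 \<le> c \<longrightarrow> 0 < \<gamma> \<longrightarrow> (\<forall>r\<in>{0..T}. \<forall>t\<in>{0..T}. norm (F \<alpha> t - F \<alpha> r) \<le> c * \<bar>t - r\<bar> powr \<gamma>) \<longrightarrow>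
      (\<forall>r\<in>{0..T}. \<forall>t\<in>{0..T}. norm (U t - U r) \<le> T * M * (c * \<bar>t - r\<bar> powr \<gamma>)))"
  have "\<forall>\<alpha>. \<exists>U. ?mild \<alpha> U" using F by (intro allI mild_solution) simp_all
  from choice[OF this] obtain U where U: "\<forall>\<alpha>. ?mild \<alpha> (U \<alpha>)" ..
  have Uc: "continuous_on {0..T} (U \<alpha>)" for \<alpha> using U by simp
  have mild: "integral {0..t} (U \<alpha>) \<in> DA \<and> A (integral {0..t} (U \<alpha>)) = U \<alpha> t - integral {0..t} (F \<alpha>)"
    if "t \<in> {0..T}" for \<alpha> t using spec[OF U, of \<alpha>] that by simp
  have bound: "norm (U \<alpha> t) \<le> T * M * C * k ^ \<alpha> / fact \<alpha> powr s" if t: "t \<in> {0..T}" for \<alpha> t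
  proof -
    have "norm (U \<alpha> t) \<le> T * M * (C * k ^ \<alpha> / fact \<alpha> powr s)"
      by (rule conjunct1[OF conjunct2[OF conjunct2[OF conjunct2[OF spec[OF U]]]], rule_format, OF _ t])
        (use F in simp)
    then show ?thesis by simp
  qed
  have "0 \<le> T * M * C" using T_pos M_nonneg C by simp
  from series_solution[where U = U and F = F and f = f, OF k this s _ Uc bound mild _ refl] F f
  have "is_solution s T DA A f (\<lambda>\<phi>. if \<phi> \<in> Bdot s T then suminf (pairing T U \<phi>) else 0)" by simp
  then show ?thesis using U by (intro exI[of _ U]) simp
qed

text \<open>The Hoelder constant of \<open>F \<alpha>\<close> is four times the \<open>L^p\<close>
  norm of its derivative, so the weighted summability of the derivatives is the summability of the
  \<open>p\<close>-th powers of the constants.\<close>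

lemma represents_hoelder:
  fixes F :: "nat \<Rightarrow> real \<Rightarrow> 'e::complex_banach"
  assumes T: "0 < T" and p: "1 < p" and h: "0 < h" and rep: "represents s T p h f F F'"
  shows "\<exists>b. (\<forall>\<alpha>. 0 \<le> b \<alpha>) \<and> summable (\<lambda>\<alpha>. (b \<alpha> * (fact \<alpha> powr s / h ^ \<alpha>)) powr p) \<and>
    (\<forall>\<alpha>. \<forall>r\<in>{0..T}. \<forall>t\<in>{0..T}. norm (F \<alpha> t - F \<alpha> r) \<le> b \<alpha> * \<bar>t - r\<bar> powr (1 - 1 / p))"
proof -
  define P where "P \<alpha> = enn2real (Lp_norm_pow T p (F' \<alpha>))" for \<alpha>
  define g where "g \<alpha> = fact \<alpha> powr s / h ^ \<alpha>" for \<alpha> :: nat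
  have g0: "0 \<le> g \<alpha>" for \<alpha> using h by (simp add: g_def)
  have W: "sobolev_W1p T p (F \<alpha>) (F' \<alpha>)" for \<alpha> using rep by (simp add: represents_def)
  then have "Lp_norm_pow T p (F' \<alpha>) < top" for \<alpha> by (simp add: sobolev_W1p_def Lp_space_def)
  then have P: "Lp_norm_pow T p (F' \<alpha>) = ennreal (P \<alpha>)" "0 \<le> P \<alpha>" for \<alpha>
    unfolding P_def by (simp_all add: ennreal_enn2real)
  have gp: "g \<alpha> powr p = fact \<alpha> powr (p * s) / h powr (p * real \<alpha>)" for \<alpha>
    using h by (simp add: g_def powr_divide powr_powr powr_realpow[symmetric] mult.commute)
  have "(\<Sum>\<alpha>. ennreal (g \<alpha> powr p * P \<alpha>)) \<le> (\<Sum>\<alpha>. ennreal (fact \<alpha> powr (p * s) / h powr (p * real \<alpha>)) *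
    (Lp_norm_pow T p (F \<alpha>) + Lp_norm_pow T p (F' \<alpha>)))"
  proof (rule suminf_le)
    fix \<alpha>
    have "ennreal (g \<alpha> powr p * P \<alpha>) = ennreal (fact \<alpha> powr (p * s) / h powr (p * real \<alpha>)) * Lp_norm_pow T p (F' \<alpha>)"
      unfolding P(1) gp[symmetric] by (rule ennreal_mult) (simp_all add: P(2))
    also have "\<dots> \<le> ennreal (fact \<alpha> powr (p * s) / h powr (p * real \<alpha>)) * (Lp_norm_pow T p (F \<alpha>) + Lp_norm_pow T p (F' \<alpha>))"
      by (intro mult_left_mono) simp_all
    finally show "ennreal (g \<alpha> powr p * P \<alpha>) \<le> \<dots>" .
  qed simp_all
  also have "\<dots> < \<infinity>" using rep by (simp add: represents_def)
  finally have summ: "summable (\<lambda>\<alpha>. g \<alpha> powr p * P \<alpha>)"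
    by (intro summable_suminf_not_top) (simp_all add: P(2))
  define b where "b \<alpha> = 4 * P \<alpha> powr (1 / p)" for \<alpha>
  have "(b \<alpha> * g \<alpha>) powr p = 4 powr p * (g \<alpha> powr p * P \<alpha>)" for \<alpha>
    using p g0[of \<alpha>] P(2)[of \<alpha>] by (simp add: b_def powr_mult powr_powr)
  then have "summable (\<lambda>\<alpha>. (b \<alpha> * g \<alpha>) powr p)" using summable_mult[OF summ, of "4 powr p"] by simp
  moreover have "norm (F \<alpha> t - F \<alpha> r) \<le> b \<alpha> * \<bar>t - r\<bar> powr (1 - 1 / p)" if "r \<in> {0..T}" "t \<in> {0..T}" for \<alpha> r t
  proof -
    note H = sobolev_hoelder[OF T p W P(2) eq_refl[OF P(1)], folded b_def]
    show ?thesis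
    proof (cases "r \<le> t")
      case True
      then show ?thesis using H[of r t \<alpha>] that by simp
    next
      case False
      then show ?thesis using H[of t r \<alpha>] that by (simp add: norm_minus_commute abs_minus_commute)
    qed
  qed
  moreover have "0 \<le> b \<alpha>" for \<alpha> by (simp add: b_def)
  ultimately show ?thesis unfolding g_def by blast
qed

lemma function_deriv_eq_pairing:
  assumes T: "0 < T" and F: "continuous_on {0..T} (F \<alpha>)" and \<phi>: "\<phi> \<in> Bdot s T"
  shows "function_deriv T \<alpha> (F \<alpha>) \<phi> = pairing T F \<phi> \<alpha>"
  unfolding function_deriv_def pairing_def
  by (simp only: bochner_integral_continuous[OF T scaleC.continuous_on[OF flat_functionsD(2)[OF Bdot_flat[OF T \<phi>]] F]])

theorem theorem5p6:
  fixes s T :: real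
    and DA :: "'e::complex_banach set" and A :: "'e \<Rightarrow> 'e"
    and f :: "(real \<Rightarrow> complex) \<Rightarrow> 'e"
  assumes "1 < s" and "0 < T"
    and "closed_operator DA A"
    and "hille_yosida DA A"
    and "f \<in> ultradist_L1 s T"
  shows "(\<exists>u. is_solution s T DA A f u) \<and>
    (\<forall>p h F F'. 1 < p \<and> 0 < h \<and> represents s T p h f F F' \<longrightarrow>
      (\<exists>u. is_solution s T DA A f u \<and> u \<in> ultradist_Lp s T p h))"
proof (intro conjI allI impI)
  have s: "0 < s" using assms(1) by simp
  note T = assms(2)
  obtain M N0 J where "euler_scheme DA A T M N0 J" using hille_yosida_euler_scheme[OF assms(3,4) T] by blast
  then interpret euler_scheme DA A T M N0 J .
  show "\<exists>u. is_solution s T DA A f u"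
  proof -
    from ultradist_L1_representation[OF T s assms(5)]
    obtain F k C where F: "0 < k" "0 \<le> C" "\<forall>\<alpha>. continuous_on {0..T} (F \<alpha>) \<and> F \<alpha> 0 = 0 \<and>
        (\<forall>t\<in>{0..T}. norm (F \<alpha> t) \<le> C * k ^ \<alpha> / fact \<alpha> powr s)"
      "\<forall>\<phi>\<in>Bdot s T. pairing T F \<phi> sums f \<phi>" by (elim exE conjE) (rule that; assumption)
    from series_solution_exists[OF F(1,2) s F(3,4)]
    show ?thesis by (elim exE conjE) (rule exI)
  qed
  fix p h F F' assume H: "1 < p \<and> 0 < h \<and> represents s T p h f F F'"
  then have p: "1 < p" and h: "0 < h" and rep: "represents s T p h f F F'" by auto
  define \<gamma> where "\<gamma> = 1 - 1 / p"
  have \<gamma>: "0 < \<gamma>" using p by (simp add: \<gamma>_def)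
  from represents_hoelder[OF T p h rep]
  obtain b where b: "\<And>\<alpha>. 0 \<le> b \<alpha>" "summable (\<lambda>\<alpha>. (b \<alpha> * (fact \<alpha> powr s / h ^ \<alpha>)) powr p)"
    and F_hoelder: "\<And>\<alpha> r t. r \<in> {0..T} \<Longrightarrow> t \<in> {0..T} \<Longrightarrow> norm (F \<alpha> t - F \<alpha> r) \<le> b \<alpha> * \<bar>t - r\<bar> powr \<gamma>"
    unfolding \<gamma>_def by blast
  have F0: "F \<alpha> 0 = 0" for \<alpha> using rep by (simp add: represents_def)
  have Fc: "continuous_on {0..T} (F \<alpha>)" for \<alpha> by (rule continuous_on_hoelder[OF \<gamma> F_hoelder])
  have Fsums: "pairing T F \<phi> sums f \<phi>" if \<phi>: "\<phi> \<in> Bdot s T" for \<phi>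
  proof -
    have "(\<lambda>\<alpha>. function_deriv T \<alpha> (F \<alpha>) \<phi>) sums f \<phi>" using rep \<phi> by (simp add: represents_def)
    then show ?thesis by (simp only: function_deriv_eq_pairing[where F = F, OF T Fc \<phi>])
  qed
  define a where "a \<alpha> = (b \<alpha> * (fact \<alpha> powr s / h ^ \<alpha>)) powr p" for \<alpha>
  have a: "summable a" "0 \<le> a \<alpha>" for \<alpha> using b(2) by (simp_all add: a_def[abs_def])
  define S where "S = suminf a"
  \<comment> \<open>A single term of a convergent nonnegative series is at most its sum. This turns
    summability of the Hoelder constants into the pointwise bound required for existence, with the
    same radius \<open>h\<close>; \<open>F \<alpha> 0 = 0\<close> passes from increments to
    values.\<close>
  have F_bound: "norm (F \<alpha> t) \<le> (S powr (1 / p) * T powr \<gamma>) * h ^ \<alpha> / fact \<alpha> powr s" if t: "t \<in> {0..T}" for \<alpha> t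
  proof -
    let ?x = "b \<alpha> * (fact \<alpha> powr s / h ^ \<alpha>)"
    have x0: "0 \<le> ?x" using b(1) h by simp
    have "a \<alpha> \<le> S" unfolding S_def using sum_le_suminf[OF a(1), of "{\<alpha>}"] a(2) by simp
    then have "?x powr p \<le> S" unfolding a_def .
    then have "(?x powr p) powr (1 / p) \<le> S powr (1 / p)" using p by (intro powr_mono2) auto
    moreover have "(x powr p) powr (1 / p) = x" if "0 \<le> x" for x :: real using p that by (simp add: powr_powr)
    ultimately have x: "?x \<le> S powr (1 / p)" using x0 by metis
    have "norm (F \<alpha> t) \<le> b \<alpha> * \<bar>t - 0\<bar> powr \<gamma>" using F_hoelder[of 0 t \<alpha>] t T by (simp add: F0)
    also have "\<dots> \<le> b \<alpha> * T powr \<gamma>" by (rule mult_left_mono[OF powr_mono2 b(1)]) (use t \<gamma> in auto)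
    also have "\<dots> = ?x * (T powr \<gamma> * h ^ \<alpha> / fact \<alpha> powr s)" using h by simp
    also have "\<dots> \<le> S powr (1 / p) * (T powr \<gamma> * h ^ \<alpha> / fact \<alpha> powr s)"
      by (rule mult_right_mono[OF x]) (use h in simp)
    finally show ?thesis by simp
  qed
  have C0: "0 \<le> S powr (1 / p) * T powr \<gamma>" by simp
  have "\<forall>\<alpha>. continuous_on {0..T} (F \<alpha>) \<and> F \<alpha> 0 = 0 \<and>
    (\<forall>t\<in>{0..T}. norm (F \<alpha> t) \<le> (S powr (1 / p) * T powr \<gamma>) * h ^ \<alpha> / fact \<alpha> powr s)"
    by (intro allI conjI ballI Fc F0 F_bound)
  moreover have "\<forall>\<phi>\<in>Bdot s T. pairing T F \<phi> sums f \<phi>" by (intro ballI Fsums)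
  ultimately have "\<exists>U. (\<forall>\<alpha>. U \<alpha> 0 = 0 \<and> (\<forall>c \<gamma>. 0 \<le> c \<longrightarrow> 0 < \<gamma> \<longrightarrow>
      (\<forall>r\<in>{0..T}. \<forall>t\<in>{0..T}. norm (F \<alpha> t - F \<alpha> r) \<le> c * \<bar>t - r\<bar> powr \<gamma>) \<longrightarrow>
      (\<forall>r\<in>{0..T}. \<forall>t\<in>{0..T}. norm (U \<alpha> t - U \<alpha> r) \<le> T * M * (c * \<bar>t - r\<bar> powr \<gamma>)))) \<and>
    is_solution s T DA A f (\<lambda>\<phi>. if \<phi> \<in> Bdot s T then suminf (pairing T U \<phi>) else 0)"
    by (rule series_solution_exists[OF h C0 s])
  then
  obtain U where U: "\<forall>\<alpha>. U \<alpha> 0 = 0 \<and> (\<forall>c \<gamma>. 0 \<le> c \<longrightarrow> 0 < \<gamma> \<longrightarrow>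
      (\<forall>r\<in>{0..T}. \<forall>t\<in>{0..T}. norm (F \<alpha> t - F \<alpha> r) \<le> c * \<bar>t - r\<bar> powr \<gamma>) \<longrightarrow>
      (\<forall>r\<in>{0..T}. \<forall>t\<in>{0..T}. norm (U \<alpha> t - U \<alpha> r) \<le> T * M * (c * \<bar>t - r\<bar> powr \<gamma>)))"
    and u: "is_solution s T DA A f (\<lambda>\<phi>. if \<phi> \<in> Bdot s T then suminf (pairing T U \<phi>) else 0)"
    by (elim exE conjE) (rule that; assumption)
  have U0: "U \<alpha> 0 = 0" for \<alpha> using U by simp
  \<comment> \<open>The solutions have the Hoelder constants of the data times \<open>T * M\<close>,
    so their weighted \<open>p\<close>-th powers remain summable.\<close>
  have TMa: "(T * M * b \<alpha> * (fact \<alpha> powr s / h ^ \<alpha>)) powr p = (T * M) powr p * a \<alpha>" for \<alpha>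
    by (simp only: a_def powr_mult mult_ac)
  have uL1: "(\<lambda>\<phi>. if \<phi> \<in> Bdot s T then suminf (pairing T U \<phi>) else 0) \<in> ultradist_L1 s T"
    using u unfolding is_solution_def by (rule conjunct1)
  have "(\<lambda>\<phi>. if \<phi> \<in> Bdot s T then suminf (pairing T U \<phi>) else 0) \<in> ultradist_Lp s T p h"
  proof (rule series_ultradist_Lp[where B = "\<lambda>\<alpha>. T * M * b \<alpha>", OF T h p _ _ U0 _ refl uL1])
    show "0 \<le> T * M * b \<alpha>" for \<alpha> using T M_nonneg b(1) by simp
    show "summable (\<lambda>\<alpha>. (T * M * b \<alpha> * (fact \<alpha> powr s / h ^ \<alpha>)) powr p)"
      unfolding TMa by (rule summable_mult[OF a(1)])
    show "norm (U \<alpha> t - U \<alpha> r) \<le> T * M * b \<alpha> * \<bar>t - r\<bar> powr (1 - 1 / p)" if "r \<in> {0..T}" "t \<in> {0..T}" for \<alpha> r t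
      using conjunct2[OF spec[OF U], rule_format, OF b(1) \<gamma> F_hoelder that] by (simp add: \<gamma>_def mult.assoc)
  qed
  then show "\<exists>u. is_solution s T DA A f u \<and> u \<in> ultradist_Lp s T p h" using u by blast
qed

end
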